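(* Let $\mathrm{supp}\subset\Pi$ be a set of pairwise orthogonal simple roots, $\lambda^\pm_\alpha\in\mathbb{C}^\times$ ($\alpha\in\mathrm{supp}$) scalars with $\lambda^+_{\alpha}\lambda^-_{\alpha}=\frac{q_{\alpha}^2}{(1-q_\alpha^{2})(q_\alpha-q_\alpha^{-1})}$, and $C=U^-[x]^{op}_{\phi_-}\mathbb{C}[L]\psi U^+_{\phi_+}$ the associated right coideal subalgebra of $U_q(\mathfrak g)$, with $L=\mathrm{supp}^\perp$. Then the action of $C$ on any finite-dimensional irreducible $C$-module $V$ factors over the algebra $$\bar C=\mathbb{C}[L]\otimes\bigotimes_{\alpha\in\mathrm{supp}}\langle\bar E_\alpha,\bar F_\alpha\rangle,$$ (the quotient of $C$ in which $\mathbb{C}[L]$, and $\bar E_\alpha,\bar F_\alpha$ for $\alpha\in\mathrm{supp}$, map to the elements of the same name), where each $\langle\bar E_\alpha,\bar F_\alpha\rangle$ is a quantum Weyl algebra.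
   Context: $\mathfrak g$ is a finite-dimensional semisimple complex Lie algebra with simple roots $\Pi$, root lattice $\Lambda$, simple reflections $s_\alpha$, invariant form $(\,,)$ (with $(\alpha,\alpha)\in2\mathbb{Z}_{>0}$ for roots). $q\in\mathbb{C}^\times$ is not a root of unity, $q_\alpha=q^{(\alpha,\alpha)/2}$. $U=U_q(\mathfrak g)$ is generated by $E_\alpha,F_\alpha,K_\alpha^{\pm1}$ with $K_\alpha E_\beta=q^{(\alpha,\beta)}E_\beta K_\alpha$, $K_\alpha F_\beta=q^{-(\alpha,\beta)}F_\beta K_\alpha$, $[E_\alpha,F_\beta]=\delta_{\alpha\beta}\frac{K_\alpha-K_\alpha^{-1}}{q_\alpha-q_\alpha^{-1}}$, quantum Serre relations, $\Delta(E_\alpha)=E_\alpha\otimes1+K_\alpha\otimes E_\alpha$, $\Delta(F_\alpha)=F_\alpha\otimes K_\alpha^{-1}+1\otimes F_\alpha$, $\Delta(K_\alpha)=K_\alpha\otimes K_\alpha$. $\mathbb{C}[L]$ is the span of $K_\mu$, $\mu\in L$, where $K_\mu=\prod K_{\alpha_i}^{a_i}$ for $\mu=\sum a_i\alpha_i$. $x=\prod_{\alpha\in\mathrm{supp}}s_\alpha$; $\psi U^+$ is the subalgebra generated by all $E_\alpha K_\alpha^{-1}$, $\alpha\in\Pi$; $U^-[x]^{op}$ is generated by the $F_\alpha$, $\alpha\in\mathrm{supp}$. Characters: $\phi_+(E_\alpha K_\alpha^{-1})=\lambda^+_\alpha$ for $\alpha\in\mathrm{supp}$ and $=0$ for $\alpha\in\Pi\setminus\mathrm{supp}$;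 $\phi_-(F_\alpha)=\lambda_\alpha^-$. For a right coideal subalgebra $A$ with character $\phi$, $A_\phi=\{\phi(a^{(1)})a^{(2)}\mid a\in A\}$. For $\alpha\in\mathrm{supp}$: $\bar E_\alpha=E_\alpha K_\alpha^{-1}+\lambda^+_\alpha K_\alpha^{-1}$, $\bar F_\alpha=F_\alpha+\lambda^-_\alpha K_\alpha^{-1}$, and $\langle\bar E_\alpha,\bar F_\alpha\rangle$ is the subalgebra they generate. The quantum Weyl algebra (with parameter $q_\alpha$) is, up to rescaling generators, $\mathbb{C}\langle X,Y\rangle/(XY-q_\alpha^2YX-1)$. *)

theory Defs
  imports
    "HOL-Analysis.Inner_Product"
    "HOL-Library.Poly_Mapping"
    "HOL-Algebra.QuotRing"
    "HOL-Algebra.Module"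
    "HOL-Algebra.Product_Groups"
begin

unbundle inner_syntax

section \<open>Complex associative algebras\<close>

text \<open>
  An algebra over the complex numbers is represented by a record of type \<open>(complex, 'a) module\<close>,
  i.e. a ring record with a scalar multiplication. The locale \<^locale>\<open>algebra\<close> of the
  library is not used, since it is restricted to commutative rings. The same record type serves for
  complex vector spaces, whose fields \<open>mult\<close> and \<open>one\<close> are then irrelevant.
\<close>

definition complex_alg :: "(complex, complex) module" where
  "complex_alg = \<lparr>carrier = UNIV, monoid.mult = (*), one = 1, zero = 0, add = (+), smult = (*)\<rparr>"

definition alg_hom :: "(complex, 'a) module \<Rightarrow> (complex, 'b) module \<Rightarrow> ('a \<Rightarrow> 'b) set" where
  "alg_hom A B = {h \<in> ring_hom A B.
     \<forall>c. \<forall>x\<in>carrier A. h (c \<odot>\<^bsub>A\<^esub> x) = c \<odot>\<^bsub>B\<^esub> h x}"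

definition alg_iso :: "(complex, 'a) module \<Rightarrow> (complex, 'b) module \<Rightarrow> ('a \<Rightarrow> 'b) set" where
  "alg_iso A B = {h \<in> alg_hom A B. bij_betw h (carrier A) (carrier B)}"

inductive_set lin_span :: "(complex, 'a) module \<Rightarrow> 'a set \<Rightarrow> 'a set"
  for V :: "(complex, 'a) module" and S :: "'a set" where
  span_zero: "\<zero>\<^bsub>V\<^esub> \<in> lin_span V S"
| span_base: "x \<in> S \<Longrightarrow> x \<in> lin_span V S"
| span_add: "x \<in> lin_span V S \<Longrightarrow> y \<in> lin_span V S \<Longrightarrow> x \<oplus>\<^bsub>V\<^esub> y \<in> lin_span V S"
| span_smult: "x \<in> lin_span V S \<Longrightarrow> c \<odot>\<^bsub>V\<^esub> x \<in> lin_span V S"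

definition subalg :: "'a set \<Rightarrow> (complex, 'a) module \<Rightarrow> bool" where
  "subalg B A \<longleftrightarrow> B \<subseteq> carrier A \<and> \<zero>\<^bsub>A\<^esub> \<in> B \<and> \<one>\<^bsub>A\<^esub> \<in> B \<and>
     (\<forall>x\<in>B. \<forall>y\<in>B. x \<oplus>\<^bsub>A\<^esub> y \<in> B \<and> x \<otimes>\<^bsub>A\<^esub> y \<in> B) \<and> (\<forall>c. \<forall>x\<in>B. c \<odot>\<^bsub>A\<^esub> x \<in> B)"

definition alg_gen :: "(complex, 'a) module \<Rightarrow> 'a set \<Rightarrow> 'a set" where
  "alg_gen A S = \<Inter>{B. subalg B A \<and> S \<subseteq> B}"

text \<open>The subset \<open>B\<close> of \<open>A\<close> as an algebra in its own right.\<close>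

abbreviation restrict_alg :: "(complex, 'a) module \<Rightarrow> 'a set \<Rightarrow> (complex, 'a) module" where
  "restrict_alg A B \<equiv> A\<lparr>carrier := B\<rparr>"

definition quot_alg :: "(complex, 'a) module \<Rightarrow> 'a set \<Rightarrow> (complex, 'a set) module" where
  "quot_alg A I = \<lparr>carrier = carrier (A Quot I), monoid.mult = monoid.mult (A Quot I),
     one = one (A Quot I), zero = zero (A Quot I), add = add (A Quot I),
     smult = (\<lambda>c X. \<Union>x\<in>X. I +>\<^bsub>A\<^esub> (c \<odot>\<^bsub>A\<^esub> x))\<rparr>"

text \<open>The algebra with basis the monoid \<open>M\<close> and multiplication extended bilinearly.\<close>

definition monoid_alg :: "('m, 'x) monoid_scheme \<Rightarrow> (complex, 'm \<Rightarrow>\<^sub>0 complex) module" where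
  "monoid_alg M = \<lparr>carrier = {p. Poly_Mapping.keys p \<subseteq> carrier M},
     monoid.mult = (\<lambda>p r. \<Sum>x\<in>Poly_Mapping.keys p. \<Sum>y\<in>Poly_Mapping.keys r.
       Poly_Mapping.single (x \<otimes>\<^bsub>M\<^esub> y) (Poly_Mapping.lookup p x * Poly_Mapping.lookup r y)),
     one = Poly_Mapping.single \<one>\<^bsub>M\<^esub> 1, zero = 0, add = (+),
     smult = (\<lambda>c. Poly_Mapping.map ((*) c))\<rparr>"

definition free_monoid :: "'g set \<Rightarrow> 'g list monoid" where
  "free_monoid G = \<lparr>carrier = lists G, monoid.mult = (@), one = []\<rparr>"

definition free_alg :: "'g set \<Rightarrow> (complex, 'g list \<Rightarrow>\<^sub>0 complex) module" where
  "free_alg G = monoid_alg (free_monoid G)"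

text \<open>
  The algebra generated by \<open>G\<close> subject to the relations \<open>r = 0\<close> for \<open>r \<in> R\<close>; note that
  \<^const>\<open>genideal\<close> is the generated two-sided ideal.
\<close>

definition presented_alg ::
  "'g set \<Rightarrow> ('g list \<Rightarrow>\<^sub>0 complex) set \<Rightarrow> (complex, ('g list \<Rightarrow>\<^sub>0 complex) set) module" where
  "presented_alg G R = quot_alg (free_alg G) (Idl\<^bsub>free_alg G\<^esub> R)"

definition presented_word ::
  "'g set \<Rightarrow> ('g list \<Rightarrow>\<^sub>0 complex) set \<Rightarrow> 'g list \<Rightarrow> ('g list \<Rightarrow>\<^sub>0 complex) set" where
  "presented_word G R w = (Idl\<^bsub>free_alg G\<^esub> R) +>\<^bsub>free_alg G\<^esub> Poly_Mapping.single w 1"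

section \<open>Tensor products of families of algebras\<close>

text \<open>
  The tensor product of the algebras \<open>A j\<close>, \<open>j \<in> J\<close>, is the algebra whose basis is the product of
  their multiplicative monoids, modulo the relations expressing multilinearity. The linear span of
  these relations is an ideal, so that the underlying vector space is the usual tensor product.
  (\<^const>\<open>product_group\<close> is the componentwise product of any family of monoids.)
\<close>

definition multilinear_rels ::
  "'j set \<Rightarrow> ('j \<Rightarrow> (complex, 'a) module) \<Rightarrow> (('j \<Rightarrow> 'a) \<Rightarrow>\<^sub>0 complex) set" where
  "multilinear_rels J A =
     {Poly_Mapping.single (x(j := a \<oplus>\<^bsub>A j\<^esub> b)) 1
        - Poly_Mapping.single (x(j := a)) 1 - Poly_Mapping.single (x(j := b)) 1
      | x j a b. x \<in> (\<Pi>\<^sub>E i\<in>J. carrier (A i)) \<and> j \<in> J \<and> a \<in> carrier (A j) \<and> b \<in> carrier (A j)} \<union>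
     {Poly_Mapping.single (x(j := c \<odot>\<^bsub>A j\<^esub> a)) 1 - Poly_Mapping.single (x(j := a)) c
      | x j a c. x \<in> (\<Pi>\<^sub>E i\<in>J. carrier (A i)) \<and> j \<in> J \<and> a \<in> carrier (A j)}"

definition tensor_ideal ::
  "'j set \<Rightarrow> ('j \<Rightarrow> (complex, 'a) module) \<Rightarrow> (('j \<Rightarrow> 'a) \<Rightarrow>\<^sub>0 complex) set" where
  "tensor_ideal J A = Idl\<^bsub>monoid_alg (product_group J A)\<^esub> (multilinear_rels J A)"

definition tensor_alg ::
  "'j set \<Rightarrow> ('j \<Rightarrow> (complex, 'a) module) \<Rightarrow> (complex, (('j \<Rightarrow> 'a) \<Rightarrow>\<^sub>0 complex) set) module" where
  "tensor_alg J A = quot_alg (monoid_alg (product_group J A)) (tensor_ideal J A)"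

definition pure_tensor ::
  "'j set \<Rightarrow> ('j \<Rightarrow> (complex, 'a) module) \<Rightarrow> ('j \<Rightarrow> 'a) \<Rightarrow> (('j \<Rightarrow> 'a) \<Rightarrow>\<^sub>0 complex) set" where
  "pure_tensor J A x = tensor_ideal J A +>\<^bsub>monoid_alg (product_group J A)\<^esub>
     Poly_Mapping.single (restrict x J) 1"

text \<open>The canonical map from the \<open>j\<close>-th factor, \<open>a \<mapsto> 1 \<otimes> \<dots> \<otimes> a \<otimes> \<dots> \<otimes> 1\<close>.\<close>

definition tensor_incl ::
  "'j set \<Rightarrow> ('j \<Rightarrow> (complex, 'a) module) \<Rightarrow> 'j \<Rightarrow> 'a \<Rightarrow> (('j \<Rightarrow> 'a) \<Rightarrow>\<^sub>0 complex) set" where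
  "tensor_incl J A j a = pure_tensor J A (\<lambda>i. if i = j then a else \<one>\<^bsub>A i\<^esub>)"

text \<open>\<open>H \<otimes> H\<close>, with \<^const>\<open>False\<close> indexing the left factor and \<^const>\<open>True\<close> the right one.\<close>

definition tensor_square ::
  "(complex, 'a) module \<Rightarrow> (complex, ((bool \<Rightarrow> 'a) \<Rightarrow>\<^sub>0 complex) set) module" where
  "tensor_square H = tensor_alg UNIV (\<lambda>_. H)"

definition tensor2 ::
  "(complex, 'a) module \<Rightarrow> 'a \<Rightarrow> 'a \<Rightarrow> ((bool \<Rightarrow> 'a) \<Rightarrow>\<^sub>0 complex) set" where
  "tensor2 H x y = pure_tensor UNIV (\<lambda>_. H) (\<lambda>b. if b then y else x)"

section \<open>Root data\<close>

text \<open>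
  Finite-dimensional semisimple complex Lie algebras enter only through their root data: a reduced
  crystallographic root system \<open>\<Phi>\<close> (spanning a subspace of the ambient inner product space), a base
  \<open>B\<close> of simple roots, and the invariant form, which is the inner product. By the theorems of
  Killing, Cartan and Serre every such triple arises from a semisimple Lie algebra, unique up to
  isomorphism, and conversely.
\<close>

definition root_system :: "'a::real_inner set \<Rightarrow> bool" where
  "root_system \<Phi> \<longleftrightarrow> finite \<Phi> \<and> 0 \<notin> \<Phi> \<and>
     (\<forall>\<alpha>\<in>\<Phi>. \<forall>\<beta>\<in>\<Phi>. \<beta> - (2 * (\<beta> \<bullet> \<alpha>) / (\<alpha> \<bullet> \<alpha>)) *\<^sub>R \<alpha> \<in> \<Phi>) \<and>
     (\<forall>\<alpha>\<in>\<Phi>. \<forall>\<beta>\<in>\<Phi>. 2 * (\<beta> \<bullet> \<alpha>) / (\<alpha> \<bullet> \<alpha>) \<in> \<int>) \<and>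
     (\<forall>\<alpha>\<in>\<Phi>. \<forall>c::real. c *\<^sub>R \<alpha> \<in> \<Phi> \<longrightarrow> c = 1 \<or> c = -1)"

definition simple_roots :: "'a::real_inner set \<Rightarrow> 'a set \<Rightarrow> bool" where
  "simple_roots \<Phi> B \<longleftrightarrow> B \<subseteq> \<Phi> \<and> independent B \<and>
     (\<forall>\<beta>\<in>\<Phi>. \<exists>c :: 'a \<Rightarrow> nat. \<beta> = (\<Sum>\<alpha>\<in>B. real (c \<alpha>) *\<^sub>R \<alpha>) \<or> \<beta> = - (\<Sum>\<alpha>\<in>B. real (c \<alpha>) *\<^sub>R \<alpha>))"

definition even_form :: "'a::real_inner set \<Rightarrow> bool" where
  "even_form \<Phi> \<longleftrightarrow> (\<forall>\<alpha>\<in>\<Phi>. \<exists>n::nat. n > 0 \<and> \<alpha> \<bullet> \<alpha> = 2 * real n)"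

definition root_lattice :: "'a::real_inner set \<Rightarrow> 'a set" where
  "root_lattice B = {\<Sum>\<alpha>\<in>B. real_of_int (c \<alpha>) *\<^sub>R \<alpha> | c :: 'a \<Rightarrow> int. True}"

text \<open>
  The form is integral on the root lattice, and the Cartan numbers of simple roots are integers, so
  the floor functions below do not round.
\<close>

definition int_form :: "'a::real_inner \<Rightarrow> 'a \<Rightarrow> int" where
  "int_form \<mu> \<nu> = \<lfloor>\<mu> \<bullet> \<nu>\<rfloor>"

definition cartan :: "'a::real_inner \<Rightarrow> 'a \<Rightarrow> int" where
  "cartan \<alpha> \<beta> = \<lfloor>2 * (\<alpha> \<bullet> \<beta>) / (\<alpha> \<bullet> \<alpha>)\<rfloor>"

definition q_root :: "complex \<Rightarrow> 'a::real_inner \<Rightarrow> complex" where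
  "q_root q \<alpha> = q powi \<lfloor>(\<alpha> \<bullet> \<alpha>) / 2\<rfloor>"

section \<open>The quantized enveloping algebra\<close>

text \<open>Symbols for the generators; \<open>gKI \<alpha>\<close> stands for the inverse of \<open>gK \<alpha>\<close>.\<close>

datatype 'a qgen = gE 'a | gF 'a | gK 'a | gKI 'a

definition qgens :: "'a set \<Rightarrow> 'a qgen set" where
  "qgens B = gE ` B \<union> gF ` B \<union> gK ` B \<union> gKI ` B"

definition qnum :: "complex \<Rightarrow> nat \<Rightarrow> complex" where
  "qnum v n = (v ^ n - inverse v ^ n) / (v - inverse v)"

definition qfact :: "complex \<Rightarrow> nat \<Rightarrow> complex" where
  "qfact v n = (\<Prod>k=1..n. qnum v k)"

definition qbinom :: "complex \<Rightarrow> nat \<Rightarrow> nat \<Rightarrow> complex" where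
  "qbinom v n k = qfact v n / (qfact v k * qfact v (n - k))"

abbreviation wd :: "'g list \<Rightarrow> ('g list \<Rightarrow>\<^sub>0 complex)" where
  "wd w \<equiv> Poly_Mapping.single w 1"

definition serre_rel ::
  "complex \<Rightarrow> ('a \<Rightarrow> 'a qgen) \<Rightarrow> 'a::real_inner \<Rightarrow> 'a \<Rightarrow> ('a qgen list \<Rightarrow>\<^sub>0 complex)" where
  "serre_rel q X \<alpha> \<beta> = (let n = nat (1 - cartan \<alpha> \<beta>) in
     \<Sum>k\<le>n. Poly_Mapping.single (replicate (n - k) (X \<alpha>) @ [X \<beta>] @ replicate k (X \<alpha>))
        ((- 1) ^ k * qbinom (q_root q \<alpha>) n k))"

definition Uq_rels ::
  "'a::real_inner set \<Rightarrow> complex \<Rightarrow> ('a qgen list \<Rightarrow>\<^sub>0 complex) set" where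
  "Uq_rels B q =
     (\<Union>\<alpha>\<in>B. {wd [gK \<alpha>, gKI \<alpha>] - wd [], wd [gKI \<alpha>, gK \<alpha>] - wd []}) \<union>
     (\<Union>\<alpha>\<in>B. \<Union>\<beta>\<in>B.
       {wd [gK \<alpha>, gK \<beta>] - wd [gK \<beta>, gK \<alpha>],
        wd [gK \<alpha>, gE \<beta>] - Poly_Mapping.single [gE \<beta>, gK \<alpha>] (q powi int_form \<alpha> \<beta>),
        wd [gK \<alpha>, gF \<beta>] - Poly_Mapping.single [gF \<beta>, gK \<alpha>] (q powi (- int_form \<alpha> \<beta>)),
        wd [gE \<alpha>, gF \<beta>] - wd [gF \<beta>, gE \<alpha>]
          - (if \<alpha> = \<beta> then
               Poly_Mapping.single [gK \<alpha>] (1 / (q_root q \<alpha> - inverse (q_root q \<alpha>)))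
               - Poly_Mapping.single [gKI \<alpha>] (1 / (q_root q \<alpha> - inverse (q_root q \<alpha>)))
             else 0)}) \<union>
     (\<Union>\<alpha>\<in>B. \<Union>\<beta>\<in>B - {\<alpha>}. {serre_rel q gE \<alpha> \<beta>, serre_rel q gF \<alpha> \<beta>})"

type_synonym 'a uq = "('a qgen list \<Rightarrow>\<^sub>0 complex) set"

definition Uq :: "'a::real_inner set \<Rightarrow> complex \<Rightarrow> (complex, 'a uq) module" where
  "Uq B q = presented_alg (qgens B) (Uq_rels B q)"

definition uword :: "'a::real_inner set \<Rightarrow> complex \<Rightarrow> 'a qgen list \<Rightarrow> 'a uq" where
  "uword B q = presented_word (qgens B) (Uq_rels B q)"

text \<open>
  For \<open>\<mu> = \<Sum>\<alpha>\<in>B. a \<alpha> *\<^sub>R \<alpha>\<close> in the root lattice, \<open>K_elt B q \<mu>\<close> is the product of the \<open>gK \<alpha>\<close> to the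
  power \<open>a \<alpha>\<close>. These commute in \<^const>\<open>Uq\<close>, so the chosen enumeration of \<open>B\<close> is immaterial.
\<close>

definition K_power_word :: "'a \<Rightarrow> int \<Rightarrow> 'a qgen list" where
  "K_power_word \<alpha> n = (if n \<ge> 0 then replicate (nat n) (gK \<alpha>) else replicate (nat (- n)) (gKI \<alpha>))"

definition K_elt :: "'a::real_inner set \<Rightarrow> complex \<Rightarrow> 'a \<Rightarrow> 'a uq" where
  "K_elt B q \<mu> = uword B q
     (concat (map (\<lambda>\<alpha>. K_power_word \<alpha> \<lfloor>representation B \<mu> \<alpha>\<rfloor>)
       (SOME xs. set xs = B \<and> distinct xs)))"

definition torus_alg :: "'a::real_inner set \<Rightarrow> complex \<Rightarrow> 'a set \<Rightarrow> 'a uq set" where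
  "torus_alg B q L = lin_span (Uq B q) (K_elt B q ` L)"

definition is_comult ::
  "'a::real_inner set \<Rightarrow> complex \<Rightarrow> ('a uq \<Rightarrow> ((bool \<Rightarrow> 'a uq) \<Rightarrow>\<^sub>0 complex) set) \<Rightarrow> bool" where
  "is_comult B q \<Delta> \<longleftrightarrow> (let U = Uq B q; u = uword B q; T = tensor_square U in
     \<Delta> \<in> alg_hom U T \<and>
     (\<forall>\<alpha>\<in>B.
       \<Delta> (u [gE \<alpha>]) = tensor2 U (u [gE \<alpha>]) \<one>\<^bsub>U\<^esub> \<oplus>\<^bsub>T\<^esub> tensor2 U (u [gK \<alpha>]) (u [gE \<alpha>]) \<and>
       \<Delta> (u [gF \<alpha>]) = tensor2 U (u [gF \<alpha>]) (u [gKI \<alpha>]) \<oplus>\<^bsub>T\<^esub> tensor2 U \<one>\<^bsub>U\<^esub> (u [gF \<alpha>]) \<and>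
       \<Delta> (u [gK \<alpha>]) = tensor2 U (u [gK \<alpha>]) (u [gK \<alpha>])))"

definition right_coideal_subalg ::
  "(complex, 'a) module \<Rightarrow> ('a \<Rightarrow> ((bool \<Rightarrow> 'a) \<Rightarrow>\<^sub>0 complex) set) \<Rightarrow> 'a set \<Rightarrow> bool" where
  "right_coideal_subalg H \<Delta> A \<longleftrightarrow> subalg A H \<and>
     (\<forall>a\<in>A. \<Delta> a \<in> lin_span (tensor_square H) {tensor2 H x y | x y. x \<in> A \<and> y \<in> carrier H})"

definition is_character :: "(complex, 'a) module \<Rightarrow> 'a set \<Rightarrow> ('a \<Rightarrow> complex) \<Rightarrow> bool" where
  "is_character H A \<phi> \<longleftrightarrow> \<phi> \<in> alg_hom (restrict_alg H A) complex_alg"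

text \<open>
  \<open>A\<^sub>\<phi>\<close>, the set of all \<open>\<phi>(a\<^sub>1) a\<^sub>2\<close> (Sweedler notation) with \<open>a \<in> A\<close>: the list \<open>ts\<close> of pairs
  \<open>(x, y)\<close> is an expression \<open>\<Sum> x \<otimes> y\<close> of \<open>\<Delta> a\<close> as an element of \<open>A \<otimes> H\<close>, which exists if \<open>A\<close> is a
  right coideal.
\<close>

definition character_shift ::
  "(complex, 'a) module \<Rightarrow> ('a \<Rightarrow> ((bool \<Rightarrow> 'a) \<Rightarrow>\<^sub>0 complex) set) \<Rightarrow> 'a set \<Rightarrow> ('a \<Rightarrow> complex) \<Rightarrow> 'a set"
  where
  "character_shift H \<Delta> A \<phi> =
     {foldr (\<lambda>(x, y) s. (\<phi> x \<odot>\<^bsub>H\<^esub> y) \<oplus>\<^bsub>H\<^esub> s) ts \<zero>\<^bsub>H\<^esub> | ts.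
        set ts \<subseteq> A \<times> carrier H \<and>
        (\<exists>a\<in>A. \<Delta> a = foldr (\<lambda>(x, y) s. tensor2 H x y \<oplus>\<^bsub>tensor_square H\<^esub> s) ts
                         \<zero>\<^bsub>tensor_square H\<^esub>)}"

section \<open>The coideal subalgebra and its quotient\<close>

definition EK :: "'a::real_inner set \<Rightarrow> complex \<Rightarrow> 'a \<Rightarrow> 'a uq" where
  "EK B q \<alpha> = uword B q [gE \<alpha>] \<otimes>\<^bsub>Uq B q\<^esub> uword B q [gKI \<alpha>]"

definition psi_Uplus :: "'a::real_inner set \<Rightarrow> complex \<Rightarrow> 'a uq set" where
  "psi_Uplus B q = alg_gen (Uq B q) (EK B q ` B)"

definition Uminus :: "'a::real_inner set \<Rightarrow> complex \<Rightarrow> 'a set \<Rightarrow> 'a uq set" where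
  "Uminus B q S = alg_gen (Uq B q) ((\<lambda>\<alpha>. uword B q [gF \<alpha>]) ` S)"

definition orth_lattice :: "'a::real_inner set \<Rightarrow> 'a set \<Rightarrow> 'a set" where
  "orth_lattice B S = {\<mu> \<in> root_lattice B. \<forall>\<alpha>\<in>S. \<mu> \<bullet> \<alpha> = 0}"

definition coideal_C ::
  "'a::real_inner set \<Rightarrow> complex \<Rightarrow> ('a uq \<Rightarrow> ((bool \<Rightarrow> 'a uq) \<Rightarrow>\<^sub>0 complex) set) \<Rightarrow>
   'a set \<Rightarrow> ('a uq \<Rightarrow> complex) \<Rightarrow> ('a uq \<Rightarrow> complex) \<Rightarrow> 'a uq set" where
  "coideal_C B q \<Delta> S \<phi>m \<phi>p = lin_span (Uq B q)
     {u \<otimes>\<^bsub>Uq B q\<^esub> k \<otimes>\<^bsub>Uq B q\<^esub> v | u k v.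
        u \<in> character_shift (Uq B q) \<Delta> (Uminus B q S) \<phi>m \<and>
        k \<in> torus_alg B q (orth_lattice B S) \<and>
        v \<in> character_shift (Uq B q) \<Delta> (psi_Uplus B q) \<phi>p}"

definition E_bar :: "'a::real_inner set \<Rightarrow> complex \<Rightarrow> ('a \<Rightarrow> complex) \<Rightarrow> 'a \<Rightarrow> 'a uq" where
  "E_bar B q lp \<alpha> = EK B q \<alpha> \<oplus>\<^bsub>Uq B q\<^esub> (lp \<alpha> \<odot>\<^bsub>Uq B q\<^esub> uword B q [gKI \<alpha>])"

definition F_bar :: "'a::real_inner set \<Rightarrow> complex \<Rightarrow> ('a \<Rightarrow> complex) \<Rightarrow> 'a \<Rightarrow> 'a uq" where
  "F_bar B q lm \<alpha> = uword B q [gF \<alpha>] \<oplus>\<^bsub>Uq B q\<^esub> (lm \<alpha> \<odot>\<^bsub>Uq B q\<^esub> uword B q [gKI \<alpha>])"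

definition EF_alg ::
  "'a::real_inner set \<Rightarrow> complex \<Rightarrow> ('a \<Rightarrow> complex) \<Rightarrow> ('a \<Rightarrow> complex) \<Rightarrow> 'a \<Rightarrow> (complex, 'a uq) module"
  where
  "EF_alg B q lp lm \<alpha> =
     restrict_alg (Uq B q) (alg_gen (Uq B q) {E_bar B q lp \<alpha>, F_bar B q lm \<alpha>})"

text \<open>
  The factors of the tensor product: \<^const>\<open>None\<close> indexes the group algebra of the lattice and
  \<open>Some \<alpha>\<close> the algebra attached to \<open>\<alpha> \<in> S\<close>.
\<close>

definition bar_index :: "'a set \<Rightarrow> 'a option set" where
  "bar_index S = insert None (Some ` S)"

definition bar_factor ::
  "'a::real_inner set \<Rightarrow> complex \<Rightarrow> 'a set \<Rightarrow> ('a \<Rightarrow> complex) \<Rightarrow> ('a \<Rightarrow> complex) \<Rightarrow>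
   'a option \<Rightarrow> (complex, 'a uq) module" where
  "bar_factor B q S lp lm j = (case j of
      None \<Rightarrow> restrict_alg (Uq B q) (torus_alg B q (orth_lattice B S))
    | Some \<alpha> \<Rightarrow> EF_alg B q lp lm \<alpha>)"

definition C_bar ::
  "'a::real_inner set \<Rightarrow> complex \<Rightarrow> 'a set \<Rightarrow> ('a \<Rightarrow> complex) \<Rightarrow> ('a \<Rightarrow> complex) \<Rightarrow>
   (complex, (('a option \<Rightarrow> 'a uq) \<Rightarrow>\<^sub>0 complex) set) module" where
  "C_bar B q S lp lm = tensor_alg (bar_index S) (bar_factor B q S lp lm)"

definition bar_incl ::
  "'a::real_inner set \<Rightarrow> complex \<Rightarrow> 'a set \<Rightarrow> ('a \<Rightarrow> complex) \<Rightarrow> ('a \<Rightarrow> complex) \<Rightarrow>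
   'a option \<Rightarrow> 'a uq \<Rightarrow> (('a option \<Rightarrow> 'a uq) \<Rightarrow>\<^sub>0 complex) set" where
  "bar_incl B q S lp lm = tensor_incl (bar_index S) (bar_factor B q S lp lm)"

text \<open>
  \<open>\<pi>\<close> exhibits \<^const>\<open>C_bar\<close> as the quotient of \<open>C\<close> in which the torus part and the
  generators \<^const>\<open>E_bar\<close>, \<^const>\<open>F_bar\<close> map to the elements of the same name.
\<close>

definition is_bar_quotient ::
  "'a::real_inner set \<Rightarrow> complex \<Rightarrow> 'a set \<Rightarrow> ('a \<Rightarrow> complex) \<Rightarrow> ('a \<Rightarrow> complex) \<Rightarrow> 'a uq set \<Rightarrow>
   ('a uq \<Rightarrow> (('a option \<Rightarrow> 'a uq) \<Rightarrow>\<^sub>0 complex) set) \<Rightarrow> bool" where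
  "is_bar_quotient B q S lp lm C \<pi> \<longleftrightarrow>
     \<pi> \<in> alg_hom (restrict_alg (Uq B q) C) (C_bar B q S lp lm) \<and>
     \<pi> ` C = carrier (C_bar B q S lp lm) \<and>
     (\<forall>k\<in>torus_alg B q (orth_lattice B S). \<pi> k = bar_incl B q S lp lm None k) \<and>
     (\<forall>\<alpha>\<in>S. \<pi> (E_bar B q lp \<alpha>) = bar_incl B q S lp lm (Some \<alpha>) (E_bar B q lp \<alpha>) \<and>
            \<pi> (F_bar B q lm \<alpha>) = bar_incl B q S lp lm (Some \<alpha>) (F_bar B q lm \<alpha>))"

section \<open>Quantum Weyl algebras\<close>

datatype weyl_gen = wX | wY

definition weyl_rels :: "complex \<Rightarrow> (weyl_gen list \<Rightarrow>\<^sub>0 complex) set" where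
  "weyl_rels v = {wd [wX, wY] - Poly_Mapping.single [wY, wX] (v\<^sup>2) - wd []}"

definition quantum_weyl :: "complex \<Rightarrow> (complex, (weyl_gen list \<Rightarrow>\<^sub>0 complex) set) module" where
  "quantum_weyl v = presented_alg UNIV (weyl_rels v)"

definition weyl_word :: "complex \<Rightarrow> weyl_gen list \<Rightarrow> (weyl_gen list \<Rightarrow>\<^sub>0 complex) set" where
  "weyl_word v = presented_word UNIV (weyl_rels v)"

text \<open>\<open>a, b\<close> generate \<open>A\<close> as a quantum Weyl algebra, up to rescaling the generators.\<close>

definition is_quantum_weyl :: "complex \<Rightarrow> (complex, 'a) module \<Rightarrow> 'a \<Rightarrow> 'a \<Rightarrow> bool" where
  "is_quantum_weyl v A a b \<longleftrightarrow> (\<exists>h c d. h \<in> alg_iso (quantum_weyl v) A \<and> c \<noteq> 0 \<and> d \<noteq> 0 \<and>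
     h (weyl_word v [wX]) = c \<odot>\<^bsub>A\<^esub> a \<and> h (weyl_word v [wY]) = d \<odot>\<^bsub>A\<^esub> b)"

section \<open>Modules\<close>

definition alg_module ::
  "(complex, 'a) module \<Rightarrow> (complex, 'v) module \<Rightarrow> ('a \<Rightarrow> 'v \<Rightarrow> 'v) \<Rightarrow> bool" where
  "alg_module A V act \<longleftrightarrow> module complex_alg V \<and>
     (\<forall>a\<in>carrier A. \<forall>v\<in>carrier V. act a v \<in> carrier V) \<and>
     (\<forall>a\<in>carrier A. \<forall>v\<in>carrier V. \<forall>w\<in>carrier V. act a (v \<oplus>\<^bsub>V\<^esub> w) = act a v \<oplus>\<^bsub>V\<^esub> act a w) \<and>
     (\<forall>a\<in>carrier A. \<forall>c. \<forall>v\<in>carrier V. act a (c \<odot>\<^bsub>V\<^esub> v) = c \<odot>\<^bsub>V\<^esub> act a v) \<and>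
     (\<forall>a\<in>carrier A. \<forall>b\<in>carrier A. \<forall>v\<in>carrier V. act (a \<oplus>\<^bsub>A\<^esub> b) v = act a v \<oplus>\<^bsub>V\<^esub> act b v) \<and>
     (\<forall>c. \<forall>a\<in>carrier A. \<forall>v\<in>carrier V. act (c \<odot>\<^bsub>A\<^esub> a) v = c \<odot>\<^bsub>V\<^esub> act a v) \<and>
     (\<forall>a\<in>carrier A. \<forall>b\<in>carrier A. \<forall>v\<in>carrier V. act (a \<otimes>\<^bsub>A\<^esub> b) v = act a (act b v)) \<and>
     (\<forall>v\<in>carrier V. act \<one>\<^bsub>A\<^esub> v = v)"

definition finite_dim :: "(complex, 'v) module \<Rightarrow> bool" where
  "finite_dim V \<longleftrightarrow> (\<exists>S. finite S \<and> S \<subseteq> carrier V \<and> lin_span V S = carrier V)"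

definition irreducible_module ::
  "(complex, 'a) module \<Rightarrow> (complex, 'v) module \<Rightarrow> ('a \<Rightarrow> 'v \<Rightarrow> 'v) \<Rightarrow> bool" where
  "irreducible_module A V act \<longleftrightarrow> alg_module A V act \<and> carrier V \<noteq> {\<zero>\<^bsub>V\<^esub>} \<and>
     (\<forall>W. submodule W complex_alg V \<and> (\<forall>a\<in>carrier A. \<forall>w\<in>W. act a w \<in> W) \<longrightarrow>
          W = {\<zero>\<^bsub>V\<^esub>} \<or> W = carrier V)"

text \<open>The action of \<open>A\<close> on \<open>V\<close> is the pullback along \<open>\<pi>\<close> of an action of \<open>A'\<close>.\<close>

definition factors_over ::
  "(complex, 'a) module \<Rightarrow> (complex, 'v) module \<Rightarrow> ('a \<Rightarrow> 'v \<Rightarrow> 'v) \<Rightarrow>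
   (complex, 'b) module \<Rightarrow> ('a \<Rightarrow> 'b) \<Rightarrow> bool" where
  "factors_over A V act A' \<pi> \<longleftrightarrow> (\<exists>act'. alg_module A' V act' \<and>
     (\<forall>a\<in>carrier A. \<forall>v\<in>carrier V. act a v = act' (\<pi> a) v))"

end

theory Submission
  imports "HOL-Library.Multiset" "HOL-Computational_Algebra.Fundamental_Theorem_Algebra" Defs
begin

text \<open>
  Let \<open>E_bar \<beta> = E\<^sub>\<beta> K\<^sub>\<beta>\<^sup>-\<^sup>1\<close> for the simple roots \<open>\<beta> \<notin> supp\<close>. Every generator \<open>g = F\<^sub>\<alpha>\<close> or \<open>g = E\<^sub>\<beta> K\<^sub>\<beta>\<^sup>-\<^sup>1\<close>
  has a coproduct of the form \<open>g \<otimes> K\<^sup>-\<^sup>1 + 1 \<otimes> g\<close>, so the character shifts turn it into \<open>F_bar \<alpha>\<close> or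
  \<open>E_bar \<beta>\<close>, and \<open>C\<close> is the subalgebra generated by these elements and the \<open>K\<^sub>\<mu>\<close> with \<open>\<mu> \<in> L\<close>
  (\<open>character_shift_gen\<close>, \<open>coideal_C_eq\<close>). The generators commute up to powers of \<open>q\<close>, except that
  \<open>E_bar \<alpha>\<close> and \<open>F_bar \<alpha>\<close> for \<open>\<alpha> \<in> supp\<close> satisfy the relation of a quantum Weyl algebra: the condition on
  \<open>\<lambda>\<^sup>+\<^sub>\<alpha> \<lambda>\<^sup>-\<^sub>\<alpha>\<close> makes the terms in \<open>K\<^sub>\<alpha>\<^sup>-\<^sup>2\<close> cancel. Hence \<open>C\<close> is spanned by the products of some
  \<open>F_bar\<close>, one \<open>K\<^sub>\<mu>\<close> and some \<open>E_bar\<close>, in this order.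

  The heart of the proof is that these products, as long as only roots of \<open>supp\<close> occur, are linearly
  independent even modulo the span of the others (\<open>normal_forms_independent\<close>). Instead of a PBW basis
  of \<open>U\<close> this uses a right action of \<open>U\<close> on functions of triples (word, weight, word), dual to left
  multiplication on products \<open>F\<^sub>w K\<^sub>\<nu> E\<^sub>z\<close>. The functions that vanish on the Serre elements form a
  submodule. As the roots of \<open>supp\<close> are pairwise orthogonal, functions of the multisets of letters belong
  to it, and they separate the normal forms. Independence yields a universal property
  (\<open>coideal_hom\<close>): elements of any algebra which satisfy the same rules, with zero in place of the
  \<open>E_bar \<beta>\<close>, \<open>\<beta> \<notin> supp\<close>, define a homomorphism. This gives the quotient map from \<open>C\<close> to the tensor
  product, and the isomorphisms of the tensor factors with quantum Weyl algebras.

  For the modules, take \<open>\<mu> = 2\<rho> - \<Sum>supp\<close>, which lies in \<open>L\<close> and satisfies \<open>(\<mu>, \<beta>) > 0\<close> for simple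
  \<open>\<beta> \<notin> supp\<close>. Applying such an \<open>E_bar \<beta>\<close> multiplies the eigenvalue of \<open>K\<^sub>\<mu>\<close> by \<open>q\<close> to the power
  \<open>(\<mu>, \<beta>)\<close>, and the other generators preserve it. A finite-dimensional module has an eigenvalue \<open>z\<close> of \<open>K\<^sub>\<mu>\<close>
  such that no \<open>z q\<^sup>n\<close> with \<open>n > 0\<close> is an eigenvalue; its eigenspace is a submodule killed by the
  \<open>E_bar \<beta>\<close>, \<open>\<beta> \<notin> supp\<close>, and so it is all of an irreducible module (\<open>irreducible_kills\<close>). The quotient
  map kills the same elements (\<open>bar_quotient_kills\<close>), hence the action factors over the quotient, which
  acts through the multiplication map into \<open>C\<close>.
\<close>

section \<open>Complex vector spaces and algebras\<close>

text \<open>Scalars are complex numbers rather than elements of the carrier of a ring, so that the axioms apply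
  without side conditions on them.\<close>

locale cspace = abelian_group V for V :: "(complex, 'v) module" (structure) +
  assumes smult_closed [simp, intro]: "x \<in> carrier V \<Longrightarrow> c \<odot> x \<in> carrier V"
    and smult_l_distr: "x \<in> carrier V \<Longrightarrow> (c + d) \<odot> x = c \<odot> x \<oplus> d \<odot> x"
    and smult_r_distr: "x \<in> carrier V \<Longrightarrow> y \<in> carrier V \<Longrightarrow> c \<odot> (x \<oplus> y) = c \<odot> x \<oplus> c \<odot> y"
    and smult_smult: "x \<in> carrier V \<Longrightarrow> c \<odot> (d \<odot> x) = (c * d) \<odot> x"
    and smult_one [simp]: "x \<in> carrier V \<Longrightarrow> 1 \<odot> x = x"
begin

lemma smult_0_l [simp]: "x \<in> carrier V \<Longrightarrow> 0 \<odot> x = \<zero>"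
  using smult_l_distr[of x 0 0] by (metis add_0 add.r_cancel_one' smult_closed)

lemma smult_0_r [simp]: "c \<odot> \<zero> = \<zero>"
  using smult_smult[of \<zero> c 0] by simp

lemma smult_eq_zero: "x \<in> carrier V \<Longrightarrow> c \<noteq> 0 \<Longrightarrow> c \<odot> x = \<zero> \<Longrightarrow> x = \<zero>"
  using smult_smult[of x "inverse c" c] by simp

lemma smult_finsum:
  "f \<in> I \<rightarrow> carrier V \<Longrightarrow> c \<odot> finsum V f I = (\<Oplus>i\<in>I. c \<odot> f i)"
proof (induction I rule: infinite_finite_induct)
  case (insert x F)
  then have "f x \<in> carrier V" "f \<in> F \<rightarrow> carrier V" by auto
  then show ?case using insert by (simp add: Pi_def smult_r_distr)
qed auto

end

locale calg = ring A + cspace A for A :: "(complex, 'a) module" (structure) +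
  assumes smult_mult_l: "x \<in> carrier A \<Longrightarrow> y \<in> carrier A \<Longrightarrow> (c \<odot> x) \<otimes> y = c \<odot> (x \<otimes> y)"
    and smult_mult_r: "x \<in> carrier A \<Longrightarrow> y \<in> carrier A \<Longrightarrow> x \<otimes> (c \<odot> y) = c \<odot> (x \<otimes> y)"
begin

lemma smult_uminus: "x \<in> carrier A \<Longrightarrow> (- c) \<odot> x = \<ominus> (c \<odot> x)"
  using smult_l_distr[of x "- c" c] by (simp add: minus_equality)

lemma smult_neg_one_l_neg: "x \<in> carrier A \<Longrightarrow> (- 1) \<odot> x \<oplus> x = \<zero>"
  by (simp add: smult_uminus l_neg)

lemma minus_smult: "x \<in> carrier A \<Longrightarrow> y \<in> carrier A \<Longrightarrow> x \<ominus> y = x \<oplus> (- 1) \<odot> y"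
  by (simp add: smult_uminus a_minus_def)

lemma minus_eq_zeroD: "x \<in> carrier A \<Longrightarrow> y \<in> carrier A \<Longrightarrow> x \<ominus> y = \<zero> \<Longrightarrow> x = y"
  by (metis a_minus_def a_inv_closed minus_equality minus_minus)

lemma smult_diff_distr: "x \<in> carrier A \<Longrightarrow> (c - d) \<odot> x = c \<odot> x \<ominus> d \<odot> x"
  using smult_l_distr[of x c "- d"] by (simp add: smult_uminus a_minus_def)

end

lemma calgI:
  fixes A :: "(complex, 'a) module" (structure)
  assumes "\<And>x y. x \<in> carrier A \<Longrightarrow> y \<in> carrier A \<Longrightarrow> x \<oplus> y \<in> carrier A"
    "\<zero> \<in> carrier A" "\<one> \<in> carrier A"
    "\<And>x y. x \<in> carrier A \<Longrightarrow> y \<in> carrier A \<Longrightarrow> x \<otimes> y \<in> carrier A"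
    "\<And>x c. x \<in> carrier A \<Longrightarrow> c \<odot> x \<in> carrier A"
    "\<And>x. x \<in> carrier A \<Longrightarrow> \<exists>y\<in>carrier A. y \<oplus> x = \<zero>"
    "\<And>x y z. x \<in> carrier A \<Longrightarrow> y \<in> carrier A \<Longrightarrow> z \<in> carrier A \<Longrightarrow> x \<oplus> y \<oplus> z = x \<oplus> (y \<oplus> z)"
    "\<And>x y. x \<in> carrier A \<Longrightarrow> y \<in> carrier A \<Longrightarrow> x \<oplus> y = y \<oplus> x"
    "\<And>x. x \<in> carrier A \<Longrightarrow> \<zero> \<oplus> x = x"
    "\<And>x y z. x \<in> carrier A \<Longrightarrow> y \<in> carrier A \<Longrightarrow> z \<in> carrier A \<Longrightarrow> x \<otimes> y \<otimes> z = x \<otimes> (y \<otimes> z)"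
    "\<And>x. x \<in> carrier A \<Longrightarrow> \<one> \<otimes> x = x" "\<And>x. x \<in> carrier A \<Longrightarrow> x \<otimes> \<one> = x"
    "\<And>x y z. x \<in> carrier A \<Longrightarrow> y \<in> carrier A \<Longrightarrow> z \<in> carrier A \<Longrightarrow> (x \<oplus> y) \<otimes> z = x \<otimes> z \<oplus> y \<otimes> z"
    "\<And>x y z. x \<in> carrier A \<Longrightarrow> y \<in> carrier A \<Longrightarrow> z \<in> carrier A \<Longrightarrow> z \<otimes> (x \<oplus> y) = z \<otimes> x \<oplus> z \<otimes> y"
    "\<And>x c d. x \<in> carrier A \<Longrightarrow> (c + d) \<odot> x = c \<odot> x \<oplus> d \<odot> x"
    "\<And>x y c. x \<in> carrier A \<Longrightarrow> y \<in> carrier A \<Longrightarrow> c \<odot> (x \<oplus> y) = c \<odot> x \<oplus> c \<odot> y"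
    "\<And>x c d. x \<in> carrier A \<Longrightarrow> c \<odot> (d \<odot> x) = (c * d) \<odot> x"
    "\<And>x. x \<in> carrier A \<Longrightarrow> 1 \<odot> x = x"
    "\<And>x y c. x \<in> carrier A \<Longrightarrow> y \<in> carrier A \<Longrightarrow> (c \<odot> x) \<otimes> y = c \<odot> (x \<otimes> y)"
    "\<And>x y c. x \<in> carrier A \<Longrightarrow> y \<in> carrier A \<Longrightarrow> x \<otimes> (c \<odot> y) = c \<odot> (x \<otimes> y)"
  shows "calg A"
  by (intro calg.intro cspace.intro ringI calg_axioms.intro cspace_axioms.intro abelian_groupI monoidI) (fact assms)+

context calg
begin

subsection \<open>Subalgebras\<close>

lemma subalg_carrier: "subalg (carrier A) A"
  by (auto simp: subalg_def)

lemma subalg_calg: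
  assumes "subalg B A"
  shows "calg (restrict_alg A B)"
proof -
  have B: "x \<in> carrier A" if "x \<in> B" for x using assms that by (auto simp: subalg_def)
  have neg: "\<exists>y\<in>B. y \<oplus> x = \<zero>" if "x \<in> B" for x
    using assms that B[OF that] by (intro bexI[of _ "(- 1) \<odot> x"]) (auto simp: subalg_def smult_neg_one_l_neg)
  have Bc: "x \<in> B \<Longrightarrow> y \<in> B \<Longrightarrow> x \<oplus> y \<in> B" "x \<in> B \<Longrightarrow> y \<in> B \<Longrightarrow> x \<otimes> y \<in> B"
    "x \<in> B \<Longrightarrow> c \<odot> x \<in> B" "\<zero> \<in> B" "\<one> \<in> B" for x y c
    using assms by (auto simp: subalg_def)
  show ?thesis
    by (rule calgI) (use neg in \<open>auto simp: Bc B a_ac m_assoc l_distr r_distr smult_l_distr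
        smult_r_distr smult_smult smult_mult_l smult_mult_r\<close>)
qed

lemma subalg_minus: "subalg B A \<Longrightarrow> x \<in> B \<Longrightarrow> y \<in> B \<Longrightarrow> x \<ominus> y \<in> B"
  by (subst minus_smult) (auto simp: subalg_def)

lemma alg_gen_subalg: "S \<subseteq> carrier A \<Longrightarrow> subalg (alg_gen A S) A"
proof -
  assume S: "S \<subseteq> carrier A"
  then have "alg_gen A S \<subseteq> carrier A" using subalg_carrier by (auto simp: alg_gen_def)
  then show ?thesis by (simp add: subalg_def alg_gen_def)
qed

lemma alg_gen_incl: "S \<subseteq> alg_gen A S"
  by (auto simp: alg_gen_def)

lemma alg_gen_least: "subalg B A \<Longrightarrow> S \<subseteq> B \<Longrightarrow> alg_gen A S \<subseteq> B"
  by (auto simp: alg_gen_def)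

lemma alg_gen_closed: "S \<subseteq> carrier A \<Longrightarrow> alg_gen A S \<subseteq> carrier A"
  using alg_gen_subalg by (auto simp: subalg_def)

lemma alg_gen_mono: "S \<subseteq> T \<Longrightarrow> alg_gen A S \<subseteq> alg_gen A T"
  by (auto simp: alg_gen_def)

lemma centralizer_subalg:
  assumes "T \<subseteq> carrier A"
  shows "subalg {x \<in> carrier A. \<forall>y\<in>T. x \<otimes> y = y \<otimes> x} A"
proof -
  have T: "t \<in> carrier A" if "t \<in> T" for t using assms that by auto
  have "(x \<otimes> y) \<otimes> t = t \<otimes> (x \<otimes> y)"
    if "x \<in> carrier A" "y \<in> carrier A" "t \<in> T" "x \<otimes> t = t \<otimes> x" "y \<otimes> t = t \<otimes> y" for x y t
    using that T[OF that(3)] by (simp add: m_assoc) (simp add: m_assoc[symmetric])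
  then show ?thesis
    using T unfolding subalg_def by (auto simp: l_distr r_distr smult_mult_l smult_mult_r)
qed

lemma alg_gen_commute:
  assumes "S \<subseteq> carrier A" "T \<subseteq> carrier A" "\<And>s t. s \<in> S \<Longrightarrow> t \<in> T \<Longrightarrow> s \<otimes> t = t \<otimes> s"
    "x \<in> alg_gen A S" "y \<in> alg_gen A T"
  shows "x \<otimes> y = y \<otimes> x"
proof -
  have 1: "x \<otimes> t = t \<otimes> x" if "t \<in> T" for t
    using alg_gen_least[OF centralizer_subalg[OF assms(2)], of S] assms that by auto
  have "alg_gen A T \<subseteq> {y \<in> carrier A. \<forall>x'\<in>{x}. y \<otimes> x' = x' \<otimes> y}"
    by (rule alg_gen_least[OF centralizer_subalg])
       (use 1 assms alg_gen_closed[OF assms(1)] in auto)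
  then show ?thesis using assms by auto
qed

lemma lin_span_closed: "S \<subseteq> carrier A \<Longrightarrow> lin_span A S \<subseteq> carrier A"
proof
  fix x assume S: "S \<subseteq> carrier A" and "x \<in> lin_span A S"
  from this(2) show "x \<in> carrier A" by induction (use S in auto)
qed

lemma lin_span_least:
  assumes "subalg B A" "S \<subseteq> B" shows "lin_span A S \<subseteq> B"
proof
  fix x assume "x \<in> lin_span A S"
  then show "x \<in> B" by induction (use assms in \<open>auto simp: subalg_def\<close>)
qed

lemma lin_span_mono: "S \<subseteq> T \<Longrightarrow> lin_span A S \<subseteq> lin_span A T"
proof
  fix x assume "S \<subseteq> T" "x \<in> lin_span A S"
  from this(2) show "x \<in> lin_span A T" by induction (use \<open>S \<subseteq> T\<close> in \<open>auto intro: lin_span.intros\<close>)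
qed

lemma lin_span_mult:
  assumes "S \<subseteq> carrier A" "T \<subseteq> carrier A" "\<And>s t. s \<in> S \<Longrightarrow> t \<in> T \<Longrightarrow> s \<otimes> t \<in> lin_span A R"
    "x \<in> lin_span A S" "y \<in> lin_span A T" "R \<subseteq> carrier A"
  shows "x \<otimes> y \<in> lin_span A R"
proof -
  note cl = subsetD[OF lin_span_closed[OF assms(1)]] subsetD[OF lin_span_closed[OF assms(2)]]
  have 1: "s \<otimes> y \<in> lin_span A R" if s: "s \<in> S" for s
    using assms(5)
  proof induction
    case span_zero
    have "s \<otimes> \<zero> = \<zero>" using s assms(1) by auto
    then show ?case by (auto intro: lin_span.intros)
  next
    case (span_base x)
    then show ?case using s assms by auto
  next
    case (span_add x y)
    then show ?case using s assms(1) cl by (auto simp: r_distr subset_iff intro: lin_span.intros)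
  next
    case (span_smult x c)
    then show ?case using s assms(1) cl by (auto simp: smult_mult_r subset_iff intro: lin_span.intros)
  qed
  from assms(4) show ?thesis
  proof induction
    case span_zero
    have "\<zero> \<otimes> y = \<zero>" using cl(2)[OF assms(5)] by auto
    then show ?case by (auto intro: lin_span.intros)
  next
    case (span_base x)
    then show ?case using 1 by auto
  next
    case (span_add x z)
    then show ?case using assms(5) cl by (auto simp: l_distr subset_iff intro: lin_span.intros)
  next
    case (span_smult x c)
    then show ?case using assms(5) cl by (auto simp: smult_mult_l subset_iff intro: lin_span.intros)
  qed
qed

lemma lin_span_subalg:
  assumes "S \<subseteq> carrier A" "\<one> \<in> lin_span A S" "\<And>s t. s \<in> S \<Longrightarrow> t \<in> S \<Longrightarrow> s \<otimes> t \<in> lin_span A S"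
  shows "subalg (lin_span A S) A"
  unfolding subalg_def using lin_span_mult[OF assms(1,1) assms(3)] assms lin_span_closed[OF assms(1)]
  by (auto intro: lin_span.intros)

end

subsection \<open>Homomorphisms\<close>

definition lin_hom :: "(complex, 'a) module \<Rightarrow> (complex, 'b) module \<Rightarrow> ('a \<Rightarrow> 'b) set" where
  "lin_hom A B = {h. (\<forall>x\<in>carrier A. h x \<in> carrier B) \<and>
     (\<forall>x\<in>carrier A. \<forall>y\<in>carrier A. h (x \<oplus>\<^bsub>A\<^esub> y) = h x \<oplus>\<^bsub>B\<^esub> h y) \<and>
     (\<forall>c. \<forall>x\<in>carrier A. h (c \<odot>\<^bsub>A\<^esub> x) = c \<odot>\<^bsub>B\<^esub> h x)}"

lemma lin_homD:
  assumes "h \<in> lin_hom A B"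
  shows "x \<in> carrier A \<Longrightarrow> h x \<in> carrier B"
    "x \<in> carrier A \<Longrightarrow> y \<in> carrier A \<Longrightarrow> h (x \<oplus>\<^bsub>A\<^esub> y) = h x \<oplus>\<^bsub>B\<^esub> h y"
    "x \<in> carrier A \<Longrightarrow> h (c \<odot>\<^bsub>A\<^esub> x) = c \<odot>\<^bsub>B\<^esub> h x"
  using assms by (auto simp: lin_hom_def)

lemma alg_hom_iff:
  "h \<in> alg_hom A B \<longleftrightarrow> h \<in> lin_hom A B \<and>
     (\<forall>x\<in>carrier A. \<forall>y\<in>carrier A. h (x \<otimes>\<^bsub>A\<^esub> y) = h x \<otimes>\<^bsub>B\<^esub> h y) \<and> h \<one>\<^bsub>A\<^esub> = \<one>\<^bsub>B\<^esub>"
  by (auto simp: alg_hom_def lin_hom_def ring_hom_def)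

lemma alg_homD:
  assumes "h \<in> alg_hom A B"
  shows "h \<in> lin_hom A B" "x \<in> carrier A \<Longrightarrow> h x \<in> carrier B"
    "x \<in> carrier A \<Longrightarrow> y \<in> carrier A \<Longrightarrow> h (x \<oplus>\<^bsub>A\<^esub> y) = h x \<oplus>\<^bsub>B\<^esub> h y"
    "x \<in> carrier A \<Longrightarrow> h (c \<odot>\<^bsub>A\<^esub> x) = c \<odot>\<^bsub>B\<^esub> h x"
    "x \<in> carrier A \<Longrightarrow> y \<in> carrier A \<Longrightarrow> h (x \<otimes>\<^bsub>A\<^esub> y) = h x \<otimes>\<^bsub>B\<^esub> h y"
    "h \<one>\<^bsub>A\<^esub> = \<one>\<^bsub>B\<^esub>"
  using assms by (auto simp: alg_hom_iff lin_hom_def)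

lemma lin_hom_zero:
  assumes "calg A" "calg B" "h \<in> lin_hom A B" shows "h \<zero>\<^bsub>A\<^esub> = \<zero>\<^bsub>B\<^esub>"
proof -
  interpret A: calg A by fact
  interpret B: calg B by fact
  have "h (0 \<odot>\<^bsub>A\<^esub> \<zero>\<^bsub>A\<^esub>) = 0 \<odot>\<^bsub>B\<^esub> h \<zero>\<^bsub>A\<^esub>" using lin_homD(3)[OF assms(3), of "\<zero>\<^bsub>A\<^esub>" 0] by blast
  then show ?thesis using lin_homD(1)[OF assms(3)] by simp
qed

lemma lin_hom_minus:
  assumes "calg A" "calg B" "h \<in> lin_hom A B" "x \<in> carrier A" "y \<in> carrier A"
  shows "h (x \<ominus>\<^bsub>A\<^esub> y) = h x \<ominus>\<^bsub>B\<^esub> h y"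
proof -
  interpret A: calg A by fact
  interpret B: calg B by fact
  show ?thesis using assms(4,5) lin_homD[OF assms(3)] by (simp add: A.minus_smult B.minus_smult)
qed

lemma alg_hom_comp: "g \<in> alg_hom A B \<Longrightarrow> h \<in> alg_hom B C \<Longrightarrow> h \<circ> g \<in> alg_hom A C"
  by (simp add: alg_hom_iff lin_hom_def)

lemma alg_hom_image_subalg:
  assumes "calg A" "calg B" "h \<in> alg_hom A B" "subalg S A" shows "subalg (h ` S) B"
proof -
  note h = alg_homD[OF assms(3)]
  have S: "x \<in> carrier A" if "x \<in> S" for x using assms(4) that by (auto simp: subalg_def)
  have "h \<zero>\<^bsub>A\<^esub> = \<zero>\<^bsub>B\<^esub>" by (rule lin_hom_zero[OF assms(1,2) h(1)])
  then have "\<zero>\<^bsub>B\<^esub> \<in> h ` S" "\<one>\<^bsub>B\<^esub> \<in> h ` S" using assms(4) h(6) by (metis subalg_def imageI)+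
  moreover have "h x \<oplus>\<^bsub>B\<^esub> h y \<in> h ` S" "h x \<otimes>\<^bsub>B\<^esub> h y \<in> h ` S" "c \<odot>\<^bsub>B\<^esub> h x \<in> h ` S"
    if "x \<in> S" "y \<in> S" for x y c
    using that assms(4) h(3-5)[OF S[OF that(1)]] S by (metis subalg_def imageI)+
  ultimately show ?thesis using h(2) S unfolding subalg_def by blast
qed

lemma alg_hom_vimage_subalg:
  assumes "calg A" "calg B" "h \<in> alg_hom A B" "subalg S B"
  shows "subalg {x \<in> carrier A. h x \<in> S} A"
proof -
  interpret A: calg A by fact
  note h = alg_homD[OF assms(3)]
  have "h \<zero>\<^bsub>A\<^esub> = \<zero>\<^bsub>B\<^esub>" using lin_hom_zero[OF assms(1,2)] h(1) by simp
  then show ?thesis using h(2-) assms(4) by (auto simp: subalg_def)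
qed

text \<open>Two homomorphisms can therefore be compared on generators.\<close>

lemma alg_hom_equalizer:
  assumes "calg A" "calg B" "g \<in> alg_hom A B" "h \<in> alg_hom A B"
  shows "subalg {x \<in> carrier A. g x = h x} A"
proof -
  interpret A: calg A by fact
  note g = alg_homD[OF assms(3)] and h = alg_homD[OF assms(4)]
  have "g \<zero>\<^bsub>A\<^esub> = h \<zero>\<^bsub>A\<^esub>" using lin_hom_zero[OF assms(1,2) g(1)] lin_hom_zero[OF assms(1,2) h(1)] by simp
  then show ?thesis using g(2-) h(2-) by (auto simp: subalg_def)
qed

lemma lin_hom_foldr:
  assumes "calg A" "calg B" "h \<in> lin_hom A B" "\<And>t. t \<in> set ts \<Longrightarrow> g t \<in> carrier A"
  shows "foldr (\<lambda>t s. g t \<oplus>\<^bsub>A\<^esub> s) ts \<zero>\<^bsub>A\<^esub> \<in> carrier A \<and>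
    h (foldr (\<lambda>t s. g t \<oplus>\<^bsub>A\<^esub> s) ts \<zero>\<^bsub>A\<^esub>) = foldr (\<lambda>t s. h (g t) \<oplus>\<^bsub>B\<^esub> s) ts \<zero>\<^bsub>B\<^esub>"
proof -
  interpret A: calg A by fact
  show ?thesis using assms(4)
    by (induction ts) (auto simp: lin_hom_zero[OF assms(1-3)] lin_homD[OF assms(3)])
qed

subsection \<open>Products\<close>

definition prod_alg :: "(complex, 'a) module \<Rightarrow> (complex, 'b) module \<Rightarrow> (complex, 'a \<times> 'b) module" where
  "prod_alg A B = \<lparr>carrier = carrier A \<times> carrier B,
     monoid.mult = (\<lambda>x y. (fst x \<otimes>\<^bsub>A\<^esub> fst y, snd x \<otimes>\<^bsub>B\<^esub> snd y)),
     one = (\<one>\<^bsub>A\<^esub>, \<one>\<^bsub>B\<^esub>), zero = (\<zero>\<^bsub>A\<^esub>, \<zero>\<^bsub>B\<^esub>),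
     add = (\<lambda>x y. (fst x \<oplus>\<^bsub>A\<^esub> fst y, snd x \<oplus>\<^bsub>B\<^esub> snd y)),
     smult = (\<lambda>c x. (c \<odot>\<^bsub>A\<^esub> fst x, c \<odot>\<^bsub>B\<^esub> snd x))\<rparr>"

lemma prod_alg_simps [simp]:
  "carrier (prod_alg A B) = carrier A \<times> carrier B"
  "x \<otimes>\<^bsub>prod_alg A B\<^esub> y = (fst x \<otimes>\<^bsub>A\<^esub> fst y, snd x \<otimes>\<^bsub>B\<^esub> snd y)"
  "\<one>\<^bsub>prod_alg A B\<^esub> = (\<one>\<^bsub>A\<^esub>, \<one>\<^bsub>B\<^esub>)" "\<zero>\<^bsub>prod_alg A B\<^esub> = (\<zero>\<^bsub>A\<^esub>, \<zero>\<^bsub>B\<^esub>)"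
  "x \<oplus>\<^bsub>prod_alg A B\<^esub> y = (fst x \<oplus>\<^bsub>A\<^esub> fst y, snd x \<oplus>\<^bsub>B\<^esub> snd y)"
  "c \<odot>\<^bsub>prod_alg A B\<^esub> x = (c \<odot>\<^bsub>A\<^esub> fst x, c \<odot>\<^bsub>B\<^esub> snd x)"
  by (simp_all add: prod_alg_def)

lemma prod_alg_calg: assumes "calg A" "calg B" shows "calg (prod_alg A B)"
proof -
  interpret A: calg A by fact
  interpret B: calg B by fact
  have neg: "\<exists>y\<in>carrier A \<times> carrier B. fst y \<oplus>\<^bsub>A\<^esub> fst x = \<zero>\<^bsub>A\<^esub> \<and> snd y \<oplus>\<^bsub>B\<^esub> snd x = \<zero>\<^bsub>B\<^esub>"
    if "x \<in> carrier A \<times> carrier B" for x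
    using that by (intro bexI[of _ "(\<ominus>\<^bsub>A\<^esub> fst x, \<ominus>\<^bsub>B\<^esub> snd x)"]) (auto simp: A.l_neg B.l_neg)
  show ?thesis
    by (rule calgI; (use neg in simp)?; (elim SigmaE)?) (auto simp: A.a_ac A.m_assoc A.l_distr A.r_distr
      A.smult_l_distr A.smult_r_distr A.smult_smult A.smult_mult_l A.smult_mult_r
      B.a_ac B.m_assoc B.l_distr B.r_distr
      B.smult_l_distr B.smult_r_distr B.smult_smult B.smult_mult_l B.smult_mult_r)
qed

lemma fst_alg_hom: "fst \<in> alg_hom (prod_alg A B) A"
  and snd_alg_hom: "snd \<in> alg_hom (prod_alg A B) B"
  by (auto simp: alg_hom_iff lin_hom_def)

subsection \<open>Quotients\<close>

context calg
begin

lemma ideal_smult: assumes "ideal I A" "x \<in> I" shows "c \<odot> x \<in> I"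
proof -
  interpret ideal I A by fact
  have "x \<in> carrier A" using assms(2) by (rule a_Hcarr)
  then have "c \<odot> x = (c \<odot> \<one>) \<otimes> x" by (simp add: smult_mult_l)
  then show ?thesis using assms by (simp add: I_l_closed)
qed

lemma ideal_coset_eq:
  assumes "ideal I A" "x \<in> carrier A" "y \<in> carrier A"
  shows "I +> x = I +> y \<longleftrightarrow> x \<ominus> y \<in> I"
  using assms by (simp add: quotient_eq_iff_same_a_r_cos)

lemma ideal_coset_rep:
  assumes "ideal I A" "x \<in> carrier A" "y \<in> I +> x" shows "y \<in> carrier A" "I +> y = I +> x"
proof -
  interpret ideal I A by fact
  show "y \<in> carrier A" using assms a_elemrcos_carrier by blast
  show "I +> y = I +> x" using assms a_repr_independence[OF assms(3,2)] a_subgroup by simp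
qed

lemma quot_alg_simps:
  assumes "ideal I A"
  shows "carrier (quot_alg A I) = (\<lambda>x. I +> x) ` carrier A"
    "\<one>\<^bsub>quot_alg A I\<^esub> = I +> \<one>" "\<zero>\<^bsub>quot_alg A I\<^esub> = I +> \<zero>"
    "x \<in> carrier A \<Longrightarrow> y \<in> carrier A \<Longrightarrow> (I +> x) \<otimes>\<^bsub>quot_alg A I\<^esub> (I +> y) = I +> (x \<otimes> y)"
    "x \<in> carrier A \<Longrightarrow> y \<in> carrier A \<Longrightarrow> (I +> x) \<oplus>\<^bsub>quot_alg A I\<^esub> (I +> y) = I +> (x \<oplus> y)"
    "x \<in> carrier A \<Longrightarrow> c \<odot>\<^bsub>quot_alg A I\<^esub> (I +> x) = I +> (c \<odot> x)"
proof -
  interpret I: ideal I A by fact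
  show "carrier (quot_alg A I) = (\<lambda>x. I +> x) ` carrier A"
    by (auto simp: quot_alg_def FactRing_def A_RCOSETS_def' a_r_coset_def[symmetric])
  show "\<one>\<^bsub>quot_alg A I\<^esub> = I +> \<one>" by (simp add: quot_alg_def FactRing_def)
  show "\<zero>\<^bsub>quot_alg A I\<^esub> = I +> \<zero>"
    by (simp add: quot_alg_def FactRing_def a_coset_add_zero I.a_subset)
  show "(I +> x) \<otimes>\<^bsub>quot_alg A I\<^esub> (I +> y) = I +> (x \<otimes> y)" if "x \<in> carrier A" "y \<in> carrier A"
    using that by (simp add: quot_alg_def FactRing_def I.rcoset_mult_add)
  show "(I +> x) \<oplus>\<^bsub>quot_alg A I\<^esub> (I +> y) = I +> (x \<oplus> y)" if "x \<in> carrier A" "y \<in> carrier A"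
    using that by (simp add: quot_alg_def FactRing_def I.a_rcos_sum)
  show "c \<odot>\<^bsub>quot_alg A I\<^esub> (I +> x) = I +> (c \<odot> x)" if x: "x \<in> carrier A"
  proof -
    have "I +> (c \<odot> y) = I +> (c \<odot> x)" if "y \<in> I +> x" for y
    proof -
      note y = ideal_coset_rep[OF assms x that]
      have "c \<odot> y \<ominus> c \<odot> x = c \<odot> (y \<ominus> x)" using x y by (simp add: minus_smult smult_r_distr smult_smult)
      moreover have "y \<ominus> x \<in> I" using y x assms by (simp add: ideal_coset_eq)
      ultimately show ?thesis using ideal_smult[OF assms] x y by (simp add: ideal_coset_eq[OF assms])
    qed
    then have "(\<Union>y\<in>I +> x. I +> (c \<odot> y)) = (\<Union>y\<in>I +> x. I +> (c \<odot> x))" by (intro SUP_cong refl)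
    moreover have "I +> x \<noteq> {}" using I.a_rcos_self[OF x] by (metis empty_iff)
    ultimately show ?thesis by (simp add: quot_alg_def)
  qed
qed

lemma quot_alg_calg:
  assumes "ideal I A" shows "calg (quot_alg A I)"
proof -
  note s = quot_alg_simps[OF assms]
  have neg: "\<exists>y\<in>carrier (quot_alg A I). y \<oplus>\<^bsub>quot_alg A I\<^esub> x = \<zero>\<^bsub>quot_alg A I\<^esub>"
    if x: "x \<in> carrier (quot_alg A I)" for x
  proof -
    from x obtain a where a: "a \<in> carrier A" "x = I +> a" by (auto simp: s)
    then show ?thesis by (intro bexI[of _ "I +> \<ominus> a"]) (auto simp: s l_neg)
  qed
  show ?thesis
    by (rule calgI; (rule neg, assumption)?; (unfold s(1))?; (elim imageE)?)
       (simp_all add: s a_ac m_assoc l_distr r_distr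
      smult_l_distr smult_r_distr smult_smult smult_mult_l smult_mult_r)
qed

lemma quot_alg_hom: "ideal I A \<Longrightarrow> (\<lambda>x. I +> x) \<in> alg_hom A (quot_alg A I)"
  by (auto simp: alg_hom_iff lin_hom_def quot_alg_simps)

lemma quot_alg_lift:
  assumes "ideal I A" "calg W" "g \<in> lin_hom A W" "\<And>x. x \<in> I \<Longrightarrow> g x = \<zero>\<^bsub>W\<^esub>"
  obtains h where "h \<in> lin_hom (quot_alg A I) W" "\<And>x. x \<in> carrier A \<Longrightarrow> h (I +> x) = g x"
    "g \<in> alg_hom A W \<Longrightarrow> h \<in> alg_hom (quot_alg A I) W"
proof -
  interpret W: calg W by fact
  interpret I: ideal I A by fact
  define h where "h X = g (SOME x. x \<in> X)" for X
  have h: "h (I +> x) = g x" if x: "x \<in> carrier A" for x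
  proof -
    have "x \<in> I +> x" by (rule I.a_rcos_self[OF x])
    then have "(SOME y. y \<in> I +> x) \<in> I +> x" by (metis someI)
    note y = ideal_coset_rep[OF assms(1) x this]
    have "(SOME y. y \<in> I +> x) \<ominus> x \<in> I" using y x assms(1) by (simp add: ideal_coset_eq)
    then have "g ((SOME y. y \<in> I +> x) \<ominus> x) = \<zero>\<^bsub>W\<^esub>" by (rule assms(4))
    then have "g (SOME y. y \<in> I +> x) \<ominus>\<^bsub>W\<^esub> g x = \<zero>\<^bsub>W\<^esub>"
      using lin_hom_minus[OF calg_axioms assms(2,3)] x y by simp
    then show ?thesis using lin_homD(1)[OF assms(3)] x y(1) unfolding h_def by (metis W.minus_eq_zeroD)
  qed
  show ?thesis
  proof (rule that[of h])
    show "h \<in> lin_hom (quot_alg A I) W"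
      using lin_homD[OF assms(3)] by (auto simp: lin_hom_def quot_alg_simps[OF assms(1)] h)
    then show "h \<in> alg_hom (quot_alg A I) W" if "g \<in> alg_hom A W"
      using alg_homD[OF that] by (auto simp: alg_hom_iff quot_alg_simps[OF assms(1)] h)
  qed (fact h)
qed

end

section \<open>Monoid algebras and presented algebras\<close>

abbreviation pm_scale :: "complex \<Rightarrow> ('m \<Rightarrow>\<^sub>0 complex) \<Rightarrow> ('m \<Rightarrow>\<^sub>0 complex)" where
  "pm_scale c \<equiv> Poly_Mapping.map ((*) c)"

lemma lookup_pm_scale [simp]: "Poly_Mapping.lookup (pm_scale c p) k = c * Poly_Mapping.lookup p k"
  by (simp add: Poly_Mapping.map.rep_eq when_def)

lemma pm_scale_simps:
  "pm_scale c (p + r) = pm_scale c p + pm_scale c r" "pm_scale (c + d) p = pm_scale c p + pm_scale d p"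
  "pm_scale c (pm_scale d p) = pm_scale (c * d) p" "pm_scale 1 p = p" "pm_scale c 0 = 0"
  "pm_scale c (Poly_Mapping.single k a) = Poly_Mapping.single k (c * a)"
  "p - r = p + pm_scale (-1) r"
  by (auto intro!: poly_mapping_eqI simp: lookup_add lookup_minus lookup_single when_def algebra_simps)

lemma keys_pm_scale: "Poly_Mapping.keys (pm_scale c p) \<subseteq> Poly_Mapping.keys p"
  by (auto simp: in_keys_iff)

lemma keys_add_subset:
  "Poly_Mapping.keys p \<subseteq> S \<Longrightarrow> Poly_Mapping.keys r \<subseteq> S \<Longrightarrow> Poly_Mapping.keys (p + r) \<subseteq> S"
  by (rule subset_trans[OF keys_add]) simp

lemma poly_mapping_keys_induct [consumes 1, case_names zero single add]:
  fixes p :: "'m \<Rightarrow>\<^sub>0 complex"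
  assumes "Poly_Mapping.keys p \<subseteq> S" "P 0" "\<And>x c. x \<in> S \<Longrightarrow> P (Poly_Mapping.single x c)"
    and "\<And>p r. Poly_Mapping.keys p \<subseteq> S \<Longrightarrow> Poly_Mapping.keys r \<subseteq> S \<Longrightarrow> P p \<Longrightarrow> P r \<Longrightarrow> P (p + r)"
  shows "P p"
proof -
  have "p = (\<Sum>k\<in>Poly_Mapping.keys p. Poly_Mapping.single k (Poly_Mapping.lookup p k))"
    by (rule poly_mapping_eqI)
       (auto simp: lookup_sum lookup_single when_def in_keys_iff sum.delta' intro!: sum.neutral)
  moreover have "Poly_Mapping.keys (\<Sum>k\<in>F. Poly_Mapping.single k (Poly_Mapping.lookup p k)) \<subseteq> S \<and>
      P (\<Sum>k\<in>F. Poly_Mapping.single k (Poly_Mapping.lookup p k))"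
    if "finite F" "F \<subseteq> S" for F
    using that
  proof (induction F)
    case (insert x F)
    have "Poly_Mapping.keys (Poly_Mapping.single x (Poly_Mapping.lookup p x)) \<subseteq> S" using insert by auto
    moreover have "P (Poly_Mapping.single x (Poly_Mapping.lookup p x))" using insert by (intro assms(3)) auto
    ultimately show ?case using insert
      by (simp add: assms(4) keys_add_subset del: keys_single)
  qed (use assms in auto)
  ultimately show ?thesis using assms(1) finite_keys[of p] by metis
qed

text \<open>The linear extension of a map \<open>\<phi>\<close> defined on a basis.\<close>

definition (in calg) lin :: "('m \<Rightarrow> 'a) \<Rightarrow> ('m \<Rightarrow>\<^sub>0 complex) \<Rightarrow> 'a" where
  "lin \<phi> p = (\<Oplus>x\<in>Poly_Mapping.keys p. Poly_Mapping.lookup p x \<odot> \<phi> x)"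

context calg
begin

lemma lin_superset:
  assumes "finite X" "Poly_Mapping.keys p \<subseteq> X" "\<phi> \<in> X \<rightarrow> carrier A"
  shows "lin \<phi> p = (\<Oplus>x\<in>X. Poly_Mapping.lookup p x \<odot> \<phi> x)"
  unfolding lin_def
  by (rule add.finprod_mono_neutral_cong_left[OF assms(1,2)]) (use assms in \<open>auto simp: in_keys_iff Pi_def\<close>)

lemma lin_closed: "Poly_Mapping.keys p \<subseteq> S \<Longrightarrow> \<phi> \<in> S \<rightarrow> carrier A \<Longrightarrow> lin \<phi> p \<in> carrier A"
  unfolding lin_def by (rule finsum_closed) auto

lemma lin_zero [simp]: "lin \<phi> 0 = \<zero>"
  by (simp add: lin_def)

lemma lin_single: "\<phi> x \<in> carrier A \<Longrightarrow> lin \<phi> (Poly_Mapping.single x c) = c \<odot> \<phi> x"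
  by (subst lin_superset[of "{x}"]) (auto simp: finsum_insert)

lemma lin_add:
  assumes "Poly_Mapping.keys p \<subseteq> S" "Poly_Mapping.keys r \<subseteq> S" "\<phi> \<in> S \<rightarrow> carrier A"
  shows "lin \<phi> (p + r) = lin \<phi> p \<oplus> lin \<phi> r"
proof -
  let ?X = "Poly_Mapping.keys p \<union> Poly_Mapping.keys r"
  have X: "finite ?X" "?X \<subseteq> S" "\<phi> \<in> ?X \<rightarrow> carrier A" using assms by auto
  have "lin \<phi> (p + r) = (\<Oplus>x\<in>?X. Poly_Mapping.lookup (p + r) x \<odot> \<phi> x)"
    by (rule lin_superset[OF X(1) keys_add X(3)])
  also have "\<dots> = (\<Oplus>x\<in>?X. Poly_Mapping.lookup p x \<odot> \<phi> x \<oplus> Poly_Mapping.lookup r x \<odot> \<phi> x)"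
    by (rule finsum_cong') (use X in \<open>auto simp: lookup_add smult_l_distr Pi_def\<close>)
  also have "\<dots> = lin \<phi> p \<oplus> lin \<phi> r"
    by (subst finsum_addf) (use X in \<open>auto simp: lin_superset[of ?X] Pi_def\<close>)
  finally show ?thesis .
qed

lemma lin_scale:
  assumes "Poly_Mapping.keys p \<subseteq> S" "\<phi> \<in> S \<rightarrow> carrier A"
  shows "lin \<phi> (pm_scale c p) = c \<odot> lin \<phi> p"
proof -
  let ?X = "Poly_Mapping.keys p"
  have "lin \<phi> (pm_scale c p) = (\<Oplus>x\<in>?X. Poly_Mapping.lookup (pm_scale c p) x \<odot> \<phi> x)"
    by (rule lin_superset[OF _ keys_pm_scale]) (use assms in auto)
  also have "\<dots> = (\<Oplus>x\<in>?X. c \<odot> (Poly_Mapping.lookup p x \<odot> \<phi> x))"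
    by (rule finsum_cong') (use assms in \<open>auto simp: smult_smult Pi_def\<close>)
  also have "\<dots> = c \<odot> lin \<phi> p"
    unfolding lin_def by (subst smult_finsum) (use assms in \<open>auto simp: Pi_def\<close>)
  finally show ?thesis .
qed

end

context
  fixes M :: "('m, 'x) monoid_scheme" (structure)
begin

lemma monoid_alg_simps:
  "carrier (monoid_alg M) = {p. Poly_Mapping.keys p \<subseteq> carrier M}"
  "\<one>\<^bsub>monoid_alg M\<^esub> = Poly_Mapping.single \<one> 1" "\<zero>\<^bsub>monoid_alg M\<^esub> = 0"
  "p \<oplus>\<^bsub>monoid_alg M\<^esub> r = p + r" "c \<odot>\<^bsub>monoid_alg M\<^esub> p = pm_scale c p"
  by (simp_all add: monoid_alg_def)

lemma monoid_alg_mult_superset: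
  assumes "finite X" "Poly_Mapping.keys p \<subseteq> X" "finite Y" "Poly_Mapping.keys r \<subseteq> Y"
  shows "p \<otimes>\<^bsub>monoid_alg M\<^esub> r = (\<Sum>x\<in>X. \<Sum>y\<in>Y.
    Poly_Mapping.single (x \<otimes> y) (Poly_Mapping.lookup p x * Poly_Mapping.lookup r y))"
  unfolding monoid_alg_def using assms
  by (auto intro!: sum.mono_neutral_cong_left sum.neutral simp: in_keys_iff)

lemma monoid_alg_mult_single:
  "Poly_Mapping.single x a \<otimes>\<^bsub>monoid_alg M\<^esub> Poly_Mapping.single y b = Poly_Mapping.single (x \<otimes> y) (a * b)"
  by (subst monoid_alg_mult_superset[of "{x}" _ "{y}"]) auto

lemma monoid_alg_mult_distrib:
  "(p + r) \<otimes>\<^bsub>monoid_alg M\<^esub> s = p \<otimes>\<^bsub>monoid_alg M\<^esub> s + r \<otimes>\<^bsub>monoid_alg M\<^esub> s"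
  "s \<otimes>\<^bsub>monoid_alg M\<^esub> (p + r) = s \<otimes>\<^bsub>monoid_alg M\<^esub> p + s \<otimes>\<^bsub>monoid_alg M\<^esub> r"
proof -
  let ?X = "Poly_Mapping.keys p \<union> Poly_Mapping.keys r" and ?Y = "Poly_Mapping.keys s"
  have X: "Poly_Mapping.keys (p + r) \<subseteq> ?X" by (rule keys_add)
  show "(p + r) \<otimes>\<^bsub>monoid_alg M\<^esub> s = p \<otimes>\<^bsub>monoid_alg M\<^esub> s + r \<otimes>\<^bsub>monoid_alg M\<^esub> s"
    using X by (simp add: monoid_alg_mult_superset[of ?X _ ?Y] lookup_add ring_distribs single_add sum.distrib)
  show "s \<otimes>\<^bsub>monoid_alg M\<^esub> (p + r) = s \<otimes>\<^bsub>monoid_alg M\<^esub> p + s \<otimes>\<^bsub>monoid_alg M\<^esub> r"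
    using X by (simp add: monoid_alg_mult_superset[of ?Y _ ?X] lookup_add ring_distribs single_add sum.distrib)
qed

lemma monoid_alg_mult_zero:
  "0 \<otimes>\<^bsub>monoid_alg M\<^esub> s = 0" "s \<otimes>\<^bsub>monoid_alg M\<^esub> 0 = 0"
  by (simp_all add: monoid_alg_def)

lemma pm_scale_sum: "pm_scale c (sum f I) = (\<Sum>i\<in>I. pm_scale c (f i))"
  by (rule poly_mapping_eqI) (simp add: lookup_sum sum_distrib_left)

lemma monoid_alg_mult_scale:
  "pm_scale c p \<otimes>\<^bsub>monoid_alg M\<^esub> s = pm_scale c (p \<otimes>\<^bsub>monoid_alg M\<^esub> s)"
  "p \<otimes>\<^bsub>monoid_alg M\<^esub> pm_scale c s = pm_scale c (p \<otimes>\<^bsub>monoid_alg M\<^esub> s)"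
  by (simp_all add: monoid_alg_mult_superset[of "Poly_Mapping.keys p" _ "Poly_Mapping.keys s"]
      keys_pm_scale pm_scale_sum pm_scale_simps mult_ac)

lemma monoid_alg_calg:
  assumes "monoid M" shows "calg (monoid_alg M)"
proof -
  interpret monoid M by fact
  note s = monoid_alg_simps monoid_alg_mult_distrib monoid_alg_mult_zero monoid_alg_mult_scale
    monoid_alg_mult_single
  have cl: "Poly_Mapping.keys (p \<otimes>\<^bsub>monoid_alg M\<^esub> r) \<subseteq> carrier M"
    if "Poly_Mapping.keys p \<subseteq> carrier M" "Poly_Mapping.keys r \<subseteq> carrier M" for p r
    using that(1)
  proof (induction p rule: poly_mapping_keys_induct)
    case (single x c)
    note x = this
    show ?case using that(2)
    proof (induction r rule: poly_mapping_keys_induct)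
      case (add p r)
      then show ?case by (simp add: s keys_add_subset)
    qed (use x in \<open>auto simp: s\<close>)
  next
    case (add p r)
    then show ?case by (simp add: s keys_add_subset)
  qed (auto simp: s)
  have assoc: "p \<otimes>\<^bsub>monoid_alg M\<^esub> r \<otimes>\<^bsub>monoid_alg M\<^esub> t = p \<otimes>\<^bsub>monoid_alg M\<^esub> (r \<otimes>\<^bsub>monoid_alg M\<^esub> t)"
    if "Poly_Mapping.keys p \<subseteq> carrier M" "Poly_Mapping.keys r \<subseteq> carrier M" "Poly_Mapping.keys t \<subseteq> carrier M" for p r t
    using that(1)
  proof (induction p rule: poly_mapping_keys_induct)
    case (single x c)
    note x = this
    show ?case using that(2)
    proof (induction r rule: poly_mapping_keys_induct)
      case (single y d)
      note y = this
      show ?case using that(3)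
        by (induction t rule: poly_mapping_keys_induct) (use x y in \<open>auto simp: s m_assoc mult.assoc\<close>)
    qed (auto simp: s)
  qed (auto simp: s)
  have id: "Poly_Mapping.single \<one> 1 \<otimes>\<^bsub>monoid_alg M\<^esub> p = p \<and> p \<otimes>\<^bsub>monoid_alg M\<^esub> Poly_Mapping.single \<one> 1 = p"
    if "Poly_Mapping.keys p \<subseteq> carrier M" for p
    using that by (induction p rule: poly_mapping_keys_induct) (auto simp: s)
  have add: "Poly_Mapping.keys (p + r) \<subseteq> carrier M"
    if "Poly_Mapping.keys p \<subseteq> carrier M" "Poly_Mapping.keys r \<subseteq> carrier M" for p r :: "'m \<Rightarrow>\<^sub>0 complex"
    using that by (rule keys_add_subset)
  have scale: "Poly_Mapping.keys (pm_scale c p) \<subseteq> carrier M" if "Poly_Mapping.keys p \<subseteq> carrier M" for p c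
    using keys_pm_scale that by (rule subset_trans)
  have neg: "\<exists>y. Poly_Mapping.keys y \<subseteq> carrier M \<and> p + y = 0"
    if "Poly_Mapping.keys p \<subseteq> carrier M" for p :: "'m \<Rightarrow>\<^sub>0 complex"
    by (rule exI[of _ "pm_scale (-1) p"]) (use scale[OF that, of "-1"] in \<open>simp add: pm_scale_simps(7)[symmetric]\<close>)
  show ?thesis
    by (rule calgI) (simp_all add: s cl assoc id add scale neg pm_scale_simps(1-5) add_ac)
qed

lemma lin_alg_hom:
  assumes "monoid M" "calg W" "\<phi> \<in> carrier M \<rightarrow> carrier W" "\<phi> \<one> = \<one>\<^bsub>W\<^esub>"
    and "\<And>x y. x \<in> carrier M \<Longrightarrow> y \<in> carrier M \<Longrightarrow> \<phi> (x \<otimes> y) = \<phi> x \<otimes>\<^bsub>W\<^esub> \<phi> y"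
  shows "calg.lin W \<phi> \<in> alg_hom (monoid_alg M) W"
proof -
  interpret monoid M by fact
  interpret W: calg W by fact
  interpret A: calg "monoid_alg M" by (rule monoid_alg_calg) fact
  have \<phi>: "\<phi> x \<in> carrier W" if "x \<in> carrier M" for x using assms(3) that by auto
  have cl: "W.lin \<phi> p \<in> carrier W" if "p \<in> carrier (monoid_alg M)" for p
    using that W.lin_closed assms(3) by (auto simp: monoid_alg_simps)
  have add: "W.lin \<phi> (p + r) = W.lin \<phi> p \<oplus>\<^bsub>W\<^esub> W.lin \<phi> r" 
    if "Poly_Mapping.keys p \<subseteq> carrier M" "Poly_Mapping.keys r \<subseteq> carrier M" for p r
    by (rule W.lin_add) (use that assms in auto)
  have "W.lin \<phi> (p \<otimes>\<^bsub>monoid_alg M\<^esub> r) = W.lin \<phi> p \<otimes>\<^bsub>W\<^esub> W.lin \<phi> r"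
    if p: "Poly_Mapping.keys p \<subseteq> carrier M" and r: "Poly_Mapping.keys r \<subseteq> carrier M" for p r
    using p
  proof (induction p rule: poly_mapping_keys_induct)
    case zero
    then show ?case using cl r by (simp add: monoid_alg_mult_zero monoid_alg_simps)
  next
    case (single x c)
    note x = this
    show ?case using r
    proof (induction r rule: poly_mapping_keys_induct)
      case zero
      then show ?case using x \<phi> by (simp add: monoid_alg_mult_zero W.lin_single)
    next
      case (single y d)
      then show ?case using x \<phi>
        by (simp add: monoid_alg_mult_single W.lin_single assms(5) W.smult_mult_l W.smult_mult_r W.smult_smult mult_ac)
    next
      case (add p r)
      have "Poly_Mapping.keys (Poly_Mapping.single x c) \<subseteq> carrier M" using x by auto
      then have "Poly_Mapping.keys (Poly_Mapping.single x c \<otimes>\<^bsub>monoid_alg M\<^esub> p) \<subseteq> carrier M"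
        "Poly_Mapping.keys (Poly_Mapping.single x c \<otimes>\<^bsub>monoid_alg M\<^esub> r) \<subseteq> carrier M"
        using A.m_closed[of "Poly_Mapping.single x c"] add by (auto simp: monoid_alg_simps)
      then show ?case using add x \<phi> cl
        by (simp add: monoid_alg_mult_distrib \<open>\<And>r p. _ \<Longrightarrow> _ \<Longrightarrow> W.lin \<phi> (p + r) = _\<close> monoid_alg_simps W.r_distr W.lin_single)
    qed
  next
    case (add p p')
    have "Poly_Mapping.keys (p \<otimes>\<^bsub>monoid_alg M\<^esub> r) \<subseteq> carrier M"
      "Poly_Mapping.keys (p' \<otimes>\<^bsub>monoid_alg M\<^esub> r) \<subseteq> carrier M"
      using A.m_closed[of _ r] add r by (auto simp: monoid_alg_simps)
    then show ?case using add r cl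
      by (simp add: monoid_alg_mult_distrib \<open>\<And>r p. _ \<Longrightarrow> _ \<Longrightarrow> W.lin \<phi> (p + r) = _\<close> monoid_alg_simps W.l_distr)
  qed
  then show ?thesis using cl add assms \<phi>
    by (auto simp: alg_hom_iff lin_hom_def monoid_alg_simps W.lin_single W.lin_scale[OF _ assms(3)])
qed

end

lemma (in calg) idealI:
  assumes "I \<subseteq> carrier A" "\<zero> \<in> I" "\<And>x y. x \<in> I \<Longrightarrow> y \<in> I \<Longrightarrow> x \<oplus> y \<in> I"
    "\<And>x y. x \<in> I \<Longrightarrow> y \<in> carrier A \<Longrightarrow> x \<otimes> y \<in> I" "\<And>x y. x \<in> I \<Longrightarrow> y \<in> carrier A \<Longrightarrow> y \<otimes> x \<in> I"
  shows "ideal I A"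
proof (rule Ideal.idealI)
  show "subgroup I (add_monoid A)"
  proof
    fix x assume x: "x \<in> I"
    then have "\<ominus> x = (\<ominus> \<one>) \<otimes> x" using assms(1) by (auto simp: l_minus)
    then show "inv\<^bsub>add_monoid A\<^esub> x \<in> I" using x assms(5) by (simp add: a_inv_def)
  qed (use assms in auto)
qed (use assms ring_axioms in auto)

lemma alg_hom_kernel_ideal:
  assumes "calg A" "calg B" "h \<in> alg_hom A B" shows "ideal {x \<in> carrier A. h x = \<zero>\<^bsub>B\<^esub>} A"
proof -
  interpret A: calg A by fact
  interpret B: calg B by fact
  note h = alg_homD[OF assms(3)]
  have "h \<zero>\<^bsub>A\<^esub> = \<zero>\<^bsub>B\<^esub>" by (rule lin_hom_zero[OF assms(1,2) h(1)])
  then show ?thesis by (intro A.idealI) (auto simp: h(2-))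
qed

primrec (in calg) wprod :: "('g \<Rightarrow> 'a) \<Rightarrow> 'g list \<Rightarrow> 'a" where
  "wprod f [] = \<one>"
| "wprod f (g # w) = f g \<otimes> wprod f w"

lemma (in calg) wprod_closed [simp]: "(\<And>g. g \<in> set w \<Longrightarrow> f g \<in> carrier A) \<Longrightarrow> wprod f w \<in> carrier A"
  by (induction w) auto

lemma (in calg) wprod_append:
  "(\<And>g. g \<in> set v \<union> set w \<Longrightarrow> f g \<in> carrier A) \<Longrightarrow> wprod f (v @ w) = wprod f v \<otimes> wprod f w"
  by (induction v) (auto simp: m_assoc)

lemma (in calg) wprod_cong: "(\<And>g. g \<in> set w \<Longrightarrow> f g = f' g) \<Longrightarrow> wprod f w = wprod f' w"
  by (induction w) auto

lemma free_monoid: "monoid (free_monoid G)"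
  by (auto simp: free_monoid_def intro!: monoidI)

lemma free_alg_calg: "calg (free_alg G)"
  unfolding free_alg_def by (rule monoid_alg_calg[OF free_monoid])

lemma free_alg_simps:
  "carrier (free_alg G) = {p. Poly_Mapping.keys p \<subseteq> lists G}"
  "\<one>\<^bsub>free_alg G\<^esub> = wd []" "\<zero>\<^bsub>free_alg G\<^esub> = 0"
  "p \<oplus>\<^bsub>free_alg G\<^esub> r = p + r" "c \<odot>\<^bsub>free_alg G\<^esub> p = pm_scale c p"
  "Poly_Mapping.single x a \<otimes>\<^bsub>free_alg G\<^esub> Poly_Mapping.single y b = Poly_Mapping.single (x @ y) (a * b)"
  unfolding free_alg_def by (simp_all add: monoid_alg_simps monoid_alg_mult_single free_monoid_def)

lemma free_alg_lin_hom:
  assumes "calg W" "f \<in> G \<rightarrow> carrier W"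
  shows "calg.lin W (calg.wprod W f) \<in> alg_hom (free_alg G) W"
proof -
  interpret W: calg W by fact
  have "f g \<in> carrier W" if "g \<in> G" for g using assms(2) that by auto
  then show ?thesis unfolding free_alg_def
    by (intro lin_alg_hom assms(1) free_monoid) (auto simp: free_monoid_def intro!: W.wprod_append)
qed

locale presentation =
  fixes G :: "'g set" and R :: "('g list \<Rightarrow>\<^sub>0 complex) set"
  assumes rels: "R \<subseteq> carrier (free_alg G)"
begin

abbreviation "PA \<equiv> presented_alg G R"
abbreviation "pw \<equiv> presented_word G R"

lemma rel_ideal: "ideal (Idl\<^bsub>free_alg G\<^esub> R) (free_alg G)"
proof -
  interpret F: calg "free_alg G" by (rule free_alg_calg)
  show ?thesis using rels by (rule F.genideal_ideal)
qed

lemma presented_calg: "calg PA"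
proof -
  interpret F: calg "free_alg G" by (rule free_alg_calg)
  show ?thesis unfolding presented_alg_def by (rule F.quot_alg_calg[OF rel_ideal])
qed

sublocale P: calg PA by (rule presented_calg)

abbreviation "proj \<equiv> (\<lambda>x. (Idl\<^bsub>free_alg G\<^esub> R) +>\<^bsub>free_alg G\<^esub> x)"

lemma proj_hom: "proj \<in> alg_hom (free_alg G) PA"
proof -
  interpret F: calg "free_alg G" by (rule free_alg_calg)
  show ?thesis unfolding presented_alg_def by (rule F.quot_alg_hom[OF rel_ideal])
qed

lemma presented_carrier: "carrier PA = proj ` carrier (free_alg G)"
proof -
  interpret F: calg "free_alg G" by (rule free_alg_calg)
  show ?thesis unfolding presented_alg_def by (rule F.quot_alg_simps(1)[OF rel_ideal])
qed

lemma proj_eq_zero_iff: "x \<in> carrier (free_alg G) \<Longrightarrow> proj x = \<zero>\<^bsub>PA\<^esub> \<longleftrightarrow> x \<in> Idl\<^bsub>free_alg G\<^esub> R"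
proof -
  interpret F: calg "free_alg G" by (rule free_alg_calg)
  assume x: "x \<in> carrier (free_alg G)"
  have "\<zero>\<^bsub>PA\<^esub> = proj \<zero>\<^bsub>free_alg G\<^esub>"
    unfolding presented_alg_def by (rule F.quot_alg_simps(3)[OF rel_ideal])
  then show ?thesis using x by (simp add: F.ideal_coset_eq[OF rel_ideal] F.minus_smult)
qed

lemma pw_closed [simp]: "set w \<subseteq> G \<Longrightarrow> pw w \<in> carrier PA"
  unfolding presented_word_def by (rule alg_homD(2)[OF proj_hom]) (auto simp: free_alg_simps)

lemma pw_append: "set v \<subseteq> G \<Longrightarrow> set w \<subseteq> G \<Longrightarrow> pw (v @ w) = pw v \<otimes>\<^bsub>PA\<^esub> pw w"
  unfolding presented_word_def
  by (subst alg_homD(5)[OF proj_hom, symmetric]) (auto simp: free_alg_simps)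

lemma pw_Nil: "pw [] = \<one>\<^bsub>PA\<^esub>"
  unfolding presented_word_def using alg_homD(6)[OF proj_hom] by (simp add: free_alg_simps)

lemma pw_Cons: "g \<in> G \<Longrightarrow> set w \<subseteq> G \<Longrightarrow> pw (g # w) = pw [g] \<otimes>\<^bsub>PA\<^esub> pw w"
  using pw_append[of "[g]" w] by simp

lemma pw_wprod: "set w \<subseteq> G \<Longrightarrow> pw w = P.wprod (\<lambda>g. pw [g]) w"
  by (induction w) (simp_all add: pw_Nil, metis pw_Cons)

lemma proj_single: "set w \<subseteq> G \<Longrightarrow> proj (Poly_Mapping.single w c) = c \<odot>\<^bsub>PA\<^esub> pw w"
  unfolding presented_word_def
  by (subst alg_homD(4)[OF proj_hom, symmetric]) (auto simp: free_alg_simps pm_scale_simps)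

lemma proj_eq_lin: "x \<in> carrier (free_alg G) \<Longrightarrow> proj x = P.lin pw x"
proof -
  assume "x \<in> carrier (free_alg G)"
  then have x: "Poly_Mapping.keys x \<subseteq> lists G" by (simp add: free_alg_simps)
  have pw: "pw \<in> lists G \<rightarrow> carrier PA" by (auto intro!: pw_closed)
  interpret F: calg "free_alg G" by (rule free_alg_calg)
  show ?thesis using x
  proof (induction x rule: poly_mapping_keys_induct)
    case zero
    then show ?case using proj_eq_zero_iff[of 0] F.genideal_ideal[OF rels] 
      by (metis F.zero_closed P.lin_zero additive_subgroup.zero_closed free_alg_simps(3) ideal.axioms(1))
  next
    case (single w c)
    then have "set w \<subseteq> G" by auto
    then show ?case by (simp add: proj_single P.lin_single)
  next
    case (add p r)
    then show ?case
      using alg_homD(3)[OF proj_hom, of p r] P.lin_add[OF _ _ pw, of p r] by (simp add: free_alg_simps)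
  qed
qed

lemma rel_zero: "r \<in> R \<Longrightarrow> P.lin pw r = \<zero>\<^bsub>PA\<^esub>"
proof -
  interpret F: calg "free_alg G" by (rule free_alg_calg)
  assume r: "r \<in> R"
  then have "r \<in> Idl\<^bsub>free_alg G\<^esub> R" using F.genideal_self[OF rels] by auto
  then show ?thesis using r rels proj_eq_lin[of r] proj_eq_zero_iff[of r] by auto
qed

lemma presented_span: "carrier PA = lin_span PA (pw ` lists G)"
proof
  show "lin_span PA (pw ` lists G) \<subseteq> carrier PA"
    by (rule P.lin_span_closed) (auto intro!: pw_closed)
  show "carrier PA \<subseteq> lin_span PA (pw ` lists G)"
  proof
    fix y assume "y \<in> carrier PA"
    then obtain x where x: "Poly_Mapping.keys x \<subseteq> lists G" "y = proj x"
      by (auto simp: presented_carrier free_alg_simps)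
    have "proj x \<in> lin_span PA (pw ` lists G)" using x(1)
    proof (induction x rule: poly_mapping_keys_induct)
      case zero
      then show ?case using proj_eq_lin[of 0] by (auto simp: free_alg_simps intro: lin_span.intros)
    next
      case (single w c)
      then have "set w \<subseteq> G" by auto
      then show ?case using single by (simp only: proj_single) (intro lin_span.intros imageI)
    next
      case (add p r)
      then show ?case
        using alg_homD(3)[OF proj_hom, of p r] by (auto simp: free_alg_simps intro: lin_span.intros)
    qed
    then show "y \<in> lin_span PA (pw ` lists G)" using x by simp
  qed
qed

lemma presented_gen: "carrier PA = alg_gen PA ((\<lambda>g. pw [g]) ` G)"
proof
  have gens: "(\<lambda>g. pw [g]) ` G \<subseteq> carrier PA" by auto
  note S = P.alg_gen_subalg[OF gens]
  show "alg_gen PA ((\<lambda>g. pw [g]) ` G) \<subseteq> carrier PA" using S by (simp add: subalg_def)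
  have "pw w \<in> alg_gen PA ((\<lambda>g. pw [g]) ` G)" if "set w \<subseteq> G" for w
    using that
  proof (induction w)
    case Nil
    then show ?case using S by (simp add: pw_Nil subalg_def)
  next
    case (Cons g w)
    then have "pw [g] \<in> alg_gen PA ((\<lambda>g. pw [g]) ` G)" by (intro subsetD[OF P.alg_gen_incl]) auto
    then show ?case using S Cons by (subst pw_Cons) (auto simp: subalg_def)
  qed
  then show "carrier PA \<subseteq> alg_gen PA ((\<lambda>g. pw [g]) ` G)"
    unfolding presented_span by (intro P.lin_span_least[OF S]) auto
qed

lemma presented_lift:
  assumes "calg W" "f \<in> G \<rightarrow> carrier W" "\<And>r. r \<in> R \<Longrightarrow> calg.lin W (calg.wprod W f) r = \<zero>\<^bsub>W\<^esub>"
  obtains h where "h \<in> alg_hom PA W" "\<And>g. g \<in> G \<Longrightarrow> h (pw [g]) = f g"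
proof -
  interpret F: calg "free_alg G" by (rule free_alg_calg)
  interpret W: calg W by fact
  let ?k = "W.lin (W.wprod f)"
  have k: "?k \<in> alg_hom (free_alg G) W" by (rule free_alg_lin_hom) fact+
  have "R \<subseteq> {x \<in> carrier (free_alg G). ?k x = \<zero>\<^bsub>W\<^esub>}" using rels assms(3) by auto
  then have "Idl\<^bsub>free_alg G\<^esub> R \<subseteq> {x \<in> carrier (free_alg G). ?k x = \<zero>\<^bsub>W\<^esub>}"
    by (intro F.genideal_minimal alg_hom_kernel_ideal[OF free_alg_calg assms(1) k])
  then obtain h where h: "\<And>x. x \<in> carrier (free_alg G) \<Longrightarrow> h (proj x) = ?k x"
     "h \<in> alg_hom PA W"
    using F.quot_alg_lift[OF rel_ideal assms(1) alg_homD(1)[OF k]] k unfolding presented_alg_def by blast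
  have "h (pw [g]) = f g" if "g \<in> G" for g
  proof -
    have "f g \<in> carrier W" using assms(2) that by auto
    then show ?thesis
      using h(1)[of "wd [g]"] that by (simp add: presented_word_def free_alg_simps W.lin_single)
  qed
  then show ?thesis using that h(2) by blast
qed

end

section \<open>Tensor products\<close>

lemma (in calg) wprod_commute:
  assumes "x \<in> carrier A" "\<And>g. g \<in> set w \<Longrightarrow> f g \<in> carrier A" "\<And>g. g \<in> set w \<Longrightarrow> x \<otimes> f g = f g \<otimes> x"
  shows "x \<otimes> wprod f w = wprod f w \<otimes> x"
  using assms(2,3)
proof (induction w)
  case (Cons g w)
  have cl: "f g \<in> carrier A" "wprod f w \<in> carrier A" and xg: "x \<otimes> f g = f g \<otimes> x" using Cons.prems by auto
  have "x \<otimes> wprod f (g # w) = f g \<otimes> (x \<otimes> wprod f w)"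
    using cl xg assms(1) by (simp add: m_assoc[symmetric])
  then show ?case using Cons cl assms(1) by (simp add: m_assoc)
qed (use assms(1) in auto)

lemma (in calg) wprod_mult:
  assumes "distinct w" "\<And>g. g \<in> set w \<Longrightarrow> f g \<in> carrier A \<and> f' g \<in> carrier A"
    and "\<And>g k. g \<in> set w \<Longrightarrow> k \<in> set w \<Longrightarrow> g \<noteq> k \<Longrightarrow> f' g \<otimes> f k = f k \<otimes> f' g"
  shows "wprod (\<lambda>g. f g \<otimes> f' g) w = wprod f w \<otimes> wprod f' w"
  using assms
proof (induction w)
  case (Cons g w)
  have cl: "f g \<in> carrier A" "f' g \<in> carrier A" "wprod f w \<in> carrier A" "wprod f' w \<in> carrier A"
    using Cons.prems(2) by auto
  have "f' g \<otimes> wprod f w = wprod f w \<otimes> f' g"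
    using Cons.prems by (intro wprod_commute) auto
  then have "f' g \<otimes> (wprod f w \<otimes> wprod f' w) = wprod f w \<otimes> (f' g \<otimes> wprod f' w)"
    using cl by (simp add: m_assoc[symmetric])
  then show ?case using Cons cl by (simp add: m_assoc)
qed simp

lemma (in calg) add_minus_cancel:
  assumes "x \<in> carrier A" "y \<in> carrier A" shows "x \<oplus> y \<ominus> x \<ominus> y = \<zero>"
proof -
  have "x \<oplus> y \<ominus> x = \<ominus> x \<oplus> (x \<oplus> y)" using assms by (simp add: a_minus_def a_comm)
  then show ?thesis using assms by (simp add: r_neg1) (simp add: a_minus_def r_neg)
qed

lemma lin_hom_mult_span:
  assumes "calg A" "calg B" "h \<in> lin_hom A B" "S \<subseteq> carrier A" "carrier A = lin_span A S"
    and mult: "\<And>s t. s \<in> S \<Longrightarrow> t \<in> S \<Longrightarrow> h (s \<otimes>\<^bsub>A\<^esub> t) = h s \<otimes>\<^bsub>B\<^esub> h t"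
    and xy: "x \<in> carrier A" "y \<in> carrier A"
  shows "h (x \<otimes>\<^bsub>A\<^esub> y) = h x \<otimes>\<^bsub>B\<^esub> h y"
proof -
  interpret A: calg A by fact
  interpret B: calg B by fact
  note h = lin_homD[OF assms(3)] lin_hom_zero[OF assms(1-3)]
  have cl: "x \<in> carrier A" if "x \<in> lin_span A S" for x using that assms(5) by simp
  have 1: "h (s \<otimes>\<^bsub>A\<^esub> y) = h s \<otimes>\<^bsub>B\<^esub> h y" if s: "s \<in> S" "y \<in> lin_span A S" for s y
  proof -
    have "s \<in> carrier A" using s assms(4) by auto
    with s(2) show ?thesis
      by induction (use h cl s(1) assms(4) in \<open>auto simp: mult A.r_distr B.r_distr A.smult_mult_r B.smult_mult_r subset_iff\<close>)
  qed
  have "x \<in> lin_span A S" using xy assms(5) by simp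
  then show ?thesis
    by induction (use h cl xy(2) assms(4) 1[OF _ xy(2)[unfolded assms(5)]] in \<open>auto simp: A.l_distr B.l_distr A.smult_mult_l B.smult_mult_l subset_iff\<close>)
qed

locale tensor_family =
  fixes J :: "'j set" and A :: "'j \<Rightarrow> (complex, 'a) module"
  assumes factor_calg: "\<And>j. j \<in> J \<Longrightarrow> calg (A j)"
begin

abbreviation "PG \<equiv> product_group J A"
abbreviation "MA \<equiv> monoid_alg PG"
abbreviation "T \<equiv> tensor_alg J A"
abbreviation "pt \<equiv> pure_tensor J A"

lemma factor_monoid: "j \<in> J \<Longrightarrow> monoid (A j)"
  by (rule ring.axioms(2)[OF calg.axioms(1)[OF factor_calg]])

lemma PG_monoid: "monoid PG"
proof (rule monoidI)
  fix x y z assume *: "x \<in> carrier PG" "y \<in> carrier PG" "z \<in> carrier PG"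
  show "x \<otimes>\<^bsub>PG\<^esub> y \<in> carrier PG"
    using * monoid.m_closed[OF factor_monoid] by (auto simp: PiE_iff)
  show "x \<otimes>\<^bsub>PG\<^esub> y \<otimes>\<^bsub>PG\<^esub> z = x \<otimes>\<^bsub>PG\<^esub> (y \<otimes>\<^bsub>PG\<^esub> z)"
    using * monoid.m_assoc[OF factor_monoid] by (auto simp: PiE_iff restrict_def fun_eq_iff)
  show "\<one>\<^bsub>PG\<^esub> \<otimes>\<^bsub>PG\<^esub> x = x" "x \<otimes>\<^bsub>PG\<^esub> \<one>\<^bsub>PG\<^esub> = x"
    using * monoid.l_one[OF factor_monoid] monoid.r_one[OF factor_monoid]
    by (auto simp: PiE_iff extensional_def restrict_def fun_eq_iff)
qed (auto simp: monoid.one_closed[OF factor_monoid])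

sublocale MA: calg MA by (rule monoid_alg_calg[OF PG_monoid])

lemma rels_carrier: "multilinear_rels J A \<subseteq> carrier MA"
proof -
  have u: "x(j := a) \<in> carrier PG" if "x \<in> (\<Pi>\<^sub>E i\<in>J. carrier (A i))" "j \<in> J" "a \<in> carrier (A j)" for x j a
    using that by (auto simp: PiE_iff extensional_def)
  have s: "Poly_Mapping.single x c \<in> carrier MA" if "x \<in> carrier PG" for x c
    using that by (auto simp: monoid_alg_simps)
  have m: "p - r \<in> carrier MA" if "p \<in> carrier MA" "r \<in> carrier MA" for p r
  proof -
    have "p - r = p \<oplus>\<^bsub>MA\<^esub> ((-1) \<odot>\<^bsub>MA\<^esub> r)" by (simp only: monoid_alg_simps pm_scale_simps(7))
    then show ?thesis using that by (simp only: MA.a_closed MA.smult_closed)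
  qed
  have add: "a \<oplus>\<^bsub>A j\<^esub> b \<in> carrier (A j)" "c \<odot>\<^bsub>A j\<^esub> a \<in> carrier (A j)"
    if "j \<in> J" "a \<in> carrier (A j)" "b \<in> carrier (A j)" for j a b c
  proof -
    interpret calg "A j" using that by (rule_tac factor_calg)
    show "a \<oplus>\<^bsub>A j\<^esub> b \<in> carrier (A j)" "c \<odot>\<^bsub>A j\<^esub> a \<in> carrier (A j)" using that by auto
  qed
  show ?thesis
    unfolding multilinear_rels_def by (auto intro!: m s u add simp del: carrier_product_group)
qed

lemma tensor_ideal: "ideal (tensor_ideal J A) MA"
  unfolding tensor_ideal_def by (rule MA.genideal_ideal[OF rels_carrier])

sublocale T: calg T unfolding tensor_alg_def by (rule MA.quot_alg_calg[OF tensor_ideal])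

abbreviation "tproj \<equiv> (\<lambda>x. tensor_ideal J A +>\<^bsub>MA\<^esub> x)"

lemma tproj_hom: "tproj \<in> alg_hom MA T"
  unfolding tensor_alg_def by (rule MA.quot_alg_hom[OF tensor_ideal])

lemma tensor_carrier: "carrier T = tproj ` carrier MA"
  unfolding tensor_alg_def by (rule MA.quot_alg_simps(1)[OF tensor_ideal])

lemma tproj_eq: "x - y \<in> multilinear_rels J A \<Longrightarrow> x \<in> carrier MA \<Longrightarrow> y \<in> carrier MA \<Longrightarrow> tproj x = tproj y"
proof -
  assume *: "x - y \<in> multilinear_rels J A" "x \<in> carrier MA" "y \<in> carrier MA"
  have "x \<ominus>\<^bsub>MA\<^esub> y = x - y"
    using * by (simp only: MA.minus_smult monoid_alg_simps pm_scale_simps(7)[of x])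
  moreover have "x - y \<in> tensor_ideal J A"
    unfolding tensor_ideal_def using MA.genideal_self[OF rels_carrier] * by auto
  ultimately show ?thesis using * by (simp add: MA.ideal_coset_eq[OF tensor_ideal])
qed

lemma pt_cong: "(\<And>j. j \<in> J \<Longrightarrow> x j = y j) \<Longrightarrow> pt x = pt y"
  unfolding pure_tensor_def by (metis restrict_ext)

lemma single_MA: "x \<in> (\<Pi> j\<in>J. carrier (A j)) \<Longrightarrow> Poly_Mapping.single (restrict x J) c \<in> carrier MA"
  by (auto simp: monoid_alg_simps)

lemma pt_closed: "x \<in> (\<Pi> j\<in>J. carrier (A j)) \<Longrightarrow> pt x \<in> carrier T"
  unfolding pure_tensor_def by (rule alg_homD(2)[OF tproj_hom single_MA])

lemma pt_mult:
  assumes "x \<in> (\<Pi> j\<in>J. carrier (A j))" "y \<in> (\<Pi> j\<in>J. carrier (A j))"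
  shows "pt x \<otimes>\<^bsub>T\<^esub> pt y = pt (\<lambda>j. x j \<otimes>\<^bsub>A j\<^esub> y j)"
proof -
  have "restrict x J \<otimes>\<^bsub>PG\<^esub> restrict y J = restrict (\<lambda>j. x j \<otimes>\<^bsub>A j\<^esub> y j) J" by auto
  then show ?thesis unfolding pure_tensor_def
    by (subst alg_homD(5)[OF tproj_hom, symmetric]) (simp_all add: assms single_MA monoid_alg_mult_single del: mult_product_group)
qed

lemma pt_one: "pt (\<lambda>j. \<one>\<^bsub>A j\<^esub>) = \<one>\<^bsub>T\<^esub>"
  unfolding pure_tensor_def using alg_homD(6)[OF tproj_hom] by (simp add: monoid_alg_simps)

lemma pt_single: "x \<in> (\<Pi> j\<in>J. carrier (A j)) \<Longrightarrow> tproj (Poly_Mapping.single (restrict x J) c) = c \<odot>\<^bsub>T\<^esub> pt x"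
  unfolding pure_tensor_def
  by (subst alg_homD(4)[OF tproj_hom, symmetric]) (simp_all add: single_MA, simp add: monoid_alg_simps pm_scale_simps)

lemma pt_add:
  assumes "x \<in> (\<Pi> j\<in>J. carrier (A j))" "j \<in> J" "a \<in> carrier (A j)" "b \<in> carrier (A j)"
  shows "pt (x(j := a \<oplus>\<^bsub>A j\<^esub> b)) = pt (x(j := a)) \<oplus>\<^bsub>T\<^esub> pt (x(j := b))"
proof -
  interpret Aj: calg "A j" using assms by (rule_tac factor_calg)
  have r: "restrict (x(j := c)) J = (restrict x J)(j := c)" for c using assms(2) by auto
  have c: "x(j := c) \<in> (\<Pi> j\<in>J. carrier (A j))" if "c \<in> carrier (A j)" for c using assms that by auto
  note s = single_MA[OF c[OF assms(3)], of 1] single_MA[OF c[OF assms(4)], of 1]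
     single_MA[OF c[OF Aj.a_closed[OF assms(3,4)]], of 1]
  have "tproj (Poly_Mapping.single (restrict (x(j := a \<oplus>\<^bsub>A j\<^esub> b)) J) 1) =
     tproj (Poly_Mapping.single (restrict (x(j := a)) J) 1 \<oplus>\<^bsub>MA\<^esub> Poly_Mapping.single (restrict (x(j := b)) J) 1)"
    by (rule tproj_eq[OF _ s(3) MA.a_closed[OF s(1,2)]])
       (use assms in \<open>auto simp: multilinear_rels_def r monoid_alg_simps diff_diff_eq[symmetric] intro!: exI[of _ "restrict x J"]\<close>)
  then show ?thesis unfolding pure_tensor_def
    by (subst alg_homD(3)[OF tproj_hom, symmetric]) (use s in auto)
qed

lemma pt_smult:
  assumes "x \<in> (\<Pi> j\<in>J. carrier (A j))" "j \<in> J" "a \<in> carrier (A j)"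
  shows "pt (x(j := c \<odot>\<^bsub>A j\<^esub> a)) = c \<odot>\<^bsub>T\<^esub> pt (x(j := a))"
proof -
  interpret Aj: calg "A j" using assms by (rule_tac factor_calg)
  have r: "restrict (x(j := c)) J = (restrict x J)(j := c)" for c using assms(2) by auto
  have c: "x(j := c) \<in> (\<Pi> j\<in>J. carrier (A j))" if "c \<in> carrier (A j)" for c using assms that by auto
  have "tproj (Poly_Mapping.single (restrict (x(j := c \<odot>\<^bsub>A j\<^esub> a)) J) 1) =
     tproj (Poly_Mapping.single (restrict (x(j := a)) J) c)"
    by (rule tproj_eq[OF _ single_MA[OF c] single_MA[OF c]], unfold multilinear_rels_def r, rule UnI2, rule CollectI,
        intro exI[of _ "restrict x J"] exI[of _ j] exI[of _ a] exI[of _ c])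
       (use assms in auto)
  then show ?thesis using pt_single[OF c[OF assms(3)], of c] unfolding pure_tensor_def by simp
qed

lemma tensor_span: "carrier T = lin_span T (pt ` (\<Pi> j\<in>J. carrier (A j)))"
proof
  show "lin_span T (pt ` (\<Pi> j\<in>J. carrier (A j))) \<subseteq> carrier T"
    by (rule T.lin_span_closed) (auto intro!: pt_closed)
  show "carrier T \<subseteq> lin_span T (pt ` (\<Pi> j\<in>J. carrier (A j)))"
  proof
    fix y assume "y \<in> carrier T"
    then obtain x where x: "Poly_Mapping.keys x \<subseteq> carrier PG" "y = tproj x"
      by (auto simp: tensor_carrier monoid_alg_simps)
    have "tproj x \<in> lin_span T (pt ` (\<Pi> j\<in>J. carrier (A j)))" using x(1)
    proof (induction x rule: poly_mapping_keys_induct)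
      case zero
      have "tproj \<zero>\<^bsub>MA\<^esub> = \<zero>\<^bsub>T\<^esub>" by (rule lin_hom_zero[OF MA.calg_axioms T.calg_axioms alg_homD(1)[OF tproj_hom]])
      then show ?case by (simp add: monoid_alg_simps lin_span.intros)
    next
      case (single x c)
      then have x: "x \<in> (\<Pi> j\<in>J. carrier (A j))" "restrict x J = x" by (auto simp: PiE_iff extensional_restrict)
      have "pt x \<in> lin_span T (pt ` (\<Pi> j\<in>J. carrier (A j)))" using x by (auto intro: lin_span.intros)
      then show ?case using pt_single[OF x(1), of c] x(2) by (auto intro: lin_span.intros)
    next
      case (add p r)
      then show ?case
        using alg_homD(3)[OF tproj_hom, of p r] by (auto simp: monoid_alg_simps intro: lin_span.intros)
    qed
    then show "y \<in> lin_span T (pt ` (\<Pi> j\<in>J. carrier (A j)))" using x by simp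
  qed
qed

text \<open>The kernel of the linear extension of a multilinear map need not be an ideal. Multiplying a
  multilinear relation by basis elements on both sides gives another one, so the elements all of
  whose such multiples are killed do form an ideal containing the relations.\<close>

lemma tensor_linear_lift:
  assumes W: "calg W" and cl: "\<And>x. x \<in> (\<Pi>\<^sub>E i\<in>J. carrier (A i)) \<Longrightarrow> \<phi> x \<in> carrier W"
    and add: "\<And>x j a b. x \<in> (\<Pi>\<^sub>E i\<in>J. carrier (A i)) \<Longrightarrow> j \<in> J \<Longrightarrow> a \<in> carrier (A j) \<Longrightarrow> b \<in> carrier (A j) \<Longrightarrow>
       \<phi> (x(j := a \<oplus>\<^bsub>A j\<^esub> b)) = \<phi> (x(j := a)) \<oplus>\<^bsub>W\<^esub> \<phi> (x(j := b))"
    and smult: "\<And>x j a c. x \<in> (\<Pi>\<^sub>E i\<in>J. carrier (A i)) \<Longrightarrow> j \<in> J \<Longrightarrow> a \<in> carrier (A j) \<Longrightarrow>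
       \<phi> (x(j := c \<odot>\<^bsub>A j\<^esub> a)) = c \<odot>\<^bsub>W\<^esub> \<phi> (x(j := a))"
  obtains h where "h \<in> lin_hom T W" "\<And>x. x \<in> (\<Pi> j\<in>J. carrier (A j)) \<Longrightarrow> h (pt x) = \<phi> (restrict x J)"
proof -
  interpret W: calg W by fact
  interpret PG: monoid PG by (rule PG_monoid)
  let ?C = "carrier PG"
  have \<phi>: "\<phi> \<in> ?C \<rightarrow> carrier W" using cl by auto
  have lin: "W.lin \<phi> \<in> lin_hom MA W"
    using W.lin_closed[OF _ \<phi>] W.lin_add[OF _ _ \<phi>] W.lin_scale[OF _ \<phi>] by (auto simp: lin_hom_def monoid_alg_simps)
  note linD = lin_homD[OF lin]
  let ?s = "\<lambda>x. Poly_Mapping.single x (1::complex)"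
  have s: "?s x \<in> carrier MA" "Poly_Mapping.single x c \<in> carrier MA" if "x \<in> ?C" for x c
    using that by (auto simp: monoid_alg_simps)
  \<comment> \<open>\<open>K\<close> is the largest two-sided ideal on which the linear extension of \<open>\<phi>\<close> vanishes.\<close>
  define K where "K = {r \<in> carrier MA. \<forall>x\<in>?C. \<forall>y\<in>?C. W.lin \<phi> (?s x \<otimes>\<^bsub>MA\<^esub> r \<otimes>\<^bsub>MA\<^esub> ?s y) = \<zero>\<^bsub>W\<^esub>}"
  have zero: "W.lin \<phi> \<zero>\<^bsub>MA\<^esub> = \<zero>\<^bsub>W\<^esub>" by (rule lin_hom_zero[OF MA.calg_axioms W lin])
  have K_sub: "K \<subseteq> carrier MA" by (auto simp: K_def)
  have K_add: "p \<oplus>\<^bsub>MA\<^esub> r \<in> K" if "p \<in> K" "r \<in> K" for p r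
    using that s linD by (auto simp: K_def MA.r_distr MA.l_distr)
  have K_smult: "c \<odot>\<^bsub>MA\<^esub> r \<in> K" if "r \<in> K" for c r
    using that s linD by (auto simp: K_def MA.smult_mult_l MA.smult_mult_r)
  have K_zero: "\<zero>\<^bsub>MA\<^esub> \<in> K" using s zero by (auto simp: K_def)
  have K_r: "r \<otimes>\<^bsub>MA\<^esub> p \<in> K" if "r \<in> K" "p \<in> carrier MA" for r p
  proof -
    from that(2) have "Poly_Mapping.keys p \<subseteq> ?C" by (simp add: monoid_alg_simps)
    then show ?thesis
    proof (induction p rule: poly_mapping_keys_induct)
      case zero
      have "r \<otimes>\<^bsub>MA\<^esub> \<zero>\<^bsub>MA\<^esub> = \<zero>\<^bsub>MA\<^esub>" using that(1) K_sub by (intro MA.r_null) auto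
      then show ?case using K_zero by (simp add: monoid_alg_simps)
    next
      case (single z c)
      have "r \<otimes>\<^bsub>MA\<^esub> ?s z \<in> K"
      proof -
        have "?s x \<otimes>\<^bsub>MA\<^esub> (r \<otimes>\<^bsub>MA\<^esub> ?s z) \<otimes>\<^bsub>MA\<^esub> ?s y = ?s x \<otimes>\<^bsub>MA\<^esub> r \<otimes>\<^bsub>MA\<^esub> ?s (z \<otimes>\<^bsub>PG\<^esub> y)" if "x \<in> ?C" "y \<in> ?C" for x y
        proof -
          have rc: "r \<in> carrier MA" using \<open>r \<in> K\<close> K_sub by blast
          have "?s (z \<otimes>\<^bsub>PG\<^esub> y) = ?s z \<otimes>\<^bsub>MA\<^esub> ?s y" by (simp only: monoid_alg_mult_single mult_1)
          then show ?thesis using rc s(1)[OF that(1)] s(1)[OF that(2)] s(1)[OF single]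
            by (simp only: MA.m_assoc MA.m_closed)
        qed
        then show ?thesis using \<open>r \<in> K\<close> single s[of z] PG.m_closed[of z]
          unfolding K_def by (simp del: carrier_product_group mult_product_group)
      qed
      moreover have "Poly_Mapping.single z c = c \<odot>\<^bsub>MA\<^esub> ?s z" by (simp add: monoid_alg_simps pm_scale_simps)
      moreover have "r \<otimes>\<^bsub>MA\<^esub> (c \<odot>\<^bsub>MA\<^esub> ?s z) = c \<odot>\<^bsub>MA\<^esub> (r \<otimes>\<^bsub>MA\<^esub> ?s z)"
        by (rule MA.smult_mult_r[OF subsetD[OF K_sub that(1)] s(1)[OF single]])
      ultimately show ?case using K_smult[of "r \<otimes>\<^bsub>MA\<^esub> ?s z" c] by presburger
    next
      case (add p p')
      then have "r \<otimes>\<^bsub>MA\<^esub> p \<oplus>\<^bsub>MA\<^esub> r \<otimes>\<^bsub>MA\<^esub> p' \<in> K" by (intro K_add)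
      then show ?case by (simp add: monoid_alg_simps monoid_alg_mult_distrib)
    qed
  qed
  have K_l: "p \<otimes>\<^bsub>MA\<^esub> r \<in> K" if "r \<in> K" "p \<in> carrier MA" for r p
  proof -
    from that(2) have "Poly_Mapping.keys p \<subseteq> ?C" by (simp add: monoid_alg_simps)
    then show ?thesis
    proof (induction p rule: poly_mapping_keys_induct)
      case zero
      have "\<zero>\<^bsub>MA\<^esub> \<otimes>\<^bsub>MA\<^esub> r = \<zero>\<^bsub>MA\<^esub>" using that(1) K_sub by (intro MA.l_null) auto
      then show ?case using K_zero by (simp add: monoid_alg_simps)
    next
      case (single z c)
      have "?s z \<otimes>\<^bsub>MA\<^esub> r \<in> K"
      proof -
        have "?s x \<otimes>\<^bsub>MA\<^esub> (?s z \<otimes>\<^bsub>MA\<^esub> r) \<otimes>\<^bsub>MA\<^esub> ?s y = ?s (x \<otimes>\<^bsub>PG\<^esub> z) \<otimes>\<^bsub>MA\<^esub> r \<otimes>\<^bsub>MA\<^esub> ?s y" if "x \<in> ?C" "y \<in> ?C" for x y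
        proof -
          have rc: "r \<in> carrier MA" using \<open>r \<in> K\<close> K_sub by blast
          have "?s (x \<otimes>\<^bsub>PG\<^esub> z) = ?s x \<otimes>\<^bsub>MA\<^esub> ?s z" by (simp only: monoid_alg_mult_single mult_1)
          then show ?thesis using rc s(1)[OF that(1)] s(1)[OF that(2)] s(1)[OF single]
            by (simp only: MA.m_assoc MA.m_closed)
        qed
        then show ?thesis using \<open>r \<in> K\<close> single s[of z] PG.m_closed[of _ z]
          unfolding K_def by (simp del: carrier_product_group mult_product_group)
      qed
      moreover have "Poly_Mapping.single z c = c \<odot>\<^bsub>MA\<^esub> ?s z" by (simp add: monoid_alg_simps pm_scale_simps)
      moreover have "(c \<odot>\<^bsub>MA\<^esub> ?s z) \<otimes>\<^bsub>MA\<^esub> r = c \<odot>\<^bsub>MA\<^esub> (?s z \<otimes>\<^bsub>MA\<^esub> r)"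
        by (rule MA.smult_mult_l[OF s(1)[OF single] subsetD[OF K_sub that(1)]])
      ultimately show ?case using K_smult[of "?s z \<otimes>\<^bsub>MA\<^esub> r" c] by presburger
    next
      case (add p p')
      then have "p \<otimes>\<^bsub>MA\<^esub> r \<oplus>\<^bsub>MA\<^esub> p' \<otimes>\<^bsub>MA\<^esub> r \<in> K" by (intro K_add)
      then show ?case by (simp add: monoid_alg_simps monoid_alg_mult_distrib)
    qed
  qed
  have "ideal K MA" by (rule MA.idealI) (use K_sub K_zero K_add K_r K_l in auto)
  moreover have "multilinear_rels J A \<subseteq> K"
  proof -
    have m: "?s x \<otimes>\<^bsub>MA\<^esub> (p - r) \<otimes>\<^bsub>MA\<^esub> ?s y = ?s x \<otimes>\<^bsub>MA\<^esub> p \<otimes>\<^bsub>MA\<^esub> ?s y - ?s x \<otimes>\<^bsub>MA\<^esub> r \<otimes>\<^bsub>MA\<^esub> ?s y" for x y p r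
      by (simp only: pm_scale_simps(7) monoid_alg_mult_distrib monoid_alg_mult_scale)
    have u: "x \<otimes>\<^bsub>PG\<^esub> (z(j := a)) \<otimes>\<^bsub>PG\<^esub> y = (x \<otimes>\<^bsub>PG\<^esub> z \<otimes>\<^bsub>PG\<^esub> y)(j := x j \<otimes>\<^bsub>A j\<^esub> a \<otimes>\<^bsub>A j\<^esub> y j)"
      if "j \<in> J" for x y z j a using that by auto
    have ucl: "x(j := a) \<in> ?C" if "x \<in> ?C" "j \<in> J" "a \<in> carrier (A j)" for x j a
      using that by (auto simp: PiE_iff extensional_def)
    have lmin: "W.lin \<phi> (p - r) = W.lin \<phi> p \<ominus>\<^bsub>W\<^esub> W.lin \<phi> r" if "p \<in> carrier MA" "r \<in> carrier MA" for p r
      using lin_hom_minus[OF MA.calg_axioms W lin that] that by (simp only: MA.minus_smult monoid_alg_simps pm_scale_simps(7)[of p])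
    have mm: "p - r \<in> carrier MA" if "p \<in> carrier MA" "r \<in> carrier MA" for p r
      using that MA.a_closed[OF that(1) MA.smult_closed[OF that(2)], of "-1"] by (simp only: monoid_alg_simps pm_scale_simps(7)[of p])
    have ls: "W.lin \<phi> (Poly_Mapping.single x c) = c \<odot>\<^bsub>W\<^esub> \<phi> x" if "x \<in> ?C" for x c
      using that \<phi> by (intro W.lin_single) auto
    have one: "Poly_Mapping.single (z(j := a \<oplus>\<^bsub>A j\<^esub> b)) 1 - Poly_Mapping.single (z(j := a)) 1 - Poly_Mapping.single (z(j := b)) 1 \<in> K"
      if z: "z \<in> (\<Pi>\<^sub>E i\<in>J. carrier (A i))" and j: "j \<in> J" and ab: "a \<in> carrier (A j)" "b \<in> carrier (A j)" for z j a b
    proof -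
      interpret Aj: calg "A j" using j by (rule factor_calg)
      have *: "\<phi> ((x \<otimes>\<^bsub>PG\<^esub> z \<otimes>\<^bsub>PG\<^esub> y)(j := x j \<otimes>\<^bsub>A j\<^esub> (a \<oplus>\<^bsub>A j\<^esub> b) \<otimes>\<^bsub>A j\<^esub> y j)) =
          \<phi> ((x \<otimes>\<^bsub>PG\<^esub> z \<otimes>\<^bsub>PG\<^esub> y)(j := x j \<otimes>\<^bsub>A j\<^esub> a \<otimes>\<^bsub>A j\<^esub> y j)) \<oplus>\<^bsub>W\<^esub> \<phi> ((x \<otimes>\<^bsub>PG\<^esub> z \<otimes>\<^bsub>PG\<^esub> y)(j := x j \<otimes>\<^bsub>A j\<^esub> b \<otimes>\<^bsub>A j\<^esub> y j))"
        if "x \<in> ?C" "y \<in> ?C" for x y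
      proof -
        have "x j \<in> carrier (A j)" "y j \<in> carrier (A j)" using that j by auto
        then show ?thesis
          using add[of "x \<otimes>\<^bsub>PG\<^esub> z \<otimes>\<^bsub>PG\<^esub> y" j "x j \<otimes>\<^bsub>A j\<^esub> a \<otimes>\<^bsub>A j\<^esub> y j" "x j \<otimes>\<^bsub>A j\<^esub> b \<otimes>\<^bsub>A j\<^esub> y j"] that z j ab
           PG.m_closed[OF PG.m_closed[of x z], of y]
          by (simp add: Aj.r_distr Aj.l_distr del: mult_product_group)
      qed
      have c: "(x \<otimes>\<^bsub>PG\<^esub> z \<otimes>\<^bsub>PG\<^esub> y)(j := x j \<otimes>\<^bsub>A j\<^esub> a \<otimes>\<^bsub>A j\<^esub> y j) \<in> ?C" if "x \<in> ?C" "y \<in> ?C" "a \<in> carrier (A j)" for x y a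
      proof -
        have "x j \<in> carrier (A j)" "y j \<in> carrier (A j)" using that j by auto
        moreover have "z \<in> ?C" using z by simp
        ultimately show ?thesis using that j by (intro ucl PG.m_closed) auto
      qed
      have "W.lin \<phi> (?s x \<otimes>\<^bsub>MA\<^esub> (?s (z(j := a \<oplus>\<^bsub>A j\<^esub> b)) - ?s (z(j := a)) - ?s (z(j := b))) \<otimes>\<^bsub>MA\<^esub> ?s y) = \<zero>\<^bsub>W\<^esub>"
        if xy: "x \<in> ?C" "y \<in> ?C" for x y
      proof -
        have f: "\<phi> ((x \<otimes>\<^bsub>PG\<^esub> z \<otimes>\<^bsub>PG\<^esub> y)(j := x j \<otimes>\<^bsub>A j\<^esub> a \<otimes>\<^bsub>A j\<^esub> y j)) \<in> carrier W" if "a \<in> carrier (A j)" for a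
          using c[OF xy that] \<phi> by blast
        show ?thesis
          unfolding m monoid_alg_mult_single u[OF j]
          using c[OF xy] ab f
          by (simp add: lmin mm s ls *[OF xy] del: mult_product_group carrier_product_group)
             (simp only: W.add_minus_cancel)
      qed
      moreover have "z \<in> ?C" using z by simp
      ultimately show ?thesis using j ab unfolding K_def by (auto intro!: mm s ucl simp del: carrier_product_group mult_product_group)
    qed
    have two: "Poly_Mapping.single (z(j := c \<odot>\<^bsub>A j\<^esub> a)) 1 - Poly_Mapping.single (z(j := a)) c \<in> K"
      if z: "z \<in> (\<Pi>\<^sub>E i\<in>J. carrier (A i))" and j: "j \<in> J" and ab: "a \<in> carrier (A j)" for z j a c
    proof -
      interpret Aj: calg "A j" using j by (rule factor_calg)
      have c: "(x \<otimes>\<^bsub>PG\<^esub> z \<otimes>\<^bsub>PG\<^esub> y)(j := x j \<otimes>\<^bsub>A j\<^esub> a \<otimes>\<^bsub>A j\<^esub> y j) \<in> ?C" if "x \<in> ?C" "y \<in> ?C" "a \<in> carrier (A j)" for x y a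
      proof -
        have "x j \<in> carrier (A j)" "y j \<in> carrier (A j)" using that j by auto
        moreover have "z \<in> ?C" using z by simp
        ultimately show ?thesis using that j by (intro ucl PG.m_closed) auto
      qed
      have "W.lin \<phi> (?s x \<otimes>\<^bsub>MA\<^esub> (?s (z(j := c \<odot>\<^bsub>A j\<^esub> a)) - Poly_Mapping.single (z(j := a)) c) \<otimes>\<^bsub>MA\<^esub> ?s y) = \<zero>\<^bsub>W\<^esub>"
        if xy: "x \<in> ?C" "y \<in> ?C" for x y
      proof -
        have xyj: "x j \<in> carrier (A j)" "y j \<in> carrier (A j)" using xy j by auto
        have f: "\<phi> ((x \<otimes>\<^bsub>PG\<^esub> z \<otimes>\<^bsub>PG\<^esub> y)(j := x j \<otimes>\<^bsub>A j\<^esub> a \<otimes>\<^bsub>A j\<^esub> y j)) \<in> carrier W" if "a \<in> carrier (A j)" for a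
          using c[OF xy that] \<phi> by blast
        have "\<phi> ((x \<otimes>\<^bsub>PG\<^esub> z \<otimes>\<^bsub>PG\<^esub> y)(j := x j \<otimes>\<^bsub>A j\<^esub> (c \<odot>\<^bsub>A j\<^esub> a) \<otimes>\<^bsub>A j\<^esub> y j)) =
          c \<odot>\<^bsub>W\<^esub> \<phi> ((x \<otimes>\<^bsub>PG\<^esub> z \<otimes>\<^bsub>PG\<^esub> y)(j := x j \<otimes>\<^bsub>A j\<^esub> a \<otimes>\<^bsub>A j\<^esub> y j))"
          using smult[of "x \<otimes>\<^bsub>PG\<^esub> z \<otimes>\<^bsub>PG\<^esub> y" j "x j \<otimes>\<^bsub>A j\<^esub> a \<otimes>\<^bsub>A j\<^esub> y j" c] xy z j ab xyj
           PG.m_closed[OF PG.m_closed[of x z], of y]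
          by (simp add: Aj.smult_mult_l Aj.smult_mult_r del: mult_product_group)
        then show ?thesis
          unfolding m monoid_alg_mult_single u[OF j]
          using c[OF xy] ab f
          by (simp add: lmin mm s ls del: mult_product_group carrier_product_group)
             (simp add: a_minus_def W.r_neg)
      qed
      moreover have "z \<in> ?C" using z by simp
      ultimately show ?thesis using j ab unfolding K_def by (auto intro!: mm s ucl simp del: carrier_product_group mult_product_group)
    qed
    show ?thesis unfolding multilinear_rels_def using one two by blast
  qed
  ultimately have "tensor_ideal J A \<subseteq> K" unfolding tensor_ideal_def by (rule MA.genideal_minimal)
  moreover have "W.lin \<phi> r = \<zero>\<^bsub>W\<^esub>" if "r \<in> K" for r
  proof -
    have "W.lin \<phi> (\<one>\<^bsub>MA\<^esub> \<otimes>\<^bsub>MA\<^esub> r \<otimes>\<^bsub>MA\<^esub> \<one>\<^bsub>MA\<^esub>) = \<zero>\<^bsub>W\<^esub>"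
      using that PG.one_closed by (simp add: K_def monoid_alg_simps del: carrier_product_group one_product_group)
    then show ?thesis using that K_sub by auto
  qed
  ultimately have kill: "W.lin \<phi> r = \<zero>\<^bsub>W\<^esub>" if "r \<in> tensor_ideal J A" for r using that by auto
  obtain h where h: "h \<in> lin_hom T W" "\<And>x. x \<in> carrier MA \<Longrightarrow> h (tproj x) = W.lin \<phi> x"
    by (rule MA.quot_alg_lift[OF tensor_ideal W lin kill]) (auto simp: tensor_alg_def)
  have "h (pt x) = \<phi> (restrict x J)" if "x \<in> (\<Pi> j\<in>J. carrier (A j))" for x
    using that cl[of "restrict x J"] unfolding pure_tensor_def by (simp add: h(2) single_MA W.lin_single)
  then show ?thesis using that h(1) by blast
qed

abbreviation "incl \<equiv> tensor_incl J A"

lemma one_update: "(\<lambda>i. if i = j then a else \<one>\<^bsub>A i\<^esub>) = (\<lambda>i. \<one>\<^bsub>A i\<^esub>)(j := a)"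
  by auto

lemma ones_closed: "(\<lambda>i. \<one>\<^bsub>A i\<^esub>) \<in> (\<Pi> j\<in>J. carrier (A j))"
  by (auto simp: monoid.one_closed[OF factor_monoid])

lemma incl_alg_hom:
  assumes j: "j \<in> J" shows "incl j \<in> alg_hom (A j) T"
proof -
  interpret Aj: calg "A j" using j by (rule factor_calg)
  have c: "(\<lambda>i. if i = j then a else \<one>\<^bsub>A i\<^esub>) \<in> (\<Pi> j\<in>J. carrier (A j))" if "a \<in> carrier (A j)" for a
    using that by (auto simp: monoid.one_closed[OF factor_monoid])
  have "incl j (a \<otimes>\<^bsub>A j\<^esub> b) = incl j a \<otimes>\<^bsub>T\<^esub> incl j b" if "a \<in> carrier (A j)" "b \<in> carrier (A j)" for a b
    unfolding tensor_incl_def pt_mult[OF c[OF that(1)] c[OF that(2)]]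
    by (rule pt_cong) (use monoid.one_closed[OF factor_monoid] monoid.l_one[OF factor_monoid] in auto)
  moreover have "incl j \<one>\<^bsub>A j\<^esub> = \<one>\<^bsub>T\<^esub>"
    unfolding tensor_incl_def pt_one[symmetric] by (rule pt_cong) auto
  ultimately show ?thesis
    using c pt_closed pt_add[OF ones_closed j] pt_smult[OF ones_closed j]
    by (auto simp: alg_hom_iff lin_hom_def tensor_incl_def one_update)
qed

lemma incl_commute:
  assumes "i \<in> J" "j \<in> J" "i \<noteq> j" "a \<in> carrier (A i)" "b \<in> carrier (A j)"
  shows "incl i a \<otimes>\<^bsub>T\<^esub> incl j b = incl j b \<otimes>\<^bsub>T\<^esub> incl i a"
proof -
  have c: "(\<lambda>k. if k = j then a else \<one>\<^bsub>A k\<^esub>) \<in> (\<Pi> j\<in>J. carrier (A j))" if "a \<in> carrier (A j)" for a j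
    using that by (auto simp: monoid.one_closed[OF factor_monoid])
  show ?thesis
    unfolding tensor_incl_def pt_mult[OF c[OF assms(4)] c[OF assms(5)]] pt_mult[OF c[OF assms(5)] c[OF assms(4)]]
    by (rule pt_cong) (use assms monoid.one_closed[OF factor_monoid] monoid.l_one[OF factor_monoid] monoid.r_one[OF factor_monoid] in auto)
qed

text \<open>A pure tensor is the product of the images of its components.\<close>

lemma tensor_generated:
  assumes fin: "finite J" and S: "subalg S T" and inS: "\<And>j a. j \<in> J \<Longrightarrow> a \<in> carrier (A j) \<Longrightarrow> incl j a \<in> S"
  shows "S = carrier T"
proof
  show "S \<subseteq> carrier T" using S by (simp add: subalg_def)
  have part: "pt (\<lambda>j. if j \<in> F then x j else \<one>\<^bsub>A j\<^esub>) \<in> S"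
    if x: "x \<in> (\<Pi> j\<in>J. carrier (A j))" and F: "finite F" "F \<subseteq> J" for x F
    using F
  proof (induction F)
    case empty
    then show ?case using S by (simp add: pt_one subalg_def)
  next
    case (insert i F)
    have "pt (\<lambda>j. if j \<in> insert i F then x j else \<one>\<^bsub>A j\<^esub>) = incl i (x i) \<otimes>\<^bsub>T\<^esub> pt (\<lambda>j. if j \<in> F then x j else \<one>\<^bsub>A j\<^esub>)"
      unfolding tensor_incl_def
      by (subst pt_mult) (use x insert monoid.one_closed[OF factor_monoid] monoid.l_one[OF factor_monoid] monoid.r_one[OF factor_monoid] in \<open>auto simp: Pi_iff intro!: pt_cong\<close>)
    moreover have "incl i (x i) \<in> S" using inS x insert by auto
    ultimately show ?case using insert S by (simp add: subalg_def)
  qed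
  have "pt x \<in> S" if "x \<in> (\<Pi> j\<in>J. carrier (A j))" for x
    using part[OF that fin] pt_cong[of "\<lambda>j. if j \<in> J then x j else \<one>\<^bsub>A j\<^esub>" x] by auto
  then show "carrier T \<subseteq> S" unfolding tensor_span by (intro T.lin_span_least[OF S]) auto
qed

text \<open>The product of the images of the components, in a fixed order of the factors, is multilinear; it is
  multiplicative because the images of different factors commute.\<close>

lemma tensor_alg_lift:
  assumes fin: "finite J" and W: "calg W" and g: "\<And>j. j \<in> J \<Longrightarrow> g j \<in> alg_hom (A j) W"
    and comm: "\<And>i j a b. i \<in> J \<Longrightarrow> j \<in> J \<Longrightarrow> i \<noteq> j \<Longrightarrow> a \<in> carrier (A i) \<Longrightarrow> b \<in> carrier (A j) \<Longrightarrow>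
       g i a \<otimes>\<^bsub>W\<^esub> g j b = g j b \<otimes>\<^bsub>W\<^esub> g i a"
  obtains h where "h \<in> alg_hom T W" "\<And>j a. j \<in> J \<Longrightarrow> a \<in> carrier (A j) \<Longrightarrow> h (incl j a) = g j a"
proof -
  interpret W: calg W by fact
  obtain js where js: "set js = J" "distinct js" using fin finite_distinct_list by blast
  define \<phi> where "\<phi> x = W.wprod (\<lambda>j. g j (x j)) js" for x
  have gc: "g j (x j) \<in> carrier W" if "x \<in> (\<Pi> i\<in>J. carrier (A i))" "j \<in> J" for x j
    using alg_homD(2)[OF g[OF that(2)]] that by auto
  have upd: "\<exists>P Q. P \<in> carrier W \<and> Q \<in> carrier W \<and> (\<forall>a\<in>carrier (A j). \<phi> (x(j := a)) = P \<otimes>\<^bsub>W\<^esub> g j a \<otimes>\<^bsub>W\<^esub> Q)"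
    if x: "x \<in> (\<Pi> i\<in>J. carrier (A i))" and j: "j \<in> J" for x j
  proof -
    obtain l1 l2 where l: "js = l1 @ j # l2" using j js(1) by (metis split_list)
    have n: "j \<notin> set l1" "j \<notin> set l2" and sub: "set l1 \<subseteq> J" "set l2 \<subseteq> J" using js l by auto
    have cl: "W.wprod (\<lambda>j. g j (x j)) l1 \<in> carrier W" "W.wprod (\<lambda>j. g j (x j)) l2 \<in> carrier W"
      using gc[OF x] sub by (auto intro!: W.wprod_closed)
    have "\<phi> (x(j := a)) = W.wprod (\<lambda>j. g j (x j)) l1 \<otimes>\<^bsub>W\<^esub> g j a \<otimes>\<^bsub>W\<^esub> W.wprod (\<lambda>j. g j (x j)) l2"
      if a: "a \<in> carrier (A j)" for a
    proof -
      have ga: "g j a \<in> carrier W" using alg_homD(2)[OF g[OF j]] a by auto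
      have "\<phi> (x(j := a)) = W.wprod (\<lambda>i. g i ((x(j := a)) i)) l1 \<otimes>\<^bsub>W\<^esub> W.wprod (\<lambda>i. g i ((x(j := a)) i)) (j # l2)"
        unfolding \<phi>_def l using x a gc sub j ga by (intro W.wprod_append) (auto simp: subset_iff)
      also have "W.wprod (\<lambda>i. g i ((x(j := a)) i)) l1 = W.wprod (\<lambda>j. g j (x j)) l1"
        using n by (intro W.wprod_cong) auto
      also have "W.wprod (\<lambda>i. g i ((x(j := a)) i)) (j # l2) = g j a \<otimes>\<^bsub>W\<^esub> W.wprod (\<lambda>j. g j (x j)) l2"
      proof -
        have "W.wprod (\<lambda>i. g i ((x(j := a)) i)) l2 = W.wprod (\<lambda>j. g j (x j)) l2"
          using n by (intro W.wprod_cong) auto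
        then show ?thesis by simp
      qed
      finally show ?thesis using cl ga by (simp add: W.m_assoc fun_upd_def)
    qed
    then show ?thesis using cl by blast
  qed
  have PiE: "x \<in> (\<Pi> i\<in>J. carrier (A i))" if "x \<in> (\<Pi>\<^sub>E i\<in>J. carrier (A i))" for x using that by auto
  obtain h where h: "h \<in> lin_hom T W" and hpt: "\<And>x. x \<in> (\<Pi> j\<in>J. carrier (A j)) \<Longrightarrow> h (pt x) = \<phi> (restrict x J)"
  proof (rule tensor_linear_lift[OF W, of \<phi>])
    show "\<phi> x \<in> carrier W" if "x \<in> (\<Pi>\<^sub>E i\<in>J. carrier (A i))" for x
      unfolding \<phi>_def using gc[OF PiE[OF that]] js(1) by (intro W.wprod_closed) auto
    fix x j a b c assume x: "x \<in> (\<Pi>\<^sub>E i\<in>J. carrier (A i))" and j: "j \<in> J"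
    interpret Aj: calg "A j" using j by (rule factor_calg)
    obtain P Q where PQ: "P \<in> carrier W" "Q \<in> carrier W" "\<And>a. a \<in> carrier (A j) \<Longrightarrow> \<phi> (x(j := a)) = P \<otimes>\<^bsub>W\<^esub> g j a \<otimes>\<^bsub>W\<^esub> Q"
      using upd[OF PiE[OF x] j] by blast
    note gj = alg_homD[OF g[OF j]]
    assume a: "a \<in> carrier (A j)"
    show "\<phi> (x(j := c \<odot>\<^bsub>A j\<^esub> a)) = c \<odot>\<^bsub>W\<^esub> \<phi> (x(j := a))"
      using a PQ gj by (simp add: W.smult_mult_l W.smult_mult_r)
    assume b: "b \<in> carrier (A j)"
    show "\<phi> (x(j := a \<oplus>\<^bsub>A j\<^esub> b)) = \<phi> (x(j := a)) \<oplus>\<^bsub>W\<^esub> \<phi> (x(j := b))"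
      using a b PQ gj by (simp add: W.r_distr W.l_distr)
  qed blast
  have hpt': "h (pt x) = \<phi> x" if "x \<in> (\<Pi> j\<in>J. carrier (A j))" for x
    unfolding hpt[OF that] \<phi>_def using js(1) by (intro W.wprod_cong) auto
  have one: "h \<one>\<^bsub>T\<^esub> = \<one>\<^bsub>W\<^esub>"
  proof -
    have "W.wprod (\<lambda>j. g j \<one>\<^bsub>A j\<^esub>) l = \<one>\<^bsub>W\<^esub>" if "set l \<subseteq> J" for l
      using that by (induction l) (auto simp: alg_homD(6)[OF g])
    then show ?thesis unfolding pt_one[symmetric] hpt'[OF ones_closed] \<phi>_def using js(1) by simp
  qed
  have mult: "h (pt x \<otimes>\<^bsub>T\<^esub> pt y) = h (pt x) \<otimes>\<^bsub>W\<^esub> h (pt y)"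
    if x: "x \<in> (\<Pi> j\<in>J. carrier (A j))" and y: "y \<in> (\<Pi> j\<in>J. carrier (A j))" for x y
  proof -
    have xy: "(\<lambda>j. x j \<otimes>\<^bsub>A j\<^esub> y j) \<in> (\<Pi> j\<in>J. carrier (A j))"
      using x y monoid.m_closed[OF factor_monoid] by (auto simp: Pi_iff)
    have "\<phi> (\<lambda>j. x j \<otimes>\<^bsub>A j\<^esub> y j) = W.wprod (\<lambda>j. g j (x j) \<otimes>\<^bsub>W\<^esub> g j (y j)) js"
      unfolding \<phi>_def using x y js(1) by (intro W.wprod_cong alg_homD(5)[OF g]) auto
    also have "\<dots> = \<phi> x \<otimes>\<^bsub>W\<^esub> \<phi> y"
      unfolding \<phi>_def using gc[OF x] gc[OF y] js x y by (intro W.wprod_mult) (auto intro!: comm)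
    finally show ?thesis by (simp add: pt_mult[OF x y] hpt'[OF xy] hpt'[OF x] hpt'[OF y])
  qed
  have "h (x \<otimes>\<^bsub>T\<^esub> y) = h x \<otimes>\<^bsub>W\<^esub> h y" if "x \<in> carrier T" "y \<in> carrier T" for x y
    by (rule lin_hom_mult_span[OF T.calg_axioms W h _ tensor_span _ that])
       (use mult pt_closed in \<open>auto simp: image_subset_iff\<close>)
  then have "h \<in> alg_hom T W"
    unfolding alg_hom_iff using h one by blast
  moreover have "h (incl j a) = g j a" if j: "j \<in> J" and a: "a \<in> carrier (A j)" for j a
  proof -
    have 1: "g i \<one>\<^bsub>A i\<^esub> = \<one>\<^bsub>W\<^esub>" if "i \<in> J" for i using alg_homD(6)[OF g[OF that]] .
    have ga: "g j a \<in> carrier W" using alg_homD(2)[OF g[OF j]] a by auto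
    have w: "W.wprod (\<lambda>i. g i (if i = j then a else \<one>\<^bsub>A i\<^esub>)) l = (if j \<in> set l then g j a else \<one>\<^bsub>W\<^esub>)"
      if "set l \<subseteq> J" "distinct l" for l
      using that by (induction l) (auto simp: 1 ga)
    have "(\<lambda>i. if i = j then a else \<one>\<^bsub>A i\<^esub>) \<in> (\<Pi> j\<in>J. carrier (A j))"
      using a by (auto simp: monoid.one_closed[OF factor_monoid])
    then show ?thesis unfolding tensor_incl_def by (simp add: hpt' \<phi>_def w js j)
  qed
  ultimately show ?thesis using that by blast
qed

end

section \<open>Root data\<close>

locale root_data =
  fixes \<Phi> B :: "'a::real_inner set" and q :: complex
  assumes rs: "root_system \<Phi>" and sr: "simple_roots \<Phi> B" and ev: "even_form \<Phi>"
    and q0: "q \<noteq> 0" and q_not_root: "\<And>n::nat. n > 0 \<Longrightarrow> q ^ n \<noteq> 1"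
begin

lemma B_sub: "B \<subseteq> \<Phi>" and indep: "independent B" and finB: "finite B" and finPhi: "finite \<Phi>"
  using rs sr finite_subset by (auto simp: root_system_def simple_roots_def)

lemma q_powi_eq_1_iff: "q powi n = 1 \<longleftrightarrow> n = 0"
proof
  assume *: "q powi n = 1"
  show "n = 0"
  proof (rule ccontr)
    assume "n \<noteq> 0"
    then have "q ^ nat \<bar>n\<bar> \<noteq> 1" by (intro q_not_root) auto
    with * show False by (auto simp: power_int_def abs_if power_inverse split: if_splits)
  qed
qed simp

lemma norm_root: assumes "\<alpha> \<in> \<Phi>" obtains n where "n > 0" "\<alpha> \<bullet> \<alpha> = 2 * real n"
  using ev assms by (auto simp: even_form_def)

lemma norm_root_pos: "\<alpha> \<in> \<Phi> \<Longrightarrow> \<alpha> \<bullet> \<alpha> > 0"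
  by (erule norm_root) simp

lemma cartan_exact: "\<alpha> \<in> B \<Longrightarrow> \<beta> \<in> B \<Longrightarrow> real_of_int (cartan \<alpha> \<beta>) = 2 * (\<alpha> \<bullet> \<beta>) / (\<alpha> \<bullet> \<alpha>)"
proof -
  assume "\<alpha> \<in> B" "\<beta> \<in> B"
  then have "\<alpha> \<in> \<Phi>" "\<beta> \<in> \<Phi>" using B_sub by auto
  then have "2 * (\<alpha> \<bullet> \<beta>) / (\<alpha> \<bullet> \<alpha>) \<in> \<int>" using rs by (simp add: root_system_def inner_commute)
  then show ?thesis by (auto simp: cartan_def elim: Ints_cases)
qed

lemma half_norm: "\<alpha> \<in> B \<Longrightarrow> real_of_int \<lfloor>(\<alpha> \<bullet> \<alpha>) / 2\<rfloor> = (\<alpha> \<bullet> \<alpha>) / 2 \<and> \<lfloor>(\<alpha> \<bullet> \<alpha>) / 2\<rfloor> > 0"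
  using B_sub by (auto elim!: norm_root[of \<alpha>])

lemma inner_cartan: assumes "\<alpha> \<in> B" "\<beta> \<in> B" shows "\<alpha> \<bullet> \<beta> = of_int (cartan \<alpha> \<beta> * \<lfloor>(\<alpha> \<bullet> \<alpha>) / 2\<rfloor>)"
proof -
  have "\<alpha> \<bullet> \<alpha> \<noteq> 0" using norm_root_pos[of \<alpha>] assms B_sub by auto
  then have "of_int (cartan \<alpha> \<beta>) * (\<alpha> \<bullet> \<alpha>) = 2 * (\<alpha> \<bullet> \<beta>)" using cartan_exact[OF assms] by simp
  moreover have "\<alpha> \<bullet> \<alpha> = 2 * of_int \<lfloor>(\<alpha> \<bullet> \<alpha>) / 2\<rfloor>" using half_norm[OF assms(1)] by simp
  ultimately have "of_int (cartan \<alpha> \<beta>) * (2 * of_int \<lfloor>(\<alpha> \<bullet> \<alpha>) / 2\<rfloor>) = 2 * (\<alpha> \<bullet> \<beta>)" by metis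
  then show ?thesis by simp
qed

lemma int_form_simple: "\<alpha> \<in> B \<Longrightarrow> \<beta> \<in> B \<Longrightarrow> int_form \<alpha> \<beta> = cartan \<alpha> \<beta> * \<lfloor>(\<alpha> \<bullet> \<alpha>) / 2\<rfloor>"
  using inner_cartan[of \<alpha> \<beta>] by (simp only: int_form_def floor_of_int)

lemma int_form_exact_simple: "\<alpha> \<in> B \<Longrightarrow> \<beta> \<in> B \<Longrightarrow> of_int (int_form \<alpha> \<beta>) = \<alpha> \<bullet> \<beta>"
  using inner_cartan[of \<alpha> \<beta>] int_form_simple by simp

lemma int_form_commute: "int_form \<mu> \<nu> = int_form \<nu> \<mu>"
  by (simp add: int_form_def inner_commute)

lemma q_int_form: "\<alpha> \<in> B \<Longrightarrow> \<beta> \<in> B \<Longrightarrow> q powi int_form \<alpha> \<beta> = q_root q \<alpha> powi cartan \<alpha> \<beta>"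
  by (simp only: int_form_simple q_root_def power_int_mult[symmetric] mult.commute)

lemma cartan_same: "\<alpha> \<in> B \<Longrightarrow> cartan \<alpha> \<alpha> = 2"
  using norm_root_pos[of \<alpha>] B_sub by (auto simp: cartan_def)

lemma q_root_not_root: assumes "\<alpha> \<in> B" "n > 0" shows "q_root q \<alpha> ^ n \<noteq> 1"
proof -
  have "q_root q \<alpha> ^ n = q powi (\<lfloor>(\<alpha> \<bullet> \<alpha>) / 2\<rfloor> * int n)" by (simp add: q_root_def power_int_mult)
  then show ?thesis using assms half_norm[OF assms(1)] by (simp add: q_powi_eq_1_iff)
qed

lemma q_root_nonzero: "q_root q \<alpha> \<noteq> 0"
  using q0 by (simp add: q_root_def)

lemma q_root_diff: assumes "\<alpha> \<in> B" shows "q_root q \<alpha> - inverse (q_root q \<alpha>) \<noteq> 0"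
proof
  assume "q_root q \<alpha> - inverse (q_root q \<alpha>) = 0"
  then have "q_root q \<alpha> ^ 2 = 1" using q_root_nonzero[of \<alpha>]
    by (metis eq_iff_diff_eq_0 power2_eq_square right_inverse)
  then show False using q_root_not_root[OF assms, of 2] by simp
qed

lemma sum_in_span: "(\<Sum>\<beta>\<in>B. f \<beta> *\<^sub>R \<beta>) \<in> span B"
  by (rule real_vector.span_sum, rule real_vector.span_scale, rule real_vector.span_base)

lemma rep_sum: "\<alpha> \<in> B \<Longrightarrow> representation B (\<Sum>\<beta>\<in>B. f \<beta> *\<^sub>R \<beta>) \<alpha> = f \<alpha>"
proof -
  assume \<alpha>: "\<alpha> \<in> B"
  have "representation B (\<Sum>\<beta>\<in>B. f \<beta> *\<^sub>R \<beta>) \<alpha> = (\<Sum>\<beta>\<in>B. representation B (f \<beta> *\<^sub>R \<beta>) \<alpha>)"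
    by (subst real_vector.representation_sum[OF indep]) (auto intro: real_vector.span_scale real_vector.span_base)
  also have "\<dots> = (\<Sum>\<beta>\<in>B. if \<beta> = \<alpha> then f \<beta> else 0)"
    by (rule sum.cong) (auto simp: real_vector.representation_scale[OF indep] real_vector.span_base real_vector.representation_basis[OF indep])
  finally show ?thesis using \<alpha> finB by simp
qed

lemma rep_simple: "\<beta> \<in> B \<Longrightarrow> representation B \<beta> \<alpha> = (if \<alpha> = \<beta> then 1 else 0)"
  using real_vector.representation_basis[OF indep] by auto

lemma root_coeffs:
  assumes "\<gamma> \<in> \<Phi>"
  obtains (pos) c :: "'a \<Rightarrow> nat" where "\<gamma> = (\<Sum>\<alpha>\<in>B. real (c \<alpha>) *\<^sub>R \<alpha>)"
  | (neg) c :: "'a \<Rightarrow> nat" where "\<gamma> = - (\<Sum>\<alpha>\<in>B. real (c \<alpha>) *\<^sub>R \<alpha>)"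
  using sr assms unfolding simple_roots_def by blast

lemma root_rep_sign:
  assumes "\<gamma> \<in> \<Phi>"
  shows "(\<forall>\<alpha>\<in>B. representation B \<gamma> \<alpha> \<ge> 0) \<or> (\<forall>\<alpha>\<in>B. representation B \<gamma> \<alpha> \<le> 0)"
  using assms
proof (cases rule: root_coeffs)
  case (neg c)
  then show ?thesis by (simp add: real_vector.representation_neg[OF indep] rep_sum sum_in_span)
qed (simp add: rep_sum)

lemma root_in_span: "\<gamma> \<in> \<Phi> \<Longrightarrow> \<gamma> \<in> span B"
  by (cases rule: root_coeffs[of \<gamma>]) (auto simp: real_vector.span_neg[OF sum_in_span] sum_in_span)

lemma span_expand: "\<gamma> \<in> span B \<Longrightarrow> \<gamma> = (\<Sum>\<alpha>\<in>B. representation B \<gamma> \<alpha> *\<^sub>R \<alpha>)"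
  using real_vector.sum_representation_eq[OF indep _ finB order_refl] by simp

lemma reflection: "\<gamma> \<in> \<Phi> \<Longrightarrow> \<alpha> \<in> \<Phi> \<Longrightarrow> \<gamma> - (2 * (\<gamma> \<bullet> \<alpha>) / (\<alpha> \<bullet> \<alpha>)) *\<^sub>R \<alpha> \<in> \<Phi>"
  using rs by (simp add: root_system_def)

lemma rep_reflection:
  "\<gamma> \<in> \<Phi> \<Longrightarrow> \<alpha> \<in> B \<Longrightarrow> representation B (\<gamma> - c *\<^sub>R \<alpha>) \<delta> = representation B \<gamma> \<delta> - (if \<delta> = \<alpha> then c else 0)"
  using real_vector.representation_diff[OF indep, of "c *\<^sub>R \<alpha>" \<gamma>] root_in_span
  by (simp add: real_vector.representation_scale[OF indep] real_vector.span_base real_vector.span_scale rep_simple)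

text \<open>Otherwise the reflection of one root in the other would have coefficients of both signs.\<close>

lemma inner_simple_nonpos:
  assumes "\<alpha> \<in> B" "\<beta> \<in> B" "\<alpha> \<noteq> \<beta>" shows "\<alpha> \<bullet> \<beta> \<le> 0"
proof (rule ccontr)
  assume n: "\<not> \<alpha> \<bullet> \<beta> \<le> 0"
  let ?c = "2 * (\<beta> \<bullet> \<alpha>) / (\<alpha> \<bullet> \<alpha>)"
  have c: "?c > 0" using n norm_root_pos[of \<alpha>] assms B_sub by (auto simp: inner_commute)
  have g: "\<beta> - ?c *\<^sub>R \<alpha> \<in> \<Phi>" using assms B_sub by (intro reflection) auto
  have "representation B (\<beta> - ?c *\<^sub>R \<alpha>) \<alpha> = - ?c" "representation B (\<beta> - ?c *\<^sub>R \<alpha>) \<beta> = 1"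
    using assms B_sub by (auto simp: rep_reflection rep_simple)
  then show False using root_rep_sign[OF g] assms c by (metis neg_le_0_iff_le not_le zero_less_one neg_0_le_iff_le)
qed

lemma cartan_nonpos: "\<alpha> \<in> B \<Longrightarrow> \<beta> \<in> B \<Longrightarrow> \<alpha> \<noteq> \<beta> \<Longrightarrow> cartan \<alpha> \<beta> \<le> 0"
  using inner_cartan[of \<alpha> \<beta>] half_norm[of \<alpha>] inner_simple_nonpos[of \<alpha> \<beta>]
  by (metis mult_le_0_iff not_less of_int_le_0_iff order_less_le)

definition pos_roots :: "'a set" where
  "pos_roots = {\<gamma> \<in> \<Phi>. \<forall>\<alpha>\<in>B. representation B \<gamma> \<alpha> \<ge> 0}"

text \<open>A positive root other than \<open>\<beta>\<close> involves a second simple root, since the root system is reduced, and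
  the reflection does not change the coefficient of that root.\<close>

lemma reflection_pos_roots:
  assumes "\<gamma> \<in> pos_roots - {\<beta>}" "\<beta> \<in> B"
  shows "\<gamma> - (2 * (\<gamma> \<bullet> \<beta>) / (\<beta> \<bullet> \<beta>)) *\<^sub>R \<beta> \<in> pos_roots - {\<beta>}"
proof -
  let ?g = "\<gamma> - (2 * (\<gamma> \<bullet> \<beta>) / (\<beta> \<bullet> \<beta>)) *\<^sub>R \<beta>"
  have \<gamma>: "\<gamma> \<in> \<Phi>" "\<And>\<alpha>. \<alpha> \<in> B \<Longrightarrow> representation B \<gamma> \<alpha> \<ge> 0" "\<gamma> \<noteq> \<beta>"
    using assms by (auto simp: pos_roots_def)
  obtain \<delta> where \<delta>: "\<delta> \<in> B" "\<delta> \<noteq> \<beta>" "representation B \<gamma> \<delta> > 0"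
  proof (rule ccontr)
    assume n: "\<not> thesis"
    have "representation B \<gamma> \<delta> *\<^sub>R \<delta> = 0" if "\<delta> \<in> B - {\<beta>}" for \<delta>
      using n that \<gamma>(2)[of \<delta>] \<open>\<And>\<delta>. _ \<Longrightarrow> _ \<Longrightarrow> _ \<Longrightarrow> thesis\<close> by force
    then have "(\<Sum>\<alpha>\<in>B - {\<beta>}. representation B \<gamma> \<alpha> *\<^sub>R \<alpha>) = 0" by (intro sum.neutral) blast
    then have "\<gamma> = representation B \<gamma> \<beta> *\<^sub>R \<beta>"
      using span_expand[OF root_in_span[OF \<gamma>(1)]] assms(2) finB sum.remove[of B \<beta> "\<lambda>\<alpha>. representation B \<gamma> \<alpha> *\<^sub>R \<alpha>"] by simp
    moreover from this have "representation B \<gamma> \<beta> = 1 \<or> representation B \<gamma> \<beta> = -1"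
    proof -
      have "\<beta> \<in> \<Phi>" using assms(2) B_sub by auto
      moreover have "representation B \<gamma> \<beta> *\<^sub>R \<beta> \<in> \<Phi>" using \<gamma>(1) \<open>\<gamma> = _\<close> by simp
      ultimately show ?thesis using rs by (simp add: root_system_def)
    qed
    ultimately show False using \<gamma>(2)[OF assms(2)] \<gamma>(3) by auto
  qed
  have g: "?g \<in> \<Phi>" using \<gamma>(1) assms(2) B_sub by (intro reflection) auto
  have r: "representation B ?g \<delta> = representation B \<gamma> \<delta>" using rep_reflection[OF \<gamma>(1) assms(2)] \<delta> by simp
  then have "?g \<in> pos_roots" using root_rep_sign[OF g] g \<delta> by (force simp: pos_roots_def)
  moreover have "?g \<noteq> \<beta>" using r \<delta> rep_simple[OF assms(2), of \<delta>] by auto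
  ultimately show ?thesis by simp
qed

text \<open>The simple reflection of \<open>\<beta>\<close> permutes the positive roots other than \<open>\<beta>\<close> and reverses the
  sign of their inner products with \<open>\<beta>\<close>, so these cancel in the sum.\<close>

lemma sum_pos_roots_inner:
  assumes "\<beta> \<in> B" shows "(\<Sum>\<gamma>\<in>pos_roots. \<gamma>) \<bullet> \<beta> = \<beta> \<bullet> \<beta>"
proof -
  define s where "s \<gamma> = \<gamma> - (2 * (\<gamma> \<bullet> \<beta>) / (\<beta> \<bullet> \<beta>)) *\<^sub>R \<beta>" for \<gamma>
  have fin: "finite pos_roots" using finPhi by (simp add: pos_roots_def)
  have n: "\<beta> \<bullet> \<beta> \<noteq> 0" using norm_root_pos[of \<beta>] assms B_sub by auto
  have inn: "s \<gamma> \<bullet> \<beta> = - (\<gamma> \<bullet> \<beta>)" for \<gamma> using n by (simp add: s_def inner_diff_left)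
  have inv: "s (s \<gamma>) = \<gamma>" for \<gamma>
    using inn[of \<gamma>] by (simp add: s_def[of "s \<gamma>"]) (simp add: s_def)
  have pos: "s \<gamma> \<in> pos_roots - {\<beta>}" if "\<gamma> \<in> pos_roots - {\<beta>}" for \<gamma>
    unfolding s_def by (rule reflection_pos_roots[OF that assms])
  have "(\<Sum>\<gamma>\<in>pos_roots - {\<beta>}. \<gamma> \<bullet> \<beta>) = (\<Sum>\<gamma>\<in>pos_roots - {\<beta>}. s \<gamma> \<bullet> \<beta>)"
    by (rule sum.reindex_bij_witness[of _ s s]) (use inv pos in auto)
  then have "(\<Sum>\<gamma>\<in>pos_roots - {\<beta>}. \<gamma> \<bullet> \<beta>) = 0" by (simp add: inn sum_negf)
  moreover have "\<beta> \<in> pos_roots" using assms B_sub by (auto simp: pos_roots_def rep_simple)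
  ultimately have "(\<Sum>\<gamma>\<in>pos_roots. \<gamma> \<bullet> \<beta>) = \<beta> \<bullet> \<beta>" using fin by (simp add: sum.remove[of _ \<beta>])
  then show ?thesis by (simp add: inner_sum_left)
qed

lemma root_lattice_iff:
  "\<mu> \<in> root_lattice B \<longleftrightarrow> \<mu> \<in> span B \<and> (\<forall>\<alpha>\<in>B. representation B \<mu> \<alpha> \<in> \<int>)"
proof
  assume "\<mu> \<in> root_lattice B"
  then show "\<mu> \<in> span B \<and> (\<forall>\<alpha>\<in>B. representation B \<mu> \<alpha> \<in> \<int>)"
    by (auto simp: root_lattice_def rep_sum sum_in_span)
next
  assume *: "\<mu> \<in> span B \<and> (\<forall>\<alpha>\<in>B. representation B \<mu> \<alpha> \<in> \<int>)"
  then have "\<mu> = (\<Sum>\<alpha>\<in>B. of_int \<lfloor>representation B \<mu> \<alpha>\<rfloor> *\<^sub>R \<alpha>)"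
    by (subst span_expand) (auto intro!: sum.cong)
  then show "\<mu> \<in> root_lattice B" by (auto simp: root_lattice_def)
qed

lemma root_lattice_add: "\<mu> \<in> root_lattice B \<Longrightarrow> \<nu> \<in> root_lattice B \<Longrightarrow> \<mu> + \<nu> \<in> root_lattice B"
  by (auto simp: root_lattice_iff real_vector.span_add real_vector.representation_add[OF indep])

lemma root_lattice_diff: "\<mu> \<in> root_lattice B \<Longrightarrow> \<nu> \<in> root_lattice B \<Longrightarrow> \<mu> - \<nu> \<in> root_lattice B"
  by (auto simp: root_lattice_iff real_vector.span_diff real_vector.representation_diff[OF indep])

lemma root_lattice_zero: "0 \<in> root_lattice B"
  by (auto simp: root_lattice_iff real_vector.span_zero real_vector.representation_zero)

lemma root_lattice_uminus: "\<mu> \<in> root_lattice B \<Longrightarrow> - \<mu> \<in> root_lattice B"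
  using root_lattice_diff[OF root_lattice_zero] by simp

lemma root_lattice_sum: "(\<And>i. i \<in> I \<Longrightarrow> f i \<in> root_lattice B) \<Longrightarrow> sum f I \<in> root_lattice B"
  by (induction I rule: infinite_finite_induct) (auto simp: root_lattice_zero root_lattice_add)

lemma root_lattice_root: "\<gamma> \<in> \<Phi> \<Longrightarrow> \<gamma> \<in> root_lattice B"
  by (cases rule: root_coeffs[of \<gamma>])
     (auto simp: root_lattice_iff rep_sum sum_in_span real_vector.span_neg[OF sum_in_span] real_vector.representation_neg[OF indep])

lemma root_lattice_simple: "\<alpha> \<in> B \<Longrightarrow> \<alpha> \<in> root_lattice B"
  using root_lattice_root B_sub by auto

lemma int_form_exact: assumes "\<mu> \<in> root_lattice B" "\<beta> \<in> B" shows "of_int (int_form \<mu> \<beta>) = \<mu> \<bullet> \<beta>"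
proof -
  obtain c where "\<mu> = (\<Sum>\<alpha>\<in>B. real_of_int (c \<alpha>) *\<^sub>R \<alpha>)" using assms(1) by (auto simp: root_lattice_def)
  then have "\<mu> \<bullet> \<beta> = (\<Sum>\<alpha>\<in>B. real_of_int (c \<alpha>) * of_int (int_form \<alpha> \<beta>))"
    using assms(2) by (simp add: inner_sum_left int_form_exact_simple)
  also have "\<dots> = of_int (\<Sum>\<alpha>\<in>B. c \<alpha> * int_form \<alpha> \<beta>)" by simp
  finally show ?thesis by (simp only: int_form_def floor_of_int)
qed

lemma int_form_add: "\<mu> \<in> root_lattice B \<Longrightarrow> \<nu> \<in> root_lattice B \<Longrightarrow> \<beta> \<in> B \<Longrightarrow> int_form (\<mu> + \<nu>) \<beta> = int_form \<mu> \<beta> + int_form \<nu> \<beta>"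
  using int_form_exact[of "\<mu> + \<nu>" \<beta>] int_form_exact[of \<mu> \<beta>] int_form_exact[of \<nu> \<beta>]
  by (simp add: root_lattice_add inner_add_left flip: of_int_eq_iff[where ?'a = real])

text \<open>The vector \<open>2\<rho> - \<Sum>S\<close> is orthogonal to \<open>S\<close> and has positive products with the other simple
  roots, since simple roots form obtuse angles.\<close>

lemma orth_dominant_exists:
  assumes S: "S \<subseteq> B" and orth: "\<And>\<alpha> \<beta>. \<alpha> \<in> S \<Longrightarrow> \<beta> \<in> S \<Longrightarrow> \<alpha> \<noteq> \<beta> \<Longrightarrow> \<alpha> \<bullet> \<beta> = 0"
  obtains \<mu> where "\<mu> \<in> orth_lattice B S" "\<And>\<beta>. \<beta> \<in> B - S \<Longrightarrow> int_form \<mu> \<beta> > 0"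
proof -
  define \<mu> where "\<mu> = (\<Sum>\<gamma>\<in>pos_roots. \<gamma>) - (\<Sum>\<alpha>\<in>S. \<alpha>)"
  have fS: "finite S" using S finB finite_subset by blast
  have L: "\<mu> \<in> root_lattice B" unfolding \<mu>_def
    using S B_sub by (intro root_lattice_diff root_lattice_sum root_lattice_root) (auto simp: pos_roots_def)
  have in1: "(\<Sum>\<alpha>\<in>S. \<alpha> \<bullet> \<beta>) = \<beta> \<bullet> \<beta>" if "\<beta> \<in> S" for \<beta>
    using fS that orth by (subst sum.remove[OF fS that]) (auto intro!: sum.neutral)
  have "\<mu> \<bullet> \<beta> = 0" if "\<beta> \<in> S" for \<beta>
    using that S sum_pos_roots_inner[of \<beta>] in1[OF that] by (auto simp: \<mu>_def inner_diff_left inner_sum_left)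
  then have "\<mu> \<in> orth_lattice B S" using L by (simp add: orth_lattice_def)
  moreover have "int_form \<mu> \<beta> > 0" if "\<beta> \<in> B - S" for \<beta>
  proof -
    have "(\<Sum>\<alpha>\<in>S. \<alpha> \<bullet> \<beta>) \<le> 0" using that S by (intro sum_nonpos inner_simple_nonpos) auto
    moreover have "\<beta> \<bullet> \<beta> > 0" using that norm_root_pos B_sub by blast
    moreover have "\<mu> \<bullet> \<beta> = \<beta> \<bullet> \<beta> - (\<Sum>\<alpha>\<in>S. \<alpha> \<bullet> \<beta>)"
      unfolding \<mu>_def inner_diff_left using that sum_pos_roots_inner[of \<beta>] by (simp add: inner_sum_left)
    ultimately have "\<mu> \<bullet> \<beta> > 0" by linarith
    then show ?thesis using int_form_exact[OF L, of \<beta>] that by (metis DiffD1 of_int_0_less_iff)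
  qed
  ultimately show ?thesis using that by blast
qed

end

section \<open>Relations in the quantized enveloping algebra\<close>

lemma serre_rel_carrier:
  assumes "X \<alpha> \<in> G" "X \<beta> \<in> G" shows "serre_rel q X \<alpha> \<beta> \<in> carrier (free_alg G)"
proof -
  have sum: "(\<Sum>i\<in>I. f i) \<in> carrier (free_alg G)" if "\<And>i. i \<in> I \<Longrightarrow> f i \<in> carrier (free_alg G)"
    for I :: "nat set" and f :: "nat \<Rightarrow> 'g list \<Rightarrow>\<^sub>0 complex" and G :: "'g set"
    using that by (induction I rule: infinite_finite_induct) (auto simp: free_alg_simps keys_add_subset)
  show ?thesis unfolding serre_rel_def Let_def
    by (rule sum) (use assms in \<open>auto simp: free_alg_simps\<close>)
qed

lemma free_alg_diff: "p \<in> carrier (free_alg G) \<Longrightarrow> r \<in> carrier (free_alg G) \<Longrightarrow> p - r \<in> carrier (free_alg G)"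
  unfolding free_alg_simps pm_scale_simps(7)[of p] mem_Collect_eq
  by (rule keys_add_subset[OF _ subset_trans[OF keys_pm_scale]])

lemma free_alg_single: "set w \<subseteq> G \<Longrightarrow> Poly_Mapping.single w c \<in> carrier (free_alg G)"
  by (auto simp: free_alg_simps)

lemma (in calg) minus_eq_imp: "x \<in> carrier A \<Longrightarrow> y \<in> carrier A \<Longrightarrow> x \<ominus> y = z \<Longrightarrow> x = y \<oplus> z"
  by (auto simp: a_minus_def a_lcomm r_neg)

lemma (in calg) inverse_q_commute:
  assumes "K \<in> carrier A" "K' \<in> carrier A" "X \<in> carrier A" "K \<otimes> K' = \<one>" "K' \<otimes> K = \<one>" "c \<noteq> 0"
    and "K \<otimes> X = c \<odot> (X \<otimes> K)"
  shows "K' \<otimes> X = inverse c \<odot> (X \<otimes> K')"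
proof -
  have "X \<otimes> K' = K' \<otimes> (K \<otimes> X) \<otimes> K'" using assms(1-3,5) by (simp add: m_assoc[symmetric])
  also have "\<dots> = c \<odot> (K' \<otimes> X)" using assms by (simp add: smult_mult_l smult_mult_r m_assoc)
  finally show ?thesis using assms by (simp add: smult_smult)
qed

context root_data
begin

lemma qgens_iff [simp]: "gE \<alpha> \<in> qgens B \<longleftrightarrow> \<alpha> \<in> B" "gF \<alpha> \<in> qgens B \<longleftrightarrow> \<alpha> \<in> B"
  "gK \<alpha> \<in> qgens B \<longleftrightarrow> \<alpha> \<in> B" "gKI \<alpha> \<in> qgens B \<longleftrightarrow> \<alpha> \<in> B"
  by (auto simp: qgens_def)

lemma Uq_rels_carrier: "Uq_rels B q \<subseteq> carrier (free_alg (qgens B))"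
proof -
  have "0 \<in> carrier (free_alg (qgens B))" by (simp add: free_alg_simps)
  then show ?thesis unfolding Uq_rels_def
    by (auto intro!: free_alg_diff free_alg_single serre_rel_carrier)
qed

sublocale presentation "qgens B" "Uq_rels B q"
  by unfold_locales (rule Uq_rels_carrier)

abbreviation "U \<equiv> Uq B q"
abbreviation "u \<equiv> uword B q"

lemma U_eq: "Uq B q = PA" and u_eq: "uword B q = pw"
  by (simp_all add: Uq_def uword_def)

sublocale U: calg U unfolding U_eq by (rule presented_calg)

lemma u_closed [simp]: "set w \<subseteq> qgens B \<Longrightarrow> u w \<in> carrier U"
  unfolding U_eq u_eq by (rule pw_closed)

lemma u_append: "set v \<subseteq> qgens B \<Longrightarrow> set w \<subseteq> qgens B \<Longrightarrow> u (v @ w) = u v \<otimes>\<^bsub>U\<^esub> u w"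
  unfolding U_eq u_eq by (rule pw_append)

lemma u_Nil: "u [] = \<one>\<^bsub>U\<^esub>"
  unfolding U_eq u_eq by (rule pw_Nil)

lemma u_Cons: "g \<in> qgens B \<Longrightarrow> set w \<subseteq> qgens B \<Longrightarrow> u (g # w) = u [g] \<otimes>\<^bsub>U\<^esub> u w"
  unfolding U_eq u_eq by (rule pw_Cons)

text \<open>The image in \<open>U\<close> of an element of the free algebra, written as a combination of words.\<close>

definition lin_u where "lin_u x = P.lin pw x"

lemma lin_u_single: "set w \<subseteq> qgens B \<Longrightarrow> lin_u (Poly_Mapping.single w c) = c \<odot>\<^bsub>U\<^esub> u w"
  unfolding lin_u_def U_eq u_eq by (rule P.lin_single) simp

lemma lin_u_hom: "lin_u \<in> lin_hom (free_alg (qgens B)) U"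
proof -
  have pw: "pw \<in> lists (qgens B) \<rightarrow> carrier PA" by (auto intro!: pw_closed)
  show ?thesis unfolding lin_u_def U_eq
    using P.lin_closed[OF _ pw] P.lin_add[OF _ _ pw] P.lin_scale[OF _ pw] by (auto simp: lin_hom_def free_alg_simps)
qed

lemma lin_u_diff: assumes "p \<in> carrier (free_alg (qgens B))" "r \<in> carrier (free_alg (qgens B))"
  shows "lin_u (p - r) = lin_u p \<ominus>\<^bsub>U\<^esub> lin_u r"
proof -
  interpret F: calg "free_alg (qgens B)" by (rule free_alg_calg)
  have "p - r = p \<ominus>\<^bsub>free_alg (qgens B)\<^esub> r"
    unfolding F.minus_smult[OF assms] by (simp only: free_alg_simps pm_scale_simps(7)[of p])
  then show ?thesis using lin_hom_minus[OF F.calg_axioms U.calg_axioms lin_u_hom assms] by simp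
qed

lemma rel: "r \<in> Uq_rels B q \<Longrightarrow> lin_u r = \<zero>\<^bsub>U\<^esub>"
  unfolding lin_u_def U_eq by (rule rel_zero)

lemma rel_diff:
  assumes "p - r \<in> Uq_rels B q" "p \<in> carrier (free_alg (qgens B))" "r \<in> carrier (free_alg (qgens B))"
  shows "lin_u p = lin_u r"
  using rel[OF assms(1)] lin_u_diff[OF assms(2,3)] lin_homD(1)[OF lin_u_hom] assms(2,3) by (metis U.minus_eq_zeroD)

abbreviation "eE \<alpha> \<equiv> u [gE \<alpha>]"
abbreviation "eF \<alpha> \<equiv> u [gF \<alpha>]"
abbreviation "eK \<alpha> \<equiv> u [gK \<alpha>]"
abbreviation "eKI \<alpha> \<equiv> u [gKI \<alpha>]"

lemma u2: "g \<in> qgens B \<Longrightarrow> k \<in> qgens B \<Longrightarrow> u [g, k] = u [g] \<otimes>\<^bsub>U\<^esub> u [k]"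
  by (rule u_Cons) auto

lemmas lin_u_simps = lin_u_single free_alg_single u2 u_Nil

lemma K_KI: "\<alpha> \<in> B \<Longrightarrow> eK \<alpha> \<otimes>\<^bsub>U\<^esub> eKI \<alpha> = \<one>\<^bsub>U\<^esub>"
proof -
  assume *: "\<alpha> \<in> B"
  then have "wd [gK \<alpha>, gKI \<alpha>] - wd [] \<in> Uq_rels B q" unfolding Uq_rels_def by blast
  from rel_diff[OF this] * show ?thesis by (simp add: lin_u_simps)
qed

lemma KI_K: "\<alpha> \<in> B \<Longrightarrow> eKI \<alpha> \<otimes>\<^bsub>U\<^esub> eK \<alpha> = \<one>\<^bsub>U\<^esub>"
proof -
  assume *: "\<alpha> \<in> B"
  then have "wd [gKI \<alpha>, gK \<alpha>] - wd [] \<in> Uq_rels B q" unfolding Uq_rels_def by blast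
  from rel_diff[OF this] * show ?thesis by (simp add: lin_u_simps)
qed

lemma K_K: "\<alpha> \<in> B \<Longrightarrow> \<beta> \<in> B \<Longrightarrow> eK \<alpha> \<otimes>\<^bsub>U\<^esub> eK \<beta> = eK \<beta> \<otimes>\<^bsub>U\<^esub> eK \<alpha>"
proof -
  assume *: "\<alpha> \<in> B" "\<beta> \<in> B"
  then have "wd [gK \<alpha>, gK \<beta>] - wd [gK \<beta>, gK \<alpha>] \<in> Uq_rels B q" unfolding Uq_rels_def by blast
  from rel_diff[OF this] * show ?thesis by (simp add: lin_u_simps)
qed

lemma K_E: "\<alpha> \<in> B \<Longrightarrow> \<beta> \<in> B \<Longrightarrow> eK \<alpha> \<otimes>\<^bsub>U\<^esub> eE \<beta> = q powi int_form \<alpha> \<beta> \<odot>\<^bsub>U\<^esub> (eE \<beta> \<otimes>\<^bsub>U\<^esub> eK \<alpha>)"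
proof -
  assume *: "\<alpha> \<in> B" "\<beta> \<in> B"
  then have "wd [gK \<alpha>, gE \<beta>] - Poly_Mapping.single [gE \<beta>, gK \<alpha>] (q powi int_form \<alpha> \<beta>) \<in> Uq_rels B q"
    unfolding Uq_rels_def by blast
  from rel_diff[OF this] * show ?thesis by (simp add: lin_u_simps)
qed

lemma K_F: "\<alpha> \<in> B \<Longrightarrow> \<beta> \<in> B \<Longrightarrow> eK \<alpha> \<otimes>\<^bsub>U\<^esub> eF \<beta> = q powi (- int_form \<alpha> \<beta>) \<odot>\<^bsub>U\<^esub> (eF \<beta> \<otimes>\<^bsub>U\<^esub> eK \<alpha>)"
proof -
  assume *: "\<alpha> \<in> B" "\<beta> \<in> B"
  then have "wd [gK \<alpha>, gF \<beta>] - Poly_Mapping.single [gF \<beta>, gK \<alpha>] (q powi (- int_form \<alpha> \<beta>)) \<in> Uq_rels B q"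
    unfolding Uq_rels_def by blast
  from rel_diff[OF this] * show ?thesis by (simp add: lin_u_simps)
qed

lemma KI_E: "\<alpha> \<in> B \<Longrightarrow> \<beta> \<in> B \<Longrightarrow> eKI \<alpha> \<otimes>\<^bsub>U\<^esub> eE \<beta> = q powi (- int_form \<alpha> \<beta>) \<odot>\<^bsub>U\<^esub> (eE \<beta> \<otimes>\<^bsub>U\<^esub> eKI \<alpha>)"
  using U.inverse_q_commute[OF _ _ _ K_KI KI_K _ K_E, of \<alpha> \<beta>] q0 by (simp add: power_int_minus)

lemma KI_F: "\<alpha> \<in> B \<Longrightarrow> \<beta> \<in> B \<Longrightarrow> eKI \<alpha> \<otimes>\<^bsub>U\<^esub> eF \<beta> = q powi (int_form \<alpha> \<beta>) \<odot>\<^bsub>U\<^esub> (eF \<beta> \<otimes>\<^bsub>U\<^esub> eKI \<alpha>)"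
  using U.inverse_q_commute[OF _ _ _ K_KI KI_K _ K_F, of \<alpha> \<beta>] q0 by (simp add: power_int_minus)

lemma KI_K': "\<alpha> \<in> B \<Longrightarrow> \<beta> \<in> B \<Longrightarrow> eKI \<alpha> \<otimes>\<^bsub>U\<^esub> eK \<beta> = eK \<beta> \<otimes>\<^bsub>U\<^esub> eKI \<alpha>"
  using U.inverse_q_commute[OF _ _ _ K_KI KI_K, of \<alpha> "eK \<beta>" 1] K_K[of \<alpha> \<beta>] by simp

lemma KI_KI: "\<alpha> \<in> B \<Longrightarrow> \<beta> \<in> B \<Longrightarrow> eKI \<alpha> \<otimes>\<^bsub>U\<^esub> eKI \<beta> = eKI \<beta> \<otimes>\<^bsub>U\<^esub> eKI \<alpha>"
  using U.inverse_q_commute[OF _ _ _ K_KI KI_K, of \<alpha> "eKI \<beta>" 1] KI_K'[of \<beta> \<alpha>] by simp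

lemma E_F_same: "\<alpha> \<in> B \<Longrightarrow> eE \<alpha> \<otimes>\<^bsub>U\<^esub> eF \<alpha> = eF \<alpha> \<otimes>\<^bsub>U\<^esub> eE \<alpha> \<oplus>\<^bsub>U\<^esub>
    (1 / (q_root q \<alpha> - inverse (q_root q \<alpha>))) \<odot>\<^bsub>U\<^esub> (eK \<alpha> \<ominus>\<^bsub>U\<^esub> eKI \<alpha>)"
proof -
  assume *: "\<alpha> \<in> B"
  let ?d = "1 / (q_root q \<alpha> - inverse (q_root q \<alpha>))"
  have "wd [gE \<alpha>, gF \<alpha>] - wd [gF \<alpha>, gE \<alpha>] - (if \<alpha> = \<alpha> then
      Poly_Mapping.single [gK \<alpha>] ?d - Poly_Mapping.single [gKI \<alpha>] ?d else 0) \<in> Uq_rels B q"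
    unfolding Uq_rels_def using * by blast
  from rel_diff[OF this] * have "eE \<alpha> \<otimes>\<^bsub>U\<^esub> eF \<alpha> \<ominus>\<^bsub>U\<^esub> eF \<alpha> \<otimes>\<^bsub>U\<^esub> eE \<alpha> = ?d \<odot>\<^bsub>U\<^esub> (eK \<alpha> \<ominus>\<^bsub>U\<^esub> eKI \<alpha>)"
    by (simp add: lin_u_simps lin_u_diff free_alg_diff) (simp add: U.minus_smult U.smult_r_distr U.smult_smult)
  then show ?thesis using * by (intro U.minus_eq_imp) auto
qed

lemma E_F_diff: "\<alpha> \<in> B \<Longrightarrow> \<beta> \<in> B \<Longrightarrow> \<alpha> \<noteq> \<beta> \<Longrightarrow> eE \<alpha> \<otimes>\<^bsub>U\<^esub> eF \<beta> = eF \<beta> \<otimes>\<^bsub>U\<^esub> eE \<alpha>"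
proof -
  assume *: "\<alpha> \<in> B" "\<beta> \<in> B" "\<alpha> \<noteq> \<beta>"
  let ?d = "1 / (q_root q \<alpha> - inverse (q_root q \<alpha>))"
  have "wd [gE \<alpha>, gF \<beta>] - wd [gF \<beta>, gE \<alpha>] - (if \<alpha> = \<beta> then
      Poly_Mapping.single [gK \<alpha>] ?d - Poly_Mapping.single [gKI \<alpha>] ?d else 0) \<in> Uq_rels B q"
    unfolding Uq_rels_def using * by blast
  then have "wd [gE \<alpha>, gF \<beta>] - wd [gF \<beta>, gE \<alpha>] \<in> Uq_rels B q" using * by simp
  from rel_diff[OF this] * show ?thesis by (simp add: lin_u_simps)
qed

text \<open>The Cartan number of orthogonal roots is \<open>0\<close>, so their quantum Serre relation has only two terms.\<close>

lemma orthogonal_commute: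
  assumes "\<alpha> \<in> B" "\<beta> \<in> B" "\<alpha> \<noteq> \<beta>" "\<alpha> \<bullet> \<beta> = 0"
  shows "eE \<alpha> \<otimes>\<^bsub>U\<^esub> eE \<beta> = eE \<beta> \<otimes>\<^bsub>U\<^esub> eE \<alpha>" "eF \<alpha> \<otimes>\<^bsub>U\<^esub> eF \<beta> = eF \<beta> \<otimes>\<^bsub>U\<^esub> eF \<alpha>"
proof -
  let ?v = "q_root q \<alpha>"
  have c: "cartan \<alpha> \<beta> = 0" using assms by (simp add: cartan_def)
  have "qnum ?v (Suc 0) = 1" using q_root_diff[OF assms(1)] by (simp add: qnum_def)
  then have s: "serre_rel q X \<alpha> \<beta> = wd [X \<alpha>, X \<beta>] - wd [X \<beta>, X \<alpha>]" for X
    by (simp add: serre_rel_def c Let_def qbinom_def qfact_def single_uminus)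
  have "serre_rel q gE \<alpha> \<beta> \<in> Uq_rels B q" "serre_rel q gF \<alpha> \<beta> \<in> Uq_rels B q"
    unfolding Uq_rels_def using assms by blast+
  then show "eE \<alpha> \<otimes>\<^bsub>U\<^esub> eE \<beta> = eE \<beta> \<otimes>\<^bsub>U\<^esub> eE \<alpha>" "eF \<alpha> \<otimes>\<^bsub>U\<^esub> eF \<beta> = eF \<beta> \<otimes>\<^bsub>U\<^esub> eF \<alpha>"
    unfolding s using rel_diff assms by (auto simp: lin_u_simps dest!: rel_diff)
qed

subsection \<open>The torus\<close>

definition Kgens where "Kgens = gK ` B \<union> gKI ` B"

definition torus_wt :: "'a qgen list \<Rightarrow> 'a" where
  "torus_wt w = sum_list (map (\<lambda>g. case g of gK \<alpha> \<Rightarrow> \<alpha> | gKI \<alpha> \<Rightarrow> - \<alpha> | _ \<Rightarrow> 0) w)"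

lemma torus_wt_simps [simp]: "torus_wt [] = 0" "torus_wt (gK \<alpha> # w) = \<alpha> + torus_wt w" "torus_wt (gKI \<alpha> # w) = - \<alpha> + torus_wt w"
  "torus_wt (v @ w) = torus_wt v + torus_wt w"
  by (simp_all add: torus_wt_def)

lemma Kgens_qgens: "Kgens \<subseteq> qgens B"
  by (auto simp: Kgens_def qgens_def)

lemma torus_wt_lattice: "set w \<subseteq> Kgens \<Longrightarrow> torus_wt w \<in> root_lattice B"
proof (induction w)
  case (Cons g w)
  then obtain \<alpha> where \<alpha>: "\<alpha> \<in> B" "g = gK \<alpha> \<or> g = gKI \<alpha>" by (auto simp: Kgens_def)
  then have "torus_wt (g # w) = \<alpha> + torus_wt w \<or> torus_wt (g # w) = - \<alpha> + torus_wt w" by auto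
  then show ?case using Cons root_lattice_add[OF root_lattice_simple[OF \<alpha>(1)]]
     root_lattice_add[OF root_lattice_uminus[OF root_lattice_simple[OF \<alpha>(1)]]] by auto
qed (simp add: root_lattice_zero)

text \<open>The word that defines \<open>K_elt\<close>, for an arbitrary list of simple roots and arbitrary exponents: this
  makes induction on the list possible.\<close>

definition canon_word :: "'a list \<Rightarrow> ('a \<Rightarrow> int) \<Rightarrow> 'a qgen list" where
  "canon_word xs f = concat (map (\<lambda>\<alpha>. K_power_word \<alpha> (f \<alpha>)) xs)"

definition B_list :: "'a list" where "B_list = (SOME xs. set xs = B \<and> distinct xs)"

lemma B_list: "set B_list = B" "distinct B_list"
  using someI_ex[OF finite_distinct_list[OF finB]] by (auto simp: B_list_def)

definition coord :: "'a \<Rightarrow> 'a \<Rightarrow> int" where "coord \<mu> \<alpha> = \<lfloor>representation B \<mu> \<alpha>\<rfloor>"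

lemma K_elt_canon: "K_elt B q \<mu> = u (canon_word B_list (coord \<mu>))"
  by (simp add: K_elt_def canon_word_def B_list_def coord_def[abs_def])

lemma set_K_power_word: "\<alpha> \<in> B \<Longrightarrow> set (K_power_word \<alpha> n) \<subseteq> Kgens"
  by (auto simp: K_power_word_def Kgens_def)

lemma set_canon_word: "set xs \<subseteq> B \<Longrightarrow> set (canon_word xs f) \<subseteq> Kgens"
  using set_K_power_word by (fastforce simp: canon_word_def)

lemma K_power_word_step:
  assumes "\<alpha> \<in> B"
  shows "eK \<alpha> \<otimes>\<^bsub>U\<^esub> u (K_power_word \<alpha> n) = u (K_power_word \<alpha> (n + 1))"
    "eKI \<alpha> \<otimes>\<^bsub>U\<^esub> u (K_power_word \<alpha> n) = u (K_power_word \<alpha> (n - 1))"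
proof -
  have set: "set (replicate k (gK \<alpha>)) \<subseteq> qgens B" "set (replicate k (gKI \<alpha>)) \<subseteq> qgens B" for k
    using assms by auto
  have canc: "eK \<alpha> \<otimes>\<^bsub>U\<^esub> (eKI \<alpha> \<otimes>\<^bsub>U\<^esub> x) = x" "eKI \<alpha> \<otimes>\<^bsub>U\<^esub> (eK \<alpha> \<otimes>\<^bsub>U\<^esub> x) = x" if "x \<in> carrier U" for x
    using that assms by (simp_all add: U.m_assoc[symmetric] K_KI KI_K)
  define R where "R k = u (replicate k (gK \<alpha>))" for k
  define R' where "R' k = u (replicate k (gKI \<alpha>))" for k
  have cl: "R k \<in> carrier U" "R' k \<in> carrier U" for k
    unfolding R_def R'_def by (rule u_closed[OF set(1)], rule u_closed[OF set(2)])
  have Suc: "R (Suc k) = eK \<alpha> \<otimes>\<^bsub>U\<^esub> R k" "R' (Suc k) = eKI \<alpha> \<otimes>\<^bsub>U\<^esub> R' k" for k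
    unfolding R_def R'_def replicate_Suc by (rule u_Cons[OF _ set(1)], simp add: assms, rule u_Cons[OF _ set(2)], simp add: assms)
  have zero: "R 0 = R' 0" by (simp add: R_def R'_def)
  have p: "u (K_power_word \<alpha> n) = (if n \<ge> 0 then R (nat n) else R' (nat (- n)))" for n
    by (simp add: K_power_word_def R_def R'_def)
  show "eK \<alpha> \<otimes>\<^bsub>U\<^esub> u (K_power_word \<alpha> n) = u (K_power_word \<alpha> (n + 1))"
  proof (cases "n \<ge> 0")
    case True
    then have "nat (n + 1) = Suc (nat n)" by simp
    then show ?thesis using True by (simp add: p Suc)
  next
    case False
    then have *: "nat (- n) = Suc (nat (- (n + 1)))" by simp
    have "eK \<alpha> \<otimes>\<^bsub>U\<^esub> u (K_power_word \<alpha> n) = R' (nat (- (n + 1)))"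
      using False by (simp only: p * Suc canc cl if_False)
    then show ?thesis using False zero by (cases "n + 1 = 0") (simp_all add: p)
  qed
  show "eKI \<alpha> \<otimes>\<^bsub>U\<^esub> u (K_power_word \<alpha> n) = u (K_power_word \<alpha> (n - 1))"
  proof (cases "n > 0")
    case True
    then have *: "nat n = Suc (nat (n - 1))" "n \<ge> 0" by simp_all
    have "eKI \<alpha> \<otimes>\<^bsub>U\<^esub> u (K_power_word \<alpha> n) = R (nat (n - 1))"
      by (simp only: p * Suc canc cl if_True)
    then show ?thesis using True by (simp add: p)
  next
    case False
    then have "nat (1 - n) = Suc (nat (- n))" by simp
    then show ?thesis using False zero
      by (cases "n = 0") (simp_all add: p Suc zero)
  qed
qed

lemma torus_commute:
  assumes "set v \<subseteq> Kgens" "set w \<subseteq> Kgens" shows "u v \<otimes>\<^bsub>U\<^esub> u w = u w \<otimes>\<^bsub>U\<^esub> u v"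
proof -
  have g: "u [g] \<otimes>\<^bsub>U\<^esub> u [k] = u [k] \<otimes>\<^bsub>U\<^esub> u [g]" if "g \<in> Kgens" "k \<in> Kgens" for g k
    using that unfolding Kgens_def by (elim UnE imageE) (simp_all add: K_K KI_KI KI_K')
  have mem: "u w \<in> alg_gen U ((\<lambda>g. u [g]) ` Kgens)" if "set w \<subseteq> Kgens" for w
  proof -
    have S: "subalg (alg_gen U ((\<lambda>g. u [g]) ` Kgens)) U"
      using Kgens_qgens by (intro U.alg_gen_subalg) auto
    show ?thesis using that
    proof (induction w)
      case Nil
      then show ?case using S by (simp add: u_Nil subalg_def)
    next
      case (Cons g w)
      then have "u (g # w) = u [g] \<otimes>\<^bsub>U\<^esub> u w" using Kgens_qgens by (intro u_Cons) auto
      moreover have "u [g] \<in> alg_gen U ((\<lambda>g. u [g]) ` Kgens)" using Cons by (intro subsetD[OF U.alg_gen_incl]) auto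
      ultimately show ?case using Cons S by (simp add: subalg_def)
    qed
  qed
  show ?thesis
  proof (rule U.alg_gen_commute[OF _ _ _ mem[OF assms(1)] mem[OF assms(2)]])
    show "(\<lambda>g. u [g]) ` Kgens \<subseteq> carrier U" "(\<lambda>g. u [g]) ` Kgens \<subseteq> carrier U" using Kgens_qgens by auto
  qed (elim imageE, simp add: g)
qed

lemma canon_word_step:
  assumes "\<alpha> \<in> set xs" "set xs \<subseteq> B" "distinct xs" "g = gK \<alpha> \<and> d = 1 \<or> g = gKI \<alpha> \<and> d = -1"
  shows "u [g] \<otimes>\<^bsub>U\<^esub> u (canon_word xs f) = u (canon_word xs (f(\<alpha> := f \<alpha> + d)))"
  using assms(1-3)
proof (induction xs)
  case (Cons \<beta> xs)
  have \<beta>: "\<beta> \<in> B" and xs: "set xs \<subseteq> B" and \<alpha>: "\<alpha> \<in> B" using Cons.prems by auto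
  have g: "g \<in> Kgens" using assms(4) \<alpha> by (auto simp: Kgens_def)
  note s = subset_trans[OF set_canon_word[OF xs] Kgens_qgens] subset_trans[OF set_K_power_word[OF \<beta>] Kgens_qgens]
  have c: "u (canon_word (\<beta> # xs) f) = u (K_power_word \<beta> (f \<beta>)) \<otimes>\<^bsub>U\<^esub> u (canon_word xs f)" for f
    using u_append[OF s(2) s(1)] by (simp add: canon_word_def)
  have cl: "u [g] \<in> carrier U" "u (K_power_word \<beta> n) \<in> carrier U" "u (canon_word xs f) \<in> carrier U" for n f
    using g Kgens_qgens s by auto
  show ?case
  proof (cases "\<alpha> = \<beta>")
    case True
    then have "\<alpha> \<notin> set xs" using Cons.prems by simp
    then have "canon_word xs (f(\<alpha> := f \<alpha> + d)) = canon_word xs f"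
      by (auto simp: canon_word_def intro!: arg_cong[of _ _ concat])
    moreover have "u [g] \<otimes>\<^bsub>U\<^esub> u (K_power_word \<beta> (f \<beta>)) = u (K_power_word \<beta> (f \<beta> + d))"
      using assms(4) True K_power_word_step[OF \<alpha>, of "f \<alpha>"] by (elim disjE) simp_all
    ultimately show ?thesis unfolding c using cl True by (simp add: U.m_assoc[symmetric])
  next
    case False
    have IH: "u [g] \<otimes>\<^bsub>U\<^esub> u (canon_word xs f) = u (canon_word xs (f(\<alpha> := f \<alpha> + d)))"
      by (rule Cons.IH) (use Cons.prems False in auto)
    have "u [g] \<otimes>\<^bsub>U\<^esub> u (K_power_word \<beta> (f \<beta>)) = u (K_power_word \<beta> (f \<beta>)) \<otimes>\<^bsub>U\<^esub> u [g]"
      using g set_K_power_word[OF \<beta>] by (intro torus_commute) auto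
    then have "u [g] \<otimes>\<^bsub>U\<^esub> (u (K_power_word \<beta> (f \<beta>)) \<otimes>\<^bsub>U\<^esub> u (canon_word xs f)) =
       u (K_power_word \<beta> (f \<beta>)) \<otimes>\<^bsub>U\<^esub> (u [g] \<otimes>\<^bsub>U\<^esub> u (canon_word xs f))"
      using cl by (simp add: U.m_assoc[symmetric])
    then show ?thesis unfolding c IH using False by (simp add: fun_upd_def)
  qed
qed simp

lemma coord_add_simple:
  assumes "\<mu> \<in> root_lattice B" "\<alpha> \<in> B"
  shows "coord (\<mu> + \<alpha>) = (coord \<mu>)(\<alpha> := coord \<mu> \<alpha> + 1)" "coord (\<mu> - \<alpha>) = (coord \<mu>)(\<alpha> := coord \<mu> \<alpha> + (-1))"
  using assms real_vector.representation_add[OF indep, of \<alpha> \<mu>] real_vector.representation_diff[OF indep, of \<alpha> \<mu>]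
  by (auto simp: coord_def fun_eq_iff root_lattice_iff real_vector.span_base rep_simple)

text \<open>The torus generators commute, so appending a letter merely changes one exponent of the canonical word.\<close>

lemma torus_word: "set w \<subseteq> Kgens \<Longrightarrow> u w = K_elt B q (torus_wt w)"
proof (induction w)
  case Nil
  have "canon_word xs (coord 0) = []" for xs
    by (induction xs) (auto simp: canon_word_def coord_def real_vector.representation_zero K_power_word_def)
  then show ?case by (simp add: K_elt_canon)
next
  case (Cons g w)
  then obtain \<alpha> where \<alpha>: "\<alpha> \<in> B" "g = gK \<alpha> \<or> g = gKI \<alpha>" by (auto simp: Kgens_def)
  have w: "torus_wt w \<in> root_lattice B" "set w \<subseteq> qgens B" using Cons torus_wt_lattice Kgens_qgens by auto
  have "u (g # w) = u [g] \<otimes>\<^bsub>U\<^esub> K_elt B q (torus_wt w)" using Cons \<alpha> w by (subst u_Cons) auto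
  then show ?case
    using \<alpha>(2) canon_word_step[of \<alpha> B_list g _ "coord (torus_wt w)"] coord_add_simple[OF w(1) \<alpha>(1)] \<alpha>(1) B_list
    by (elim disjE) (simp_all add: K_elt_canon add.commute)
qed

lemma torus_wt_canon: assumes "\<mu> \<in> root_lattice B" shows "torus_wt (canon_word B_list (coord \<mu>)) = \<mu>"
proof -
  have p: "torus_wt (K_power_word \<alpha> n) = of_int n *\<^sub>R \<alpha>" for \<alpha> n
  proof -
    have "torus_wt (replicate k (gK \<alpha>)) = of_nat k *\<^sub>R \<alpha>" "torus_wt (replicate k (gKI \<alpha>)) = - (of_nat k *\<^sub>R \<alpha>)" for k
      by (induction k) (auto simp: algebra_simps)
    then show ?thesis by (simp add: K_power_word_def)
  qed
  have "torus_wt (canon_word xs f) = (\<Sum>\<alpha>\<leftarrow>xs. of_int (f \<alpha>) *\<^sub>R \<alpha>)" for xs f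
    by (induction xs) (simp_all add: canon_word_def p)
  then have "torus_wt (canon_word B_list (coord \<mu>)) = (\<Sum>\<alpha>\<in>B. of_int (coord \<mu> \<alpha>) *\<^sub>R \<alpha>)"
    using B_list by (simp add: sum_list_distinct_conv_sum_set)
  also have "\<dots> = (\<Sum>\<alpha>\<in>B. representation B \<mu> \<alpha> *\<^sub>R \<alpha>)"
    using assms by (intro sum.cong) (auto simp: coord_def root_lattice_iff)
  finally show ?thesis using span_expand[of \<mu>] assms by (simp add: root_lattice_iff)
qed

lemma K_elt_word:
  assumes "\<mu> \<in> root_lattice B"
  obtains w where "set w \<subseteq> Kgens" "torus_wt w = \<mu>" "K_elt B q \<mu> = u w"
  using assms torus_wt_canon set_canon_word[of B_list] B_list K_elt_canon by blast

lemma K_elt_closed: "\<mu> \<in> root_lattice B \<Longrightarrow> K_elt B q \<mu> \<in> carrier U"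
  by (metis K_elt_word u_closed subset_trans Kgens_qgens)

lemma K_elt_add: assumes "\<mu> \<in> root_lattice B" "\<nu> \<in> root_lattice B"
  shows "K_elt B q \<mu> \<otimes>\<^bsub>U\<^esub> K_elt B q \<nu> = K_elt B q (\<mu> + \<nu>)"
proof -
  obtain v where v: "set v \<subseteq> Kgens" "torus_wt v = \<mu>" "K_elt B q \<mu> = u v" by (rule K_elt_word[OF assms(1)])
  obtain w where w: "set w \<subseteq> Kgens" "torus_wt w = \<nu>" "K_elt B q \<nu> = u w" by (rule K_elt_word[OF assms(2)])
  have "u (v @ w) = u v \<otimes>\<^bsub>U\<^esub> u w" using v w Kgens_qgens by (intro u_append) auto
  then show ?thesis using torus_word[of "v @ w"] v w by simp
qed

lemma K_elt_zero: "K_elt B q 0 = \<one>\<^bsub>U\<^esub>"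
  using torus_word[of "[]"] by (simp add: u_Nil)

lemma K_elt_simple: "\<alpha> \<in> B \<Longrightarrow> K_elt B q \<alpha> = eK \<alpha>" "\<alpha> \<in> B \<Longrightarrow> K_elt B q (- \<alpha>) = eKI \<alpha>"
  using torus_word[of "[gK \<alpha>]"] torus_word[of "[gKI \<alpha>]"] by (simp_all add: Kgens_def)

text \<open>The sign \<open>s\<close> is \<open>1\<close> for \<open>X = E\<^sub>\<beta>\<close> and \<open>-1\<close> for \<open>X = F\<^sub>\<beta>\<close>.\<close>

lemma torus_word_q_commute:
  assumes "set w \<subseteq> Kgens" "X \<in> carrier U"
    and "\<And>\<alpha>. \<alpha> \<in> B \<Longrightarrow> eK \<alpha> \<otimes>\<^bsub>U\<^esub> X = q powi (s * int_form \<alpha> \<beta>) \<odot>\<^bsub>U\<^esub> (X \<otimes>\<^bsub>U\<^esub> eK \<alpha>)"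
    and \<beta>: "\<beta> \<in> B"
  shows "u w \<otimes>\<^bsub>U\<^esub> X = q powi (s * int_form (torus_wt w) \<beta>) \<odot>\<^bsub>U\<^esub> (X \<otimes>\<^bsub>U\<^esub> u w)"
  using assms(1)
proof (induction w)
  case Nil
  then show ?case using assms(2) by (simp add: u_Nil int_form_def)
next
  case (Cons g w)
  then obtain \<alpha> where \<alpha>: "\<alpha> \<in> B" "g = gK \<alpha> \<or> g = gKI \<alpha>" by (auto simp: Kgens_def)
  have w: "torus_wt w \<in> root_lattice B" "set w \<subseteq> qgens B" using Cons torus_wt_lattice Kgens_qgens by auto
  have "eKI \<alpha> \<otimes>\<^bsub>U\<^esub> X = q powi (s * - int_form \<alpha> \<beta>) \<odot>\<^bsub>U\<^esub> (X \<otimes>\<^bsub>U\<^esub> eKI \<alpha>)"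
    using U.inverse_q_commute[OF _ _ assms(2) K_KI KI_K _ assms(3), of \<alpha>] \<alpha> q0 by (simp add: power_int_minus)
  moreover have "int_form (- \<alpha>) \<beta> = - int_form \<alpha> \<beta>"
    using int_form_exact[of "- \<alpha>" \<beta>] int_form_exact[of \<alpha> \<beta>] \<alpha> \<beta>
    by (simp add: root_lattice_uminus root_lattice_simple flip: of_int_eq_iff[where ?'a = real])
  ultimately obtain \<nu> where \<nu>: "torus_wt (g # w) = \<nu> + torus_wt w" "\<nu> \<in> root_lattice B"
     and g: "u [g] \<otimes>\<^bsub>U\<^esub> X = q powi (s * int_form \<nu> \<beta>) \<odot>\<^bsub>U\<^esub> (X \<otimes>\<^bsub>U\<^esub> u [g])"
    using \<alpha> assms(3)[OF \<alpha>(1)] root_lattice_simple[OF \<alpha>(1)] root_lattice_uminus[OF root_lattice_simple[OF \<alpha>(1)]]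
      that[of \<alpha>] that[of "- \<alpha>"] by (elim disjE) simp_all
  have cl: "u [g] \<in> carrier U" "u w \<in> carrier U" using \<alpha> w by auto
  have c: "u (g # w) = u [g] \<otimes>\<^bsub>U\<^esub> u w" using \<alpha> w by (intro u_Cons) auto
  have "u (g # w) \<otimes>\<^bsub>U\<^esub> X = q powi (s * int_form (torus_wt w) \<beta>) \<odot>\<^bsub>U\<^esub> (u [g] \<otimes>\<^bsub>U\<^esub> X \<otimes>\<^bsub>U\<^esub> u w)"
    unfolding c using Cons cl assms(2) by (simp add: U.m_assoc U.smult_mult_r)
  also have "\<dots> = (q powi (s * int_form (torus_wt w) \<beta>) * q powi (s * int_form \<nu> \<beta>)) \<odot>\<^bsub>U\<^esub> (X \<otimes>\<^bsub>U\<^esub> u (g # w))"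
    unfolding c g using cl assms(2) by (simp add: U.m_assoc U.smult_mult_l U.smult_smult)
  finally show ?case using q0 \<nu> w \<beta> by (simp add: int_form_add power_int_add[symmetric] algebra_simps)
qed

lemma K_elt_E: assumes "\<mu> \<in> root_lattice B" "\<beta> \<in> B"
  shows "K_elt B q \<mu> \<otimes>\<^bsub>U\<^esub> eE \<beta> = q powi int_form \<mu> \<beta> \<odot>\<^bsub>U\<^esub> (eE \<beta> \<otimes>\<^bsub>U\<^esub> K_elt B q \<mu>)"
proof -
  obtain w where w: "set w \<subseteq> Kgens" "torus_wt w = \<mu>" "K_elt B q \<mu> = u w" by (rule K_elt_word[OF assms(1)])
  show ?thesis using torus_word_q_commute[OF w(1), of "eE \<beta>" 1 \<beta>] w K_E assms by simp
qed

lemma K_elt_F: assumes "\<mu> \<in> root_lattice B" "\<beta> \<in> B"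
  shows "K_elt B q \<mu> \<otimes>\<^bsub>U\<^esub> eF \<beta> = q powi (- int_form \<mu> \<beta>) \<odot>\<^bsub>U\<^esub> (eF \<beta> \<otimes>\<^bsub>U\<^esub> K_elt B q \<mu>)"
proof -
  obtain w where w: "set w \<subseteq> Kgens" "torus_wt w = \<mu>" "K_elt B q \<mu> = u w" by (rule K_elt_word[OF assms(1)])
  show ?thesis using torus_word_q_commute[OF w(1), of "eF \<beta>" "-1" \<beta>] w K_F assms by simp
qed

lemma K_elt_commute: "\<mu> \<in> root_lattice B \<Longrightarrow> \<nu> \<in> root_lattice B \<Longrightarrow>
   K_elt B q \<mu> \<otimes>\<^bsub>U\<^esub> K_elt B q \<nu> = K_elt B q \<nu> \<otimes>\<^bsub>U\<^esub> K_elt B q \<mu>"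
  by (simp add: K_elt_add add.commute)

end

section \<open>Quantum binomial coefficients\<close>

lemma qnum_inverse: "qnum (inverse v) n = qnum v n"
proof -
  have "inverse v ^ n - v ^ n = - (v ^ n - inverse v ^ n)" "inverse v - v = - (v - inverse v)" by simp_all
  then show ?thesis unfolding qnum_def inverse_inverse_eq by (simp only: minus_divide_divide)
qed

lemma qbinom_inverse: "qbinom (inverse v) n k = qbinom v n k"
  by (simp add: qbinom_def qfact_def qnum_inverse)

lemma qnum_split:
  assumes "v \<noteq> 0" shows "qnum v (a + b) = inverse v ^ b * qnum v a + v ^ a * qnum v b"
proof -
  have "v ^ (a + b) - inverse v ^ (a + b) = inverse v ^ b * (v ^ a - inverse v ^ a) + v ^ a * (v ^ b - inverse v ^ b)"
    by (simp add: power_add algebra_simps)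
  then show ?thesis by (simp add: qnum_def add_divide_distrib)
qed

lemma qfact_Suc: "qfact v (Suc n) = qnum v (Suc n) * qfact v n"
  by (simp add: qfact_def mult.commute)

locale q_param =
  fixes v :: complex
  assumes v0: "v \<noteq> 0" and v_not_root: "\<And>n::nat. n > 0 \<Longrightarrow> v ^ n \<noteq> 1"
begin

lemma v_diff: "v - inverse v \<noteq> 0"
proof
  assume "v - inverse v = 0"
  then have "v ^ 2 = 1" using v0 by (metis eq_iff_diff_eq_0 power2_eq_square right_inverse)
  then show False using v_not_root[of 2] by simp
qed

lemma qnum_nonzero: "n > 0 \<Longrightarrow> qnum v n \<noteq> 0"
proof
  assume "n > 0" "qnum v n = 0"
  then have "v ^ n = inverse v ^ n" using v_diff by (simp add: qnum_def)
  then have "v ^ (n + n) = 1" using v0 unfolding power_add power_inverse by (metis power_not_zero right_inverse)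
  then show False using v_not_root[of "n + n"] \<open>n > 0\<close> by simp
qed

lemma qfact_nonzero: "qfact v n \<noteq> 0"
  by (simp add: qfact_def qnum_nonzero)

lemma inverse_q_param: "q_param (inverse v)"
  using v0 v_not_root by unfold_locales (auto simp: power_inverse)

lemma qbinom_0: "qbinom v n 0 = 1"
  using qfact_nonzero[of n] by (simp add: qbinom_def qfact_def)

lemma qbinom_step:
  assumes "k < n" shows "qbinom v n (Suc k) * qnum v (Suc k) = qbinom v n k * qnum v (n - k)"
proof -
  have "n - k = Suc (n - Suc k)" using assms by simp
  then show ?thesis
    using qfact_nonzero qnum_nonzero by (simp add: qbinom_def qfact_Suc field_simps)
qed

lemma qbinom_pascal:
  assumes "Suc j < n"
  shows "qbinom v n (Suc j) = inverse v ^ (n - Suc j) * qbinom v (n - 1) j + v ^ Suc j * qbinom v (n - 1) (Suc j)"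
proof -
  obtain b where b: "n = Suc j + Suc b" using assms less_iff_Suc_add by auto
  define F where "F = qfact v (Suc j + b) / (qfact v (Suc j) * qfact v (Suc b))"
  note nz = qfact_nonzero qnum_nonzero
  have "qbinom v n (Suc j) = qnum v (Suc j + Suc b) * F"
    using nz by (simp add: qbinom_def b F_def qfact_Suc)
  moreover have "qbinom v (n - 1) j = qnum v (Suc j) * F"
    using nz by (simp add: qbinom_def b F_def qfact_Suc field_simps)
  moreover have "qbinom v (n - 1) (Suc j) = qnum v (Suc b) * F"
    using nz by (simp add: qbinom_def b F_def qfact_Suc field_simps)
  ultimately show ?thesis using qnum_split[OF v0, of "Suc j" "Suc b"] by (simp add: b algebra_simps)
qed

text \<open>The partial sums telescope by Pascal's rule.\<close>

lemma qbinom_alternating_sum: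
  assumes "n \<ge> 1" shows "(\<Sum>k\<le>n. (- 1) ^ k * qbinom v n k * v ^ ((n - 1) * k)) = 0"
proof -
  have partial: "(\<Sum>k\<le>j. (- 1) ^ k * qbinom v n k * v ^ ((n - 1) * k)) = (- 1) ^ j * v ^ (n * j) * qbinom v (n - 1) j"
    if "j < n" for j
    using that
  proof (induction j)
    case 0
    then show ?case by (simp add: qbinom_0)
  next
    case (Suc j)
    obtain b where b: "n = Suc j + Suc b" using Suc.prems less_iff_Suc_add by auto
    have e: "v ^ ((n - 1) * Suc j) = v ^ (n * j) * v ^ (n - Suc j)"
    proof -
      have "(n - 1) * Suc j = n * j + (n - Suc j) " by (simp add: b algebra_simps)
      then show ?thesis by (simp add: power_add)
    qed
    have e2: "v ^ ((n - 1) * Suc j) * v ^ Suc j = v ^ (n * Suc j)"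
    proof -
      have "(n - 1) * Suc j + Suc j = n * Suc j" by (simp add: b algebra_simps)
      then show ?thesis by (metis power_add)
    qed
    have i: "v ^ (n - Suc j) * inverse v ^ (n - Suc j) = 1" using v0 by (simp add: power_inverse)
    have "qbinom v n (Suc j) * v ^ ((n - 1) * Suc j) =
      v ^ (n * j) * (v ^ (n - Suc j) * inverse v ^ (n - Suc j)) * qbinom v (n - 1) j + (v ^ ((n - 1) * Suc j) * v ^ Suc j) * qbinom v (n - 1) (Suc j)"
      unfolding qbinom_pascal[OF Suc.prems] e distrib_right by (simp only: mult_ac)
    also have "\<dots> = v ^ (n * j) * qbinom v (n - 1) j + v ^ (n * Suc j) * qbinom v (n - 1) (Suc j)"
      unfolding i e2 by simp
    finally show ?case using Suc by (simp add: mult.assoc algebra_simps)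
  qed
  obtain m where m: "n = Suc m" using assms by (metis Suc_le_D One_nat_def)
  have "qbinom v k k = 1" for k using qfact_nonzero[of k] by (simp add: qbinom_def qfact_def)
  then show ?thesis using partial[of m] by (simp add: m mult.commute)
qed

text \<open>Replacing \<open>v\<close> by its inverse does not change the quantum binomial coefficients.\<close>

lemma qbinom_alternating_sum':
  assumes "n \<ge> 1" shows "(\<Sum>k\<le>n. (- 1) ^ k * qbinom v n k * inverse v ^ ((n - 1) * k)) = 0"
proof -
  interpret I: q_param "inverse v" by (rule inverse_q_param)
  show ?thesis using I.qbinom_alternating_sum[OF assms] by (simp add: qbinom_inverse)
qed

end

section \<open>Commutation with the quantum Serre operators\<close>

definition lin_op :: "(('x \<Rightarrow> complex) \<Rightarrow> ('x \<Rightarrow> complex)) \<Rightarrow> bool" where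
  "lin_op T \<longleftrightarrow> (\<forall>a b f g. T (\<lambda>x. a * f x + b * g x) = (\<lambda>x. a * T f x + b * T g x))"

lemma lin_op_D: "lin_op T \<Longrightarrow> T (\<lambda>x. a * f x + b * g x) = (\<lambda>x. a * T f x + b * T g x)"
  by (simp add: lin_op_def)

lemma lin_op_zero: "lin_op T \<Longrightarrow> T (\<lambda>x. 0) = (\<lambda>x. 0)"
  using lin_op_D[of T 0 "\<lambda>x. 0" 0 "\<lambda>x. 0"] by simp

lemma lin_op_scale: "lin_op T \<Longrightarrow> T (\<lambda>x. a * f x) = (\<lambda>x. a * T f x)"
  using lin_op_D[of T a f 0 f] by simp

lemma lin_op_add: "lin_op T \<Longrightarrow> T (\<lambda>x. f x + g x) = (\<lambda>x. T f x + T g x)"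
  using lin_op_D[of T 1 f 1 g] by simp

lemma lin_op_diff: "lin_op T \<Longrightarrow> T (\<lambda>x. f x - g x) = (\<lambda>x. T f x - T g x)"
  using lin_op_D[of T 1 f "-1" g] by simp

lemma lin_op_sum:
  assumes "lin_op T" shows "T (\<lambda>x. \<Sum>i\<in>I. c i * F i x) = (\<lambda>x. \<Sum>i\<in>I. c i * T (F i) x)"
proof (induction I rule: infinite_finite_induct)
  case (insert i I)
  then show ?case using lin_op_D[OF assms, of "c i" "F i" 1 "\<lambda>x. \<Sum>i\<in>I. c i * F i x"] by simp
qed (simp_all add: lin_op_zero[OF assms])

lemma lin_op_funpow: "lin_op T \<Longrightarrow> lin_op (T ^^ k)"
  by (induction k) (auto simp: lin_op_def)

lemma funpow_q_commute:
  assumes "lin_op X" "\<And>f. X (K f) = (\<lambda>x. c * K (X f) x)"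
  shows "(X ^^ k) (K f) = (\<lambda>x. c ^ k * K ((X ^^ k) f) x)"
proof (induction k)
  case (Suc k)
  have "(X ^^ Suc k) (K f) = X (\<lambda>x. c ^ k * K ((X ^^ k) f) x)" by (simp add: Suc)
  then show ?case unfolding lin_op_scale[OF assms(1)] by (simp add: assms(2) mult_ac)
qed simp

text \<open>The quantum Serre element in two operators, of a right action: the leftmost letter of a word is
  applied first.\<close>

definition serre_op :: "complex \<Rightarrow> nat \<Rightarrow> (('x \<Rightarrow> complex) \<Rightarrow> ('x \<Rightarrow> complex)) \<Rightarrow>
    (('x \<Rightarrow> complex) \<Rightarrow> ('x \<Rightarrow> complex)) \<Rightarrow> ('x \<Rightarrow> complex) \<Rightarrow> ('x \<Rightarrow> complex)" where
  "serre_op v n X Y f = (\<lambda>x. \<Sum>k\<le>n. ((- 1) ^ k * qbinom v n k) * (X ^^ k) (Y ((X ^^ (n - k)) f)) x)"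

lemma serre_op_commute_other:
  assumes "lin_op E" "\<And>f. X (E f) = E (X f)" "\<And>f. Y (E f) = E (Y f)"
  shows "serre_op v n X Y (E f) = E (serre_op v n X Y f)"
proof -
  have "(X ^^ k) (E f) = E ((X ^^ k) f)" for k f by (induction k) (simp_all add: assms)
  then show ?thesis by (simp add: serre_op_def lin_op_sum[OF assms(1)] assms)
qed

context q_param
begin

text \<open>\<open>E\<close> commutes with \<open>X\<close>, and with \<open>Y\<close> up to the difference of \<open>K\<close> and \<open>L\<close>. Collecting powers of \<open>X\<close>,
  the error is a multiple of the alternating sums of quantum binomial coefficients, which vanish.\<close>

lemma serre_op_commute_beta:
  assumes lin: "lin_op E" "lin_op X" "lin_op Y" "lin_op K" "lin_op L" and n: "n \<ge> 1"
    and XE: "\<And>f. X (E f) = E (X f)"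
    and YE: "\<And>f. Y (E f) = (\<lambda>x. E (Y f) x + (K f x - L f x) / d)"
    and XK: "\<And>f. X (K f) = (\<lambda>x. v ^ (n - 1) * K (X f) x)"
    and XL: "\<And>f. X (L f) = (\<lambda>x. inverse v ^ (n - 1) * L (X f) x)"
  shows "serre_op v n X Y (E f) = E (serre_op v n X Y f)"
proof
  fix x
  have XkE: "(X ^^ k) (E f) = E ((X ^^ k) f)" for k f by (induction k) (simp_all add: XE)
  have XkK: "(X ^^ k) (K f) = (\<lambda>x. v ^ ((n - 1) * k) * K ((X ^^ k) f) x)" for k f
    using funpow_q_commute[where K = K, OF lin(2) XK] by (simp only: power_mult)
  have XkL: "(X ^^ k) (L f) = (\<lambda>x. inverse v ^ ((n - 1) * k) * L ((X ^^ k) f) x)" for k f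
    using funpow_q_commute[where K = L, OF lin(2) XL] by (simp only: power_mult)
  have X: "lin_op (X ^^ k)" for k by (rule lin_op_funpow[OF lin(2)])
  have t: "(X ^^ k) (Y ((X ^^ (n - k)) (E f))) x = E ((X ^^ k) (Y ((X ^^ (n - k)) f))) x +
      (v ^ ((n - 1) * k) * K ((X ^^ n) f) x - inverse v ^ ((n - 1) * k) * L ((X ^^ n) f) x) / d" if "k \<le> n" for k
  proof -
    have n: "(X ^^ k) ((X ^^ (n - k)) f) = (X ^^ n) f" using that by (metis add_diff_inverse_nat comp_apply funpow_add not_less)
    have "Y ((X ^^ (n - k)) (E f)) = (\<lambda>x. E (Y ((X ^^ (n - k)) f)) x + (inverse d * K ((X ^^ (n - k)) f) x - inverse d * L ((X ^^ (n - k)) f) x))"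
      by (simp add: XkE YE divide_inverse algebra_simps)
    then show ?thesis
      by (simp add: lin_op_add[OF X] lin_op_diff[OF X] lin_op_scale[OF X] XkE XkK XkL n divide_inverse algebra_simps)
  qed
  let ?c = "\<lambda>k. (- 1) ^ k * qbinom v n k"
  have "serre_op v n X Y (E f) x = (\<Sum>k\<le>n. ?c k * (E ((X ^^ k) (Y ((X ^^ (n - k)) f))) x +
      (v ^ ((n - 1) * k) * K ((X ^^ n) f) x - inverse v ^ ((n - 1) * k) * L ((X ^^ n) f) x) / d))"
    unfolding serre_op_def by (intro sum.cong refl) (simp add: t)
  also have "\<dots> = (\<Sum>k\<le>n. ?c k * E ((X ^^ k) (Y ((X ^^ (n - k)) f))) x) +
      ((\<Sum>k\<le>n. ?c k * v ^ ((n - 1) * k)) * K ((X ^^ n) f) x - (\<Sum>k\<le>n. ?c k * inverse v ^ ((n - 1) * k)) * L ((X ^^ n) f) x) / d"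
    unfolding sum_distrib_right sum_subtractf[symmetric] sum_divide_distrib sum.distrib[symmetric]
    by (intro sum.cong refl) (simp add: divide_inverse algebra_simps)
  also have "\<dots> = E (serre_op v n X Y f) x"
    unfolding serre_op_def lin_op_sum[OF lin(1)] qbinom_alternating_sum[OF n] qbinom_alternating_sum'[OF n] by simp
  finally show "serre_op v n X Y (E f) x = E (serre_op v n X Y f) x" .
qed

text \<open>Moving \<open>E\<close> past the \<open>m\<close>-th power of \<open>X\<close> leaves terms with \<open>K X\<^sup>m\<^sup>-\<^sup>1\<close> and \<open>L X\<^sup>m\<^sup>-\<^sup>1\<close> whose coefficients
  \<open>A m\<close> and \<open>A' m\<close> are geometric sums, that is, quantum numbers up to powers of \<open>v\<close>. In the Serre element
  such terms arise on both sides of \<open>Y\<close>, and they cancel between neighbouring summands.\<close>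

lemma serre_op_commute_alpha:
  assumes lin: "lin_op E" "lin_op X" "lin_op Y" "lin_op K" "lin_op L" and n: "n \<ge> 1"
    and YE: "\<And>f. Y (E f) = E (Y f)"
    and XE: "\<And>f. X (E f) = (\<lambda>x. E (X f) x + (K f x - L f x) / d)"
    and XK: "\<And>f. X (K f) = (\<lambda>x. inverse v ^ 2 * K (X f) x)"
    and XL: "\<And>f. X (L f) = (\<lambda>x. v ^ 2 * L (X f) x)"
    and YK: "\<And>f. Y (K f) = (\<lambda>x. v ^ (n - 1) * K (Y f) x)"
    and YL: "\<And>f. Y (L f) = (\<lambda>x. inverse v ^ (n - 1) * L (Y f) x)"
  shows "serre_op v n X Y (E f) = E (serre_op v n X Y f)"
proof
  fix x
  define A where "A m = (if m = 0 then 0 else inverse v ^ (m - 1) * qnum v m)" for m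
  define A' where "A' m = (if m = 0 then 0 else v ^ (m - 1) * qnum v m)" for m
  have A_Suc: "A (Suc m) = 1 + inverse v ^ 2 * A m" for m
  proof (cases m)
    case (Suc k)
    have "qnum v 1 = 1" using v_diff by (simp add: qnum_def)
    then have "qnum v (Suc m) = inverse v * qnum v m + v ^ m" using qnum_split[OF v0, of m 1] by simp
    then show ?thesis using v0 by (simp add: A_def Suc power_inverse field_simps power2_eq_square)
  qed (use v_diff in \<open>simp add: A_def qnum_def\<close>)
  have A'_Suc: "A' (Suc m) = 1 + v ^ 2 * A' m" for m
  proof (cases m)
    case (Suc k)
    have "qnum v 1 = 1" using v_diff by (simp add: qnum_def)
    then have "qnum v (Suc m) = inverse v ^ m + v * qnum v m" using qnum_split[OF v0, of 1 m] by simp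
    then show ?thesis using v0 by (simp add: A'_def Suc power_inverse field_simps power2_eq_square)
  qed (use v_diff in \<open>simp add: A'_def qnum_def\<close>)
  have X: "lin_op (X ^^ k)" for k by (rule lin_op_funpow[OF lin(2)])
  have XmE: "(X ^^ m) (E f) = (\<lambda>x. E ((X ^^ m) f) x +
      (inverse d * A m * K ((X ^^ (m - 1)) f) x - inverse d * A' m * L ((X ^^ (m - 1)) f) x))" for m f
  proof (induction m)
    case 0
    then show ?case by (simp add: A_def A'_def)
  next
    case (Suc m)
    have sh: "A m * K (X ((X ^^ (m - 1)) f)) x = A m * K ((X ^^ m) f) x"
      "A' m * L (X ((X ^^ (m - 1)) f)) x = A' m * L ((X ^^ m) f) x" for x
      by (cases m; simp add: A_def A'_def)+
    have "(X ^^ Suc m) (E f) = X ((X ^^ m) (E f))" by simp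
    also have "\<dots> = (\<lambda>x. E ((X ^^ Suc m) f) x + (K ((X ^^ m) f) x - L ((X ^^ m) f) x) / d +
        (inverse d * A m * (inverse v ^ 2 * K (X ((X ^^ (m - 1)) f)) x) - inverse d * A' m * (v ^ 2 * L (X ((X ^^ (m - 1)) f)) x)))"
      unfolding Suc.IH by (simp add: lin_op_add[OF lin(2)] lin_op_diff[OF lin(2)] lin_op_scale[OF lin(2)] XE XK XL)
    also have "\<dots> = (\<lambda>x. E ((X ^^ Suc m) f) x + (inverse d * A (Suc m) * K ((X ^^ m) f) x - inverse d * A' (Suc m) * L ((X ^^ m) f) x))"
    proof
      fix x
      have "inverse d * A m * (inverse v ^ 2 * K (X ((X ^^ (m - 1)) f)) x) = inverse d * inverse v ^ 2 * (A m * K ((X ^^ m) f) x)"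
        "inverse d * A' m * (v ^ 2 * L (X ((X ^^ (m - 1)) f)) x) = inverse d * v ^ 2 * (A' m * L ((X ^^ m) f) x)"
        unfolding sh[symmetric] by (simp_all add: mult_ac)
      then show "E ((X ^^ Suc m) f) x + (K ((X ^^ m) f) x - L ((X ^^ m) f) x) / d +
        (inverse d * A m * (inverse v ^ 2 * K (X ((X ^^ (m - 1)) f)) x) - inverse d * A' m * (v ^ 2 * L (X ((X ^^ (m - 1)) f)) x)) =
        E ((X ^^ Suc m) f) x + (inverse d * A (Suc m) * K ((X ^^ m) f) x - inverse d * A' (Suc m) * L ((X ^^ m) f) x)"
        by (simp only: A_Suc A'_Suc) (simp add: divide_inverse algebra_simps)
    qed
    finally show ?case by simp
  qed
  have XkK: "(X ^^ k) (K f) = (\<lambda>x. inverse v ^ (2 * k) * K ((X ^^ k) f) x)" for k f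
    using funpow_q_commute[where K = K, OF lin(2) XK] by (simp only: power_mult)
  have XkL: "(X ^^ k) (L f) = (\<lambda>x. v ^ (2 * k) * L ((X ^^ k) f) x)" for k f
    using funpow_q_commute[where K = L, OF lin(2) XL] by (simp only: power_mult)
  define G where "G k = (X ^^ k) (Y ((X ^^ (n - 1 - k)) f))" for k
  have t: "(X ^^ k) (Y ((X ^^ (n - k)) (E f))) x = E ((X ^^ k) (Y ((X ^^ (n - k)) f))) x +
      inverse d * (A k * K (G (k - 1)) x - A' k * L (G (k - 1)) x) +
      inverse d * (A (n - k) * v ^ (n - 1) * inverse v ^ (2 * k) * K (G k) x - A' (n - k) * inverse v ^ (n - 1) * v ^ (2 * k) * L (G k) x)"
    if "k \<le> n" for k
  proof -
    have g1: "A k * K ((X ^^ (k - 1)) (Y ((X ^^ (n - k)) f))) x = A k * K (G (k - 1)) x"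
      "A' k * L ((X ^^ (k - 1)) (Y ((X ^^ (n - k)) f))) x = A' k * L (G (k - 1)) x"
    proof -
      have "k > 0 \<Longrightarrow> n - 1 - (k - 1) = n - k" by simp
      then show "A k * K ((X ^^ (k - 1)) (Y ((X ^^ (n - k)) f))) x = A k * K (G (k - 1)) x"
        "A' k * L ((X ^^ (k - 1)) (Y ((X ^^ (n - k)) f))) x = A' k * L (G (k - 1)) x"
        by (cases "k = 0"; simp add: A_def A'_def G_def)+
    qed
    have g2: "(X ^^ k) (Y ((X ^^ (n - k - 1)) f)) = G k" by (simp add: G_def diff_commute)
    have "(X ^^ k) (Y ((X ^^ (n - k)) (E f))) x = E ((X ^^ k) (Y ((X ^^ (n - k)) f))) x +
      inverse d * (A k * K ((X ^^ (k - 1)) (Y ((X ^^ (n - k)) f))) x - A' k * L ((X ^^ (k - 1)) (Y ((X ^^ (n - k)) f))) x) +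
      inverse d * (A (n - k) * v ^ (n - 1) * inverse v ^ (2 * k) * K (G k) x - A' (n - k) * inverse v ^ (n - 1) * v ^ (2 * k) * L (G k) x)"
      unfolding XmE[of "n - k"]
      by (simp add: lin_op_add[OF lin(3)] lin_op_diff[OF lin(3)] lin_op_scale[OF lin(3)] YE YK YL
          lin_op_add[OF X] lin_op_diff[OF X] lin_op_scale[OF X] XmE[of k] XkK XkL g2[symmetric])
         (simp add: algebra_simps)
    then show ?thesis unfolding g1 .
  qed
  let ?c = "\<lambda>k. (- 1) ^ k * qbinom v n k"
  have cancel: "?c (Suc k) * A (Suc k) + ?c k * (A (n - k) * v ^ (n - 1) * inverse v ^ (2 * k)) = 0"
    "?c (Suc k) * A' (Suc k) + ?c k * (A' (n - k) * inverse v ^ (n - 1) * v ^ (2 * k)) = 0" if k: "k < n" for k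
  proof -
    have "n - 1 = (n - k - 1) + k" using k by simp
    then have n1: "v ^ (n - 1) = v ^ (n - k - 1) * v ^ k" "inverse v ^ (n - 1) = inverse v ^ (n - k - 1) * inverse v ^ k"
      by (simp_all only: power_add)
    have n2: "v ^ (2 * k) = v ^ k * v ^ k" "inverse v ^ (2 * k) = inverse v ^ k * inverse v ^ k"
      by (simp_all only: mult_2 power_add)
    have i: "inverse v ^ m * v ^ m = 1" "v ^ m * inverse v ^ m = 1" for m using v0 by (simp_all add: power_inverse)
    have "A (n - k) * v ^ (n - 1) * inverse v ^ (2 * k) = qnum v (n - k) * inverse v ^ k * (inverse v ^ (n - k - 1) * v ^ (n - k - 1)) * (v ^ k * inverse v ^ k)"
      unfolding n1 n2 using k by (simp add: A_def mult_ac)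
    then have a: "A (n - k) * v ^ (n - 1) * inverse v ^ (2 * k) = qnum v (n - k) * inverse v ^ k" by (simp add: i)
    have "A' (n - k) * inverse v ^ (n - 1) * v ^ (2 * k) = qnum v (n - k) * v ^ k * (inverse v ^ (n - k - 1) * v ^ (n - k - 1)) * (v ^ k * inverse v ^ k)"
      unfolding n1 n2 using k by (simp add: A'_def mult_ac)
    then have a': "A' (n - k) * inverse v ^ (n - 1) * v ^ (2 * k) = qnum v (n - k) * v ^ k" by (simp add: i)
    have "?c (Suc k) * A (Suc k) + ?c k * (qnum v (n - k) * inverse v ^ k) =
        (- 1) ^ k * inverse v ^ k * (qbinom v n k * qnum v (n - k) - qbinom v n (Suc k) * qnum v (Suc k))"
      by (simp add: A_def algebra_simps)
    then show "?c (Suc k) * A (Suc k) + ?c k * (A (n - k) * v ^ (n - 1) * inverse v ^ (2 * k)) = 0"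
      unfolding a by (simp add: qbinom_step[OF k])
    have "?c (Suc k) * A' (Suc k) + ?c k * (qnum v (n - k) * v ^ k) =
        (- 1) ^ k * v ^ k * (qbinom v n k * qnum v (n - k) - qbinom v n (Suc k) * qnum v (Suc k))"
      by (simp add: A'_def algebra_simps)
    then show "?c (Suc k) * A' (Suc k) + ?c k * (A' (n - k) * inverse v ^ (n - 1) * v ^ (2 * k)) = 0"
      unfolding a' by (simp add: qbinom_step[OF k])
  qed
  have shift: "(\<Sum>k\<le>n. p k * g (k - 1)) + (\<Sum>k\<le>n. r k * g k) = 0"
    if "p 0 = 0" "r n = 0" "\<And>k. k < n \<Longrightarrow> p (Suc k) + r k = 0" for p r g :: "nat \<Rightarrow> complex"
  proof -
    obtain m where m: "n = Suc m" using n by (metis Suc_le_D One_nat_def)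
    have "(\<Sum>k\<le>n. p k * g (k - 1)) = (\<Sum>k\<le>m. p (Suc k) * g k)"
      unfolding m by (subst sum.atMost_Suc_shift) (simp add: that)
    moreover have "(\<Sum>k\<le>n. r k * g k) = (\<Sum>k\<le>m. r k * g k)" using that(2) by (simp add: m)
    moreover have "p (Suc k) * g k + r k * g k = 0" if "k \<le> m" for k
      using \<open>\<And>k. k < n \<Longrightarrow> p (Suc k) + r k = 0\<close>[of k] that by (simp add: m distrib_right[symmetric])
    ultimately show ?thesis by (simp add: sum.distrib[symmetric])
  qed
  have "serre_op v n X Y (E f) x = (\<Sum>k\<le>n. ?c k * (E ((X ^^ k) (Y ((X ^^ (n - k)) f))) x +
      inverse d * (A k * K (G (k - 1)) x - A' k * L (G (k - 1)) x) +
      inverse d * (A (n - k) * v ^ (n - 1) * inverse v ^ (2 * k) * K (G k) x - A' (n - k) * inverse v ^ (n - 1) * v ^ (2 * k) * L (G k) x)))"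
    unfolding serre_op_def by (intro sum.cong refl) (simp add: t)
  also have "\<dots> = (\<Sum>k\<le>n. ?c k * E ((X ^^ k) (Y ((X ^^ (n - k)) f))) x) +
      inverse d * ((\<Sum>k\<le>n. (?c k * A k) * K (G (k - 1)) x) + (\<Sum>k\<le>n. (?c k * (A (n - k) * v ^ (n - 1) * inverse v ^ (2 * k))) * K (G k) x)) -
      inverse d * ((\<Sum>k\<le>n. (?c k * A' k) * L (G (k - 1)) x) + (\<Sum>k\<le>n. (?c k * (A' (n - k) * inverse v ^ (n - 1) * v ^ (2 * k))) * L (G k) x))"
    unfolding sum.distrib[symmetric] sum_distrib_left sum_subtractf[symmetric]
    by (intro sum.cong refl) (simp add: algebra_simps)
  also have "(\<Sum>k\<le>n. (?c k * A k) * K (G (k - 1)) x) + (\<Sum>k\<le>n. (?c k * (A (n - k) * v ^ (n - 1) * inverse v ^ (2 * k))) * K (G k) x) = 0"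
    by (rule shift[where g = "\<lambda>k. K (G k) x"]) (use cancel in \<open>simp_all add: A_def\<close>)
  also have "(\<Sum>k\<le>n. (?c k * A' k) * L (G (k - 1)) x) + (\<Sum>k\<le>n. (?c k * (A' (n - k) * inverse v ^ (n - 1) * v ^ (2 * k))) * L (G k) x) = 0"
    by (rule shift[where g = "\<lambda>k. L (G k) x"]) (use cancel in \<open>simp_all add: A'_def\<close>)
  finally show "serre_op v n X Y (E f) x = E (serre_op v n X Y f) x"
    by (simp add: serre_op_def lin_op_sum[OF lin(1)])
qed

end

section \<open>A right module that separates normal forms\<close>

text \<open>A function \<open>f (w, \<nu>, z)\<close> is thought of as a linear functional on formal products
  \<open>F\<^sub>w K\<^sub>\<nu> E\<^sub>z\<close>, where \<open>w\<close> and \<open>z\<close> are words in the simple roots. The operators \<open>rF\<close>, \<open>rK\<close>, \<open>rKI\<close>, \<open>rE\<close>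
  are the transposes of left multiplication by the generators, followed by reordering into this form.
  They define a right action that satisfies all relations except for those of Serre.\<close>

type_synonym 'a rfun = "'a list \<times> 'a \<times> 'a list \<Rightarrow> complex"

context root_data
begin

definition lform :: "'a \<Rightarrow> 'a list \<Rightarrow> int" where
  "lform \<gamma> w = (\<Sum>\<delta>\<leftarrow>w. int_form \<gamma> \<delta>)"

lemma lform_simps [simp]: "lform \<gamma> [] = 0" "lform \<gamma> (\<delta> # w) = int_form \<gamma> \<delta> + lform \<gamma> w"
  "lform \<gamma> (w @ w') = lform \<gamma> w + lform \<gamma> w'" "lform \<gamma> (replicate n \<delta>) = int n * int_form \<gamma> \<delta>"
  by (auto simp: lform_def sum_list_replicate)

definition rF :: "'a \<Rightarrow> 'a rfun \<Rightarrow> 'a rfun" where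
  "rF \<gamma> f = (\<lambda>(w, \<nu>, z). f (\<gamma> # w, \<nu>, z))"

definition rK :: "'a \<Rightarrow> 'a rfun \<Rightarrow> 'a rfun" where
  "rK \<gamma> f = (\<lambda>(w, \<nu>, z). q powi (- lform \<gamma> w) * f (w, \<nu> + \<gamma>, z))"

definition rKI :: "'a \<Rightarrow> 'a rfun \<Rightarrow> 'a rfun" where
  "rKI \<gamma> f = (\<lambda>(w, \<nu>, z). q powi (lform \<gamma> w) * f (w, \<nu> - \<gamma>, z))"

text \<open>\<open>E\<^sub>\<gamma>\<close> moves to the right past the letters of the \<open>F\<close>-word one at a time and leaves a term with \<open>K\<^sub>\<gamma>\<close> and
  its inverse at every letter \<open>\<gamma>\<close>; behind the \<open>F\<close>-word it passes \<open>K\<^sub>\<nu>\<close> and joins the \<open>E\<close>-word.\<close>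

primrec rE_aux :: "'a \<Rightarrow> 'a list \<Rightarrow> 'a rfun \<Rightarrow> 'a \<times> 'a list \<Rightarrow> complex" where
  "rE_aux \<gamma> [] f = (\<lambda>(\<nu>, z). q powi (- int_form \<gamma> \<nu>) * f ([], \<nu>, \<gamma> # z))"
| "rE_aux \<gamma> (\<delta> # w) f = (\<lambda>p. rE_aux \<gamma> w (rF \<delta> f) p +
     (if \<gamma> = \<delta> then (rK \<gamma> f (w, p) - rKI \<gamma> f (w, p)) / (q_root q \<gamma> - inverse (q_root q \<gamma>)) else 0))"

definition rE :: "'a \<Rightarrow> 'a rfun \<Rightarrow> 'a rfun" where
  "rE \<gamma> f = (\<lambda>(w, p). rE_aux \<gamma> w f p)"

lemma rF_apply [simp]: "rF \<gamma> f (w, p) = f (\<gamma> # w, p)" by (cases p) (simp add: rF_def)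
lemma rK_apply [simp]: "rK \<gamma> f (w, \<nu>, z) = q powi (- lform \<gamma> w) * f (w, \<nu> + \<gamma>, z)" by (simp add: rK_def)
lemma rKI_apply [simp]: "rKI \<gamma> f (w, \<nu>, z) = q powi (lform \<gamma> w) * f (w, \<nu> - \<gamma>, z)" by (simp add: rKI_def)
lemma rE_Nil [simp]: "rE \<gamma> f ([], \<nu>, z) = q powi (- int_form \<gamma> \<nu>) * f ([], \<nu>, \<gamma> # z)" by (simp add: rE_def)
lemma rE_Cons: "rE \<gamma> f (\<delta> # w, p) = rE \<gamma> (rF \<delta> f) (w, p) +
     (if \<gamma> = \<delta> then (rK \<gamma> f (w, p) - rKI \<gamma> f (w, p)) / (q_root q \<gamma> - inverse (q_root q \<gamma>)) else 0)"
  by (simp add: rE_def)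

lemma lin_rF: "lin_op (rF \<gamma>)" by (auto simp: lin_op_def rF_def)
lemma lin_rK: "lin_op (rK \<gamma>)" by (auto simp: lin_op_def rK_def algebra_simps)
lemma lin_rKI: "lin_op (rKI \<gamma>)" by (auto simp: lin_op_def rKI_def algebra_simps)

lemma lin_rE: "lin_op (rE \<gamma>)"
proof -
  have "rE \<gamma> (\<lambda>x. a * f x + b * g x) (w, p) = a * rE \<gamma> f (w, p) + b * rE \<gamma> g (w, p)" for a b f g w p
  proof (induction w arbitrary: f g)
    case Nil
    then show ?case by (cases p) (simp add: algebra_simps)
  next
    case (Cons \<delta> w)
    have "rF \<delta> (\<lambda>x. a * f x + b * g x) = (\<lambda>x. a * rF \<delta> f x + b * rF \<delta> g x)" by (rule lin_op_D[OF lin_rF])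
    then have "rE \<gamma> (rF \<delta> (\<lambda>x. a * f x + b * g x)) (w, p) = a * rE \<gamma> (rF \<delta> f) (w, p) + b * rE \<gamma> (rF \<delta> g) (w, p)"
      by (simp only: Cons.IH)
    then show ?case unfolding rE_Cons lin_op_D[OF lin_rK] lin_op_D[OF lin_rKI]
      by (simp add: divide_inverse algebra_simps)
  qed
  then show ?thesis by (auto simp: lin_op_def)
qed

lemma int_form_shift: "\<alpha> \<in> B \<Longrightarrow> \<beta> \<in> B \<Longrightarrow> int_form \<beta> (\<nu> + \<alpha>) = int_form \<beta> \<nu> + int_form \<alpha> \<beta>"
  "\<alpha> \<in> B \<Longrightarrow> \<beta> \<in> B \<Longrightarrow> int_form \<beta> (\<nu> - \<alpha>) = int_form \<beta> \<nu> - int_form \<alpha> \<beta>"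
proof -
  assume *: "\<alpha> \<in> B" "\<beta> \<in> B"
  have "\<beta> \<bullet> \<alpha> = of_int (int_form \<alpha> \<beta>)" using int_form_exact_simple[OF *] by (simp add: inner_commute)
  then show "int_form \<beta> (\<nu> + \<alpha>) = int_form \<beta> \<nu> + int_form \<alpha> \<beta>" "int_form \<beta> (\<nu> - \<alpha>) = int_form \<beta> \<nu> - int_form \<alpha> \<beta>"
    by (simp_all add: int_form_def[of \<beta>] inner_add_right inner_diff_right)
qed

lemma powi_add': "q powi a * (q powi b * x) = q powi (a + b) * x"
  using q0 by (simp add: power_int_add)

lemma rK_rKI: "rK \<alpha> (rKI \<alpha> f) = f" "rKI \<alpha> (rK \<alpha> f) = f"
  using q0 by (auto simp: rK_def rKI_def fun_eq_iff power_int_minus)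

lemma rK_commute: "rK \<alpha> (rK \<beta> f) = rK \<beta> (rK \<alpha> f)" "rK \<alpha> (rKI \<beta> f) = rKI \<beta> (rK \<alpha> f)"
  "rKI \<alpha> (rKI \<beta> f) = rKI \<beta> (rKI \<alpha> f)"
  by (auto simp: rK_def rKI_def fun_eq_iff algebra_simps)

lemma rF_rK: "rF \<beta> (rK \<alpha> f) = (\<lambda>x. q powi (- int_form \<alpha> \<beta>) * rK \<alpha> (rF \<beta> f) x)"
  "rF \<beta> (rKI \<alpha> f) = (\<lambda>x. q powi (int_form \<alpha> \<beta>) * rKI \<alpha> (rF \<beta> f) x)"
  by (auto simp: fun_eq_iff powi_add' algebra_simps)

lemma rE_rK:
  assumes \<alpha>: "\<alpha> \<in> B" and \<beta>: "\<beta> \<in> B"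
  shows "rE \<beta> (rK \<alpha> f) = (\<lambda>x. q powi (int_form \<alpha> \<beta>) * rK \<alpha> (rE \<beta> f) x)"
    "rE \<beta> (rKI \<alpha> f) = (\<lambda>x. q powi (- int_form \<alpha> \<beta>) * rKI \<alpha> (rE \<beta> f) x)"
proof -
  have sh: "(if \<beta> = \<delta> then x else 0) * q powi (int_form \<alpha> \<beta>) = (if \<beta> = \<delta> then x else 0) * q powi (int_form \<alpha> \<delta>)" for x \<delta>
    by simp
  have "rE \<beta> (rK \<alpha> f) (w, \<nu>, z) = q powi (int_form \<alpha> \<beta>) * rK \<alpha> (rE \<beta> f) (w, \<nu>, z)" for w \<nu> z
  proof (induction w arbitrary: f)
    case Nil
    then show ?case using \<alpha> \<beta> by (simp add: int_form_shift powi_add')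
  next
    case (Cons \<delta> w)
    have 1: "rE \<beta> (rF \<delta> (rK \<alpha> f)) (w, \<nu>, z) =
        q powi (int_form \<alpha> \<beta> - int_form \<alpha> \<delta> - lform \<alpha> w) * rE \<beta> (rF \<delta> f) (w, \<nu> + \<alpha>, z)"
      unfolding rF_rK lin_op_scale[OF lin_rE] by (simp add: Cons powi_add' algebra_simps)
    have 2: "(rK \<beta> (rK \<alpha> f) (w, \<nu>, z) - rKI \<beta> (rK \<alpha> f) (w, \<nu>, z)) =
        q powi (- lform \<alpha> w) * (rK \<beta> f (w, \<nu> + \<alpha>, z) - rKI \<beta> f (w, \<nu> + \<alpha>, z))"
      by (simp add: algebra_simps)
    show ?case
    proof (cases "\<beta> = \<delta>")
      case True
      then show ?thesis unfolding rE_Cons 1 2 rK_apply powi_add' distrib_left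
        by (simp add: powi_add' algebra_simps)
    next
      case False
      then show ?thesis unfolding rE_Cons 1 rK_apply powi_add' by (simp add: algebra_simps)
    qed
  qed
  then show "rE \<beta> (rK \<alpha> f) = (\<lambda>x. q powi (int_form \<alpha> \<beta>) * rK \<alpha> (rE \<beta> f) x)" by auto
  have "rE \<beta> (rKI \<alpha> f) (w, \<nu>, z) = q powi (- int_form \<alpha> \<beta>) * rKI \<alpha> (rE \<beta> f) (w, \<nu>, z)" for w \<nu> z
  proof (induction w arbitrary: f)
    case Nil
    then show ?case using \<alpha> \<beta> by (simp add: int_form_shift powi_add')
  next
    case (Cons \<delta> w)
    have 1: "rE \<beta> (rF \<delta> (rKI \<alpha> f)) (w, \<nu>, z) =
        q powi (- int_form \<alpha> \<beta> + int_form \<alpha> \<delta> + lform \<alpha> w) * rE \<beta> (rF \<delta> f) (w, \<nu> - \<alpha>, z)"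
      unfolding rF_rK lin_op_scale[OF lin_rE] by (simp add: Cons powi_add' algebra_simps)
    have 2: "(rK \<beta> (rKI \<alpha> f) (w, \<nu>, z) - rKI \<beta> (rKI \<alpha> f) (w, \<nu>, z)) =
        q powi (lform \<alpha> w) * (rK \<beta> f (w, \<nu> - \<alpha>, z) - rKI \<beta> f (w, \<nu> - \<alpha>, z))"
      by (simp add: algebra_simps)
    show ?case
    proof (cases "\<beta> = \<delta>")
      case True
      then show ?thesis unfolding rE_Cons 1 2 rKI_apply powi_add' distrib_left
        by (simp add: powi_add' algebra_simps)
    next
      case False
      then show ?thesis unfolding rE_Cons 1 rKI_apply powi_add' by (simp add: algebra_simps)
    qed
  qed
  then show "rE \<beta> (rKI \<alpha> f) = (\<lambda>x. q powi (- int_form \<alpha> \<beta>) * rKI \<alpha> (rE \<beta> f) x)" by auto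
qed

lemma rF_rE_same: "rF \<alpha> (rE \<alpha> f) = (\<lambda>x. rE \<alpha> (rF \<alpha> f) x + (rK \<alpha> f x - rKI \<alpha> f x) / (q_root q \<alpha> - inverse (q_root q \<alpha>)))"
  by (auto simp: rE_Cons fun_eq_iff)

lemma rF_rE_diff: "\<alpha> \<noteq> \<beta> \<Longrightarrow> rF \<beta> (rE \<alpha> f) = rE \<alpha> (rF \<beta> f)"
  by (auto simp: rE_Cons fun_eq_iff)

primrec rgen :: "'a qgen \<Rightarrow> 'a rfun \<Rightarrow> 'a rfun" where
  "rgen (gE \<alpha>) = rE \<alpha>" | "rgen (gF \<alpha>) = rF \<alpha>" | "rgen (gK \<alpha>) = rK \<alpha>" | "rgen (gKI \<alpha>) = rKI \<alpha>"

lemma lin_rgen: "lin_op (rgen g)"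
  by (cases g) (simp_all add: lin_rE lin_rF lin_rK lin_rKI)

definition ract :: "'a qgen list \<Rightarrow> 'a rfun \<Rightarrow> 'a rfun" where "ract w = fold rgen w"

lemma ract_simps [simp]: "ract [] f = f" "ract (g # w) f = ract w (rgen g f)" "ract (v @ w) f = ract w (ract v f)"
  "ract (replicate n g) f = (rgen g ^^ n) f"
  by (simp_all add: ract_def fold_replicate)

lemma lin_ract: "lin_op (ract w)"
  by (induction w) (auto simp: lin_op_def ract_def lin_op_D[OF lin_rgen])

subsection \<open>Serre elements\<close>

text \<open>Degree, coefficients and words of the quantum Serre element, and the corresponding operators.\<close>

abbreviation "serre_n \<alpha> \<beta> \<equiv> nat (1 - cartan \<alpha> \<beta>)"
abbreviation "serre_c \<alpha> \<beta> k \<equiv> (- 1) ^ k * qbinom (q_root q \<alpha>) (serre_n \<alpha> \<beta>) k"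
abbreviation "serre_w \<alpha> \<beta> k \<equiv> replicate (serre_n \<alpha> \<beta> - k) \<alpha> @ [\<beta>] @ replicate k \<alpha>"
abbreviation "serre_opF \<alpha> \<beta> \<equiv> serre_op (q_root q \<alpha>) (serre_n \<alpha> \<beta>) (rF \<alpha>) (rF \<beta>)"
abbreviation "serre_opE \<alpha> \<beta> \<equiv> serre_op (q_root q \<alpha>) (serre_n \<alpha> \<beta>) (rE \<alpha>) (rE \<beta>)"

lemma q_param_root: "\<alpha> \<in> B \<Longrightarrow> q_param (q_root q \<alpha>)"
  by unfold_locales (auto simp: q_root_nonzero q_root_not_root)

lemma int_form_powers:
  assumes "\<alpha> \<in> B" "\<beta> \<in> B" "\<alpha> \<noteq> \<beta>"
  shows "q powi (- int_form \<alpha> \<beta>) = q_root q \<alpha> ^ (serre_n \<alpha> \<beta> - 1)" "q powi (int_form \<alpha> \<beta>) = inverse (q_root q \<alpha>) ^ (serre_n \<alpha> \<beta> - 1)"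
    "q powi (- int_form \<alpha> \<alpha>) = inverse (q_root q \<alpha>) ^ 2" "q powi (int_form \<alpha> \<alpha>) = q_root q \<alpha> ^ 2" "serre_n \<alpha> \<beta> \<ge> 1"
proof -
  have c: "cartan \<alpha> \<beta> \<le> 0" by (rule cartan_nonpos[OF assms])
  have "q powi (- int_form \<alpha> \<beta>) = q_root q \<alpha> powi (- cartan \<alpha> \<beta>)"
    using q_int_form[OF assms(1,2)] by (simp add: power_int_minus)
  moreover have "- cartan \<alpha> \<beta> = int (serre_n \<alpha> \<beta> - 1)" using c by simp
  ultimately show *: "q powi (- int_form \<alpha> \<beta>) = q_root q \<alpha> ^ (serre_n \<alpha> \<beta> - 1)" by (simp only: power_int_of_nat)
  then show "q powi (int_form \<alpha> \<beta>) = inverse (q_root q \<alpha>) ^ (serre_n \<alpha> \<beta> - 1)"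
    unfolding power_inverse *[symmetric] by (simp add: power_int_minus)
  show **: "q powi (int_form \<alpha> \<alpha>) = q_root q \<alpha> ^ 2"
    using q_int_form[OF assms(1,1)] cartan_same[OF assms(1)] by simp
  then show "q powi (- int_form \<alpha> \<alpha>) = inverse (q_root q \<alpha>) ^ 2" by (simp add: power_int_minus power_inverse)
  show "serre_n \<alpha> \<beta> \<ge> 1" using c by simp
qed

lemma serreF_commute:
  assumes B: "\<alpha> \<in> B" "\<beta> \<in> B" "\<gamma> \<in> B" and n: "\<alpha> \<noteq> \<beta>"
  shows "serre_opF \<alpha> \<beta> (rE \<gamma> f) = rE \<gamma> (serre_opF \<alpha> \<beta> f)"
proof -
  interpret q_param "q_root q \<alpha>" by (rule q_param_root[OF B(1)])
  note p = int_form_powers[OF B(1,2) n] and p' = int_form_powers[OF B(1,2) n, unfolded int_form_commute[of \<alpha> \<beta>]]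
  consider "\<gamma> = \<alpha>" | "\<gamma> = \<beta>" | "\<gamma> \<noteq> \<alpha>" "\<gamma> \<noteq> \<beta>" by blast
  then show ?thesis
  proof cases
    case 1
    show ?thesis unfolding 1
      by (rule serre_op_commute_alpha[where K = "rK \<alpha>" and L = "rKI \<alpha>" and d = "q_root q \<alpha> - inverse (q_root q \<alpha>)",
           OF lin_rE lin_rF lin_rF lin_rK lin_rKI p(5)])
         (simp_all only: rF_rE_diff[OF n] rF_rE_same rF_rK p)
  next
    case 2
    show ?thesis unfolding 2
      by (rule serre_op_commute_beta[where K = "rK \<beta>" and L = "rKI \<beta>" and d = "q_root q \<beta> - inverse (q_root q \<beta>)",
           OF lin_rE lin_rF lin_rF lin_rK lin_rKI p(5)])
         (simp_all only: rF_rE_diff[OF n[symmetric]] rF_rE_same rF_rK p')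
  next
    case 3
    show ?thesis by (rule serre_op_commute_other[OF lin_rE]) (simp_all only: rF_rE_diff[OF 3(1)] rF_rE_diff[OF 3(2)])
  qed
qed

lemma rE_rF_same: "rE \<alpha> (rF \<alpha> f) = (\<lambda>x. rF \<alpha> (rE \<alpha> f) x + (rKI \<alpha> f x - rK \<alpha> f x) / (q_root q \<alpha> - inverse (q_root q \<alpha>)))"
  unfolding rF_rE_same by (simp add: divide_inverse algebra_simps)

lemma serreE_commute:
  assumes B: "\<alpha> \<in> B" "\<beta> \<in> B" and n: "\<alpha> \<noteq> \<beta>"
  shows "serre_opE \<alpha> \<beta> (rF \<gamma> f) = rF \<gamma> (serre_opE \<alpha> \<beta> f)"
proof -
  interpret q_param "q_root q \<alpha>" by (rule q_param_root[OF B(1)])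
  note p = int_form_powers[OF B(1,2) n] and p' = int_form_powers[OF B(1,2) n, unfolded int_form_commute[of \<alpha> \<beta>]]
  consider "\<gamma> = \<alpha>" | "\<gamma> = \<beta>" | "\<gamma> \<noteq> \<alpha>" "\<gamma> \<noteq> \<beta>" by blast
  then show ?thesis
  proof cases
    case 1
    show ?thesis unfolding 1
      by (rule serre_op_commute_alpha[where K = "rKI \<alpha>" and L = "rK \<alpha>" and d = "q_root q \<alpha> - inverse (q_root q \<alpha>)",
           OF lin_rF lin_rE lin_rE lin_rKI lin_rK p(5)])
         (simp_all only: rF_rE_diff[OF n[symmetric]] rE_rF_same rE_rK B p)
  next
    case 2
    show ?thesis unfolding 2
      by (rule serre_op_commute_beta[where K = "rKI \<beta>" and L = "rK \<beta>" and d = "q_root q \<beta> - inverse (q_root q \<beta>)",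
           OF lin_rF lin_rE lin_rE lin_rKI lin_rK p(5)])
         (simp_all only: rF_rE_diff[OF n] rE_rF_same rE_rK B p')
  next
    case 3
    show ?thesis
      by (rule serre_op_commute_other[OF lin_rF]) (simp_all only: rF_rE_diff[OF 3(1)[symmetric]] rF_rE_diff[OF 3(2)[symmetric]])
  qed
qed

text \<open>The functionals that vanish on all multiples of Serre elements in the \<open>F\<close>-word and in the \<open>E\<close>-word.
  On these the Serre relations hold as well; they form a submodule since each generator commutes with
  the Serre elements of the opposite kind.\<close>

definition serre_funs :: "'a rfun set" where
  "serre_funs = {f. \<forall>\<alpha>\<in>B. \<forall>\<beta>\<in>B - {\<alpha>}.
     (\<forall>w w' p. (\<Sum>k\<le>serre_n \<alpha> \<beta>. serre_c \<alpha> \<beta> k * f (w @ serre_w \<alpha> \<beta> k @ w', p)) = 0) \<and>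
     (\<forall>w \<nu> z z'. (\<Sum>k\<le>serre_n \<alpha> \<beta>. serre_c \<alpha> \<beta> k * f (w, \<nu>, z @ serre_w \<alpha> \<beta> k @ z')) = 0)}"

lemma serre_funsI:
  assumes "\<And>\<alpha> \<beta> w w' p. \<alpha> \<in> B \<Longrightarrow> \<beta> \<in> B \<Longrightarrow> \<alpha> \<noteq> \<beta> \<Longrightarrow> (\<Sum>k\<le>serre_n \<alpha> \<beta>. serre_c \<alpha> \<beta> k * f (w @ serre_w \<alpha> \<beta> k @ w', p)) = 0"
    and "\<And>\<alpha> \<beta> w \<nu> z z'. \<alpha> \<in> B \<Longrightarrow> \<beta> \<in> B \<Longrightarrow> \<alpha> \<noteq> \<beta> \<Longrightarrow> (\<Sum>k\<le>serre_n \<alpha> \<beta>. serre_c \<alpha> \<beta> k * f (w, \<nu>, z @ serre_w \<alpha> \<beta> k @ z')) = 0"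
  shows "f \<in> serre_funs"
  unfolding serre_funs_def mem_Collect_eq using assms by (intro ballI conjI allI) blast+

lemma serre_funsD:
  assumes "f \<in> serre_funs" "\<alpha> \<in> B" "\<beta> \<in> B" "\<alpha> \<noteq> \<beta>"
  shows "(\<Sum>k\<le>serre_n \<alpha> \<beta>. serre_c \<alpha> \<beta> k * f (w @ serre_w \<alpha> \<beta> k @ w', p)) = 0"
    "(\<Sum>k\<le>serre_n \<alpha> \<beta>. serre_c \<alpha> \<beta> k * f (w, \<nu>, z @ serre_w \<alpha> \<beta> k @ z')) = 0"
proof -
  have "\<beta> \<in> B - {\<alpha>}" using assms by simp
  then have "(\<forall>w w' p. (\<Sum>k\<le>serre_n \<alpha> \<beta>. serre_c \<alpha> \<beta> k * f (w @ serre_w \<alpha> \<beta> k @ w', p)) = 0) \<and>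
     (\<forall>w \<nu> z z'. (\<Sum>k\<le>serre_n \<alpha> \<beta>. serre_c \<alpha> \<beta> k * f (w, \<nu>, z @ serre_w \<alpha> \<beta> k @ z')) = 0)"
    using assms(1,2) unfolding serre_funs_def by blast
  then show "(\<Sum>k\<le>serre_n \<alpha> \<beta>. serre_c \<alpha> \<beta> k * f (w @ serre_w \<alpha> \<beta> k @ w', p)) = 0"
    "(\<Sum>k\<le>serre_n \<alpha> \<beta>. serre_c \<alpha> \<beta> k * f (w, \<nu>, z @ serre_w \<alpha> \<beta> k @ z')) = 0" by blast+
qed

lemma serre_funs_lin:
  assumes "f \<in> serre_funs" "g \<in> serre_funs" shows "(\<lambda>x. a * f x + b * g x) \<in> serre_funs"
proof (rule serre_funsI)
  fix \<alpha> \<beta> w w' p \<nu> z z' assume *: "\<alpha> \<in> B" "\<beta> \<in> B" "\<alpha> \<noteq> \<beta>"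
  have "(\<Sum>k\<le>serre_n \<alpha> \<beta>. serre_c \<alpha> \<beta> k * (a * F k + b * G k)) =
      a * (\<Sum>k\<le>serre_n \<alpha> \<beta>. serre_c \<alpha> \<beta> k * F k) + b * (\<Sum>k\<le>serre_n \<alpha> \<beta>. serre_c \<alpha> \<beta> k * G k)" for F G
    unfolding sum_distrib_left sum.distrib[symmetric] by (intro sum.cong refl) (simp add: algebra_simps)
  then show "(\<Sum>k\<le>serre_n \<alpha> \<beta>. serre_c \<alpha> \<beta> k * (a * f (w @ serre_w \<alpha> \<beta> k @ w', p) + b * g (w @ serre_w \<alpha> \<beta> k @ w', p))) = 0"
    "(\<Sum>k\<le>serre_n \<alpha> \<beta>. serre_c \<alpha> \<beta> k * (a * f (w, \<nu>, z @ serre_w \<alpha> \<beta> k @ z') + b * g (w, \<nu>, z @ serre_w \<alpha> \<beta> k @ z'))) = 0"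
    by (simp_all only: serre_funsD[OF assms(1) *] serre_funsD[OF assms(2) *]) simp_all
qed

lemma rF_serre_funs: assumes "f \<in> serre_funs" shows "rF \<gamma> f \<in> serre_funs"
proof (rule serre_funsI)
  fix \<alpha> \<beta> w w' p \<nu> z z' assume *: "\<alpha> \<in> B" "\<beta> \<in> B" "\<alpha> \<noteq> \<beta>"
  show "(\<Sum>k\<le>serre_n \<alpha> \<beta>. serre_c \<alpha> \<beta> k * rF \<gamma> f (w @ serre_w \<alpha> \<beta> k @ w', p)) = 0"
    using serre_funsD(1)[OF assms *, of "\<gamma> # w"] by simp
  show "(\<Sum>k\<le>serre_n \<alpha> \<beta>. serre_c \<alpha> \<beta> k * rF \<gamma> f (w, \<nu>, z @ serre_w \<alpha> \<beta> k @ z')) = 0"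
    using serre_funsD(2)[OF assms *, of "\<gamma> # w"] by simp
qed

lemma sum_factor: "(\<And>k. k \<le> n \<Longrightarrow> F k = c * G k) \<Longrightarrow> (\<Sum>k\<le>n. a k * G k) = 0 \<Longrightarrow> (\<Sum>k\<le>n. a k * F k) = (0::complex)"
proof -
  assume *: "\<And>k. k \<le> n \<Longrightarrow> F k = c * G k" "(\<Sum>k\<le>n. a k * G k) = 0"
  have "(\<Sum>k\<le>n. a k * F k) = c * (\<Sum>k\<le>n. a k * G k)" using *(1) by (simp add: sum_distrib_left mult_ac)
  then show ?thesis using * by simp
qed

lemma lform_serre_w: "k \<le> serre_n \<alpha> \<beta> \<Longrightarrow> lform \<gamma> (serre_w \<alpha> \<beta> k) = int (serre_n \<alpha> \<beta>) * int_form \<gamma> \<alpha> + int_form \<gamma> \<beta>"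
proof -
  assume "k \<le> serre_n \<alpha> \<beta>"
  then have "int (serre_n \<alpha> \<beta>) = int (serre_n \<alpha> \<beta> - k) + int k" by simp
  then show ?thesis by (simp only: lform_simps) (simp add: algebra_simps del: int_nat_eq of_nat_diff)
qed

lemma lform_serre_w_context: "k \<le> serre_n \<alpha> \<beta> \<Longrightarrow>
    lform \<gamma> (w @ serre_w \<alpha> \<beta> k @ w') = lform \<gamma> w + ((int (serre_n \<alpha> \<beta>) * int_form \<gamma> \<alpha> + int_form \<gamma> \<beta>) + lform \<gamma> w')"
  by (simp only: lform_simps(3)[of \<gamma> w] lform_simps(3)[of \<gamma> "serre_w \<alpha> \<beta> k"] lform_serre_w)

lemma rK_serre_funs: assumes "f \<in> serre_funs" shows "rK \<gamma> f \<in> serre_funs" "rKI \<gamma> f \<in> serre_funs"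
proof -
  show "rK \<gamma> f \<in> serre_funs"
  proof (rule serre_funsI)
    fix \<alpha> \<beta> w w' z z' and \<nu> :: 'a and p :: "'a \<times> 'a list" assume *: "\<alpha> \<in> B" "\<beta> \<in> B" "\<alpha> \<noteq> \<beta>"
    let ?c = "q powi (- (lform \<gamma> w + ((int (serre_n \<alpha> \<beta>) * int_form \<gamma> \<alpha> + int_form \<gamma> \<beta>) + lform \<gamma> w')))"
    obtain \<nu>' y where p: "p = (\<nu>', y)" by (cases p)
    show "(\<Sum>k\<le>serre_n \<alpha> \<beta>. serre_c \<alpha> \<beta> k * rK \<gamma> f (w @ serre_w \<alpha> \<beta> k @ w', p)) = 0"
      by (rule sum_factor[where c = ?c, OF _ serre_funsD(1)[OF assms *, of w w' "(\<nu>' + \<gamma>, y)"]])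
         (simp only: p rK_apply lform_serre_w_context)
    show "(\<Sum>k\<le>serre_n \<alpha> \<beta>. serre_c \<alpha> \<beta> k * rK \<gamma> f (w, \<nu>, z @ serre_w \<alpha> \<beta> k @ z')) = 0"
      by (rule sum_factor[where c = "q powi (- lform \<gamma> w)", OF _ serre_funsD(2)[OF assms *, of w "\<nu> + \<gamma>"]])
         (simp only: rK_apply)
  qed
  show "rKI \<gamma> f \<in> serre_funs"
  proof (rule serre_funsI)
    fix \<alpha> \<beta> w w' z z' and \<nu> :: 'a and p :: "'a \<times> 'a list" assume *: "\<alpha> \<in> B" "\<beta> \<in> B" "\<alpha> \<noteq> \<beta>"
    let ?c = "q powi (lform \<gamma> w + ((int (serre_n \<alpha> \<beta>) * int_form \<gamma> \<alpha> + int_form \<gamma> \<beta>) + lform \<gamma> w'))"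
    obtain \<nu>' y where p: "p = (\<nu>', y)" by (cases p)
    show "(\<Sum>k\<le>serre_n \<alpha> \<beta>. serre_c \<alpha> \<beta> k * rKI \<gamma> f (w @ serre_w \<alpha> \<beta> k @ w', p)) = 0"
      by (rule sum_factor[where c = ?c, OF _ serre_funsD(1)[OF assms *, of w w' "(\<nu>' - \<gamma>, y)"]])
         (simp only: p rKI_apply lform_serre_w_context)
    show "(\<Sum>k\<le>serre_n \<alpha> \<beta>. serre_c \<alpha> \<beta> k * rKI \<gamma> f (w, \<nu>, z @ serre_w \<alpha> \<beta> k @ z')) = 0"
      by (rule sum_factor[where c = "q powi (lform \<gamma> w)", OF _ serre_funsD(2)[OF assms *, of w "\<nu> - \<gamma>"]])
         (simp only: rKI_apply)
  qed
qed

lemma rF_funpow: "(rF \<alpha> ^^ k) f (w, p) = f (replicate k \<alpha> @ w, p)"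
  by (induction k arbitrary: w) (simp_all add: replicate_app_Cons_same)

lemma serre_opF_apply: "serre_opF \<alpha> \<beta> f (w, p) = (\<Sum>k\<le>serre_n \<alpha> \<beta>. serre_c \<alpha> \<beta> k * f (serre_w \<alpha> \<beta> k @ w, p))"
  unfolding serre_op_def by (simp add: rF_funpow)

lemma serre_opF_zero: "f \<in> serre_funs \<Longrightarrow> \<alpha> \<in> B \<Longrightarrow> \<beta> \<in> B \<Longrightarrow> \<alpha> \<noteq> \<beta> \<Longrightarrow> serre_opF \<alpha> \<beta> f = (\<lambda>x. 0)"
  using serre_funsD(1)[of f \<alpha> \<beta> "[]"] by (auto simp: fun_eq_iff serre_opF_apply)

lemma rE_serre_funs: assumes "f \<in> serre_funs" "\<gamma> \<in> B" shows "rE \<gamma> f \<in> serre_funs"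
proof (rule serre_funsI)
  fix \<alpha> \<beta> assume *: "\<alpha> \<in> B" "\<beta> \<in> B" "\<alpha> \<noteq> \<beta>"
  let ?S = "\<lambda>h. \<Sum>k\<le>serre_n \<alpha> \<beta>. serre_c \<alpha> \<beta> k * h k"
  let ?d = "q_root q \<gamma> - inverse (q_root q \<gamma>)"
  have S_lin: "?S (\<lambda>k. F k + (if c then (G k - H k) / ?d else 0)) = ?S F + (if c then (?S G - ?S H) / ?d else 0)" for F G H c
  proof (cases c)
    case True
    then show ?thesis
      unfolding if_P[OF True] sum_subtractf[symmetric] sum_divide_distrib sum.distrib[symmetric]
      by (intro sum.cong refl) (simp add: divide_inverse algebra_simps)
  qed simp
  show "?S (\<lambda>k. rE \<gamma> f (w @ serre_w \<alpha> \<beta> k @ w', p)) = 0" for w w' p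
    using assms(1)
  proof (induction w arbitrary: f)
    case Nil
    have "serre_opF \<alpha> \<beta> (rE \<gamma> f) = (\<lambda>x. 0)"
      unfolding serreF_commute[OF *(1,2) assms(2) *(3)] serre_opF_zero[OF Nil *] by (rule lin_op_zero[OF lin_rE])
    then show ?case using serre_opF_apply[of \<alpha> \<beta> "rE \<gamma> f" w' p] by simp
  next
    case (Cons \<delta> w)
    show ?case
      unfolding append_Cons[of \<delta> w] rE_Cons S_lin Cons.IH[OF rF_serre_funs[OF Cons.prems]]
        serre_funsD(1)[OF rK_serre_funs(1)[OF Cons.prems] *] serre_funsD(1)[OF rK_serre_funs(2)[OF Cons.prems] *] by simp
  qed
  show "?S (\<lambda>k. rE \<gamma> f (w, \<nu>, z @ serre_w \<alpha> \<beta> k @ z')) = 0" for w \<nu> z z'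
    using assms(1)
  proof (induction w arbitrary: f)
    case Nil
    show ?case
      by (rule sum_factor[where c = "q powi (- int_form \<gamma> \<nu>)", OF _ serre_funsD(2)[OF Nil *, of "[]" \<nu> "\<gamma> # z" z']]) simp
  next
    case (Cons \<delta> w)
    show ?case
      unfolding rE_Cons S_lin Cons.IH[OF rF_serre_funs[OF Cons.prems]]
        serre_funsD(2)[OF rK_serre_funs(1)[OF Cons.prems] *] serre_funsD(2)[OF rK_serre_funs(2)[OF Cons.prems] *] by simp
  qed
qed

lemma rE_funpow_Nil: "(rE \<alpha> ^^ k) f ([], \<nu>, z) = q powi (- int k * int_form \<alpha> \<nu>) * f ([], \<nu>, replicate k \<alpha> @ z)"
  by (induction k arbitrary: z) (simp_all add: replicate_app_Cons_same powi_add' algebra_simps)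

lemma serre_opE_zero:
  assumes "f \<in> serre_funs" "\<alpha> \<in> B" "\<beta> \<in> B" "\<alpha> \<noteq> \<beta>" shows "serre_opE \<alpha> \<beta> f = (\<lambda>x. 0)"
proof -
  have "serre_opE \<alpha> \<beta> f (w, \<nu>, z) = 0" for w \<nu> z
    using assms(1)
  proof (induction w arbitrary: f)
    case Nil
    have e: "(rE \<alpha> ^^ k) (rE \<beta> ((rE \<alpha> ^^ (serre_n \<alpha> \<beta> - k)) f)) ([], \<nu>, z) =
        q powi (- (int (serre_n \<alpha> \<beta>) * int_form \<alpha> \<nu> + int_form \<beta> \<nu>)) * f ([], \<nu>, [] @ serre_w \<alpha> \<beta> k @ z)" if "k \<le> serre_n \<alpha> \<beta>" for k
    proof -
      have i: "int (serre_n \<alpha> \<beta>) = int (serre_n \<alpha> \<beta> - k) + int k" using that by simp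
      have ex: "- x * a + (- b + - y * a) = - ((y + x) * a + b)" for x y a b :: int by (simp add: algebra_simps)
      show ?thesis unfolding i by (simp only: rE_funpow_Nil rE_Nil powi_add' ex append_assoc append_Nil append_Cons)
    qed
    show ?case unfolding serre_op_def
      by (rule sum_factor[OF _ serre_funsD(2)[OF Nil assms(2-4), of "[]" \<nu> "[]" z]]) (rule e)
  next
    case (Cons \<delta> w)
    have "serre_opE \<alpha> \<beta> f (\<delta> # w, \<nu>, z) = rF \<delta> (serre_opE \<alpha> \<beta> f) (w, \<nu>, z)" by simp
    also have "\<dots> = 0" unfolding serreE_commute[OF assms(2-4), symmetric] by (rule Cons.IH[OF rF_serre_funs[OF Cons.prems]])
    finally show ?case .
  qed
  then show ?thesis by (auto simp: fun_eq_iff)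
qed

lemma rgen_serre_funs: "f \<in> serre_funs \<Longrightarrow> g \<in> qgens B \<Longrightarrow> rgen g f \<in> serre_funs"
  by (cases g) (simp_all add: rE_serre_funs rF_serre_funs rK_serre_funs)

lemma ract_serre_funs: "f \<in> serre_funs \<Longrightarrow> set w \<subseteq> qgens B \<Longrightarrow> ract w f \<in> serre_funs"
  by (induction w arbitrary: f) (simp_all add: rgen_serre_funs)

end

context root_data
begin

subsection \<open>The action of the quantized enveloping algebra\<close>

definition ractx :: "('a qgen list \<Rightarrow>\<^sub>0 complex) \<Rightarrow> 'a rfun \<Rightarrow> 'a rfun" where
  "ractx x f = (\<lambda>p. \<Sum>w\<in>Poly_Mapping.keys x. Poly_Mapping.lookup x w * ract w f p)"

lemma ractx_superset:
  "finite W \<Longrightarrow> Poly_Mapping.keys x \<subseteq> W \<Longrightarrow> ractx x f = (\<lambda>p. \<Sum>w\<in>W. Poly_Mapping.lookup x w * ract w f p)"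
  unfolding ractx_def by (intro ext sum.mono_neutral_left) (auto simp: in_keys_iff)

lemma ractx_single: "ractx (Poly_Mapping.single w c) f = (\<lambda>p. c * ract w f p)"
  by (subst ractx_superset[of "{w}"]) auto

lemma ractx_zero: "ractx 0 f = (\<lambda>p. 0)"
  by (simp add: ractx_def)

lemma ractx_add: "ractx (x + y) f = (\<lambda>p. ractx x f p + ractx y f p)"
proof -
  let ?W = "Poly_Mapping.keys x \<union> Poly_Mapping.keys y"
  have "Poly_Mapping.keys (x + y) \<subseteq> ?W" by (rule keys_add)
  then show ?thesis
    by (simp add: ractx_superset[of ?W] lookup_add distrib_right sum.distrib)
qed

lemma ractx_scale: "ractx (pm_scale c x) f = (\<lambda>p. c * ractx x f p)"
  by (subst ractx_superset[OF finite_keys keys_pm_scale]) (simp add: ractx_def sum_distrib_left mult.assoc)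

lemma ractx_diff: "ractx (x - y) f = (\<lambda>p. ractx x f p - ractx y f p)"
  unfolding pm_scale_simps(7)[of x] ractx_add ractx_scale by simp

lemma ractx_sum: "ractx (\<Sum>i\<in>I. F i) f = (\<lambda>p. \<Sum>i\<in>I. ractx (F i) f p)"
  by (induction I rule: infinite_finite_induct) (simp_all add: ractx_zero ractx_add)

lemma ractx_lin: "lin_op (ractx x)"
  unfolding lin_op_def ractx_def lin_op_D[OF lin_ract]
  by (simp add: sum.distrib sum_distrib_left algebra_simps)

lemma ractx_mult:
  assumes "x \<in> carrier (free_alg (qgens B))" "y \<in> carrier (free_alg (qgens B))"
  shows "ractx (x \<otimes>\<^bsub>free_alg (qgens B)\<^esub> y) f = ractx y (ractx x f)"
proof -
  interpret F: calg "free_alg (qgens B)" by (rule free_alg_calg)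
  have x: "Poly_Mapping.keys x \<subseteq> lists (qgens B)" and y: "Poly_Mapping.keys y \<subseteq> lists (qgens B)"
    using assms by (simp_all add: free_alg_simps)
  note d = monoid_alg_mult_distrib[where M = "free_monoid (qgens B)", folded free_alg_def]
  note z = monoid_alg_mult_zero[where M = "free_monoid (qgens B)", folded free_alg_def]
  show ?thesis using y
  proof (induction y rule: poly_mapping_keys_induct)
    case zero
    then show ?case by (simp add: z ractx_zero)
  next
    case (single w c)
    show ?case using x
    proof (induction x rule: poly_mapping_keys_induct)
      case zero
      then show ?case by (simp add: z ractx_zero lin_op_zero[OF ractx_lin])
    next
      case (single v d)
      then show ?case by (simp add: free_alg_simps ractx_single lin_op_scale[OF lin_ract] mult_ac)
    next
      case (add p r)
      then show ?case by (simp add: d ractx_add lin_op_add[OF ractx_lin])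
    qed
  next
    case (add p r)
    then show ?case by (simp add: d ractx_add)
  qed
qed

lemma ractx_serre_funs:
  assumes "x \<in> carrier (free_alg (qgens B))" "f \<in> serre_funs" shows "ractx x f \<in> serre_funs"
proof -
  have x: "Poly_Mapping.keys x \<subseteq> lists (qgens B)" using assms by (simp add: free_alg_simps)
  have zero: "(\<lambda>p. 0) \<in> serre_funs" using serre_funs_lin[OF assms(2,2), of 0 0] by simp
  show ?thesis using x
  proof (induction x rule: poly_mapping_keys_induct)
    case (single w c)
    then have "ract w f \<in> serre_funs" by (intro ract_serre_funs assms) auto
    then show ?case using serre_funs_lin[of "ract w f" "ract w f" c 0] by (simp add: ractx_single)
  next
    case (add p r)
    then show ?case using serre_funs_lin[of "ractx p f" "ractx r f" 1 1] by (simp add: ractx_add)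
  qed (simp add: ractx_zero zero)
qed

lemma ractx_rel:
  assumes r: "r \<in> Uq_rels B q" and f: "f \<in> serre_funs" shows "ractx r f = (\<lambda>p. 0)"
proof -
  have serreF: "ractx (serre_rel q gF \<alpha> \<beta>) f = serre_opF \<alpha> \<beta> f" for \<alpha> \<beta>
    by (simp add: serre_rel_def Let_def ractx_sum ractx_single serre_op_def)
  have serreE: "ractx (serre_rel q gE \<alpha> \<beta>) f = serre_opE \<alpha> \<beta> f" for \<alpha> \<beta>
    by (simp add: serre_rel_def Let_def ractx_sum ractx_single serre_op_def)
  consider (inv) \<alpha> where "\<alpha> \<in> B" "r = wd [gK \<alpha>, gKI \<alpha>] - wd [] \<or> r = wd [gKI \<alpha>, gK \<alpha>] - wd []"
    | (K) \<alpha> \<beta> where "\<alpha> \<in> B" "\<beta> \<in> B" "r = wd [gK \<alpha>, gK \<beta>] - wd [gK \<beta>, gK \<alpha>]"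
    | (KE) \<alpha> \<beta> where "\<alpha> \<in> B" "\<beta> \<in> B" "r = wd [gK \<alpha>, gE \<beta>] - Poly_Mapping.single [gE \<beta>, gK \<alpha>] (q powi int_form \<alpha> \<beta>)"
    | (KF) \<alpha> \<beta> where "\<alpha> \<in> B" "\<beta> \<in> B" "r = wd [gK \<alpha>, gF \<beta>] - Poly_Mapping.single [gF \<beta>, gK \<alpha>] (q powi (- int_form \<alpha> \<beta>))"
    | (EF) \<alpha> \<beta> where "\<alpha> \<in> B" "\<beta> \<in> B" "r = wd [gE \<alpha>, gF \<beta>] - wd [gF \<beta>, gE \<alpha>]
          - (if \<alpha> = \<beta> then
               Poly_Mapping.single [gK \<alpha>] (1 / (q_root q \<alpha> - inverse (q_root q \<alpha>)))
               - Poly_Mapping.single [gKI \<alpha>] (1 / (q_root q \<alpha> - inverse (q_root q \<alpha>)))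
             else 0)"
    | (serre) \<alpha> \<beta> where "\<alpha> \<in> B" "\<beta> \<in> B" "\<alpha> \<noteq> \<beta>" "r = serre_rel q gE \<alpha> \<beta> \<or> r = serre_rel q gF \<alpha> \<beta>"
    using r unfolding Uq_rels_def by blast
  then show ?thesis
  proof cases
    case inv
    then show ?thesis by (elim disjE) (simp_all add: ractx_diff ractx_single rK_rKI)
  next
    case K
    then show ?thesis by (simp add: ractx_diff ractx_single rK_commute(1)[of \<alpha> \<beta>])
  next
    case KE
    then show ?thesis by (simp add: ractx_diff ractx_single rE_rK)
  next
    case KF
    then show ?thesis by (simp add: ractx_diff ractx_single rF_rK)
  next
    case EF
    show ?thesis unfolding EF(3)
      by (cases "\<alpha> = \<beta>") (simp_all add: ractx_diff ractx_single ractx_zero rF_rE_same rF_rE_diff diff_divide_distrib)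
  next
    case serre
    then show ?thesis using f by (elim disjE) (simp_all add: serreE serreF serre_opE_zero serre_opF_zero)
  qed
qed

lemma ractx_ideal:
  assumes "x \<in> Idl\<^bsub>free_alg (qgens B)\<^esub> (Uq_rels B q)" "f \<in> serre_funs" shows "ractx x f = (\<lambda>p. 0)"
proof -
  interpret F: calg "free_alg (qgens B)" by (rule free_alg_calg)
  let ?K = "{x \<in> carrier (free_alg (qgens B)). \<forall>f\<in>serre_funs. ractx x f = (\<lambda>p. 0)}"
  have "ideal ?K (free_alg (qgens B))"
  proof (rule F.idealI)
    show "\<zero>\<^bsub>free_alg (qgens B)\<^esub> \<in> ?K" by (simp add: free_alg_simps ractx_zero)
    show "x \<oplus>\<^bsub>free_alg (qgens B)\<^esub> y \<in> ?K" if "x \<in> ?K" "y \<in> ?K" for x y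
    proof -
      have "x \<oplus>\<^bsub>free_alg (qgens B)\<^esub> y \<in> carrier (free_alg (qgens B))" using that by blast
      then show ?thesis using that by (simp add: free_alg_simps(4) ractx_add)
    qed
    show "x \<otimes>\<^bsub>free_alg (qgens B)\<^esub> y \<in> ?K" if "x \<in> ?K" "y \<in> carrier (free_alg (qgens B))" for x y
      using that by (simp add: ractx_mult lin_op_zero[OF ractx_lin])
    show "y \<otimes>\<^bsub>free_alg (qgens B)\<^esub> x \<in> ?K" if "x \<in> ?K" "y \<in> carrier (free_alg (qgens B))" for x y
      using that by (simp add: ractx_mult ractx_serre_funs)
  qed blast
  moreover have "Uq_rels B q \<subseteq> ?K" using Uq_rels_carrier ractx_rel by blast
  ultimately have "Idl\<^bsub>free_alg (qgens B)\<^esub> (Uq_rels B q) \<subseteq> ?K" by (rule F.genideal_minimal)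
  then show ?thesis using assms by blast
qed

text \<open>All representatives of \<open>a\<close> act in the same way on \<open>serre_funs\<close>, because the relations act by zero there.\<close>

definition uact :: "'a uq \<Rightarrow> 'a rfun \<Rightarrow> 'a rfun" where
  "uact a f = ractx (SOME x. x \<in> carrier (free_alg (qgens B)) \<and> proj x = a) f"

lemma uact_proj:
  assumes x: "x \<in> carrier (free_alg (qgens B))" and f: "f \<in> serre_funs" shows "uact (proj x) f = ractx x f"
proof -
  interpret F: calg "free_alg (qgens B)" by (rule free_alg_calg)
  define y where "y = (SOME y. y \<in> carrier (free_alg (qgens B)) \<and> proj y = proj x)"
  have y: "y \<in> carrier (free_alg (qgens B))" "proj y = proj x"
    unfolding y_def using someI[of "\<lambda>y. y \<in> carrier (free_alg (qgens B)) \<and> proj y = proj x" x] x by blast+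
  then have "y \<ominus>\<^bsub>free_alg (qgens B)\<^esub> x \<in> Idl\<^bsub>free_alg (qgens B)\<^esub> (Uq_rels B q)"
    using F.ideal_coset_eq[OF rel_ideal y(1) x] by simp
  moreover have "y \<ominus>\<^bsub>free_alg (qgens B)\<^esub> x = y - x"
    unfolding F.minus_smult[OF y(1) x] by (simp only: free_alg_simps pm_scale_simps(7)[of y])
  ultimately have "ractx (y - x) f = (\<lambda>p. 0)" using ractx_ideal f by simp
  then have "ractx y f = ractx x f" by (simp add: ractx_diff fun_eq_iff)
  then show ?thesis by (simp add: uact_def y_def)
qed

lemma U_rep: assumes "a \<in> carrier U" obtains x where "x \<in> carrier (free_alg (qgens B))" "a = proj x"
  using assms presented_carrier by (auto simp: U_eq)

lemma proj_U_hom: "proj \<in> alg_hom (free_alg (qgens B)) U"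
  using proj_hom by (simp add: U_eq)

lemma uact_closed: "a \<in> carrier U \<Longrightarrow> f \<in> serre_funs \<Longrightarrow> uact a f \<in> serre_funs"
  by (erule U_rep) (simp add: uact_proj ractx_serre_funs)

lemma uact_mult:
  assumes "a \<in> carrier U" "b \<in> carrier U" "f \<in> serre_funs" shows "uact (a \<otimes>\<^bsub>U\<^esub> b) f = uact b (uact a f)"
proof -
  interpret F: calg "free_alg (qgens B)" by (rule free_alg_calg)
  obtain x where x: "x \<in> carrier (free_alg (qgens B))" "a = proj x" using assms(1) by (rule U_rep)
  obtain y where y: "y \<in> carrier (free_alg (qgens B))" "b = proj y" using assms(2) by (rule U_rep)
  have "a \<otimes>\<^bsub>U\<^esub> b = proj (x \<otimes>\<^bsub>free_alg (qgens B)\<^esub> y)" unfolding x(2) y(2) using alg_homD(5)[OF proj_U_hom x(1) y(1)] by simp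
  then show ?thesis using x y assms(3) by (simp add: uact_proj ractx_serre_funs ractx_mult)
qed

lemma uact_add:
  assumes "a \<in> carrier U" "b \<in> carrier U" "f \<in> serre_funs" shows "uact (a \<oplus>\<^bsub>U\<^esub> b) f = (\<lambda>p. uact a f p + uact b f p)"
proof -
  interpret F: calg "free_alg (qgens B)" by (rule free_alg_calg)
  obtain x where x: "x \<in> carrier (free_alg (qgens B))" "a = proj x" using assms(1) by (rule U_rep)
  obtain y where y: "y \<in> carrier (free_alg (qgens B))" "b = proj y" using assms(2) by (rule U_rep)
  have "a \<oplus>\<^bsub>U\<^esub> b = proj (x \<oplus>\<^bsub>free_alg (qgens B)\<^esub> y)" unfolding x(2) y(2) using alg_homD(3)[OF proj_U_hom x(1) y(1)] by simp
  then have "uact (a \<oplus>\<^bsub>U\<^esub> b) f = ractx (x \<oplus>\<^bsub>free_alg (qgens B)\<^esub> y) f" using x y assms(3) by (simp add: uact_proj)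
  then show ?thesis using x y assms(3) by (simp add: uact_proj free_alg_simps(4) ractx_add)
qed

lemma uact_smult:
  assumes "a \<in> carrier U" "f \<in> serre_funs" shows "uact (c \<odot>\<^bsub>U\<^esub> a) f = (\<lambda>p. c * uact a f p)"
proof -
  interpret F: calg "free_alg (qgens B)" by (rule free_alg_calg)
  obtain x where x: "x \<in> carrier (free_alg (qgens B))" "a = proj x" using assms(1) by (rule U_rep)
  have "c \<odot>\<^bsub>U\<^esub> a = proj (c \<odot>\<^bsub>free_alg (qgens B)\<^esub> x)" unfolding x(2) using alg_homD(4)[OF proj_U_hom x(1)] by simp
  then have "uact (c \<odot>\<^bsub>U\<^esub> a) f = ractx (c \<odot>\<^bsub>free_alg (qgens B)\<^esub> x) f" using x assms(2) by (simp add: uact_proj)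
  then show ?thesis using x assms(2) by (simp add: uact_proj free_alg_simps(5) ractx_scale)
qed

lemma uact_word: "set w \<subseteq> qgens B \<Longrightarrow> f \<in> serre_funs \<Longrightarrow> uact (u w) f = ract w f"
proof -
  assume w: "set w \<subseteq> qgens B" and f: "f \<in> serre_funs"
  have "u w = proj (wd w)" by (simp add: u_eq presented_word_def)
  then show ?thesis using uact_proj[OF free_alg_single[OF w] f, of 1] by (simp add: ractx_single)
qed

lemma uact_one: "f \<in> serre_funs \<Longrightarrow> uact \<one>\<^bsub>U\<^esub> f = f"
  using uact_word[of "[]"] by (simp add: u_Nil)

lemma uact_zero: "f \<in> serre_funs \<Longrightarrow> uact \<zero>\<^bsub>U\<^esub> f = (\<lambda>p. 0)"
  using uact_smult[of "\<zero>\<^bsub>U\<^esub>" f 0] by simp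

lemma uact_K_elt:
  assumes "\<mu> \<in> root_lattice B" "f \<in> serre_funs"
  shows "uact (K_elt B q \<mu>) f ([], \<nu>, z) = f ([], \<nu> + \<mu>, z)"
    "(\<And>\<nu>. f (w, \<nu>, z) = 0) \<Longrightarrow> uact (K_elt B q \<mu>) f (w, \<nu>, z) = 0"
proof -
  obtain k where k: "set k \<subseteq> Kgens" "torus_wt k = \<mu>" "K_elt B q \<mu> = u k" by (rule K_elt_word[OF assms(1)])
  have kq: "set k \<subseteq> qgens B" using k(1) Kgens_qgens by auto
  have "ract k f ([], \<nu>, z) = f ([], \<nu> + torus_wt k, z)" for \<nu> using k(1)
  proof (induction k arbitrary: f)
    case (Cons g k)
    then show ?case by (auto simp: Kgens_def algebra_simps)
  qed simp
  then show "uact (K_elt B q \<mu>) f ([], \<nu>, z) = f ([], \<nu> + \<mu>, z)"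
    using k uact_word[OF kq assms(2)] by simp
  assume "\<And>\<nu>. f (w, \<nu>, z) = 0"
  then have "ract k f (w, \<nu>, z) = 0" for \<nu> using k(1)
  proof (induction k arbitrary: f \<nu>)
    case (Cons g k)
    then show ?case by (auto simp: Kgens_def intro!: Cons.IH)
  qed simp
  then show "uact (K_elt B q \<mu>) f (w, \<nu>, z) = 0" using k uact_word[OF kq assms(2)] by simp
qed

subsection \<open>Dual functions\<close>

text \<open>For pairwise orthogonal roots the order of the letters is irrelevant in \<open>U\<close>, so these functions
  only look at the multisets of letters.\<close>

definition dual_fun :: "'a multiset \<Rightarrow> 'a \<Rightarrow> 'a multiset \<Rightarrow> 'a rfun" where
  "dual_fun A \<nu>0 M = (\<lambda>(w, \<nu>, z). if mset w = A \<and> \<nu> = \<nu>0 \<and> mset z = M then 1 else 0)"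

text \<open>A Serre element in two orthogonal letters is a commutator, both of whose terms have the same letters.
  A Serre element with a letter outside \<open>S\<close> only has terms on which the function is zero.\<close>

lemma dual_fun_serre:
  assumes S: "S \<subseteq> B" "\<And>\<alpha> \<beta>. \<alpha> \<in> S \<Longrightarrow> \<beta> \<in> S \<Longrightarrow> \<alpha> \<noteq> \<beta> \<Longrightarrow> \<alpha> \<bullet> \<beta> = 0"
    and A: "set_mset A \<subseteq> S" and M: "set_mset M \<subseteq> S"
  shows "dual_fun A \<nu>0 M \<in> serre_funs"
proof -
  have key: "(\<Sum>k\<le>serre_n \<alpha> \<beta>. serre_c \<alpha> \<beta> k * (if mset (w @ serre_w \<alpha> \<beta> k @ w') = A then c else 0)) = 0"
    if *: "\<alpha> \<in> B" "\<beta> \<in> B" "\<alpha> \<noteq> \<beta>" and A: "set_mset A \<subseteq> S" for \<alpha> \<beta> w w' A c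
  proof (cases "\<alpha> \<in> S \<and> \<beta> \<in> S")
    case True
    then have "cartan \<alpha> \<beta> = 0" using S(2)[of \<alpha> \<beta>] * by (simp add: cartan_def)
    moreover have "qnum (q_root q \<alpha>) (Suc 0) = 1" using q_root_diff[OF *(1)] by (simp add: qnum_def)
    ultimately show ?thesis by (simp add: qbinom_def qfact_def)
  next
    case False
    have "mset (w @ serre_w \<alpha> \<beta> k @ w') \<noteq> A" if k: "k \<le> serre_n \<alpha> \<beta>" for k
    proof
      assume eq: "mset (w @ serre_w \<alpha> \<beta> k @ w') = A"
      have "serre_n \<alpha> \<beta> \<ge> 1" by (rule int_form_powers(5)[OF *])
      then have "\<alpha> \<in> set (w @ serre_w \<alpha> \<beta> k @ w')" "\<beta> \<in> set (w @ serre_w \<alpha> \<beta> k @ w')"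
        using k by (auto simp del: of_nat_diff)
      then have "\<alpha> \<in># A" "\<beta> \<in># A" unfolding eq[symmetric] by (simp_all only: set_mset_mset)
      then show False using A False by blast
    qed
    then show ?thesis by (intro sum.neutral) (simp del: mset_append)
  qed
  show ?thesis
  proof (rule serre_funsI)
    fix \<alpha> \<beta> w w' z z' and \<nu> :: 'a and p :: "'a \<times> 'a list" assume *: "\<alpha> \<in> B" "\<beta> \<in> B" "\<alpha> \<noteq> \<beta>"
    show "(\<Sum>k\<le>serre_n \<alpha> \<beta>. serre_c \<alpha> \<beta> k * dual_fun A \<nu>0 M (w @ serre_w \<alpha> \<beta> k @ w', p)) = 0"
    proof -
      have "dual_fun A \<nu>0 M (v, p) = (if mset v = A then if fst p = \<nu>0 \<and> mset (snd p) = M then 1 else 0 else 0)" for v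
        by (cases p) (simp add: dual_fun_def)
      then show ?thesis by (simp only: key[OF * A])
    qed
    show "(\<Sum>k\<le>serre_n \<alpha> \<beta>. serre_c \<alpha> \<beta> k * dual_fun A \<nu>0 M (w, \<nu>, z @ serre_w \<alpha> \<beta> k @ z')) = 0"
    proof -
      have "dual_fun A \<nu>0 M (w, \<nu>, v) = (if mset v = M then if mset w = A \<and> \<nu> = \<nu>0 then 1 else 0 else 0)" for v
        by (simp add: dual_fun_def)
      then show ?thesis by (simp only: key[OF * M])
    qed
  qed
qed

end

section \<open>Normal forms\<close>

context calg
begin

definition q_comm :: "complex \<Rightarrow> 'a \<Rightarrow> 'a \<Rightarrow> bool" where "q_comm c x y \<longleftrightarrow> x \<otimes> y = c \<odot> (y \<otimes> x)"

lemma q_comm_mult_r: "x \<in> carrier A \<Longrightarrow> a \<in> carrier A \<Longrightarrow> b \<in> carrier A \<Longrightarrow> q_comm c x a \<Longrightarrow> q_comm d x b \<Longrightarrow> q_comm (c * d) x (a \<otimes> b)"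
proof -
  assume *: "x \<in> carrier A" "a \<in> carrier A" "b \<in> carrier A" "q_comm c x a" "q_comm d x b"
  have "x \<otimes> (a \<otimes> b) = (x \<otimes> a) \<otimes> b" using *(1-3) by (simp add: m_assoc)
  also have "\<dots> = c \<odot> (a \<otimes> (x \<otimes> b))" using *(1-4) by (simp add: q_comm_def m_assoc smult_mult_l)
  finally show ?thesis using *(1-3,5) by (simp add: q_comm_def m_assoc smult_mult_r smult_smult)
qed

lemma q_comm_mult_l: "y \<in> carrier A \<Longrightarrow> a \<in> carrier A \<Longrightarrow> b \<in> carrier A \<Longrightarrow> q_comm c a y \<Longrightarrow> q_comm d b y \<Longrightarrow> q_comm (c * d) (a \<otimes> b) y"
proof -
  assume *: "y \<in> carrier A" "a \<in> carrier A" "b \<in> carrier A" "q_comm c a y" "q_comm d b y"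
  have "(a \<otimes> b) \<otimes> y = a \<otimes> (b \<otimes> y)" using *(1-3) by (simp add: m_assoc)
  also have "\<dots> = d \<odot> ((a \<otimes> y) \<otimes> b)" using *(1-3,5) by (simp add: q_comm_def m_assoc smult_mult_r)
  also have "\<dots> = d \<odot> ((c \<odot> (y \<otimes> a)) \<otimes> b)" using *(4) by (simp add: q_comm_def)
  finally show ?thesis using *(1-3) by (simp add: q_comm_def m_assoc smult_mult_l smult_smult mult.commute)
qed

lemma q_comm_add_r: "x \<in> carrier A \<Longrightarrow> a \<in> carrier A \<Longrightarrow> b \<in> carrier A \<Longrightarrow> q_comm c x a \<Longrightarrow> q_comm c x b \<Longrightarrow> q_comm c x (a \<oplus> b)"
  by (simp add: q_comm_def r_distr l_distr smult_r_distr)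

lemma q_comm_add_l: "y \<in> carrier A \<Longrightarrow> a \<in> carrier A \<Longrightarrow> b \<in> carrier A \<Longrightarrow> q_comm c a y \<Longrightarrow> q_comm c b y \<Longrightarrow> q_comm c (a \<oplus> b) y"
  by (simp add: q_comm_def r_distr l_distr smult_r_distr)

lemma q_comm_smult_r: "x \<in> carrier A \<Longrightarrow> a \<in> carrier A \<Longrightarrow> s = 0 \<or> q_comm c x a \<Longrightarrow> q_comm c x (s \<odot> a)"
  by (auto simp: q_comm_def smult_mult_l smult_mult_r smult_smult mult.commute)

lemma q_comm_smult_l: "y \<in> carrier A \<Longrightarrow> a \<in> carrier A \<Longrightarrow> s = 0 \<or> q_comm c a y \<Longrightarrow> q_comm c (s \<odot> a) y"
  by (auto simp: q_comm_def smult_mult_l smult_mult_r smult_smult mult.commute)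

lemma q_comm_sym: "x \<in> carrier A \<Longrightarrow> y \<in> carrier A \<Longrightarrow> c \<noteq> 0 \<Longrightarrow> q_comm c x y \<Longrightarrow> q_comm (inverse c) y x"
  by (simp add: q_comm_def smult_smult)

lemma q_comm_one: "x \<in> carrier A \<Longrightarrow> y \<in> carrier A \<Longrightarrow> q_comm 1 x y \<longleftrightarrow> x \<otimes> y = y \<otimes> x"
  by (simp add: q_comm_def)

lemma left_multiplier_subalg:
  assumes "N \<subseteq> carrier A" shows "subalg {x \<in> carrier A. \<forall>y\<in>lin_span A N. x \<otimes> y \<in> lin_span A N} A"
proof -
  have "y \<in> carrier A" if "y \<in> lin_span A N" for y using lin_span_closed[OF assms] that by auto
  then show ?thesis unfolding subalg_def
    by (auto simp: l_distr smult_mult_l m_assoc intro: span_zero span_add span_smult)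
qed

text \<open>The span of the ordered products is stable under left multiplication by every generator, since the
  rules allow to move the generator to its place.\<close>

lemma normal_form_span:
  fixes f e :: "'i \<Rightarrow> 'a" and k :: "'l::ab_group_add \<Rightarrow> 'a"
  assumes f: "\<And>\<alpha>. \<alpha> \<in> S \<Longrightarrow> f \<alpha> \<in> carrier A" and e: "\<And>\<beta>. \<beta> \<in> T \<Longrightarrow> e \<beta> \<in> carrier A"
    and k: "\<And>\<mu>. \<mu> \<in> L \<Longrightarrow> k \<mu> \<in> carrier A"
    and L: "0 \<in> L" "\<And>\<mu> \<nu>. \<mu> \<in> L \<Longrightarrow> \<nu> \<in> L \<Longrightarrow> \<mu> + \<nu> \<in> L"
    and k0: "k 0 = \<one>" and kk: "\<And>\<mu> \<nu>. \<mu> \<in> L \<Longrightarrow> \<nu> \<in> L \<Longrightarrow> k \<mu> \<otimes> k \<nu> = k (\<mu> + \<nu>)"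
    and kf: "\<And>\<mu> \<alpha>. \<mu> \<in> L \<Longrightarrow> \<alpha> \<in> S \<Longrightarrow> k \<mu> \<otimes> f \<alpha> = f \<alpha> \<otimes> k \<mu>"
    and ek: "\<And>\<mu> \<beta>. \<mu> \<in> L \<Longrightarrow> \<beta> \<in> T \<Longrightarrow> e \<beta> \<otimes> k \<mu> = c \<beta> \<mu> \<odot> (k \<mu> \<otimes> e \<beta>)"
    and ef: "\<And>\<alpha> \<beta>. \<alpha> \<in> S \<Longrightarrow> \<beta> \<in> T \<Longrightarrow> e \<beta> \<otimes> f \<alpha> = r \<beta> \<alpha> \<odot> (f \<alpha> \<otimes> e \<beta>) \<oplus> d \<beta> \<alpha> \<odot> \<one>"
  shows "alg_gen A (f ` S \<union> k ` L \<union> e ` T) =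
    lin_span A {wprod f as \<otimes> k \<mu> \<otimes> wprod e bs | as \<mu> bs. set as \<subseteq> S \<and> \<mu> \<in> L \<and> set bs \<subseteq> T}"
    (is "?G = lin_span A ?N")
proof -
  let ?gen = "f ` S \<union> k ` L \<union> e ` T"
  have gen: "?gen \<subseteq> carrier A" using f e k by auto
  note G = alg_gen_subalg[OF gen]
  have wf: "wprod f as \<in> carrier A" if "set as \<subseteq> S" for as using f that by (intro wprod_closed) auto
  have we: "wprod e bs \<in> carrier A" if "set bs \<subseteq> T" for bs using e that by (intro wprod_closed) auto
  have N: "?N \<subseteq> carrier A" using wf we k by auto
  have NI: "wprod f as \<otimes> k \<mu> \<otimes> wprod e bs \<in> lin_span A ?N" if "set as \<subseteq> S" "\<mu> \<in> L" "set bs \<subseteq> T" for as \<mu> bs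
    using that by (intro span_base) blast
  note Ncl = subsetD[OF lin_span_closed[OF N]]
  have left: "x \<otimes> y \<in> lin_span A ?N"
    if x: "x \<in> carrier A" and base: "\<And>n. n \<in> ?N \<Longrightarrow> x \<otimes> n \<in> lin_span A ?N" and y: "y \<in> lin_span A ?N" for x y
    using lin_span_mult[of "{x}" ?N ?N x y] x base y N by (auto intro: span_base)
  have fN: "f \<alpha> \<otimes> y \<in> lin_span A ?N" if \<alpha>: "\<alpha> \<in> S" and y: "y \<in> lin_span A ?N" for \<alpha> y
  proof (rule left[OF f[OF \<alpha>] _ y])
    fix n assume "n \<in> ?N"
    then obtain as \<mu> bs where n: "n = wprod f as \<otimes> k \<mu> \<otimes> wprod e bs" "set as \<subseteq> S" "\<mu> \<in> L" "set bs \<subseteq> T" by blast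
    have "f \<alpha> \<otimes> n = wprod f (\<alpha> # as) \<otimes> k \<mu> \<otimes> wprod e bs" using n \<alpha> f wf we k by (simp add: m_assoc)
    then show "f \<alpha> \<otimes> n \<in> lin_span A ?N" using NI[of "\<alpha> # as" \<mu> bs] n \<alpha> by simp
  qed
  have kN: "k \<nu> \<otimes> y \<in> lin_span A ?N" if \<nu>: "\<nu> \<in> L" and y: "y \<in> lin_span A ?N" for \<nu> y
  proof (rule left[OF k[OF \<nu>] _ y])
    fix n assume "n \<in> ?N"
    then obtain as \<mu> bs where n: "n = wprod f as \<otimes> k \<mu> \<otimes> wprod e bs" "set as \<subseteq> S" "\<mu> \<in> L" "set bs \<subseteq> T" by blast
    have "k \<nu> \<otimes> wprod f as = wprod f as \<otimes> k \<nu>"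
      using n(2) kf[OF \<nu>] f k[OF \<nu>] by (intro wprod_commute) auto
    then have "k \<nu> \<otimes> n = wprod f as \<otimes> (k \<nu> \<otimes> k \<mu>) \<otimes> wprod e bs"
      using n wf we k \<nu> by (simp add: m_assoc[symmetric])
    then show "k \<nu> \<otimes> n \<in> lin_span A ?N" using NI[of as "\<nu> + \<mu>" bs] n \<nu> L kk by simp
  qed
  have eN: "e \<beta> \<otimes> y \<in> lin_span A ?N" if \<beta>: "\<beta> \<in> T" and y: "y \<in> lin_span A ?N" for \<beta> y
  proof (rule left[OF e[OF \<beta>] _ y])
    fix n assume "n \<in> ?N"
    then obtain as \<mu> bs where n: "n = wprod f as \<otimes> k \<mu> \<otimes> wprod e bs" "set as \<subseteq> S" "\<mu> \<in> L" "set bs \<subseteq> T" by blast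
    have "e \<beta> \<otimes> (wprod f as \<otimes> k \<mu> \<otimes> wprod e bs) \<in> lin_span A ?N" using n(2)
    proof (induction as)
      case Nil
      have "e \<beta> \<otimes> (wprod f [] \<otimes> k \<mu> \<otimes> wprod e bs) = c \<beta> \<mu> \<odot> (wprod f [] \<otimes> k \<mu> \<otimes> wprod e (\<beta> # bs))"
        using n \<beta> e k we by (simp add: m_assoc[symmetric] ek smult_mult_l)
      then show ?case using NI[of "[]" \<mu> "\<beta> # bs"] n \<beta> by (auto intro: span_smult)
    next
      case (Cons \<alpha> as)
      let ?M = "wprod f as \<otimes> k \<mu> \<otimes> wprod e bs"
      have \<alpha>: "\<alpha> \<in> S" "set as \<subseteq> S" using Cons.prems by auto
      have M: "?M \<in> carrier A" using wf we k n \<alpha> by auto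
      have "e \<beta> \<otimes> (wprod f (\<alpha> # as) \<otimes> k \<mu> \<otimes> wprod e bs) = (e \<beta> \<otimes> f \<alpha>) \<otimes> ?M"
        using n \<beta> \<alpha> e f k we wf by (simp add: m_assoc)
      also have "\<dots> = r \<beta> \<alpha> \<odot> (f \<alpha> \<otimes> (e \<beta> \<otimes> ?M)) \<oplus> d \<beta> \<alpha> \<odot> ?M"
        unfolding ef[OF \<alpha>(1) \<beta>] using M e[OF \<beta>] f[OF \<alpha>(1)] by (simp add: l_distr smult_mult_l m_assoc)
      finally show ?case
        using fN[OF \<alpha>(1) Cons.IH[OF \<alpha>(2)]] NI[OF \<alpha>(2) n(3,4)] by (auto intro: span_smult span_add)
    qed
    then show "e \<beta> \<otimes> n \<in> lin_span A ?N" using n by simp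
  qed
  let ?C = "{x \<in> carrier A. \<forall>y\<in>lin_span A ?N. x \<otimes> y \<in> lin_span A ?N}"
  have "subalg ?C A" by (rule left_multiplier_subalg[OF N])
  moreover have "?gen \<subseteq> ?C"
  proof
    fix x assume x: "x \<in> ?gen"
    then have "\<forall>y\<in>lin_span A ?N. x \<otimes> y \<in> lin_span A ?N" using fN kN eN by blast
    then show "x \<in> ?C" using x gen by blast
  qed
  ultimately have "?G \<subseteq> ?C" by (rule alg_gen_least)
  moreover have "\<one> \<in> lin_span A ?N" using NI[of "[]" 0 "[]"] L k0 by simp
  ultimately have one: "x \<otimes> \<one> \<in> lin_span A ?N" if "x \<in> ?G" for x using that by blast
  have "?G \<subseteq> lin_span A ?N"
  proof
    fix x assume x: "x \<in> ?G"
    then have "x \<otimes> \<one> = x" using alg_gen_closed[OF gen] by auto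
    then show "x \<in> lin_span A ?N" using one[OF x] by simp
  qed
  moreover have "lin_span A ?N \<subseteq> ?G"
  proof (rule lin_span_least[OF G])
    have prod: "wprod g w \<in> ?G" if "\<And>x. x \<in> set w \<Longrightarrow> g x \<in> ?gen" for g :: "'i \<Rightarrow> 'a" and w
      using that
    proof (induction w)
      case (Cons x w)
      have "g x \<in> ?gen" by (rule Cons.prems) simp
      then have "g x \<in> ?G" by (rule subsetD[OF alg_gen_incl])
      then show ?case using Cons G by (auto simp: subalg_def)
    qed (use G in \<open>auto simp: subalg_def\<close>)
    have "wprod f as \<otimes> k \<mu> \<otimes> wprod e bs \<in> ?G" if "set as \<subseteq> S" "\<mu> \<in> L" "set bs \<subseteq> T" for as \<mu> bs
    proof -
      have "wprod f as \<in> ?G" "wprod e bs \<in> ?G" using that by (auto intro!: prod)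
      moreover have "k \<mu> \<in> ?G" using that(2) by (intro subsetD[OF alg_gen_incl]) blast
      ultimately show ?thesis using G by (simp add: subalg_def)
    qed
    then show "?N \<subseteq> ?G" by blast
  qed
  ultimately show ?thesis by blast
qed

lemma wprod_permute:
  assumes "mset w = mset w'" "\<And>g. g \<in> set w \<Longrightarrow> f g \<in> carrier A"
    and comm: "\<And>g h. g \<in> set w \<Longrightarrow> h \<in> set w \<Longrightarrow> f g \<otimes> f h = f h \<otimes> f g"
  shows "wprod f w = wprod f w'"
  using assms
proof (induction w arbitrary: w')
  case (Cons g w)
  have "g \<in> set w'" using Cons.prems(1) by (metis list.set_intros(1) set_mset_mset)
  then obtain a b where w': "w' = a @ g # b" by (meson split_list)
  have "set (g # w) = set w'" using Cons.prems(1) by (rule mset_eq_setD)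
  then have s: "set (a @ b) \<subseteq> set (g # w)" unfolding w' by auto
  then have ab: "\<And>x. x \<in> set a \<union> set b \<Longrightarrow> f x \<in> carrier A" using Cons.prems(2) by auto
  have g: "f g \<in> carrier A" using Cons.prems(2) by simp
  have "f g \<otimes> wprod f a = wprod f a \<otimes> f g"
    using s Cons.prems(2,3) by (intro wprod_commute) auto
  then have "wprod f w' = f g \<otimes> (wprod f a \<otimes> wprod f b)"
    unfolding w' using ab g by (subst wprod_append) (auto simp: m_assoc[symmetric])
  also have "wprod f a \<otimes> wprod f b = wprod f (a @ b)" using ab by (subst wprod_append) auto
  also have "wprod f (a @ b) = wprod f w"
    using Cons.prems by (intro Cons.IH[symmetric]) (auto simp: w')
  finally show ?case by simp
qed simp

end

section \<open>Commutation rules of the shifted generators\<close>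

text \<open>\<open>l\<close> is the parameter \<open>\<lambda>\<^sup>+\<close> extended by zero, so that \<open>E_bar\<close> describes the shifted generators for all
  simple roots.\<close>

locale coideal_data = root_data +
  fixes supp :: "'a set" and l lm :: "'a \<Rightarrow> complex"
  assumes supp: "supp \<subseteq> B"
    and orth: "\<And>\<alpha> \<beta>. \<alpha> \<in> supp \<Longrightarrow> \<beta> \<in> supp \<Longrightarrow> \<alpha> \<noteq> \<beta> \<Longrightarrow> \<alpha> \<bullet> \<beta> = 0"
    and l_zero: "\<And>\<beta>. \<beta> \<in> B - supp \<Longrightarrow> l \<beta> = 0"
    and l_lm: "\<And>\<alpha>. \<alpha> \<in> supp \<Longrightarrow> l \<alpha> * lm \<alpha> =
           (q_root q \<alpha>)\<^sup>2 / ((1 - (q_root q \<alpha>)\<^sup>2) * (q_root q \<alpha> - inverse (q_root q \<alpha>)))"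
begin

abbreviation "L0 \<equiv> orth_lattice B supp"
abbreviation "fb \<equiv> F_bar B q lm"
abbreviation "ep \<equiv> E_bar B q l"
abbreviation "kk \<equiv> K_elt B q"

lemma finsupp: "finite supp"
  using finB supp finite_subset by blast

lemma L0_lattice: "\<mu> \<in> L0 \<Longrightarrow> \<mu> \<in> root_lattice B"
  by (simp add: orth_lattice_def)

lemma L0_zero: "0 \<in> L0" and L0_add: "\<mu> \<in> L0 \<Longrightarrow> \<nu> \<in> L0 \<Longrightarrow> \<mu> + \<nu> \<in> L0"
  and L0_uminus: "\<mu> \<in> L0 \<Longrightarrow> - \<mu> \<in> L0"
  by (auto simp: orth_lattice_def root_lattice_zero root_lattice_add root_lattice_uminus inner_add_left)

lemma EK_closed: "\<beta> \<in> B \<Longrightarrow> EK B q \<beta> \<in> carrier U"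
  by (simp add: EK_def)

lemma fb_closed: "\<alpha> \<in> supp \<Longrightarrow> fb \<alpha> \<in> carrier U" and ep_closed: "\<beta> \<in> B \<Longrightarrow> ep \<beta> \<in> carrier U"
  and kk_closed: "\<mu> \<in> L0 \<Longrightarrow> kk \<mu> \<in> carrier U"
  using supp K_elt_closed L0_lattice by (auto simp: F_bar_def E_bar_def EK_closed)

lemma kk_add: "\<mu> \<in> L0 \<Longrightarrow> \<nu> \<in> L0 \<Longrightarrow> kk \<mu> \<otimes>\<^bsub>U\<^esub> kk \<nu> = kk (\<mu> + \<nu>)"
  by (simp add: K_elt_add L0_lattice)

lemma int_form_L0: "\<mu> \<in> L0 \<Longrightarrow> \<alpha> \<in> supp \<Longrightarrow> int_form \<mu> \<alpha> = 0"
  by (simp add: orth_lattice_def int_form_def)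

text \<open>A lower term of \<open>E_bar\<close> is only present where the torus elements of \<open>L\<close> commute with both terms.\<close>

lemma l_cases: "\<mu> \<in> L0 \<Longrightarrow> \<beta> \<in> B \<Longrightarrow> l \<beta> = 0 \<or> int_form \<mu> \<beta> = 0"
  using int_form_L0 l_zero by blast

lemma l_cases': "\<beta> \<in> B \<Longrightarrow> \<alpha> \<in> supp \<Longrightarrow> \<beta> \<noteq> \<alpha> \<Longrightarrow> l \<beta> = 0 \<or> int_form \<beta> \<alpha> = 0"
  using orth[of \<beta> \<alpha>] l_zero[of \<beta>] by (cases "\<beta> \<in> supp") (auto simp: int_form_def)

lemma kk_KI: "\<mu> \<in> root_lattice B \<Longrightarrow> \<alpha> \<in> B \<Longrightarrow> U.q_comm 1 (kk \<mu>) (eKI \<alpha>)"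
  using K_elt_commute[of \<mu> "- \<alpha>"] root_lattice_uminus[OF root_lattice_simple]
  by (simp add: U.q_comm_one K_elt_closed K_elt_simple)

lemma kk_fb: assumes "\<mu> \<in> L0" "\<alpha> \<in> supp" shows "kk \<mu> \<otimes>\<^bsub>U\<^esub> fb \<alpha> = fb \<alpha> \<otimes>\<^bsub>U\<^esub> kk \<mu>"
proof -
  have \<alpha>: "\<alpha> \<in> B" using assms supp by auto
  have "U.q_comm 1 (kk \<mu>) (eF \<alpha>)"
    using K_elt_F[OF L0_lattice[OF assms(1)] \<alpha>] int_form_L0[OF assms] by (simp add: U.q_comm_def)
  then have "U.q_comm 1 (kk \<mu>) (fb \<alpha>)" unfolding F_bar_def
    using assms \<alpha> kk_closed kk_KI[OF L0_lattice[OF assms(1)] \<alpha>] by (intro U.q_comm_add_r U.q_comm_smult_r disjI2) simp_all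
  then show ?thesis using assms kk_closed fb_closed by (simp add: U.q_comm_one)
qed

lemma kk_ep: assumes "\<mu> \<in> L0" "\<beta> \<in> B" shows "U.q_comm (q powi int_form \<mu> \<beta>) (kk \<mu>) (ep \<beta>)"
proof -
  note KI = kk_KI[OF L0_lattice[OF assms(1)] assms(2)]
  have "U.q_comm (q powi int_form \<mu> \<beta> * 1) (kk \<mu>) (EK B q \<beta>)" unfolding EK_def
    using K_elt_E[OF L0_lattice[OF assms(1)] assms(2)] KI assms kk_closed by (intro U.q_comm_mult_r) (simp_all add: U.q_comm_def)
  moreover have "l \<beta> = 0 \<or> U.q_comm (q powi int_form \<mu> \<beta>) (kk \<mu>) (eKI \<beta>)"
    using l_cases[OF assms] KI by auto
  ultimately show ?thesis unfolding E_bar_def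
    using assms kk_closed EK_closed by (intro U.q_comm_add_r U.q_comm_smult_r) simp_all
qed

lemma ep_kk: assumes "\<mu> \<in> L0" "\<beta> \<in> B" shows "ep \<beta> \<otimes>\<^bsub>U\<^esub> kk \<mu> = q powi (- int_form \<mu> \<beta>) \<odot>\<^bsub>U\<^esub> (kk \<mu> \<otimes>\<^bsub>U\<^esub> ep \<beta>)"
  using U.q_comm_sym[OF kk_closed[OF assms(1)] ep_closed[OF assms(2)] _ kk_ep[OF assms]] q0
  by (simp add: U.q_comm_def power_int_minus)

lemma ep_fb_diff:
  assumes "\<beta> \<in> B" "\<alpha> \<in> supp" "\<beta> \<noteq> \<alpha>"
  shows "U.q_comm (q powi int_form \<beta> \<alpha>) (ep \<beta>) (fb \<alpha>)"
proof -
  have \<alpha>: "\<alpha> \<in> B" using assms supp by auto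
  let ?r = "q powi int_form \<beta> \<alpha>"
  have r0: "q powi (- int_form \<beta> \<alpha>) \<noteq> 0" using q0 by simp
  have 1: "U.q_comm 1 (eE \<beta>) (eF \<alpha>)" using E_F_diff[OF assms(1) \<alpha> assms(3)] assms \<alpha> by (simp add: U.q_comm_one)
  have 2: "U.q_comm ?r (eKI \<beta>) (eF \<alpha>)" using KI_F[OF assms(1) \<alpha>] by (simp add: U.q_comm_def)
  have "U.q_comm (q powi (- int_form \<beta> \<alpha>)) (eKI \<alpha>) (eE \<beta>)"
    using KI_E[OF \<alpha> assms(1)] by (simp add: U.q_comm_def int_form_commute)
  from U.q_comm_sym[OF _ _ r0 this] assms \<alpha> have 3: "U.q_comm ?r (eE \<beta>) (eKI \<alpha>)" by (simp add: power_int_minus)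
  have 4: "U.q_comm 1 (eKI \<beta>) (eKI \<alpha>)" using KI_KI assms \<alpha> by (simp add: U.q_comm_one)
  have EF: "U.q_comm ?r (EK B q \<beta>) (eF \<alpha>)"
    unfolding EK_def using U.q_comm_mult_l[OF _ _ _ 1 2] assms \<alpha> by simp
  have EK: "U.q_comm ?r (EK B q \<beta>) (eKI \<alpha>)"
    unfolding EK_def using U.q_comm_mult_l[OF _ _ _ 3 4] assms \<alpha> by simp
  have l: "l \<beta> = 0 \<or> U.q_comm ?r (eKI \<beta>) (eKI \<alpha>)" using l_cases'[OF assms] 4 by auto
  have "U.q_comm ?r (ep \<beta>) (eF \<alpha>)" unfolding E_bar_def
    using EF 2 assms \<alpha> EK_closed by (intro U.q_comm_add_l U.q_comm_smult_l) simp_all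
  moreover have "U.q_comm ?r (ep \<beta>) (eKI \<alpha>)" unfolding E_bar_def
    using EK l assms \<alpha> EK_closed by (intro U.q_comm_add_l U.q_comm_smult_l) simp_all
  ultimately show ?thesis unfolding F_bar_def
    using assms \<alpha> ep_closed by (intro U.q_comm_add_r U.q_comm_smult_r) simp_all
qed

definition weyl_const :: "'a \<Rightarrow> complex" where
  "weyl_const \<alpha> = (q_root q \<alpha>)\<^sup>2 / (q_root q \<alpha> - inverse (q_root q \<alpha>))"

end

text \<open>With \<open>I\<close> the inverse of \<open>K\<close>: the condition \<open>ab\<close> on the parameters says that the terms in \<open>I\<^sup>2\<close> cancel.\<close>

lemma (in calg) weyl_relation:
  assumes cl: "E \<in> carrier A" "F \<in> carrier A" "K \<in> carrier A" "I \<in> carrier A"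
    and KI: "K \<otimes> I = \<one>" and IF: "I \<otimes> F = w \<odot> (F \<otimes> I)" and IE: "I \<otimes> E = inverse w \<odot> (E \<otimes> I)"
    and EF: "E \<otimes> F = F \<otimes> E \<oplus> d \<odot> (K \<ominus> I)" and w: "w \<noteq> 0" and ab: "a * b - w * d = w * a * b"
  shows "(E \<otimes> I \<oplus> a \<odot> I) \<otimes> (F \<oplus> b \<odot> I) = w \<odot> ((F \<oplus> b \<odot> I) \<otimes> (E \<otimes> I \<oplus> a \<odot> I)) \<oplus> (w * d) \<odot> \<one>"
proof -
  define X where "X = F \<otimes> E \<otimes> I"
  define Y where "Y = F \<otimes> I"
  define Z where "Z = E \<otimes> I \<otimes> I"
  define Q where "Q = I \<otimes> I"
  have c: "X \<in> carrier A" "Y \<in> carrier A" "Z \<in> carrier A" "Q \<in> carrier A" using cl by (auto simp: X_def Y_def Z_def Q_def)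
  have 1: "E \<otimes> I \<otimes> F = w \<odot> X \<oplus> ((w * d) \<odot> \<one> \<oplus> (- (w * d)) \<odot> Q)"
  proof -
    have "E \<otimes> I \<otimes> F = w \<odot> (E \<otimes> F \<otimes> I)" using cl by (simp add: m_assoc IF smult_mult_r)
    also have "E \<otimes> F \<otimes> I = X \<oplus> d \<odot> (\<one> \<oplus> (- 1) \<odot> Q)"
      unfolding EF using cl by (simp add: l_distr smult_mult_l minus_smult KI X_def Q_def)
    finally show ?thesis using c by (simp add: smult_r_distr smult_smult)
  qed
  have 2: "E \<otimes> I \<otimes> (b \<odot> I) = b \<odot> Z" using cl by (simp add: smult_mult_r Z_def)
  have 3: "(a \<odot> I) \<otimes> F = (a * w) \<odot> Y" using cl by (simp add: smult_mult_l IF smult_smult Y_def)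
  have 4: "(a \<odot> I) \<otimes> (b \<odot> I) = (a * b) \<odot> Q" using cl by (simp add: smult_mult_l smult_mult_r smult_smult Q_def mult.commute)
  have 5: "F \<otimes> (E \<otimes> I) = X" using cl by (simp add: X_def m_assoc)
  have 6: "F \<otimes> (a \<odot> I) = a \<odot> Y" using cl by (simp add: Y_def smult_mult_r)
  have 7: "(b \<odot> I) \<otimes> (E \<otimes> I) = (b * inverse w) \<odot> Z"
    using cl by (simp add: smult_mult_l m_assoc[symmetric] IE smult_smult Z_def)
  have 8: "(b \<odot> I) \<otimes> (a \<odot> I) = (a * b) \<odot> Q" using cl by (simp add: smult_mult_l smult_mult_r smult_smult Q_def mult.commute)
  have lhs: "(E \<otimes> I \<oplus> a \<odot> I) \<otimes> (F \<oplus> b \<odot> I) =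
      (w \<odot> X \<oplus> ((w * d) \<odot> \<one> \<oplus> (- (w * d)) \<odot> Q)) \<oplus> b \<odot> Z \<oplus> ((a * w) \<odot> Y \<oplus> (a * b) \<odot> Q)"
    using cl by (simp add: l_distr r_distr 1 2 3 4)
       (simp add: a_ac c)
  have rhs: "w \<odot> ((F \<oplus> b \<odot> I) \<otimes> (E \<otimes> I \<oplus> a \<odot> I)) = w \<odot> X \<oplus> (w * a) \<odot> Y \<oplus> (b \<odot> Z \<oplus> (w * (a * b)) \<odot> Q)"
  proof -
    have "w * (b * inverse w) = b" using w by simp
    note wb = this
    show ?thesis using cl c by (simp add: l_distr r_distr 5 6 7 8 smult_r_distr smult_smult wb a_ac)
  qed
  have Qs: "(w * (a * b)) \<odot> Q = (a * b) \<odot> Q \<oplus> (- (w * d)) \<odot> Q"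
    using c ab by (simp add: smult_l_distr[symmetric] mult.assoc[symmetric])
  show ?thesis unfolding lhs rhs Qs using c by (simp add: a_ac mult.commute)
qed

context coideal_data
begin

lemma ep_fb_same:
  assumes "\<alpha> \<in> supp"
  shows "ep \<alpha> \<otimes>\<^bsub>U\<^esub> fb \<alpha> = (q_root q \<alpha>)\<^sup>2 \<odot>\<^bsub>U\<^esub> (fb \<alpha> \<otimes>\<^bsub>U\<^esub> ep \<alpha>) \<oplus>\<^bsub>U\<^esub> weyl_const \<alpha> \<odot>\<^bsub>U\<^esub> \<one>\<^bsub>U\<^esub>"
proof -
  have \<alpha>: "\<alpha> \<in> B" using assms supp by auto
  let ?v = "q_root q \<alpha>"
  have w: "q powi int_form \<alpha> \<alpha> = ?v\<^sup>2" using q_int_form[OF \<alpha> \<alpha>] cartan_same[OF \<alpha>] by simp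
  then have w': "q powi (- int_form \<alpha> \<alpha>) = inverse (?v\<^sup>2)" by (simp add: power_int_minus)
  have nz: "1 - ?v\<^sup>2 \<noteq> 0" using q_root_not_root[OF \<alpha>, of 2] by simp
  have "l \<alpha> * lm \<alpha> * (1 - ?v\<^sup>2) = ?v\<^sup>2 * (1 / (?v - inverse ?v))"
    using l_lm[OF assms] nz by simp
  then have ab: "l \<alpha> * lm \<alpha> - ?v\<^sup>2 * (1 / (?v - inverse ?v)) = ?v\<^sup>2 * l \<alpha> * lm \<alpha>"
    by (simp add: algebra_simps)
  have "ep \<alpha> \<otimes>\<^bsub>U\<^esub> fb \<alpha> = (q_root q \<alpha>)\<^sup>2 \<odot>\<^bsub>U\<^esub> (fb \<alpha> \<otimes>\<^bsub>U\<^esub> ep \<alpha>) \<oplus>\<^bsub>U\<^esub> (?v\<^sup>2 * (1 / (?v - inverse ?v))) \<odot>\<^bsub>U\<^esub> \<one>\<^bsub>U\<^esub>"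
    unfolding E_bar_def F_bar_def EK_def
    by (rule U.weyl_relation[OF _ _ _ _ K_KI KI_F[OF \<alpha> \<alpha>, unfolded w] KI_E[OF \<alpha> \<alpha>, unfolded w'] E_F_same _ ab])
       (use \<alpha> q_root_nonzero in simp_all)
  then show ?thesis by (simp add: weyl_const_def)
qed

lemma fb_commute: assumes "\<alpha> \<in> supp" "\<beta> \<in> supp" shows "fb \<alpha> \<otimes>\<^bsub>U\<^esub> fb \<beta> = fb \<beta> \<otimes>\<^bsub>U\<^esub> fb \<alpha>"
proof (cases "\<alpha> = \<beta>")
  case False
  have B: "\<alpha> \<in> B" "\<beta> \<in> B" using assms supp by auto
  have i: "int_form \<alpha> \<beta> = 0" "int_form \<beta> \<alpha> = 0" using orth[OF assms False] by (auto simp: int_form_def inner_commute)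
  have "U.q_comm 1 (eF \<alpha>) (eF \<beta>)" using orthogonal_commute(2)[OF B False orth[OF assms False]] B by (simp add: U.q_comm_one)
  moreover have 1: "U.q_comm 1 (eKI \<alpha>) (eF \<beta>)" "U.q_comm 1 (eKI \<beta>) (eF \<alpha>)" using KI_F B i by (simp_all add: U.q_comm_def)
  moreover have "U.q_comm 1 (eF \<alpha>) (eKI \<beta>)" using U.q_comm_sym[OF _ _ _ 1(2)] B by simp
  moreover have "U.q_comm 1 (eKI \<alpha>) (eKI \<beta>)" using KI_KI B by (simp add: U.q_comm_one)
  ultimately have "U.q_comm 1 (fb \<alpha>) (fb \<beta>)" unfolding F_bar_def using B
    by (intro U.q_comm_add_l U.q_comm_add_r U.q_comm_smult_l U.q_comm_smult_r disjI2) simp_all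
  then show ?thesis using assms fb_closed by (simp add: U.q_comm_one)
qed simp

lemma ep_commute: assumes "\<alpha> \<in> supp" "\<beta> \<in> supp" shows "ep \<alpha> \<otimes>\<^bsub>U\<^esub> ep \<beta> = ep \<beta> \<otimes>\<^bsub>U\<^esub> ep \<alpha>"
proof (cases "\<alpha> = \<beta>")
  case False
  have B: "\<alpha> \<in> B" "\<beta> \<in> B" using assms supp by auto
  have i: "int_form \<alpha> \<beta> = 0" "int_form \<beta> \<alpha> = 0" using orth[OF assms False] by (auto simp: int_form_def inner_commute)
  have EE: "U.q_comm 1 (eE \<alpha>) (eE \<beta>)" using orthogonal_commute(1)[OF B False orth[OF assms False]] B by (simp add: U.q_comm_one)
  have IE: "U.q_comm 1 (eKI \<alpha>) (eE \<beta>)" "U.q_comm 1 (eKI \<beta>) (eE \<alpha>)" using KI_E B i by (simp_all add: U.q_comm_def)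
  have EI: "U.q_comm 1 (eE \<alpha>) (eKI \<beta>)" using U.q_comm_sym[OF _ _ _ IE(2)] B by simp
  have II: "U.q_comm 1 (eKI \<alpha>) (eKI \<beta>)" using KI_KI B by (simp add: U.q_comm_one)
  have "U.q_comm 1 (eE \<alpha>) (EK B q \<beta>)" "U.q_comm 1 (eKI \<alpha>) (EK B q \<beta>)"
    unfolding EK_def using U.q_comm_mult_r[OF _ _ _ EE EI] U.q_comm_mult_r[OF _ _ _ IE(1) II] B by simp_all
  then have EKEK: "U.q_comm 1 (EK B q \<alpha>) (EK B q \<beta>)" and IEK: "U.q_comm 1 (eKI \<alpha>) (EK B q \<beta>)"
    using U.q_comm_mult_l[of "EK B q \<beta>" "eE \<alpha>" "eKI \<alpha>" 1 1] B EK_closed by (simp_all add: EK_def[of B q \<alpha>])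
  have EKI: "U.q_comm 1 (EK B q \<alpha>) (eKI \<beta>)"
    unfolding EK_def using U.q_comm_mult_l[OF _ _ _ EI II] B by simp
  have "U.q_comm 1 (ep \<alpha>) (ep \<beta>)" unfolding E_bar_def using B EKEK IEK EKI II EK_closed
    by (intro U.q_comm_add_l U.q_comm_add_r U.q_comm_smult_l U.q_comm_smult_r disjI2) simp_all
  then show ?thesis using U.q_comm_one[OF ep_closed[OF B(1)] ep_closed[OF B(2)]] by simp
qed simp

end

section \<open>Homomorphisms out of the coideal subalgebra\<close>

lemma alg_hom_restrict: "h \<in> alg_hom (restrict_alg A D) B \<Longrightarrow> G \<subseteq> D \<Longrightarrow> h \<in> alg_hom (restrict_alg A G) B"
  by (simp add: alg_hom_iff lin_hom_def subset_iff)

text \<open>\<open>D\<close> is the graph of \<open>\<pi>\<close>: two values over the same point differ by a value over zero.\<close>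

lemma graph_alg_hom:
  assumes A: "calg A" and B: "calg B" and D: "subalg D (prod_alg A B)" and single: "\<And>y. (\<zero>\<^bsub>A\<^esub>, y) \<in> D \<Longrightarrow> y = \<zero>\<^bsub>B\<^esub>"
  obtains \<pi> where "\<pi> \<in> alg_hom (restrict_alg A (fst ` D)) B" "\<And>x y. (x, y) \<in> D \<Longrightarrow> \<pi> x = y"
proof -
  interpret A: calg A by fact
  interpret B: calg B by fact
  interpret P: calg "prod_alg A B" by (rule prod_alg_calg[OF A B])
  have cl: "x \<in> carrier A" "y \<in> carrier B" if "(x, y) \<in> D" for x y using D that by (auto simp: subalg_def)
  have un: "y = y'" if "(x, y) \<in> D" "(x, y') \<in> D" for x y y'
  proof -
    have "(x, y) \<ominus>\<^bsub>prod_alg A B\<^esub> (x, y') \<in> D" by (rule P.subalg_minus[OF D that])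
    moreover have "(x, y) \<ominus>\<^bsub>prod_alg A B\<^esub> (x, y') = (x \<ominus>\<^bsub>A\<^esub> x, y \<ominus>\<^bsub>B\<^esub> y')"
      using cl that by (subst P.minus_smult) (simp_all add: A.minus_smult B.minus_smult)
    moreover have "x \<ominus>\<^bsub>A\<^esub> x = \<zero>\<^bsub>A\<^esub>" using cl that by (simp add: a_minus_def A.r_neg)
    ultimately have "y \<ominus>\<^bsub>B\<^esub> y' = \<zero>\<^bsub>B\<^esub>" using single by simp
    then show ?thesis using cl that by (metis B.minus_eq_zeroD)
  qed
  define \<pi> where "\<pi> x = (THE y. (x, y) \<in> D)" for x
  have \<pi>: "\<pi> x = y" if "(x, y) \<in> D" for x y unfolding \<pi>_def using that un by blast
  have D': "(x \<oplus>\<^bsub>A\<^esub> x', y \<oplus>\<^bsub>B\<^esub> y') \<in> D" "(x \<otimes>\<^bsub>A\<^esub> x', y \<otimes>\<^bsub>B\<^esub> y') \<in> D" "(c \<odot>\<^bsub>A\<^esub> x, c \<odot>\<^bsub>B\<^esub> y) \<in> D" "(\<one>\<^bsub>A\<^esub>, \<one>\<^bsub>B\<^esub>) \<in> D"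
    if "(x, y) \<in> D" "(x', y') \<in> D" for x y x' y' c
    using D that unfolding subalg_def by force+
  have ne: "(\<zero>\<^bsub>A\<^esub>, \<zero>\<^bsub>B\<^esub>) \<in> D" using D by (auto simp: subalg_def)
  have H: "\<pi> x \<in> carrier B" "\<pi> (c \<odot>\<^bsub>A\<^esub> x) = c \<odot>\<^bsub>B\<^esub> \<pi> x" if "x \<in> fst ` D" for x c
  proof -
    obtain y where y: "(x, y) \<in> D" using \<open>x \<in> fst ` D\<close> by (metis imageE prod.collapse)
    show "\<pi> x \<in> carrier B" "\<pi> (c \<odot>\<^bsub>A\<^esub> x) = c \<odot>\<^bsub>B\<^esub> \<pi> x"
      using \<pi>[OF y] cl(2)[OF y] \<pi>[OF D'(3)[OF y y, of c]] by simp_all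
  qed
  have H2: "\<pi> (x \<oplus>\<^bsub>A\<^esub> x') = \<pi> x \<oplus>\<^bsub>B\<^esub> \<pi> x'" "\<pi> (x \<otimes>\<^bsub>A\<^esub> x') = \<pi> x \<otimes>\<^bsub>B\<^esub> \<pi> x'"
    if "x \<in> fst ` D" "x' \<in> fst ` D" for x x'
  proof -
    obtain y y' where y: "(x, y) \<in> D" "(x', y') \<in> D"
      using \<open>x \<in> fst ` D\<close> \<open>x' \<in> fst ` D\<close> by (metis imageE prod.collapse)
    show "\<pi> (x \<oplus>\<^bsub>A\<^esub> x') = \<pi> x \<oplus>\<^bsub>B\<^esub> \<pi> x'" "\<pi> (x \<otimes>\<^bsub>A\<^esub> x') = \<pi> x \<otimes>\<^bsub>B\<^esub> \<pi> x'"
      using \<pi>[OF y(1)] \<pi>[OF y(2)] \<pi>[OF D'(1)[OF y]] \<pi>[OF D'(2)[OF y]] by simp_all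
  qed
  have "\<pi> \<in> alg_hom (restrict_alg A (fst ` D)) B"
    unfolding alg_hom_iff lin_hom_def using H H2 \<pi>[OF D'(4)[OF ne ne]] by simp
  then show ?thesis using that \<pi> by blast
qed

context coideal_data
begin

lemma finsum_uact:
  assumes "finite I" "\<And>i. i \<in> I \<Longrightarrow> g i \<in> carrier U" "f \<in> serre_funs"
  shows "uact (finsum U g I) f p = (\<Sum>i\<in>I. uact (g i) f p)"
  using assms(1,2)
proof (induction I)
  case (insert i I)
  have c: "g \<in> I \<rightarrow> carrier U" "g i \<in> carrier U" using insert.prems by auto
  then have "uact (finsum U g (insert i I)) f p = uact (g i) f p + uact (finsum U g I) f p"
    using insert.hyps assms(3) by (simp add: U.finsum_insert uact_add)
  then show ?case using insert by simp
qed (simp add: uact_zero assms(3))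

lemma uact_fb:
  assumes "\<alpha> \<in> supp" "f \<in> serre_funs"
  shows "uact (fb \<alpha>) f = (\<lambda>p. rF \<alpha> f p + lm \<alpha> * rKI \<alpha> f p)"
proof -
  have \<alpha>: "\<alpha> \<in> B" using assms supp by auto
  then show ?thesis unfolding F_bar_def using assms(2) by (simp add: uact_add uact_smult uact_word)
qed

lemma uact_ep:
  assumes "\<beta> \<in> B" "f \<in> serre_funs"
  shows "uact (ep \<beta>) f ([], \<nu>, z) = q powi (- int_form \<beta> (\<nu> - \<beta>)) * f ([], \<nu> - \<beta>, \<beta> # z) + l \<beta> * f ([], \<nu> - \<beta>, z)"
proof -
  have "uact (EK B q \<beta>) f = rKI \<beta> (rE \<beta> f)"
    unfolding EK_def using assms by (simp add: uact_mult uact_word rE_serre_funs)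
  then show ?thesis unfolding E_bar_def using assms EK_closed by (simp add: uact_add uact_smult uact_word)
qed

lemma fb_word_closed: "set as \<subseteq> supp \<Longrightarrow> U.wprod fb as \<in> carrier U"
  using fb_closed by (intro U.wprod_closed) auto

lemma ep_word_closed: "set bs \<subseteq> B \<Longrightarrow> U.wprod ep bs \<in> carrier U"
  using ep_closed by (intro U.wprod_closed) auto

text \<open>The lower terms of \<open>F_bar\<close> and \<open>E_bar\<close> evaluate the function at shorter words.\<close>

lemma uact_fb_word:
  assumes "set as \<subseteq> supp" "f \<in> serre_funs" "\<And>w \<nu>. length w < length as \<Longrightarrow> f (w, \<nu>, z) = 0"
  shows "uact (U.wprod fb as) f ([], \<nu>, z) = f (as, \<nu>, z)"
  using assms
proof (induction as arbitrary: f)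
  case Nil
  then show ?case by (simp add: uact_one)
next
  case (Cons \<alpha> as)
  have c: "fb \<alpha> \<in> carrier U" "U.wprod fb as \<in> carrier U" "\<alpha> \<in> supp" using Cons.prems fb_closed fb_word_closed by auto
  have f1: "uact (fb \<alpha>) f \<in> serre_funs" using c Cons.prems by (intro uact_closed)
  have "uact (U.wprod fb as) (uact (fb \<alpha>) f) ([], \<nu>, z) = uact (fb \<alpha>) f (as, \<nu>, z)"
    using Cons.prems c by (intro Cons.IH[OF _ f1]) (auto simp: uact_fb)
  also have "\<dots> = f (\<alpha> # as, \<nu>, z)" using Cons.prems c by (simp add: uact_fb)
  finally show ?case using c Cons.prems by (simp add: uact_mult)
qed

lemma uact_fb_word_zero:
  assumes "set as \<subseteq> supp" "f \<in> serre_funs" "\<And>w \<nu>. f (w, \<nu>, z) = 0"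
  shows "uact (U.wprod fb as) f (w, \<nu>, z) = 0"
  using assms
proof (induction as arbitrary: f)
  case Nil
  then show ?case by (simp add: uact_one)
next
  case (Cons \<alpha> as)
  have c: "fb \<alpha> \<in> carrier U" "U.wprod fb as \<in> carrier U" "\<alpha> \<in> supp" using Cons.prems fb_closed fb_word_closed by auto
  have f1: "uact (fb \<alpha>) f \<in> serre_funs" using c Cons.prems by (intro uact_closed)
  have "uact (U.wprod fb as) (uact (fb \<alpha>) f) (w, \<nu>, z) = 0"
    using Cons.prems c by (intro Cons.IH[OF _ f1]) (auto simp: uact_fb)
  then show ?case using c Cons.prems by (simp add: uact_mult)
qed

lemma uact_ep_word:
  assumes "set bs \<subseteq> B" "f \<in> serre_funs" "\<And>\<nu> z. length z < length bs \<Longrightarrow> f ([], \<nu>, z) = 0"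
  shows "\<exists>c. c \<noteq> 0 \<and> uact (U.wprod ep bs) f ([], \<nu>, []) = c * f ([], \<nu> - sum_list bs, bs)"
  using assms
proof (induction bs arbitrary: f)
  case Nil
  then show ?case by (intro exI[of _ 1]) (simp add: uact_one)
next
  case (Cons \<beta> bs)
  have c: "ep \<beta> \<in> carrier U" "U.wprod ep bs \<in> carrier U" "\<beta> \<in> B" using Cons.prems ep_closed ep_word_closed by auto
  have "\<exists>c. c \<noteq> 0 \<and> uact (U.wprod ep bs) (uact (ep \<beta>) f) ([], \<nu>, []) = c * uact (ep \<beta>) f ([], \<nu> - sum_list bs, bs)"
    using Cons.prems c by (intro Cons.IH) (auto simp: uact_closed uact_ep)
  then obtain c' where c': "c' \<noteq> 0" "uact (U.wprod ep bs) (uact (ep \<beta>) f) ([], \<nu>, []) = c' * uact (ep \<beta>) f ([], \<nu> - sum_list bs, bs)" by blast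
  moreover have "uact (ep \<beta>) f ([], \<nu> - sum_list bs, bs) =
      q powi (- int_form \<beta> (\<nu> - sum_list bs - \<beta>)) * f ([], \<nu> - sum_list (\<beta> # bs), \<beta> # bs)"
    using Cons.prems c by (simp add: uact_ep algebra_simps)
  ultimately show ?case using c Cons.prems q0
    by (intro exI[of _ "c' * q powi (- int_form \<beta> (\<nu> - sum_list bs - \<beta>))"]) (simp add: uact_mult)
qed

lemma uact_ep_word_zero:
  assumes "set bs \<subseteq> B" "f \<in> serre_funs" "\<And>\<nu> z. f ([], \<nu>, z) = 0"
  shows "uact (U.wprod ep bs) f ([], \<nu>, z) = 0"
  using assms
proof (induction bs arbitrary: f)
  case Nil
  then show ?case by (simp add: uact_one)
next
  case (Cons \<beta> bs)
  have c: "ep \<beta> \<in> carrier U" "U.wprod ep bs \<in> carrier U" "\<beta> \<in> B" using Cons.prems ep_closed ep_word_closed by auto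
  have "uact (U.wprod ep bs) (uact (ep \<beta>) f) ([], \<nu>, z) = 0"
    using Cons.prems c by (intro Cons.IH) (auto simp: uact_closed uact_ep)
  then show ?case using c Cons.prems by (simp add: uact_mult)
qed

lemma uact_ep_word_outside:
  assumes "set bs \<subseteq> B" "\<not> set bs \<subseteq> supp" "f \<in> serre_funs" "\<And>\<nu> z. \<not> set z \<subseteq> supp \<Longrightarrow> f ([], \<nu>, z) = 0"
  shows "uact (U.wprod ep bs) f ([], \<nu>, z) = 0"
  using assms
proof (induction bs arbitrary: f)
  case (Cons \<beta> bs)
  have c: "ep \<beta> \<in> carrier U" "U.wprod ep bs \<in> carrier U" "\<beta> \<in> B" "set bs \<subseteq> B" using Cons.prems ep_closed ep_word_closed by auto
  have f1: "uact (ep \<beta>) f \<in> serre_funs" using c Cons.prems by (simp add: uact_closed)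
  have "uact (U.wprod ep bs) (uact (ep \<beta>) f) ([], \<nu>, z) = 0"
  proof (cases "\<beta> \<in> supp")
    case True
    then show ?thesis using Cons.prems c f1 by (intro Cons.IH) (auto simp: uact_ep)
  next
    case False
    then have "uact (ep \<beta>) f ([], \<nu>, z) = 0" for \<nu> z
      using Cons.prems c l_zero[of \<beta>] by (simp add: uact_ep)
    then show ?thesis by (rule uact_ep_word_zero[OF c(4) f1])
  qed
  then show ?case using c Cons.prems by (simp add: uact_mult)
qed simp

text \<open>The elements with letters in \<open>supp\<close> commute, so normal forms are indexed by multisets.\<close>

definition mlist :: "'a multiset \<Rightarrow> 'a list" where "mlist M = (SOME w. mset w = M)"

lemma mset_mlist [simp]: "mset (mlist M) = M"
  unfolding mlist_def by (rule someI_ex) (rule ex_mset)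

lemma set_mlist [simp]: "set (mlist M) = set_mset M"
  by (metis mset_mlist set_mset_mset)

abbreviation "nform \<equiv> \<lambda>(A, \<mu>, M). U.wprod fb (mlist A) \<otimes>\<^bsub>U\<^esub> kk \<mu> \<otimes>\<^bsub>U\<^esub> U.wprod ep (mlist M)"

definition nf_index :: "('a multiset \<times> 'a \<times> 'a multiset) set" where
  "nf_index = {(A, \<mu>, M). set_mset A \<subseteq> supp \<and> \<mu> \<in> L0 \<and> set_mset M \<subseteq> supp}"

text \<open>The products with a factor \<open>E_bar \<beta>\<close>, \<open>\<beta> \<notin> supp\<close>; these are sent to zero in the quotient.\<close>

definition outside :: "'a uq set" where
  "outside = lin_span U {U.wprod fb as \<otimes>\<^bsub>U\<^esub> kk \<mu> \<otimes>\<^bsub>U\<^esub> U.wprod ep bs | as \<mu> bs.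
     set as \<subseteq> supp \<and> \<mu> \<in> L0 \<and> set bs \<subseteq> B \<and> \<not> set bs \<subseteq> supp}"

lemma word3_closed: "set as \<subseteq> supp \<Longrightarrow> \<mu> \<in> L0 \<Longrightarrow> set bs \<subseteq> B \<Longrightarrow>
  U.wprod fb as \<otimes>\<^bsub>U\<^esub> kk \<mu> \<otimes>\<^bsub>U\<^esub> U.wprod ep bs \<in> carrier U"
  using fb_word_closed ep_word_closed kk_closed by auto

lemma uact_word3:
  "set as \<subseteq> supp \<Longrightarrow> \<mu> \<in> L0 \<Longrightarrow> set bs \<subseteq> B \<Longrightarrow> f \<in> serre_funs \<Longrightarrow>
   uact (U.wprod fb as \<otimes>\<^bsub>U\<^esub> kk \<mu> \<otimes>\<^bsub>U\<^esub> U.wprod ep bs) f = uact (U.wprod ep bs) (uact (kk \<mu>) (uact (U.wprod fb as) f))"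
  using fb_word_closed ep_word_closed kk_closed by (simp add: uact_mult uact_closed)

lemma uact_outside:
  assumes "x \<in> outside" "set_mset A \<subseteq> supp" "set_mset M \<subseteq> supp"
  shows "uact x (dual_fun A \<nu>0 M) ([], 0, []) = 0"
proof -
  let ?f = "dual_fun A \<nu>0 M"
  have f: "?f \<in> serre_funs" by (rule dual_fun_serre[OF supp orth assms(2,3)])
  have cl: "x \<in> carrier U" if "x \<in> outside" for x
  proof -
    have "outside \<subseteq> carrier U" unfolding outside_def by (rule U.lin_span_closed) (auto intro!: word3_closed)
    then show ?thesis using that by auto
  qed
  from assms(1) show ?thesis unfolding outside_def
  proof induction
    case span_zero
    then show ?case by (simp add: uact_zero f)
  next
    case (span_base x)
    then obtain as \<mu> bs where x: "x = U.wprod fb as \<otimes>\<^bsub>U\<^esub> kk \<mu> \<otimes>\<^bsub>U\<^esub> U.wprod ep bs"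
      "set as \<subseteq> supp" "\<mu> \<in> L0" "set bs \<subseteq> B" "\<not> set bs \<subseteq> supp" by blast
    let ?g = "uact (kk \<mu>) (uact (U.wprod fb as) ?f)"
    have g1: "uact (U.wprod fb as) ?f \<in> serre_funs" using x f by (simp add: uact_closed fb_word_closed)
    then have g: "?g \<in> serre_funs" using x by (simp add: uact_closed kk_closed)
    have "?g ([], \<nu>, z) = 0" if z: "\<not> set z \<subseteq> supp" for \<nu> z
    proof -
      have "mset z \<noteq> M" using z assms(3) by (metis set_mset_mset)
      then have "?f (w, \<nu>, z) = 0" for w \<nu> by (simp add: dual_fun_def)
      then have "uact (U.wprod fb as) ?f (w, \<nu>, z) = 0" for w \<nu> by (rule uact_fb_word_zero[OF x(2) f])
      then show ?thesis by (rule uact_K_elt(2)[OF L0_lattice[OF x(3)] g1])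
    qed
    then show ?case unfolding x(1) uact_word3[OF x(2-4) f] by (intro uact_ep_word_outside[OF x(4,5) g])
  next
    case (span_add x y)
    then show ?case using cl f by (simp add: outside_def uact_add)
  next
    case (span_smult x c)
    then show ?case using cl f by (simp add: outside_def uact_smult)
  qed
qed

text \<open>Test against the dual function of an index of maximal total length among those present: the normal
  forms of the other indices and the elements of \<open>outside\<close> do not contribute.\<close>

lemma normal_forms_independent:
  assumes z: "Poly_Mapping.keys z \<subseteq> nf_index" and x: "x \<in> outside" and eq: "U.lin nform z \<oplus>\<^bsub>U\<^esub> x = \<zero>\<^bsub>U\<^esub>"
  shows "z = 0"
proof (rule ccontr)
  assume "z \<noteq> 0"
  then have ne: "Poly_Mapping.keys z \<noteq> {}" by simp
  define deg where "deg i = size (fst i) + size (snd (snd i))" for i :: "'a multiset \<times> 'a \<times> 'a multiset"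
  have "Max (deg ` Poly_Mapping.keys z) \<in> deg ` Poly_Mapping.keys z" using ne by (intro Max_in) auto
  then obtain i0 where i0: "i0 \<in> Poly_Mapping.keys z" "deg i0 = Max (deg ` Poly_Mapping.keys z)" by auto
  obtain A \<mu> M where i0': "i0 = (A, \<mu>, M)" by (cases i0)
  have AM: "set_mset A \<subseteq> supp" "\<mu> \<in> L0" "set_mset M \<subseteq> supp" using i0 i0' z by (auto simp: nf_index_def)
  have max: "size A' + size M' \<le> size A + size M" if "(A', \<mu>', M') \<in> Poly_Mapping.keys z" for A' \<mu>' M'
  proof -
    have "deg (A', \<mu>', M') \<le> deg i0" unfolding i0(2) using that by (intro Max_ge) auto
    then show ?thesis by (simp add: deg_def i0')
  qed
  define f where "f = dual_fun A (\<mu> - sum_list (mlist M)) M"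
  have f: "f \<in> serre_funs" unfolding f_def by (rule dual_fun_serre[OF supp orth AM(1,3)])
  let ?p = "([], 0, []) :: 'a list \<times> 'a \<times> 'a list"
  have val: "\<exists>c. c \<noteq> 0 \<and> uact (nform i) f ?p = (if i = i0 then c else 0)" if i: "i \<in> Poly_Mapping.keys z" for i
  proof -
    obtain A' \<mu>' M' where i': "i = (A', \<mu>', M')" by (cases i)
    have AM': "set (mlist A') \<subseteq> supp" "\<mu>' \<in> L0" "set (mlist M') \<subseteq> supp" using i i' z by (auto simp: nf_index_def)
    have MB: "set (mlist M') \<subseteq> B" using AM' supp by auto
    have len: "length (mlist X) = size X" for X :: "'a multiset" by (metis mset_mlist size_mset)
    define g1 where "g1 = uact (U.wprod fb (mlist A')) f"
    define g where "g = uact (kk \<mu>') g1"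
    have g1: "g1 \<in> serre_funs" unfolding g1_def using AM' f by (simp add: uact_closed fb_word_closed)
    have g: "g \<in> serre_funs" unfolding g_def using AM' g1 by (simp add: uact_closed kk_closed)
    have u: "uact (nform i) f ?p = uact (U.wprod ep (mlist M')) g ?p"
      unfolding i' g_def g1_def using uact_word3[OF AM'(1,2) MB f] by simp
    have gK: "g ([], \<nu>, y) = g1 ([], \<nu> + \<mu>', y)" for \<nu> y
      unfolding g_def by (rule uact_K_elt(1)[OF L0_lattice[OF AM'(2)] g1])
    have gz: "g1 ([], \<nu>, y) = 0" if "length y \<noteq> size M" for \<nu> y
    proof -
      have "mset y \<noteq> M" using that by auto
      then have "f (w, \<nu>, y) = 0" for w \<nu> by (simp add: f_def dual_fun_def)
      then show ?thesis unfolding g1_def by (rule uact_fb_word_zero[OF AM'(1) f])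
    qed
    have gF: "g1 ([], \<nu>, y) = f (mlist A', \<nu>, y)" if "size A' \<le> size A" for \<nu> y
    proof -
      have "f (w, \<nu>, y) = 0" if "length w < length (mlist A')" for w \<nu>
      proof -
        have "mset w \<noteq> A" using that \<open>size A' \<le> size A\<close> by (auto simp: len)
        then show ?thesis by (simp add: f_def dual_fun_def)
      qed
      then show ?thesis unfolding g1_def by (rule uact_fb_word[OF AM'(1) f])
    qed
    consider (big) "size M' > size M" | (le) "size M' \<le> size M" by linarith
    then show ?thesis
    proof cases
      \<comment> \<open>Then there are fewer \<open>F\<close>-letters than the dual function asks for.\<close>
      case big
      then have "size A' < size A" using max[of A' \<mu>' M'] i i' by simp
      then have "A' \<noteq> A" "size A' \<le> size A" by auto
      then have "g ([], \<nu>, y) = 0" for \<nu> y unfolding gK using gF by (simp add: f_def dual_fun_def)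
      then have "uact (nform i) f ?p = 0" unfolding u by (rule uact_ep_word_zero[OF MB g])
      moreover have "i \<noteq> i0" using i' i0' \<open>A' \<noteq> A\<close> by simp
      ultimately show ?thesis by (intro exI[of _ 1]) simp
    next
      \<comment> \<open>Only the product of the leading terms can reach a word of \<open>size M\<close> letters.\<close>
      case le
      have "g ([], \<nu>, y) = 0" if "length y < length (mlist M')" for \<nu> y
        unfolding gK using that le by (intro gz) (simp add: len)
      then obtain c where c: "c \<noteq> 0" "uact (U.wprod ep (mlist M')) g ?p = c * g ([], 0 - sum_list (mlist M'), mlist M')"
        using uact_ep_word[OF MB g] by blast
      have "g ([], 0 - sum_list (mlist M'), mlist M') = (if i = i0 then 1 else 0)"
      proof (cases "size M' = size M")
        case False
        then have "i \<noteq> i0" using i' i0' by auto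
        then show ?thesis unfolding gK using False by (simp add: gz len)
      next
        case True
        then have "size A' \<le> size A" using max[of A' \<mu>' M'] i i' by simp
        then show ?thesis unfolding gK using i' i0'
          by (auto simp: gF f_def dual_fun_def)
      qed
      then show ?thesis using c u by (intro exI[of _ c]) simp
    qed
  qed
  have ncl: "nform i \<in> carrier U" if "i \<in> Poly_Mapping.keys z" for i
    using that z supp word3_closed by (auto simp: nf_index_def split: prod.splits)
  have xc: "x \<in> carrier U"
  proof -
    have "outside \<subseteq> carrier U" unfolding outside_def by (rule U.lin_span_closed) (auto intro!: word3_closed)
    then show ?thesis using x by auto
  qed
  have lc: "U.lin nform z \<in> carrier U" by (rule U.lin_closed[OF order_refl]) (use ncl in blast)
  have "0 = uact (U.lin nform z \<oplus>\<^bsub>U\<^esub> x) f ?p" unfolding eq by (simp add: uact_zero f)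
  also have "\<dots> = uact (U.lin nform z) f ?p"
    using lc xc f uact_outside[OF x AM(1,3)] by (simp add: uact_add f_def)
  also have "\<dots> = (\<Sum>i\<in>Poly_Mapping.keys z. Poly_Mapping.lookup z i * uact (nform i) f ?p)"
    unfolding U.lin_def using ncl f by (subst finsum_uact) (auto simp: uact_smult simp del: split_paired_All)
  also have "\<dots> = Poly_Mapping.lookup z i0 * uact (nform i0) f ?p"
    using i0(1) val by (subst sum.remove[OF _ i0(1)]) (auto intro!: sum.neutral, metis)
  finally have "Poly_Mapping.lookup z i0 * uact (nform i0) f ?p = 0" by simp
  moreover have "uact (nform i0) f ?p \<noteq> 0" using val[OF i0(1)] by auto
  moreover have "Poly_Mapping.lookup z i0 \<noteq> 0" using i0(1) by (simp add: in_keys_iff)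
  ultimately show False by simp
qed

text \<open>The generators paired up with the given elements generate a subalgebra of the product. By its normal
  form and by independence it is the graph of a map; products with a factor \<open>E_bar \<beta>\<close>, \<open>\<beta> \<notin> supp\<close>, have second
  component zero. The subsets \<open>S\<close>, \<open>T\<close> and \<open>Lt\<close> serve to treat \<open>C\<close> and its quantum Weyl subalgebras alike.\<close>

lemma coideal_hom:
  fixes A' :: "(complex, 'b) module"
  assumes A': "calg A'" and S: "S \<subseteq> supp" and T: "T \<subseteq> B" "T \<inter> supp = S" and Lt: "Lt \<subseteq> L0" "0 \<in> Lt" "\<And>\<mu> \<nu>. \<mu> \<in> Lt \<Longrightarrow> \<nu> \<in> Lt \<Longrightarrow> \<mu> + \<nu> \<in> Lt"
    and f': "\<And>\<alpha>. \<alpha> \<in> S \<Longrightarrow> f' \<alpha> \<in> carrier A'" and e': "\<And>\<beta>. \<beta> \<in> T \<Longrightarrow> e' \<beta> \<in> carrier A'"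
    and k': "\<And>\<mu>. \<mu> \<in> Lt \<Longrightarrow> k' \<mu> \<in> carrier A'"
    and k0: "k' 0 = \<one>\<^bsub>A'\<^esub>" and kk': "\<And>\<mu> \<nu>. \<mu> \<in> Lt \<Longrightarrow> \<nu> \<in> Lt \<Longrightarrow> k' \<mu> \<otimes>\<^bsub>A'\<^esub> k' \<nu> = k' (\<mu> + \<nu>)"
    and kf': "\<And>\<mu> \<alpha>. \<mu> \<in> Lt \<Longrightarrow> \<alpha> \<in> S \<Longrightarrow> k' \<mu> \<otimes>\<^bsub>A'\<^esub> f' \<alpha> = f' \<alpha> \<otimes>\<^bsub>A'\<^esub> k' \<mu>"
    and ek': "\<And>\<mu> \<alpha>. \<mu> \<in> Lt \<Longrightarrow> \<alpha> \<in> S \<Longrightarrow> e' \<alpha> \<otimes>\<^bsub>A'\<^esub> k' \<mu> = k' \<mu> \<otimes>\<^bsub>A'\<^esub> e' \<alpha>"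
    and ef': "\<And>\<alpha>. \<alpha> \<in> S \<Longrightarrow> e' \<alpha> \<otimes>\<^bsub>A'\<^esub> f' \<alpha> = (q_root q \<alpha>)\<^sup>2 \<odot>\<^bsub>A'\<^esub> (f' \<alpha> \<otimes>\<^bsub>A'\<^esub> e' \<alpha>) \<oplus>\<^bsub>A'\<^esub> weyl_const \<alpha> \<odot>\<^bsub>A'\<^esub> \<one>\<^bsub>A'\<^esub>"
    and efd': "\<And>\<alpha> \<beta>. \<alpha> \<in> S \<Longrightarrow> \<beta> \<in> S \<Longrightarrow> \<alpha> \<noteq> \<beta> \<Longrightarrow> e' \<beta> \<otimes>\<^bsub>A'\<^esub> f' \<alpha> = f' \<alpha> \<otimes>\<^bsub>A'\<^esub> e' \<beta>"
    and ff': "\<And>\<alpha> \<beta>. \<alpha> \<in> S \<Longrightarrow> \<beta> \<in> S \<Longrightarrow> f' \<alpha> \<otimes>\<^bsub>A'\<^esub> f' \<beta> = f' \<beta> \<otimes>\<^bsub>A'\<^esub> f' \<alpha>"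
    and ee': "\<And>\<alpha> \<beta>. \<alpha> \<in> S \<Longrightarrow> \<beta> \<in> S \<Longrightarrow> e' \<alpha> \<otimes>\<^bsub>A'\<^esub> e' \<beta> = e' \<beta> \<otimes>\<^bsub>A'\<^esub> e' \<alpha>"
    and e0: "\<And>\<beta>. \<beta> \<in> T - S \<Longrightarrow> e' \<beta> = \<zero>\<^bsub>A'\<^esub>"
  obtains \<pi> where "\<pi> \<in> alg_hom (restrict_alg U (alg_gen U (fb ` S \<union> kk ` Lt \<union> ep ` T))) A'"
    "\<And>\<alpha>. \<alpha> \<in> S \<Longrightarrow> \<pi> (fb \<alpha>) = f' \<alpha>" "\<And>\<mu>. \<mu> \<in> Lt \<Longrightarrow> \<pi> (kk \<mu>) = k' \<mu>" "\<And>\<beta>. \<beta> \<in> T \<Longrightarrow> \<pi> (ep \<beta>) = e' \<beta>"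
proof -
  interpret A': calg A' by fact
  interpret Q: calg "prod_alg U A'" by (rule prod_alg_calg[OF U.calg_axioms A'])
  let ?P = "prod_alg U A'"
  define F where "F \<alpha> = (fb \<alpha>, f' \<alpha>)" for \<alpha>
  define K where "K \<mu> = (kk \<mu>, k' \<mu>)" for \<mu>
  define E where "E \<beta> = (ep \<beta>, e' \<beta>)" for \<beta>
  have Ssupp: "\<alpha> \<in> supp" "\<alpha> \<in> B" if "\<alpha> \<in> S" for \<alpha> using that S supp by auto
  have SL: "int_form \<mu> \<alpha> = 0" if "\<mu> \<in> Lt" "\<alpha> \<in> S" for \<mu> \<alpha> using int_form_L0 Lt S that by blast
  let ?gens = "F ` S \<union> K ` Lt \<union> E ` T"
  let ?N = "{Q.wprod F as \<otimes>\<^bsub>?P\<^esub> K \<mu> \<otimes>\<^bsub>?P\<^esub> Q.wprod E bs | as \<mu> bs. set as \<subseteq> S \<and> \<mu> \<in> Lt \<and> set bs \<subseteq> T}"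
  define D where "D = alg_gen ?P ?gens"
  have gens: "?gens \<subseteq> carrier ?P"
    using fb_closed kk_closed ep_closed f' e' k' S T Lt by (auto simp: F_def K_def E_def subset_iff)
  have D: "subalg D ?P" unfolding D_def by (rule Q.alg_gen_subalg[OF gens])
  have DN: "D = lin_span ?P ?N"
    unfolding D_def
  proof (rule Q.normal_form_span[where c = "\<lambda>\<beta> \<mu>. q powi (- int_form \<mu> \<beta>)"
        and r = "\<lambda>\<beta> \<alpha>. if \<beta> = \<alpha> then (q_root q \<alpha>)\<^sup>2 else q powi int_form \<beta> \<alpha>"
        and d = "\<lambda>\<beta> \<alpha>. if \<beta> = \<alpha> then weyl_const \<alpha> else 0"])
    show "K 0 = \<one>\<^bsub>?P\<^esub>" by (simp add: K_def K_elt_zero k0)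
    show "K \<mu> \<otimes>\<^bsub>?P\<^esub> K \<nu> = K (\<mu> + \<nu>)" if "\<mu> \<in> Lt" "\<nu> \<in> Lt" for \<mu> \<nu>
      using that Lt(1) by (simp add: K_def kk_add kk' subset_iff)
    show "K \<mu> \<otimes>\<^bsub>?P\<^esub> F \<alpha> = F \<alpha> \<otimes>\<^bsub>?P\<^esub> K \<mu>" if "\<mu> \<in> Lt" "\<alpha> \<in> S" for \<mu> \<alpha>
      using that Lt(1) S by (simp add: K_def F_def kk_fb kf' subset_iff)
    show "E \<beta> \<otimes>\<^bsub>?P\<^esub> K \<mu> = q powi (- int_form \<mu> \<beta>) \<odot>\<^bsub>?P\<^esub> (K \<mu> \<otimes>\<^bsub>?P\<^esub> E \<beta>)" if "\<mu> \<in> Lt" "\<beta> \<in> T" for \<mu> \<beta>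
    proof -
      have "\<mu> \<in> L0" "\<beta> \<in> B" using that Lt(1) T(1) by auto
      moreover have "e' \<beta> \<otimes>\<^bsub>A'\<^esub> k' \<mu> = q powi (- int_form \<mu> \<beta>) \<odot>\<^bsub>A'\<^esub> (k' \<mu> \<otimes>\<^bsub>A'\<^esub> e' \<beta>)"
        using that ek' SL e0 k' e' by (cases "\<beta> \<in> S") simp_all
      ultimately show ?thesis by (simp add: E_def K_def ep_kk)
    qed
    show "E \<beta> \<otimes>\<^bsub>?P\<^esub> F \<alpha> = (if \<beta> = \<alpha> then (q_root q \<alpha>)\<^sup>2 else q powi int_form \<beta> \<alpha>) \<odot>\<^bsub>?P\<^esub> (F \<alpha> \<otimes>\<^bsub>?P\<^esub> E \<beta>) \<oplus>\<^bsub>?P\<^esub>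
        (if \<beta> = \<alpha> then weyl_const \<alpha> else 0) \<odot>\<^bsub>?P\<^esub> \<one>\<^bsub>?P\<^esub>" if "\<alpha> \<in> S" "\<beta> \<in> T" for \<alpha> \<beta>
    proof (cases "\<beta> = \<alpha>")
      case True
      then show ?thesis using that Ssupp by (simp add: E_def F_def ep_fb_same ef')
    next
      case False
      have b: "\<beta> \<in> B" "\<alpha> \<in> supp" using that T Ssupp by auto
      have "ep \<beta> \<otimes>\<^bsub>U\<^esub> fb \<alpha> = q powi int_form \<beta> \<alpha> \<odot>\<^bsub>U\<^esub> (fb \<alpha> \<otimes>\<^bsub>U\<^esub> ep \<beta>)"
        using ep_fb_diff[OF b False] by (simp add: U.q_comm_def)
      moreover have "e' \<beta> \<otimes>\<^bsub>A'\<^esub> f' \<alpha> = q powi int_form \<beta> \<alpha> \<odot>\<^bsub>A'\<^esub> (f' \<alpha> \<otimes>\<^bsub>A'\<^esub> e' \<beta>)"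
      proof (cases "\<beta> \<in> S")
        case True
        then have "int_form \<beta> \<alpha> = 0" using orth[of \<beta> \<alpha>] Ssupp that False by (simp add: int_form_def)
        then show ?thesis using efd'[OF that(1) True] False e' f' that by simp
      next
        case False
        then show ?thesis using e0 f' that by simp
      qed
      ultimately show ?thesis using False that b fb_closed ep_closed e' f' by (simp add: E_def F_def)
    qed
  qed (use gens Lt in \<open>auto simp: image_subset_iff simp del: prod_alg_simps\<close>)
  have Fw: "Q.wprod F as = (U.wprod fb as, A'.wprod f' as)" for as by (induction as) (simp_all add: F_def)
  have Ew: "Q.wprod E bs = (U.wprod ep bs, A'.wprod e' bs)" for bs by (induction bs) (simp_all add: E_def)
  have fw: "A'.wprod f' as \<in> carrier A'" if "set as \<subseteq> S" for as using f' that by (intro A'.wprod_closed) auto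
  have ew: "A'.wprod e' bs \<in> carrier A'" if "set bs \<subseteq> T" for bs using e' that by (intro A'.wprod_closed) auto
  have ew0: "A'.wprod e' bs = \<zero>\<^bsub>A'\<^esub>" if "set bs \<subseteq> T" "\<not> set bs \<subseteq> S" for bs
    using that
  proof (induction bs)
    case (Cons \<beta> bs)
    show ?case
    proof (cases "\<beta> \<in> S")
      case True
      then show ?thesis using Cons e' by simp
    next
      case False
      then show ?thesis using Cons.prems e0[of \<beta>] ew[of bs] by simp
    qed
  qed simp
  define I where "I = {(A, \<mu>, M). set_mset A \<subseteq> S \<and> \<mu> \<in> Lt \<and> set_mset M \<subseteq> S}"
  define nA where "nA = (\<lambda>(A, \<mu>, M). A'.wprod f' (mlist A) \<otimes>\<^bsub>A'\<^esub> k' \<mu> \<otimes>\<^bsub>A'\<^esub> A'.wprod e' (mlist M))"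
  have ST: "S \<subseteq> T" using S T by auto
  have I_nf: "I \<subseteq> nf_index" using S Lt by (auto simp: I_def nf_index_def)
  have nAcl: "nA \<in> I \<rightarrow> carrier A'" using ST by (auto simp: I_def nA_def fw ew k')
  have nUcl: "nform \<in> I \<rightarrow> carrier U"
  proof
    fix i assume "i \<in> I"
    then obtain A \<mu> M where i: "i = (A, \<mu>, M)" "set (mlist A) \<subseteq> supp" "\<mu> \<in> L0" "set (mlist M) \<subseteq> B" using S Lt(1) supp by (auto simp: I_def)
    then show "nform i \<in> carrier U" using word3_closed[OF i(2-4)] by simp
  qed
  have outU: "outside \<subseteq> carrier U" unfolding outside_def by (rule U.lin_span_closed) (auto intro!: word3_closed)
  have rep: "\<exists>z x. Poly_Mapping.keys z \<subseteq> I \<and> x \<in> outside \<and> d = (U.lin nform z \<oplus>\<^bsub>U\<^esub> x, A'.lin nA z)" if "d \<in> D" for d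
    using that unfolding DN
  proof induction
    case span_zero
    show ?case by (rule exI[of _ 0], rule exI[of _ "\<zero>\<^bsub>U\<^esub>"]) (simp add: outside_def lin_span.span_zero)
  next
    case (span_base n)
    then obtain as \<mu> bs where n: "n = Q.wprod F as \<otimes>\<^bsub>?P\<^esub> K \<mu> \<otimes>\<^bsub>?P\<^esub> Q.wprod E bs" "set as \<subseteq> S" "\<mu> \<in> Lt" "set bs \<subseteq> T" by blast
    have n': "n = (U.wprod fb as \<otimes>\<^bsub>U\<^esub> kk \<mu> \<otimes>\<^bsub>U\<^esub> U.wprod ep bs, A'.wprod f' as \<otimes>\<^bsub>A'\<^esub> k' \<mu> \<otimes>\<^bsub>A'\<^esub> A'.wprod e' bs)"
      unfolding n(1) Fw Ew by (simp add: K_def)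
    have w: "set as \<subseteq> supp" "\<mu> \<in> L0" "set bs \<subseteq> B" using n S Lt T by auto
    show ?case
    proof (cases "set bs \<subseteq> S")
      case True
      let ?i = "(mset as, \<mu>, mset bs)"
      have i: "?i \<in> I" using n True by (simp add: I_def)
      have p1: "U.wprod fb (mlist (mset as)) = U.wprod fb as"
      proof (rule U.wprod_permute)
        show "fb g \<in> carrier U" if "g \<in> set (mlist (mset as))" for g using that n(2) by (intro fb_closed Ssupp) auto
        show "fb g \<otimes>\<^bsub>U\<^esub> fb h = fb h \<otimes>\<^bsub>U\<^esub> fb g" if "g \<in> set (mlist (mset as))" "h \<in> set (mlist (mset as))" for g h
          using that n(2) by (intro fb_commute Ssupp) (simp_all add: subset_iff)
      qed simp
      have p2: "U.wprod ep (mlist (mset bs)) = U.wprod ep bs"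
      proof (rule U.wprod_permute)
        show "ep g \<in> carrier U" if "g \<in> set (mlist (mset bs))" for g using that True by (intro ep_closed Ssupp) auto
        show "ep g \<otimes>\<^bsub>U\<^esub> ep h = ep h \<otimes>\<^bsub>U\<^esub> ep g" if "g \<in> set (mlist (mset bs))" "h \<in> set (mlist (mset bs))" for g h
          using that True by (intro ep_commute Ssupp) (simp_all add: subset_iff)
      qed simp
      have p3: "A'.wprod f' (mlist (mset as)) = A'.wprod f' as"
        by (rule A'.wprod_permute) (use n(2) f' ff' in \<open>simp_all add: subset_iff\<close>)
      have p4: "A'.wprod e' (mlist (mset bs)) = A'.wprod e' bs"
        by (rule A'.wprod_permute) (use True ST e' ee' in \<open>simp_all add: subset_iff\<close>)
      note p = p1 p2 p3 p4
      have "n = (U.lin nform (Poly_Mapping.single ?i 1) \<oplus>\<^bsub>U\<^esub> \<zero>\<^bsub>U\<^esub>, A'.lin nA (Poly_Mapping.single ?i 1))"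
        using nUcl nAcl i word3_closed[OF w] n(2,3) True ST fw ew k'
        by (simp add: U.lin_single A'.lin_single n' nA_def p Pi_def)
      then show ?thesis using i by (intro exI[of _ "Poly_Mapping.single ?i 1"] exI[of _ "\<zero>\<^bsub>U\<^esub>"]) (simp add: outside_def lin_span.span_zero)
    next
      case False
      then have "\<not> set bs \<subseteq> supp" using n(4) T(2) by auto
      then have "U.wprod fb as \<otimes>\<^bsub>U\<^esub> kk \<mu> \<otimes>\<^bsub>U\<^esub> U.wprod ep bs \<in> outside"
        unfolding outside_def using w by (intro lin_span.span_base) blast
      moreover have "n = (U.lin nform 0 \<oplus>\<^bsub>U\<^esub> (U.wprod fb as \<otimes>\<^bsub>U\<^esub> kk \<mu> \<otimes>\<^bsub>U\<^esub> U.wprod ep bs), A'.lin nA 0)"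
        using word3_closed[OF w] fw[OF n(2)] k'[OF n(3)] by (simp add: n' ew0[OF n(4) False])
      ultimately show ?thesis by (intro exI[of _ 0] exI[of _ "U.wprod fb as \<otimes>\<^bsub>U\<^esub> kk \<mu> \<otimes>\<^bsub>U\<^esub> U.wprod ep bs"]) simp
    qed
  next
    case (span_add d d')
    then obtain z x z' x' where z: "Poly_Mapping.keys z \<subseteq> I" "x \<in> outside" "d = (U.lin nform z \<oplus>\<^bsub>U\<^esub> x, A'.lin nA z)"
      "Poly_Mapping.keys z' \<subseteq> I" "x' \<in> outside" "d' = (U.lin nform z' \<oplus>\<^bsub>U\<^esub> x', A'.lin nA z')" by blast
    have c: "U.lin nform z \<in> carrier U" "U.lin nform z' \<in> carrier U" "x \<in> carrier U" "x' \<in> carrier U"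
      using z U.lin_closed[OF _ nUcl] outU by auto
    have "d \<oplus>\<^bsub>?P\<^esub> d' = (U.lin nform (z + z') \<oplus>\<^bsub>U\<^esub> (x \<oplus>\<^bsub>U\<^esub> x'), A'.lin nA (z + z'))"
      using c by (simp add: z(3,6) U.lin_add[OF z(1,4) nUcl] A'.lin_add[OF z(1,4) nAcl] U.a_ac)
    moreover have "x \<oplus>\<^bsub>U\<^esub> x' \<in> outside" using z by (simp add: outside_def lin_span.span_add)
    ultimately show ?case using keys_add_subset[OF z(1,4)] by blast
  next
    case (span_smult d c)
    then obtain z x where z: "Poly_Mapping.keys z \<subseteq> I" "x \<in> outside" "d = (U.lin nform z \<oplus>\<^bsub>U\<^esub> x, A'.lin nA z)" by blast
    have cl: "U.lin nform z \<in> carrier U" "x \<in> carrier U" using z U.lin_closed[OF _ nUcl] outU by auto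
    have "c \<odot>\<^bsub>?P\<^esub> d = (U.lin nform (pm_scale c z) \<oplus>\<^bsub>U\<^esub> c \<odot>\<^bsub>U\<^esub> x, A'.lin nA (pm_scale c z))"
      using cl by (simp add: z(3) U.lin_scale[OF z(1) nUcl] A'.lin_scale[OF z(1) nAcl] U.smult_r_distr)
    moreover have "c \<odot>\<^bsub>U\<^esub> x \<in> outside" using z by (simp add: outside_def lin_span.span_smult)
    ultimately show ?case using subset_trans[OF keys_pm_scale z(1)] by blast
  qed
  have single: "y = \<zero>\<^bsub>A'\<^esub>" if y: "(\<zero>\<^bsub>U\<^esub>, y) \<in> D" for y
  proof -
    obtain z x where z: "Poly_Mapping.keys z \<subseteq> I" "x \<in> outside" "U.lin nform z \<oplus>\<^bsub>U\<^esub> x = \<zero>\<^bsub>U\<^esub>" "y = A'.lin nA z"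
      using rep[OF y] by auto
    have "z = 0" by (rule normal_forms_independent[OF subset_trans[OF z(1) I_nf] z(2,3)])
    then show ?thesis using z(4) by simp
  qed
  obtain \<pi> where \<pi>: "\<pi> \<in> alg_hom (restrict_alg U (fst ` D)) A'" "\<And>x y. (x, y) \<in> D \<Longrightarrow> \<pi> x = y"
    using graph_alg_hom[OF U.calg_axioms A' D single] by blast
  let ?G = "alg_gen U (fb ` S \<union> kk ` Lt \<union> ep ` T)"
  have gD: "(fb \<alpha>, f' \<alpha>) \<in> D" "(kk \<mu>, k' \<mu>) \<in> D" "(ep \<beta>, e' \<beta>) \<in> D" if "\<alpha> \<in> S" "\<mu> \<in> Lt" "\<beta> \<in> T" for \<alpha> \<mu> \<beta>
    unfolding D_def F_def[symmetric] K_def[symmetric] E_def[symmetric]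
    by (rule subsetD[OF Q.alg_gen_incl]; use that in blast)+
  have gD': "\<alpha> \<in> S \<Longrightarrow> (fb \<alpha>, f' \<alpha>) \<in> D" "\<mu> \<in> Lt \<Longrightarrow> (kk \<mu>, k' \<mu>) \<in> D" "\<beta> \<in> T \<Longrightarrow> (ep \<beta>, e' \<beta>) \<in> D" for \<alpha> \<mu> \<beta>
    unfolding D_def F_def[symmetric] K_def[symmetric] E_def[symmetric]
    by (rule subsetD[OF Q.alg_gen_incl]; blast)+
  have G: "?G \<subseteq> fst ` D"
  proof (rule U.alg_gen_least)
    show "subalg (fst ` D) U" by (rule alg_hom_image_subalg[OF Q.calg_axioms U.calg_axioms fst_alg_hom D])
    show "fb ` S \<union> kk ` Lt \<union> ep ` T \<subseteq> fst ` D" using gD' by force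
  qed
  then have "\<pi> \<in> alg_hom (restrict_alg U ?G) A'" by (rule alg_hom_restrict[OF \<pi>(1)])
  then show ?thesis using that \<pi>(2) gD' by blast
qed

end

section \<open>Characters and the shift of a coideal subalgebra\<close>

lemma calg_complex: "calg complex_alg"
  by (rule calgI) (auto simp: complex_alg_def algebra_simps intro: exI[of _ "- x" for x])

lemma complex_alg_simps [simp]: "carrier complex_alg = UNIV" "x \<oplus>\<^bsub>complex_alg\<^esub> y = x + y"
  "x \<otimes>\<^bsub>complex_alg\<^esub> y = x * y" "\<zero>\<^bsub>complex_alg\<^esub> = 0" "\<one>\<^bsub>complex_alg\<^esub> = 1" "c \<odot>\<^bsub>complex_alg\<^esub> x = c * x"
  by (simp_all add: complex_alg_def)

lemma lin_span_restrict: "lin_span (restrict_alg A B) S = lin_span A S"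
proof
  show "lin_span (restrict_alg A B) S \<subseteq> lin_span A S"
  proof
    fix x assume "x \<in> lin_span (restrict_alg A B) S"
    then show "x \<in> lin_span A S"
      by induction (auto intro: lin_span.intros)
  qed
  show "lin_span A S \<subseteq> lin_span (restrict_alg A B) S"
  proof
    fix x assume "x \<in> lin_span A S"
    then show "x \<in> lin_span (restrict_alg A B) S"
      by induction (use lin_span.intros[where V="restrict_alg A B" and S=S] in simp_all)
  qed
qed

lemma alg_hom_image_alg_gen:
  assumes A: "calg A" and B: "calg B" and G: "G \<subseteq> carrier A" and h: "h \<in> alg_hom (restrict_alg A (alg_gen A G)) B"
  shows "h ` alg_gen A G = alg_gen B (h ` G)"
proof
  interpret A: calg A by fact
  interpret B: calg B by fact
  let ?G = "alg_gen A G"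
  have S: "subalg ?G A" by (rule A.alg_gen_subalg[OF G])
  have R: "calg (restrict_alg A ?G)" by (rule A.subalg_calg[OF S])
  have GG: "G \<subseteq> ?G" by (rule A.alg_gen_incl)
  note hh = alg_homD[OF h, simplified]
  have hG: "h ` G \<subseteq> carrier B" using hh(2) GG by auto
  have "subalg {x \<in> carrier (restrict_alg A ?G). h x \<in> alg_gen B (h ` G)} (restrict_alg A ?G)"
    by (rule alg_hom_vimage_subalg[OF R B h B.alg_gen_subalg[OF hG]])
  then have "subalg {x \<in> ?G. h x \<in> alg_gen B (h ` G)} A"
    using S by (simp add: subalg_def subset_iff)
  moreover have "G \<subseteq> {x \<in> ?G. h x \<in> alg_gen B (h ` G)}" using GG B.alg_gen_incl[of "h ` G"] by auto
  ultimately have "?G \<subseteq> {x \<in> ?G. h x \<in> alg_gen B (h ` G)}" by (rule A.alg_gen_least)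
  then show "h ` ?G \<subseteq> alg_gen B (h ` G)" by auto
  have "subalg (carrier (restrict_alg A ?G)) (restrict_alg A ?G)" by (rule calg.subalg_carrier[OF R])
  then have "subalg (h ` carrier (restrict_alg A ?G)) B" by (rule alg_hom_image_subalg[OF R B h])
  then show "alg_gen B (h ` G) \<subseteq> h ` ?G" using GG by (intro B.alg_gen_least) auto
qed

text \<open>Lift the functional to the free algebra and extend it there from a basis; the extension still vanishes on
  the relations.\<close>

lemma (in presentation) linear_functional_extend:
  assumes A: "subalg D PA" and \<phi>: "\<phi> \<in> lin_hom (restrict_alg PA D) complex_alg"
  obtains \<Psi> where "\<Psi> \<in> lin_hom PA complex_alg" "\<And>x. x \<in> D \<Longrightarrow> \<Psi> x = \<phi> x"
proof -
  interpret F: calg "free_alg G" by (rule free_alg_calg)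
  interpret pm: vector_space "pm_scale :: complex \<Rightarrow> ('g list \<Rightarrow>\<^sub>0 complex) \<Rightarrow> _"
    by unfold_locales (auto simp: pm_scale_simps(1-4))
  interpret c: vector_space "(*) :: complex \<Rightarrow> complex \<Rightarrow> complex"
    by unfold_locales (auto simp: algebra_simps)
  interpret pair: vector_space_pair "pm_scale :: complex \<Rightarrow> ('g list \<Rightarrow>\<^sub>0 complex) \<Rightarrow> _" "(*) :: complex \<Rightarrow> complex \<Rightarrow> complex"
    by unfold_locales
  define V where "V = {x \<in> carrier (free_alg G). proj x \<in> D}"
  note p = alg_homD[OF proj_hom]
  note \<phi>D = lin_homD[OF \<phi>, simplified]
  have zero: "0 \<in> V" "proj 0 = \<zero>\<^bsub>PA\<^esub>"
  proof -
    show "proj 0 = \<zero>\<^bsub>PA\<^esub>" using lin_hom_zero[OF free_alg_calg presented_calg p(1)] by (simp add: free_alg_simps)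
    then show "0 \<in> V" using A by (simp add: V_def subalg_def free_alg_simps)
  qed
  have add: "x + y \<in> V" "proj (x + y) = proj x \<oplus>\<^bsub>PA\<^esub> proj y" if "x \<in> V" "y \<in> V" for x y
  proof -
    have xy: "x \<in> carrier (free_alg G)" "y \<in> carrier (free_alg G)" using that by (auto simp: V_def)
    show *: "proj (x + y) = proj x \<oplus>\<^bsub>PA\<^esub> proj y" using p(3)[OF xy] by (simp add: free_alg_simps(4))
    have "x + y \<in> carrier (free_alg G)" using F.a_closed[OF xy] by (simp add: free_alg_simps(4))
    then show "x + y \<in> V" using * that A by (simp add: V_def subalg_def)
  qed
  have sc: "pm_scale c x \<in> V" "proj (pm_scale c x) = c \<odot>\<^bsub>PA\<^esub> proj x" if "x \<in> V" for x c
  proof -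
    have x: "x \<in> carrier (free_alg G)" using that by (auto simp: V_def)
    show *: "proj (pm_scale c x) = c \<odot>\<^bsub>PA\<^esub> proj x" using p(4)[OF x, of c] by (simp add: free_alg_simps(5))
    have "pm_scale c x \<in> carrier (free_alg G)" using F.smult_closed[OF x, of c] by (simp add: free_alg_simps(5))
    then show "pm_scale c x \<in> V" using * that A by (simp add: V_def subalg_def)
  qed
  obtain b where b: "b \<subseteq> V" "pm.independent b" "V \<subseteq> pm.span b" using pm.maximal_independent_subset by blast
  obtain g where g: "Vector_Spaces.linear pm_scale (*) g" "\<forall>x\<in>b. g x = \<phi> (proj x)"
    using pair.linear_independent_extend[OF b(2), of "\<lambda>x. \<phi> (proj x)"] by blast
  interpret g: Vector_Spaces.linear pm_scale "(*)" g by (rule g(1))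
  have gV: "x \<in> V \<and> g x = \<phi> (proj x)" if "x \<in> pm.span b" for x
    using that
  proof (induction rule: pm.span_induct_alt)
    case base
    have "proj 0 \<in> D" using zero(1) by (simp add: V_def)
    then have "\<phi> (0 \<odot>\<^bsub>PA\<^esub> proj 0) = 0 * \<phi> (proj 0)" by (rule \<phi>D(3))
    then have "\<phi> (proj 0) = 0" using zero(2) by simp
    then show ?case using zero g.zero by simp
  next
    case (step c x y)
    then have x: "x \<in> V" "g x = \<phi> (proj x)" using b(1) g(2) by auto
    have mem: "proj x \<in> D" "proj y \<in> D" "proj (pm_scale c x) \<in> D" using x step sc(1)[OF x(1), of c] by (auto simp: V_def)
    have "g (pm_scale c x + y) = c * g x + g y" by (simp add: g.add g.scale)
    also have "\<dots> = \<phi> (proj (pm_scale c x) \<oplus>\<^bsub>PA\<^esub> proj y)"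
      using \<phi>D(2)[OF mem(3,2)] \<phi>D(3)[OF mem(1), of c] x step sc(2)[OF x(1), of c] by simp
    finally show ?case using add[OF sc(1)[OF x(1)]] step by simp
  qed
  have glin: "g \<in> lin_hom (free_alg G) complex_alg"
    by (simp add: lin_hom_def free_alg_simps g.add g.scale)
  have kill: "g x = \<zero>\<^bsub>complex_alg\<^esub>" if "x \<in> Idl\<^bsub>free_alg G\<^esub> R" for x
  proof -
    have x: "x \<in> carrier (free_alg G)" by (rule additive_subgroup.a_Hcarr[OF ideal.axioms(1)[OF rel_ideal] that])
    then have px: "proj x = \<zero>\<^bsub>PA\<^esub>" using that by (simp add: proj_eq_zero_iff)
    then have "x \<in> V" using A x by (simp add: V_def subalg_def)
    then have "g x = \<phi> (proj x)" using gV b(3) by auto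
    moreover have "\<phi> (proj 0) = 0" using gV[OF pm.span_zero] g.zero by simp
    ultimately show ?thesis using px zero by simp
  qed
  obtain \<Psi> where \<Psi>: "\<Psi> \<in> lin_hom PA complex_alg" "\<And>x. x \<in> carrier (free_alg G) \<Longrightarrow> \<Psi> (proj x) = g x"
    by (rule F.quot_alg_lift[OF rel_ideal calg_complex glin kill]) (auto simp: presented_alg_def)
  have "\<Psi> x = \<phi> x" if x: "x \<in> D" for x
  proof -
    have "x \<in> carrier PA" using A x by (auto simp: subalg_def)
    then obtain y where y: "y \<in> carrier (free_alg G)" "x = proj y" unfolding presented_carrier by blast
    then have "y \<in> V" using x by (simp add: V_def)
    then show ?thesis using \<Psi>(2)[OF y(1)] gV b(3) y by auto
  qed
  then show ?thesis using that \<Psi>(1) by blast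
qed

locale comult_data = coideal_data +
  fixes \<Delta> :: "'a uq \<Rightarrow> ((bool \<Rightarrow> 'a uq) \<Rightarrow>\<^sub>0 complex) set"
  assumes comult: "is_comult B q \<Delta>"
begin

sublocale TS: tensor_family "UNIV :: bool set" "\<lambda>_. U"
  by unfold_locales

abbreviation "TT \<equiv> tensor_square U"
abbreviation "t2 \<equiv> tensor2 U"

lemma TT_eq: "tensor_square U = tensor_alg UNIV (\<lambda>_::bool. U)" by (simp add: tensor_square_def)

sublocale TT: calg TT unfolding TT_eq by (rule TS.T.calg_axioms)

lemma t2_fun: "x \<in> carrier U \<Longrightarrow> y \<in> carrier U \<Longrightarrow> (\<lambda>b. if b then y else x) \<in> (\<Pi> j\<in>UNIV. carrier U)" by auto

lemma t2_closed [simp]: "x \<in> carrier U \<Longrightarrow> y \<in> carrier U \<Longrightarrow> t2 x y \<in> carrier TT"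
  unfolding tensor2_def TT_eq by (rule TS.pt_closed[OF t2_fun])

lemma t2_mult: "x \<in> carrier U \<Longrightarrow> y \<in> carrier U \<Longrightarrow> x' \<in> carrier U \<Longrightarrow> y' \<in> carrier U \<Longrightarrow>
    t2 x y \<otimes>\<^bsub>TT\<^esub> t2 x' y' = t2 (x \<otimes>\<^bsub>U\<^esub> x') (y \<otimes>\<^bsub>U\<^esub> y')"
  unfolding tensor2_def TT_eq by (subst TS.pt_mult[OF t2_fun t2_fun]) (auto intro!: TS.pt_cong)

lemma t2_one: "t2 \<one>\<^bsub>U\<^esub> \<one>\<^bsub>U\<^esub> = \<one>\<^bsub>TT\<^esub>"
  unfolding tensor2_def TT_eq using TS.pt_one by simp

lemma t2_upd: "(\<lambda>b. if b then y else x) = (\<lambda>b. if b then y else x0)(False := x)"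
  "(\<lambda>b. if b then y else x) = (\<lambda>b. if b then y0 else x)(True := y)"
  by auto

lemma t2_add_l: "x \<in> carrier U \<Longrightarrow> x' \<in> carrier U \<Longrightarrow> y \<in> carrier U \<Longrightarrow> t2 (x \<oplus>\<^bsub>U\<^esub> x') y = t2 x y \<oplus>\<^bsub>TT\<^esub> t2 x' y"
  unfolding tensor2_def TT_eq
  using TS.pt_add[OF t2_fun[of "\<one>\<^bsub>U\<^esub>" y], of False x x'] by (simp only: t2_upd(1)[of y _ "\<one>\<^bsub>U\<^esub>", symmetric] UNIV_I U.one_closed)

lemma t2_smult_l: "x \<in> carrier U \<Longrightarrow> y \<in> carrier U \<Longrightarrow> t2 (c \<odot>\<^bsub>U\<^esub> x) y = c \<odot>\<^bsub>TT\<^esub> t2 x y"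
  unfolding tensor2_def TT_eq
  using TS.pt_smult[OF t2_fun[of "\<one>\<^bsub>U\<^esub>" y], of False x c] by (simp only: t2_upd(1)[of y _ "\<one>\<^bsub>U\<^esub>", symmetric] UNIV_I U.one_closed)

lemma t2_smult_r: "x \<in> carrier U \<Longrightarrow> y \<in> carrier U \<Longrightarrow> t2 x (c \<odot>\<^bsub>U\<^esub> y) = c \<odot>\<^bsub>TT\<^esub> t2 x y"
  unfolding tensor2_def TT_eq
  using TS.pt_smult[OF t2_fun[of x "\<one>\<^bsub>U\<^esub>"], of True y c] by (simp only: t2_upd(2)[of _ x "\<one>\<^bsub>U\<^esub>", symmetric] UNIV_I U.one_closed)

lemma functional_tensor_id:
  assumes "\<Psi> \<in> lin_hom U complex_alg"
  obtains h where "h \<in> lin_hom TT U" "\<And>x y. x \<in> carrier U \<Longrightarrow> y \<in> carrier U \<Longrightarrow> h (t2 x y) = \<Psi> x \<odot>\<^bsub>U\<^esub> y"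
proof -
  note \<Psi> = lin_homD[OF assms, simplified]
  obtain h where h: "h \<in> lin_hom (tensor_alg UNIV (\<lambda>_::bool. U)) U"
     "\<And>x. x \<in> (\<Pi> j\<in>UNIV. carrier U) \<Longrightarrow> h (pure_tensor UNIV (\<lambda>_. U) x) = (\<lambda>x. \<Psi> (x False) \<odot>\<^bsub>U\<^esub> x True) (restrict x UNIV)"
  proof (rule TS.tensor_linear_lift[OF U.calg_axioms, of "\<lambda>x. \<Psi> (x False) \<odot>\<^bsub>U\<^esub> x True"])
    fix x :: "bool \<Rightarrow> 'a uq" and j :: bool and a b c assume x: "x \<in> (\<Pi>\<^sub>E i\<in>UNIV. carrier U)" and j: "j \<in> UNIV"
    have xc: "x i \<in> carrier U" for i using x by auto
    assume a: "a \<in> carrier U"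
    show "\<Psi> ((x(j := c \<odot>\<^bsub>U\<^esub> a)) False) \<odot>\<^bsub>U\<^esub> (x(j := c \<odot>\<^bsub>U\<^esub> a)) True = c \<odot>\<^bsub>U\<^esub> (\<Psi> ((x(j := a)) False) \<odot>\<^bsub>U\<^esub> (x(j := a)) True)"
      using xc a by (cases j) (simp_all add: \<Psi> U.smult_smult mult.commute)
    assume b: "b \<in> carrier U"
    show "\<Psi> ((x(j := a \<oplus>\<^bsub>U\<^esub> b)) False) \<odot>\<^bsub>U\<^esub> (x(j := a \<oplus>\<^bsub>U\<^esub> b)) True =
       \<Psi> ((x(j := a)) False) \<odot>\<^bsub>U\<^esub> (x(j := a)) True \<oplus>\<^bsub>U\<^esub> \<Psi> ((x(j := b)) False) \<odot>\<^bsub>U\<^esub> (x(j := b)) True"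
      using xc a b by (cases j) (simp_all add: \<Psi> U.smult_l_distr U.smult_r_distr)
  qed auto
  have "h (t2 x y) = \<Psi> x \<odot>\<^bsub>U\<^esub> y" if "x \<in> carrier U" "y \<in> carrier U" for x y
    unfolding tensor2_def using h(2)[OF t2_fun[OF that]] by simp
  then show ?thesis using that h(1) by (auto simp: TT_eq)
qed

lemma \<Delta>_hom: "\<Delta> \<in> alg_hom U TT"
  using comult by (simp add: is_comult_def Let_def)

lemmas \<Delta>D = alg_homD[OF \<Delta>_hom]

lemma \<Delta>_gens: "\<alpha> \<in> B \<Longrightarrow> \<Delta> (eE \<alpha>) = t2 (eE \<alpha>) \<one>\<^bsub>U\<^esub> \<oplus>\<^bsub>TT\<^esub> t2 (eK \<alpha>) (eE \<alpha>)"
  "\<alpha> \<in> B \<Longrightarrow> \<Delta> (eF \<alpha>) = t2 (eF \<alpha>) (eKI \<alpha>) \<oplus>\<^bsub>TT\<^esub> t2 \<one>\<^bsub>U\<^esub> (eF \<alpha>)"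
  "\<alpha> \<in> B \<Longrightarrow> \<Delta> (eK \<alpha>) = t2 (eK \<alpha>) (eK \<alpha>)"
  using comult by (simp_all add: is_comult_def Let_def)

lemma \<Delta>_KI: assumes "\<alpha> \<in> B" shows "\<Delta> (eKI \<alpha>) = t2 (eKI \<alpha>) (eKI \<alpha>)"
proof -
  have c: "eK \<alpha> \<in> carrier U" "eKI \<alpha> \<in> carrier U" using assms by auto
  have "\<Delta> (eKI \<alpha>) = \<Delta> (eKI \<alpha>) \<otimes>\<^bsub>TT\<^esub> (t2 (eK \<alpha>) (eK \<alpha>) \<otimes>\<^bsub>TT\<^esub> t2 (eKI \<alpha>) (eKI \<alpha>))"
    using c \<Delta>D(2) assms by (simp add: t2_mult K_KI t2_one)
  also have "\<dots> = \<Delta> (eKI \<alpha> \<otimes>\<^bsub>U\<^esub> eK \<alpha>) \<otimes>\<^bsub>TT\<^esub> t2 (eKI \<alpha>) (eKI \<alpha>)"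
    using c \<Delta>D(2,5) assms by (simp add: TT.m_assoc \<Delta>_gens)
  finally show ?thesis using c assms by (simp add: KI_K \<Delta>D(6))
qed

lemma \<Delta>_EK: assumes "\<alpha> \<in> B" shows "\<Delta> (EK B q \<alpha>) = t2 (EK B q \<alpha>) (eKI \<alpha>) \<oplus>\<^bsub>TT\<^esub> t2 \<one>\<^bsub>U\<^esub> (EK B q \<alpha>)"
proof -
  have c: "eE \<alpha> \<in> carrier U" "eK \<alpha> \<in> carrier U" "eKI \<alpha> \<in> carrier U" using assms by auto
  then show ?thesis unfolding EK_def \<Delta>D(5)[OF c(1,3)] \<Delta>_gens(1)[OF assms] \<Delta>_KI[OF assms]
    using assms by (simp add: TT.l_distr t2_mult K_KI)
qed

lemma \<Delta>_kk: assumes "\<mu> \<in> root_lattice B" shows "\<Delta> (kk \<mu>) = t2 (kk \<mu>) (kk \<mu>)"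
proof -
  obtain w where w: "set w \<subseteq> Kgens" "torus_wt w = \<mu>" "kk \<mu> = u w" by (rule K_elt_word[OF assms])
  have "\<Delta> (u w) = t2 (u w) (u w)" using w(1)
  proof (induction w)
    case Nil
    then show ?case by (simp add: u_Nil \<Delta>D(6) t2_one)
  next
    case (Cons g w)
    have g: "g \<in> qgens B" "set w \<subseteq> qgens B" using Cons.prems Kgens_qgens by auto
    have c: "u [g] \<in> carrier U" "u w \<in> carrier U" using g by auto
    have "\<Delta> (u [g]) = t2 (u [g]) (u [g])"
    proof -
      obtain \<alpha> where "\<alpha> \<in> B" "g = gK \<alpha> \<or> g = gKI \<alpha>" using Cons.prems by (auto simp: Kgens_def)
      then show ?thesis using \<Delta>_gens(3) \<Delta>_KI by (elim disjE) simp_all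
    qed
    then show ?case unfolding u_Cons[OF g] \<Delta>D(5)[OF c] using Cons c by (simp add: t2_mult)
  qed
  then show ?thesis using w by simp
qed

text \<open>The elements of \<open>D \<otimes> U\<close> inside \<open>U \<otimes> U\<close>.\<close>

definition tens_span :: "'a uq set \<Rightarrow> ((bool \<Rightarrow> 'a uq) \<Rightarrow>\<^sub>0 complex) set set" where
  "tens_span D = lin_span TT {t2 x y | x y. x \<in> D \<and> y \<in> carrier U}"

lemma tens_span_subalg: assumes "subalg D U" shows "subalg (tens_span D) TT"
proof -
  have D: "x \<in> carrier U" if "x \<in> D" for x using assms that by (auto simp: subalg_def)
  have one: "t2 \<one>\<^bsub>U\<^esub> \<one>\<^bsub>U\<^esub> \<in> lin_span TT {t2 x y | x y. x \<in> D \<and> y \<in> carrier U}"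
    using assms by (intro lin_span.span_base) (auto simp: subalg_def)
  have mult: "s \<otimes>\<^bsub>TT\<^esub> t \<in> lin_span TT {t2 x y | x y. x \<in> D \<and> y \<in> carrier U}"
    if st: "s \<in> {t2 x y | x y. x \<in> D \<and> y \<in> carrier U}" "t \<in> {t2 x y | x y. x \<in> D \<and> y \<in> carrier U}" for s t
  proof -
    obtain x y x' y' where e: "s = t2 x y" "t = t2 x' y'" "x \<in> D" "y \<in> carrier U" "x' \<in> D" "y' \<in> carrier U" using st by blast
    then have "s \<otimes>\<^bsub>TT\<^esub> t = t2 (x \<otimes>\<^bsub>U\<^esub> x') (y \<otimes>\<^bsub>U\<^esub> y')" using D by (simp add: t2_mult)
    moreover have "x \<otimes>\<^bsub>U\<^esub> x' \<in> D" using assms e by (simp add: subalg_def)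
    ultimately show ?thesis using e by (intro lin_span.span_base) blast
  qed
  show ?thesis unfolding tens_span_def
    by (rule TT.lin_span_subalg[OF _ _ mult]) (use D one in \<open>auto simp: t2_one\<close>)
qed

lemma tens_span_base: "x \<in> D \<Longrightarrow> y \<in> carrier U \<Longrightarrow> t2 x y \<in> tens_span D"
  unfolding tens_span_def by (intro lin_span.span_base) blast

lemma coideal_gen:
  assumes G: "G \<subseteq> carrier U" and \<Delta>G: "\<And>g. g \<in> G \<Longrightarrow> \<Delta> g \<in> tens_span (alg_gen U G)" and a: "a \<in> alg_gen U G"
  shows "\<Delta> a \<in> tens_span (alg_gen U G)"
proof -
  have "subalg {x \<in> carrier U. \<Delta> x \<in> tens_span (alg_gen U G)} U"
    by (rule alg_hom_vimage_subalg[OF U.calg_axioms TT.calg_axioms \<Delta>_hom tens_span_subalg[OF U.alg_gen_subalg[OF G]]])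
  then have "alg_gen U G \<subseteq> {x \<in> carrier U. \<Delta> x \<in> tens_span (alg_gen U G)}"
    by (rule U.alg_gen_least) (use G \<Delta>G in auto)
  then show ?thesis using a by auto
qed

lemma tens_span_list:
  assumes "D \<subseteq> carrier U" "X \<in> tens_span D"
  shows "\<exists>ts. set ts \<subseteq> D \<times> carrier U \<and> X = foldr (\<lambda>(x, y) s. t2 x y \<oplus>\<^bsub>TT\<^esub> s) ts \<zero>\<^bsub>TT\<^esub>"
proof -
  let ?f = "\<lambda>ts. foldr (\<lambda>(x, y) s. t2 x y \<oplus>\<^bsub>TT\<^esub> s) ts \<zero>\<^bsub>TT\<^esub>"
  have D: "x \<in> carrier U" if "x \<in> D" for x using assms(1) that by auto
  have cl: "?f ts \<in> carrier TT" if "set ts \<subseteq> D \<times> carrier U" for ts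
    using that by (induction ts) (auto simp: D)
  have app: "?f (ts @ ts') = ?f ts \<oplus>\<^bsub>TT\<^esub> ?f ts'" if "set ts \<subseteq> D \<times> carrier U" "set ts' \<subseteq> D \<times> carrier U" for ts ts'
    using that
  proof (induction ts)
    case Nil
    then show ?case using cl[of ts'] by simp
  next
    case (Cons t ts)
    obtain x y where t: "t = (x, y)" "x \<in> D" "y \<in> carrier U" using Cons.prems by (cases t) auto
    then show ?case using Cons cl[of ts] cl[of ts'] D[of x] by (simp add: TT.a_assoc)
  qed
  have sc: "?f (map (\<lambda>(x, y). (x, c \<odot>\<^bsub>U\<^esub> y)) ts) = c \<odot>\<^bsub>TT\<^esub> ?f ts" if "set ts \<subseteq> D \<times> carrier U" for ts c
    using that
  proof (induction ts)
    case (Cons t ts)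
    obtain x y where t: "t = (x, y)" "x \<in> D" "y \<in> carrier U" using Cons.prems by (cases t) auto
    then show ?case using Cons cl[of ts] D[of x] by (simp add: TT.smult_r_distr t2_smult_r)
  qed simp
  from assms(2) show ?thesis unfolding tens_span_def
  proof induction
    case span_zero
    show ?case by (rule exI[of _ "[]"]) simp
  next
    case (span_base X)
    then obtain x y where x: "X = t2 x y" "x \<in> D" "y \<in> carrier U" by blast
    then show ?case using D[of x] by (intro exI[of _ "[(x, y)]"]) simp
  next
    case (span_add X Y)
    then obtain ts ts' where "set ts \<subseteq> D \<times> carrier U" "X = ?f ts" "set ts' \<subseteq> D \<times> carrier U" "Y = ?f ts'" by blast
    then show ?case using app[of ts ts'] by (intro exI[of _ "ts @ ts'"]) simp
  next
    case (span_smult X c)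
    then obtain ts where ts: "set ts \<subseteq> D \<times> carrier U" "X = ?f ts" by blast
    then have "set (map (\<lambda>(x, y). (x, c \<odot>\<^bsub>U\<^esub> y)) ts) \<subseteq> D \<times> carrier U" by (auto split: prod.splits)
    then show ?case using ts sc[OF ts(1), of c] by (intro exI[of _ "map (\<lambda>(x, y). (x, c \<odot>\<^bsub>U\<^esub> y)) ts"]) simp
  qed
qed

text \<open>The functional \<open>\<phi>\<close> is extended from the subalgebra to \<open>U\<close>, so that \<open>\<phi> \<otimes> id\<close> is defined on all of \<open>U \<otimes> U\<close>.
  Since \<open>\<phi>\<close> is a character, its composition with \<open>\<Delta>\<close> is multiplicative on the subalgebra, and the shift
  is generated by the images of the generators.\<close>

lemma character_shift_gen:
  assumes f: "\<And>i. i \<in> I \<Longrightarrow> f i \<in> carrier U" and \<kappa>: "\<And>i. i \<in> I \<Longrightarrow> \<kappa> i \<in> carrier U"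
    and \<Delta>f: "\<And>i. i \<in> I \<Longrightarrow> \<Delta> (f i) = t2 (f i) (\<kappa> i) \<oplus>\<^bsub>TT\<^esub> t2 \<one>\<^bsub>U\<^esub> (f i)"
    and \<phi>: "is_character U (alg_gen U (f ` I)) \<phi>"
  shows "character_shift U \<Delta> (alg_gen U (f ` I)) \<phi> =
    alg_gen U ((\<lambda>i. f i \<oplus>\<^bsub>U\<^esub> \<phi> (f i) \<odot>\<^bsub>U\<^esub> \<kappa> i) ` I)"
proof -
  let ?G = "f ` I"
  have G: "?G \<subseteq> carrier U" using f by auto
  let ?D = "alg_gen U ?G"
  have D: "subalg ?D U" by (rule U.alg_gen_subalg[OF G])
  have Dc: "?D \<subseteq> carrier U" using D by (simp add: subalg_def)
  have \<phi>h: "\<phi> \<in> alg_hom (restrict_alg U ?D) complex_alg" using \<phi> by (simp add: is_character_def)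
  note \<phi>D = alg_homD[OF \<phi>h, simplified]
  obtain \<Psi> where \<Psi>: "\<Psi> \<in> lin_hom U complex_alg" "\<And>x. x \<in> ?D \<Longrightarrow> \<Psi> x = \<phi> x"
    using linear_functional_extend[of ?D \<phi>] D \<phi>D(1) unfolding U_eq by blast
  obtain h where h: "h \<in> lin_hom TT U" "\<And>x y. x \<in> carrier U \<Longrightarrow> y \<in> carrier U \<Longrightarrow> h (t2 x y) = \<Psi> x \<odot>\<^bsub>U\<^esub> y"
    using functional_tensor_id[OF \<Psi>(1)] by blast
  have ht: "h (t2 x y) = \<phi> x \<odot>\<^bsub>U\<^esub> y" if "x \<in> ?D" "y \<in> carrier U" for x y using that h(2) \<Psi>(2) Dc by auto
  have \<Delta>D': "\<Delta> a \<in> tens_span ?D" if "a \<in> ?D" for a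
  proof (rule coideal_gen[OF G _ that])
    fix g assume "g \<in> ?G"
    then obtain i where i: "i \<in> I" "g = f i" by blast
    have "t2 g (\<kappa> i) \<in> tens_span ?D" "t2 \<one>\<^bsub>U\<^esub> g \<in> tens_span ?D"
      using i f \<kappa> U.alg_gen_incl[of ?G] D by (auto intro!: tens_span_base simp: subalg_def)
    then show "\<Delta> g \<in> tens_span ?D" using tens_span_subalg[OF D] by (simp add: i(2) \<Delta>f[OF i(1)] subalg_def)
  qed
  have shift: "character_shift U \<Delta> ?D \<phi> = (h \<circ> \<Delta>) ` ?D"
  proof -
    have val: "h (foldr (\<lambda>(x, y) s. t2 x y \<oplus>\<^bsub>TT\<^esub> s) ts \<zero>\<^bsub>TT\<^esub>) = foldr (\<lambda>(x, y) s. (\<phi> x \<odot>\<^bsub>U\<^esub> y) \<oplus>\<^bsub>U\<^esub> s) ts \<zero>\<^bsub>U\<^esub>"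
      if ts: "set ts \<subseteq> ?D \<times> carrier U" for ts
    proof -
      have tc: "t2 (fst t) (snd t) \<in> carrier TT" if "t \<in> set ts" for t 
      proof -
        obtain x y where "t = (x, y)" by (cases t)
        then show ?thesis using ts that Dc by (auto intro!: t2_closed)
      qed
      have "h (foldr (\<lambda>t s. t2 (fst t) (snd t) \<oplus>\<^bsub>TT\<^esub> s) ts \<zero>\<^bsub>TT\<^esub>) = foldr (\<lambda>t s. h (t2 (fst t) (snd t)) \<oplus>\<^bsub>U\<^esub> s) ts \<zero>\<^bsub>U\<^esub>"
        by (rule lin_hom_foldr[OF TT.calg_axioms U.calg_axioms h(1), of ts "\<lambda>t. t2 (fst t) (snd t)", THEN conjunct2]) (rule tc)
      also have "\<dots> = foldr (\<lambda>t s. (\<phi> (fst t) \<odot>\<^bsub>U\<^esub> snd t) \<oplus>\<^bsub>U\<^esub> s) ts \<zero>\<^bsub>U\<^esub>"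
      proof (rule foldr_cong[OF refl refl])
        fix t s assume "t \<in> set ts"
        then have "t \<in> ?D \<times> carrier U" using ts by (rule subsetD[rotated])
        then have "h (t2 (fst t) (snd t)) = \<phi> (fst t) \<odot>\<^bsub>U\<^esub> snd t" by (intro ht) (simp_all add: mem_Times_iff)
        then show "h (t2 (fst t) (snd t)) \<oplus>\<^bsub>U\<^esub> s = \<phi> (fst t) \<odot>\<^bsub>U\<^esub> snd t \<oplus>\<^bsub>U\<^esub> s" by (rule arg_cong)
      qed
      finally show ?thesis by (simp add: case_prod_unfold)
    qed
    show ?thesis
    proof (rule equalityI; rule subsetI)
      fix y assume "y \<in> character_shift U \<Delta> ?D \<phi>"
      then obtain ts a where ts: "set ts \<subseteq> ?D \<times> carrier U" "a \<in> ?D" "\<Delta> a = foldr (\<lambda>(x, y) s. t2 x y \<oplus>\<^bsub>TT\<^esub> s) ts \<zero>\<^bsub>TT\<^esub>"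
        "y = foldr (\<lambda>(x, y) s. (\<phi> x \<odot>\<^bsub>U\<^esub> y) \<oplus>\<^bsub>U\<^esub> s) ts \<zero>\<^bsub>U\<^esub>" unfolding character_shift_def by blast
      then have "y = (h \<circ> \<Delta>) a" using val by simp
      then show "y \<in> (h \<circ> \<Delta>) ` ?D" using ts(2) by blast
    next
      fix y assume "y \<in> (h \<circ> \<Delta>) ` ?D"
      then obtain a where a: "a \<in> ?D" "y = h (\<Delta> a)" by auto
      obtain ts where ts: "set ts \<subseteq> ?D \<times> carrier U" "\<Delta> a = foldr (\<lambda>(x, y) s. t2 x y \<oplus>\<^bsub>TT\<^esub> s) ts \<zero>\<^bsub>TT\<^esub>"
        using tens_span_list[OF Dc \<Delta>D'[OF a(1)]] by blast
      then have "y = foldr (\<lambda>(x, y) s. (\<phi> x \<odot>\<^bsub>U\<^esub> y) \<oplus>\<^bsub>U\<^esub> s) ts \<zero>\<^bsub>U\<^esub>" using a val by simp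
      then show "y \<in> character_shift U \<Delta> ?D \<phi>" unfolding character_shift_def using a ts by blast
    qed
  qed
  have TSp: "subalg (tens_span ?D) TT" by (rule tens_span_subalg[OF D])
  have TSpc: "calg (restrict_alg TT (tens_span ?D))" by (rule TT.subalg_calg[OF TSp])
  let ?S = "{t2 x y | x y. x \<in> ?D \<and> y \<in> carrier U}"
  have hm: "h (X \<otimes>\<^bsub>TT\<^esub> Y) = h X \<otimes>\<^bsub>U\<^esub> h Y" if XY: "X \<in> tens_span ?D" "Y \<in> tens_span ?D" for X Y
  proof -
    let ?R = "restrict_alg TT (tens_span ?D)"
    have sc: "x \<in> carrier TT" if "x \<in> tens_span ?D" for x using TSp that unfolding subalg_def by blast
    have 1: "h \<in> lin_hom ?R U"
      unfolding lin_hom_def using lin_homD[OF h(1)] sc by simp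
    have 2: "?S \<subseteq> carrier ?R" using tens_span_base by auto
    have 3: "carrier ?R = lin_span ?R ?S"
      by (simp add: lin_span_restrict tens_span_def)
    have 4: "h (s \<otimes>\<^bsub>?R\<^esub> t) = h s \<otimes>\<^bsub>U\<^esub> h t" if st: "s \<in> ?S" "t \<in> ?S" for s t
    proof -
      obtain x y x' y' where e: "s = t2 x y" "t = t2 x' y'" "x \<in> ?D" "y \<in> carrier U" "x' \<in> ?D" "y' \<in> carrier U" using st by blast
      have xx: "x \<otimes>\<^bsub>U\<^esub> x' \<in> ?D" using D e by (simp add: subalg_def)
      have c: "x \<in> carrier U" "x' \<in> carrier U" using e Dc by blast+
      have "s \<otimes>\<^bsub>?R\<^esub> t = t2 (x \<otimes>\<^bsub>U\<^esub> x') (y \<otimes>\<^bsub>U\<^esub> y')" using e c by (simp add: t2_mult)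
      then have "h (s \<otimes>\<^bsub>?R\<^esub> t) = (\<phi> x * \<phi> x') \<odot>\<^bsub>U\<^esub> (y \<otimes>\<^bsub>U\<^esub> y')"
        using ht[OF xx, of "y \<otimes>\<^bsub>U\<^esub> y'"] \<phi>D(5)[OF e(3,5)] e by simp
      also have "\<dots> = h s \<otimes>\<^bsub>U\<^esub> h t"
        using ht[OF e(3,4)] ht[OF e(5,6)] e by (simp add: U.smult_mult_l U.smult_mult_r U.smult_smult mult.commute)
      finally show ?thesis .
    qed
    show ?thesis
      using lin_hom_mult_span[OF TSpc U.calg_axioms 1 2 3 4, of X Y] XY by simp
  qed
  have h1: "h \<one>\<^bsub>TT\<^esub> = \<one>\<^bsub>U\<^esub>"
    unfolding t2_one[symmetric] using ht[of "\<one>\<^bsub>U\<^esub>" "\<one>\<^bsub>U\<^esub>"] D \<phi>D(6) by (simp add: subalg_def)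
  have "h \<circ> \<Delta> \<in> alg_hom (restrict_alg U ?D) U"
    unfolding alg_hom_iff
  proof (intro conjI ballI)
    have c: "x \<in> carrier U" if "x \<in> ?D" for x using that Dc by blast
    show "h \<circ> \<Delta> \<in> lin_hom (restrict_alg U ?D) U"
      unfolding lin_hom_def using lin_homD[OF h(1)] \<Delta>D(2-4) c by simp
    show "(h \<circ> \<Delta>) (x \<otimes>\<^bsub>restrict_alg U ?D\<^esub> y) = (h \<circ> \<Delta>) x \<otimes>\<^bsub>U\<^esub> (h \<circ> \<Delta>) y"
      if "x \<in> carrier (restrict_alg U ?D)" "y \<in> carrier (restrict_alg U ?D)" for x y
      using that \<Delta>D(5)[OF c c, of x y] hm[OF \<Delta>D' \<Delta>D', of x y] by simp
    show "(h \<circ> \<Delta>) \<one>\<^bsub>restrict_alg U ?D\<^esub> = \<one>\<^bsub>U\<^esub>" using \<Delta>D(6) h1 by simp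
  qed
  then have "(h \<circ> \<Delta>) ` ?D = alg_gen U ((h \<circ> \<Delta>) ` ?G)"
    by (rule alg_hom_image_alg_gen[OF U.calg_axioms U.calg_axioms G])
  also have "(h \<circ> \<Delta>) ` ?G = (\<lambda>i. f i \<oplus>\<^bsub>U\<^esub> \<phi> (f i) \<odot>\<^bsub>U\<^esub> \<kappa> i) ` I"
    unfolding image_image
  proof (rule image_cong[OF refl])
    fix i assume i: "i \<in> I"
    have gD: "f i \<in> ?D" "f i \<in> carrier U" "\<one>\<^bsub>U\<^esub> \<in> ?D" using i f U.alg_gen_incl[of ?G] D by (auto simp: subalg_def)
    have "h (t2 (f i) (\<kappa> i) \<oplus>\<^bsub>TT\<^esub> t2 \<one>\<^bsub>U\<^esub> (f i)) = \<phi> (f i) \<odot>\<^bsub>U\<^esub> \<kappa> i \<oplus>\<^bsub>U\<^esub> \<phi> \<one>\<^bsub>U\<^esub> \<odot>\<^bsub>U\<^esub> f i"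
      using gD \<kappa>[OF i] by (simp only: lin_homD(2)[OF h(1)] ht t2_closed U.one_closed)
    then show "(h \<circ> \<Delta>) (f i) = f i \<oplus>\<^bsub>U\<^esub> \<phi> (f i) \<odot>\<^bsub>U\<^esub> \<kappa> i"
      using gD \<kappa>[OF i] \<phi>D(6) by (simp add: \<Delta>f[OF i] U.a_comm)
  qed
  finally show ?thesis unfolding shift .
qed

end

section \<open>The coideal subalgebra in terms of generators\<close>

lemma (in calg) wprod_subalg: "subalg D A \<Longrightarrow> (\<And>g. g \<in> set w \<Longrightarrow> f g \<in> D) \<Longrightarrow> wprod f w \<in> D"
  by (induction w) (auto simp: subalg_def)

context coideal_data
begin

definition C_alg :: "'a uq set" where "C_alg = alg_gen U (fb ` supp \<union> kk ` L0 \<union> ep ` B)"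

lemma C_alg_gens: "fb ` supp \<union> kk ` L0 \<union> ep ` B \<subseteq> carrier U"
  using fb_closed kk_closed ep_closed by auto

lemma C_alg_subalg: "subalg C_alg U"
  unfolding C_alg_def by (rule U.alg_gen_subalg[OF C_alg_gens])

lemma C_alg_closed: "x \<in> C_alg \<Longrightarrow> x \<in> carrier U"
  using C_alg_subalg by (auto simp: subalg_def)

lemma fb_C_alg: "\<alpha> \<in> supp \<Longrightarrow> fb \<alpha> \<in> C_alg" and kk_C_alg: "\<mu> \<in> L0 \<Longrightarrow> kk \<mu> \<in> C_alg" and ep_C_alg: "\<beta> \<in> B \<Longrightarrow> ep \<beta> \<in> C_alg"
  using subsetD[OF U.alg_gen_incl[of "fb ` supp \<union> kk ` L0 \<union> ep ` B"]] by (auto simp: C_alg_def)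

lemma torus_subalg: "subalg (torus_alg B q L0) U"
  unfolding torus_alg_def
proof (rule U.lin_span_subalg)
  show "kk ` L0 \<subseteq> carrier U" using kk_closed by auto
  show "\<one>\<^bsub>U\<^esub> \<in> lin_span U (kk ` L0)"
    unfolding K_elt_zero[symmetric] using L0_zero by (intro lin_span.span_base imageI)
  show "s \<otimes>\<^bsub>U\<^esub> t \<in> lin_span U (kk ` L0)" if st: "s \<in> kk ` L0" "t \<in> kk ` L0" for s t
  proof -
    obtain \<mu> \<nu> where m: "s = kk \<mu>" "t = kk \<nu>" "\<mu> \<in> L0" "\<nu> \<in> L0" using st by blast
    then show ?thesis using L0_add[OF m(3,4)] kk_add[OF m(3,4)] by (auto intro!: lin_span.span_base)
  qed
qed

lemma torus_C_alg: "torus_alg B q L0 \<subseteq> C_alg"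
  unfolding torus_alg_def using kk_C_alg by (intro U.lin_span_least[OF C_alg_subalg]) auto

lemma C_alg_normal_form:
  "C_alg = lin_span U {U.wprod fb as \<otimes>\<^bsub>U\<^esub> kk \<mu> \<otimes>\<^bsub>U\<^esub> U.wprod ep bs | as \<mu> bs. set as \<subseteq> supp \<and> \<mu> \<in> L0 \<and> set bs \<subseteq> B}"
  unfolding C_alg_def
proof (rule U.normal_form_span[where c = "\<lambda>\<beta> \<mu>. q powi (- int_form \<mu> \<beta>)"
    and r = "\<lambda>\<beta> \<alpha>. if \<beta> = \<alpha> then (q_root q \<alpha>)\<^sup>2 else q powi int_form \<beta> \<alpha>"
    and d = "\<lambda>\<beta> \<alpha>. if \<beta> = \<alpha> then weyl_const \<alpha> else 0"])
  show "ep \<beta> \<otimes>\<^bsub>U\<^esub> fb \<alpha> = (if \<beta> = \<alpha> then (q_root q \<alpha>)\<^sup>2 else q powi int_form \<beta> \<alpha>) \<odot>\<^bsub>U\<^esub> (fb \<alpha> \<otimes>\<^bsub>U\<^esub> ep \<beta>) \<oplus>\<^bsub>U\<^esub>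
        (if \<beta> = \<alpha> then weyl_const \<alpha> else 0) \<odot>\<^bsub>U\<^esub> \<one>\<^bsub>U\<^esub>" if "\<alpha> \<in> supp" "\<beta> \<in> B" for \<alpha> \<beta>
    using that ep_fb_same[of \<alpha>] ep_fb_diff[of \<beta> \<alpha>] fb_closed ep_closed by (cases "\<beta> = \<alpha>") (simp_all add: U.q_comm_def)
qed (simp_all add: fb_closed ep_closed kk_closed L0_zero L0_add K_elt_zero kk_add kk_fb ep_kk)

end

locale coideal_characters = comult_data +
  fixes \<phi>p \<phi>m :: "'a uq \<Rightarrow> complex"
  assumes char_p: "is_character U (psi_Uplus B q) \<phi>p" and \<phi>p: "\<And>\<alpha>. \<alpha> \<in> B \<Longrightarrow> \<phi>p (EK B q \<alpha>) = l \<alpha>"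
    and char_m: "is_character U (Uminus B q supp) \<phi>m" and \<phi>m: "\<And>\<alpha>. \<alpha> \<in> supp \<Longrightarrow> \<phi>m (eF \<alpha>) = lm \<alpha>"
begin

lemma shift_plus: "character_shift U \<Delta> (psi_Uplus B q) \<phi>p = alg_gen U (ep ` B)"
proof -
  have "character_shift U \<Delta> (alg_gen U (EK B q ` B)) \<phi>p =
      alg_gen U ((\<lambda>\<beta>. EK B q \<beta> \<oplus>\<^bsub>U\<^esub> \<phi>p (EK B q \<beta>) \<odot>\<^bsub>U\<^esub> eKI \<beta>) ` B)"
    by (rule character_shift_gen) (use EK_closed \<Delta>_EK char_p in \<open>simp_all add: psi_Uplus_def\<close>)
  also have "(\<lambda>\<beta>. EK B q \<beta> \<oplus>\<^bsub>U\<^esub> \<phi>p (EK B q \<beta>) \<odot>\<^bsub>U\<^esub> eKI \<beta>) ` B = ep ` B"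
    by (rule image_cong[OF refl]) (simp add: E_bar_def \<phi>p)
  finally show ?thesis by (simp add: psi_Uplus_def)
qed

lemma shift_minus: "character_shift U \<Delta> (Uminus B q supp) \<phi>m = alg_gen U (fb ` supp)"
proof -
  have "character_shift U \<Delta> (alg_gen U ((\<lambda>\<alpha>. eF \<alpha>) ` supp)) \<phi>m =
      alg_gen U ((\<lambda>\<alpha>. eF \<alpha> \<oplus>\<^bsub>U\<^esub> \<phi>m (eF \<alpha>) \<odot>\<^bsub>U\<^esub> eKI \<alpha>) ` supp)"
    by (rule character_shift_gen) (use supp \<Delta>_gens(2) char_m in \<open>simp_all add: Uminus_def subset_iff\<close>)
  also have "(\<lambda>\<alpha>. eF \<alpha> \<oplus>\<^bsub>U\<^esub> \<phi>m (eF \<alpha>) \<odot>\<^bsub>U\<^esub> eKI \<alpha>) ` supp = fb ` supp"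
    by (rule image_cong[OF refl]) (simp add: F_bar_def \<phi>m)
  finally show ?thesis by (simp add: Uminus_def)
qed

text \<open>The products in the definition lie in the generated algebra; conversely that algebra is spanned by
  normal forms, which are such products.\<close>

lemma coideal_C_eq: "coideal_C B q \<Delta> supp \<phi>m \<phi>p = C_alg"
proof -
  let ?F = "alg_gen U (fb ` supp)" and ?E = "alg_gen U (ep ` B)" and ?K = "torus_alg B q L0"
  let ?P = "{u \<otimes>\<^bsub>U\<^esub> k \<otimes>\<^bsub>U\<^esub> v | u k v. u \<in> ?F \<and> k \<in> ?K \<and> v \<in> ?E}"
  have F: "subalg ?F U" and E: "subalg ?E U" using fb_closed ep_closed by (auto intro!: U.alg_gen_subalg)
  have FC: "?F \<subseteq> C_alg" and EC: "?E \<subseteq> C_alg" unfolding C_alg_def by (rule U.alg_gen_mono, blast)+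
  have "lin_span U ?P = C_alg"
  proof
    have "?P \<subseteq> C_alg"
    proof
      fix x assume "x \<in> ?P"
      then obtain u k v where x: "x = u \<otimes>\<^bsub>U\<^esub> k \<otimes>\<^bsub>U\<^esub> v" "u \<in> ?F" "k \<in> ?K" "v \<in> ?E" by blast
      have "u \<in> C_alg" using x(2) FC by blast
      moreover have "v \<in> C_alg" using x(4) EC by blast
      moreover have "k \<in> C_alg" using x(3) torus_C_alg by blast
      ultimately show "x \<in> C_alg" using C_alg_subalg by (simp add: x(1) subalg_def)
    qed
    then show "lin_span U ?P \<subseteq> C_alg" by (rule U.lin_span_least[OF C_alg_subalg])
    have "{U.wprod fb as \<otimes>\<^bsub>U\<^esub> kk \<mu> \<otimes>\<^bsub>U\<^esub> U.wprod ep bs | as \<mu> bs. set as \<subseteq> supp \<and> \<mu> \<in> L0 \<and> set bs \<subseteq> B} \<subseteq> ?P"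
    proof
      fix x assume "x \<in> {U.wprod fb as \<otimes>\<^bsub>U\<^esub> kk \<mu> \<otimes>\<^bsub>U\<^esub> U.wprod ep bs | as \<mu> bs. set as \<subseteq> supp \<and> \<mu> \<in> L0 \<and> set bs \<subseteq> B}"
      then obtain as \<mu> bs where x: "x = U.wprod fb as \<otimes>\<^bsub>U\<^esub> kk \<mu> \<otimes>\<^bsub>U\<^esub> U.wprod ep bs" "set as \<subseteq> supp" "\<mu> \<in> L0" "set bs \<subseteq> B" by blast
      have "U.wprod fb as \<in> ?F" using x(2) subsetD[OF U.alg_gen_incl[of "fb ` supp"]] by (intro U.wprod_subalg[OF F]) auto
      moreover have "U.wprod ep bs \<in> ?E" using x(4) subsetD[OF U.alg_gen_incl[of "ep ` B"]] by (intro U.wprod_subalg[OF E]) auto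
      moreover have "kk \<mu> \<in> ?K" using x(3) unfolding torus_alg_def by (intro lin_span.span_base imageI)
      ultimately show "x \<in> ?P" using x(1) by blast
    qed
    then show "C_alg \<subseteq> lin_span U ?P" by (subst C_alg_normal_form) (rule U.lin_span_mono)
  qed
  then show ?thesis unfolding coideal_C_def shift_minus shift_plus .
qed

lemma coideal_C_coideal: "right_coideal_subalg U \<Delta> C_alg"
proof -
  note TS = tens_span_subalg[OF C_alg_subalg]
  have add: "X \<oplus>\<^bsub>TT\<^esub> Y \<in> tens_span C_alg" if "X \<in> tens_span C_alg" "Y \<in> tens_span C_alg" for X Y
    using TS that by (simp add: subalg_def)
  have sc: "c \<odot>\<^bsub>TT\<^esub> X \<in> tens_span C_alg" if "X \<in> tens_span C_alg" for X c
    using TS that by (simp add: subalg_def)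
  have one: "\<one>\<^bsub>U\<^esub> \<in> C_alg" using C_alg_subalg by (simp add: subalg_def)
  have shift: "\<Delta> (x \<oplus>\<^bsub>U\<^esub> c \<odot>\<^bsub>U\<^esub> y) = t2 (x \<oplus>\<^bsub>U\<^esub> c \<odot>\<^bsub>U\<^esub> y) y \<oplus>\<^bsub>TT\<^esub> t2 \<one>\<^bsub>U\<^esub> x"
    if "x \<in> carrier U" "y \<in> carrier U" "\<Delta> x = t2 x y \<oplus>\<^bsub>TT\<^esub> t2 \<one>\<^bsub>U\<^esub> x" "\<Delta> y = t2 y y" for x y c
  proof -
    have "\<Delta> (x \<oplus>\<^bsub>U\<^esub> c \<odot>\<^bsub>U\<^esub> y) = (t2 x y \<oplus>\<^bsub>TT\<^esub> t2 \<one>\<^bsub>U\<^esub> x) \<oplus>\<^bsub>TT\<^esub> c \<odot>\<^bsub>TT\<^esub> t2 y y"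
      using that(1,2) by (simp only: \<Delta>D(3,4) U.smult_closed that(3,4))
    moreover have "t2 (x \<oplus>\<^bsub>U\<^esub> c \<odot>\<^bsub>U\<^esub> y) y = t2 x y \<oplus>\<^bsub>TT\<^esub> c \<odot>\<^bsub>TT\<^esub> t2 y y"
      using that(1,2) by (simp only: t2_add_l t2_smult_l U.smult_closed)
    ultimately show ?thesis using that(1,2)
      by (simp only: TT.a_ac t2_closed TT.smult_closed U.one_closed)
  qed
  have gen: "\<Delta> g \<in> tens_span C_alg" if g: "g \<in> fb ` supp \<union> kk ` L0 \<union> ep ` B" for g
  proof -
    consider \<alpha> where "\<alpha> \<in> supp" "g = fb \<alpha>" | \<mu> where "\<mu> \<in> L0" "g = kk \<mu>" | \<beta> where "\<beta> \<in> B" "g = ep \<beta>"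
      using g by blast
    then show ?thesis
    proof cases
      case 1
      then have \<alpha>: "\<alpha> \<in> B" using supp by auto
      then have "\<Delta> g = t2 (fb \<alpha>) (eKI \<alpha>) \<oplus>\<^bsub>TT\<^esub> t2 \<one>\<^bsub>U\<^esub> (eF \<alpha>)"
        using shift[OF _ _ \<Delta>_gens(2) \<Delta>_KI, of \<alpha> "lm \<alpha>"] 1 by (simp add: F_bar_def)
      then show ?thesis using 1 \<alpha> one fb_C_alg by (simp add: add tens_span_base)
    next
      case 2
      then show ?thesis using \<Delta>_kk[OF L0_lattice] kk_C_alg kk_closed by (simp add: tens_span_base)
    next
      case 3
      then have "\<Delta> g = t2 (ep \<beta>) (eKI \<beta>) \<oplus>\<^bsub>TT\<^esub> t2 \<one>\<^bsub>U\<^esub> (EK B q \<beta>)"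
        using shift[OF _ _ \<Delta>_EK \<Delta>_KI, of \<beta> "l \<beta>"] EK_closed by (simp add: E_bar_def)
      then show ?thesis using 3 one ep_C_alg EK_closed by (simp add: add tens_span_base)
    qed
  qed
  have "\<Delta> a \<in> tens_span C_alg" if "a \<in> C_alg" for a
    using coideal_gen[OF C_alg_gens gen[unfolded C_alg_def], of a] that by (simp add: C_alg_def)
  then show ?thesis unfolding right_coideal_subalg_def tens_span_def using C_alg_subalg by simp
qed

end

section \<open>Quantum Weyl algebras\<close>

lemma subalg_restrict_alg: "subalg D A \<Longrightarrow> subalg S (restrict_alg A D) \<Longrightarrow> subalg S A"
  by (auto simp: subalg_def)

lemma alg_hom_eq_on_generators:
  assumes A: "calg A" and B: "calg B" and G: "G \<subseteq> carrier A"
    and g: "g \<in> alg_hom (restrict_alg A (alg_gen A G)) B" and h: "h \<in> alg_hom (restrict_alg A (alg_gen A G)) B"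
    and eq: "\<And>x. x \<in> G \<Longrightarrow> g x = h x" and x: "x \<in> alg_gen A G"
  shows "g x = h x"
proof -
  interpret A: calg A by fact
  let ?D = "alg_gen A G"
  have D: "subalg ?D A" by (rule A.alg_gen_subalg[OF G])
  have "subalg {x \<in> carrier (restrict_alg A ?D). g x = h x} (restrict_alg A ?D)"
    by (rule alg_hom_equalizer[OF A.subalg_calg[OF D] B g h])
  from subalg_restrict_alg[OF D this] have "?D \<subseteq> {x \<in> carrier (restrict_alg A ?D). g x = h x}"
    by (rule A.alg_gen_least) (use eq A.alg_gen_incl in auto)
  then show ?thesis using x by auto
qed

lemma alg_iso_on_generators:
  assumes A: "calg A" and G: "carrier A = alg_gen A G" and B: "calg B" and H: "H \<subseteq> carrier B"
    and h: "h \<in> alg_hom A (restrict_alg B (alg_gen B H))" and g: "g \<in> alg_hom (restrict_alg B (alg_gen B H)) A"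
    and gh: "\<And>x. x \<in> G \<Longrightarrow> g (h x) = x" and hg: "\<And>y. y \<in> H \<Longrightarrow> h (g y) = y"
  shows "h \<in> alg_iso A (restrict_alg B (alg_gen B H))"
proof -
  interpret A: calg A by fact
  interpret B: calg B by fact
  let ?D = "alg_gen B H"
  have D: "subalg ?D B" by (rule B.alg_gen_subalg[OF H])
  have R: "calg (restrict_alg B ?D)" by (rule B.subalg_calg[OF D])
  have G': "G \<subseteq> carrier A" using A.alg_gen_incl[of G] G by simp
  have "g (h x) = x" if "x \<in> carrier A" for x
  proof -
    have "(\<lambda>x. x) \<in> alg_hom A A" by (simp add: alg_hom_iff lin_hom_def)
    then have "subalg {x \<in> carrier A. (g \<circ> h) x = x} A"
      by (rule alg_hom_equalizer[OF A A alg_hom_comp[OF h g]])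
    then have "alg_gen A G \<subseteq> {x \<in> carrier A. (g \<circ> h) x = x}" by (rule A.alg_gen_least) (use gh G' in auto)
    then show ?thesis using that G by auto
  qed
  moreover have "h (g y) = y" if "y \<in> ?D" for y
  proof -
    have "(\<lambda>y. y) \<in> alg_hom (restrict_alg B ?D) (restrict_alg B ?D)" by (simp add: alg_hom_iff lin_hom_def)
    then have "subalg {y \<in> carrier (restrict_alg B ?D). (h \<circ> g) y = y} (restrict_alg B ?D)"
      by (rule alg_hom_equalizer[OF R R alg_hom_comp[OF g h]])
    from subalg_restrict_alg[OF D this] have "?D \<subseteq> {y \<in> carrier (restrict_alg B ?D). (h \<circ> g) y = y}"
      by (rule B.alg_gen_least) (use hg B.alg_gen_incl[of H] in auto)
    then show ?thesis using that by auto
  qed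
  ultimately have "bij_betw h (carrier A) ?D"
    using alg_homD(2)[OF h] alg_homD(2)[OF g] by (intro bij_betwI[where g = g]) auto
  then show ?thesis using h by (simp add: alg_iso_def)
qed

lemma (in calg) lin_diff:
  assumes "\<phi> \<in> UNIV \<rightarrow> carrier A" shows "lin \<phi> (p - r) = lin \<phi> p \<ominus> lin \<phi> r"
proof -
  have "p - r = p + pm_scale (- 1) r" by (rule pm_scale_simps(7))
  then show ?thesis
    using lin_add[OF subset_UNIV subset_UNIV assms, of p "pm_scale (- 1) r"] lin_scale[OF subset_UNIV assms, of "- 1" r]
      lin_closed[OF subset_UNIV assms] by (simp only: minus_smult)
qed

lemma (in calg) lin_weyl_rel:
  assumes f: "\<And>g. f g \<in> carrier A" and r: "r \<in> weyl_rels v"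
  shows "lin (wprod f) r = f wX \<otimes> f wY \<ominus> v\<^sup>2 \<odot> (f wY \<otimes> f wX) \<ominus> \<one>"
proof -
  have w: "wprod f \<in> UNIV \<rightarrow> carrier A" using f by auto
  have c: "wprod f w \<in> carrier A" for w using f by auto
  have "r = wd [wX, wY] - Poly_Mapping.single [wY, wX] (v\<^sup>2) - wd []" using r by (simp add: weyl_rels_def)
  then show ?thesis using f by (simp add: lin_diff[OF w] lin_single[of "wprod f", OF c])
qed

lemma (in calg) minus_minus_eq_zeroD:
  assumes "x \<in> carrier A" "y \<in> carrier A" "z \<in> carrier A" "x \<ominus> y \<ominus> z = \<zero>" shows "x = y \<oplus> z"
proof -
  have z: "x \<ominus> y = z" by (rule minus_eq_zeroD[OF minus_closed[OF assms(1,2)] assms(3,4)])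
  have "y \<oplus> z = y \<oplus> (x \<oplus> \<ominus> y)" unfolding z[symmetric] a_minus_def ..
  also have "\<dots> = x \<oplus> (y \<oplus> \<ominus> y)" by (rule a_lcomm) (use assms in auto)
  also have "y \<oplus> \<ominus> y = \<zero>" by (rule r_neg[OF assms(2)])
  finally show ?thesis using assms(1) by (simp only: r_zero)
qed

lemma weyl_presentation: "presentation UNIV (weyl_rels v)"
  by unfold_locales (auto simp: free_alg_simps)

lemma quantum_weyl_calg: "calg (quantum_weyl v)"
  unfolding quantum_weyl_def by (rule presentation.presented_calg[OF weyl_presentation])

lemma quantum_weyl_generated: "carrier (quantum_weyl v) = alg_gen (quantum_weyl v) {weyl_word v [wX], weyl_word v [wY]}"
proof -
  have U: "(UNIV :: weyl_gen set) = {wX, wY}" using weyl_gen.exhaust by auto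
  show ?thesis using presentation.presented_gen[OF weyl_presentation, of v]
    by (simp add: quantum_weyl_def weyl_word_def U)
qed

lemma weyl_word_closed: "weyl_word v w \<in> carrier (quantum_weyl v)"
  unfolding quantum_weyl_def weyl_word_def by (rule presentation.pw_closed[OF weyl_presentation]) simp

lemma quantum_weyl_relation:
  "weyl_word v [wX] \<otimes>\<^bsub>quantum_weyl v\<^esub> weyl_word v [wY] =
     v\<^sup>2 \<odot>\<^bsub>quantum_weyl v\<^esub> (weyl_word v [wY] \<otimes>\<^bsub>quantum_weyl v\<^esub> weyl_word v [wX]) \<oplus>\<^bsub>quantum_weyl v\<^esub> \<one>\<^bsub>quantum_weyl v\<^esub>"
proof -
  interpret W: calg "quantum_weyl v" by (rule quantum_weyl_calg)
  interpret pr: presentation UNIV "weyl_rels v" by (rule weyl_presentation)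
  let ?X = "weyl_word v [wX]" and ?Y = "weyl_word v [wY]"
  have r: "wd [wX, wY] - Poly_Mapping.single [wY, wX] (v\<^sup>2) - wd [] \<in> weyl_rels v" (is "?r \<in> _") by (simp add: weyl_rels_def)
  have "weyl_word v w = W.wprod (\<lambda>g. weyl_word v [g]) w" for w
    unfolding quantum_weyl_def weyl_word_def by (rule pr.pw_wprod) simp
  then have "weyl_word v = W.wprod (\<lambda>g. weyl_word v [g])" by blast
  moreover have "W.lin (weyl_word v) ?r = \<zero>\<^bsub>quantum_weyl v\<^esub>"
    using pr.rel_zero[OF r] by (simp add: quantum_weyl_def weyl_word_def)
  ultimately have "W.lin (W.wprod (\<lambda>g. weyl_word v [g])) ?r = \<zero>\<^bsub>quantum_weyl v\<^esub>" by simp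
  then have 0: "?X \<otimes>\<^bsub>quantum_weyl v\<^esub> ?Y \<ominus>\<^bsub>quantum_weyl v\<^esub> v\<^sup>2 \<odot>\<^bsub>quantum_weyl v\<^esub> (?Y \<otimes>\<^bsub>quantum_weyl v\<^esub> ?X)
       \<ominus>\<^bsub>quantum_weyl v\<^esub> \<one>\<^bsub>quantum_weyl v\<^esub> = \<zero>\<^bsub>quantum_weyl v\<^esub>"
    using W.lin_weyl_rel[OF weyl_word_closed r] by simp
  show ?thesis by (rule W.minus_minus_eq_zeroD[OF _ _ _ 0]) (simp_all add: weyl_word_closed)
qed

lemma quantum_weyl_lift:
  assumes W: "calg W" and c: "X \<in> carrier W" "Y \<in> carrier W"
    and rel: "X \<otimes>\<^bsub>W\<^esub> Y = v\<^sup>2 \<odot>\<^bsub>W\<^esub> (Y \<otimes>\<^bsub>W\<^esub> X) \<oplus>\<^bsub>W\<^esub> \<one>\<^bsub>W\<^esub>"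
  obtains h where "h \<in> alg_hom (quantum_weyl v) W" "h (weyl_word v [wX]) = X" "h (weyl_word v [wY]) = Y"
proof -
  interpret W: calg W by fact
  interpret pr: presentation UNIV "weyl_rels v" by (rule weyl_presentation)
  let ?f = "case_weyl_gen X Y"
  have f: "?f g \<in> carrier W" for g using c by (cases g) auto
  have "W.lin (W.wprod ?f) r = \<zero>\<^bsub>W\<^esub>" if "r \<in> weyl_rels v" for r
  proof -
    have "v\<^sup>2 \<odot>\<^bsub>W\<^esub> (Y \<otimes>\<^bsub>W\<^esub> X) \<oplus>\<^bsub>W\<^esub> \<one>\<^bsub>W\<^esub> \<ominus>\<^bsub>W\<^esub> v\<^sup>2 \<odot>\<^bsub>W\<^esub> (Y \<otimes>\<^bsub>W\<^esub> X) \<ominus>\<^bsub>W\<^esub> \<one>\<^bsub>W\<^esub> = \<zero>\<^bsub>W\<^esub>"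
    proof -
      define Q where "Q = v\<^sup>2 \<odot>\<^bsub>W\<^esub> (Y \<otimes>\<^bsub>W\<^esub> X)"
      have "Q \<in> carrier W" using c by (simp add: Q_def)
      then have "Q \<oplus>\<^bsub>W\<^esub> \<one>\<^bsub>W\<^esub> \<ominus>\<^bsub>W\<^esub> Q \<ominus>\<^bsub>W\<^esub> \<one>\<^bsub>W\<^esub> = \<zero>\<^bsub>W\<^esub>" by (rule W.add_minus_cancel[OF _ W.one_closed])
      then show ?thesis by (simp add: Q_def)
    qed
    then show ?thesis using W.lin_weyl_rel[of ?f r v, OF f that] by (simp add: rel)
  qed
  then obtain h where "h \<in> alg_hom pr.PA W" "\<And>g. h (pr.pw [g]) = ?f g"
    using pr.presented_lift[OF W, of ?f] f by auto
  then show ?thesis using that[of h] by (simp add: quantum_weyl_def weyl_word_def)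
qed

context coideal_data
begin

lemma weyl_const_nz: assumes "\<alpha> \<in> supp" shows "weyl_const \<alpha> \<noteq> 0"
proof -
  have "\<alpha> \<in> B" using assms supp by auto
  then show ?thesis using q_root_nonzero[of \<alpha>] q_root_diff[of \<alpha>] by (simp add: weyl_const_def)
qed

lemma EF_gens: "\<alpha> \<in> supp \<Longrightarrow> {ep \<alpha>, fb \<alpha>} \<subseteq> carrier U"
  using ep_closed fb_closed supp by auto

text \<open>Rescaling \<open>F_bar\<close> normalizes the constant of the relation to \<open>1\<close>. The inverse homomorphism comes from
  the universal property of the subalgebra generated by \<open>F_bar \<alpha>\<close> and \<open>E_bar \<alpha>\<close>.\<close>

lemma EF_quantum_weyl:
  assumes \<alpha>: "\<alpha> \<in> supp"
  shows "is_quantum_weyl (q_root q \<alpha>) (restrict_alg U (alg_gen U {ep \<alpha>, fb \<alpha>})) (ep \<alpha>) (fb \<alpha>)"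
proof -
  let ?v = "q_root q \<alpha>" and ?D = "alg_gen U {ep \<alpha>, fb \<alpha>}"
  let ?W = "quantum_weyl ?v" and ?R = "restrict_alg U ?D"
  let ?X = "weyl_word ?v [wX]" and ?Y = "weyl_word ?v [wY]"
  define c where "c = weyl_const \<alpha>"
  have c: "c \<noteq> 0" using weyl_const_nz[OF \<alpha>] by (simp add: c_def)
  have \<alpha>B: "\<alpha> \<in> B" using \<alpha> supp by auto
  interpret W: calg ?W by (rule quantum_weyl_calg)
  have D: "subalg ?D U" by (rule U.alg_gen_subalg[OF EF_gens[OF \<alpha>]])
  interpret R: calg ?R by (rule U.subalg_calg[OF D])
  have gD: "ep \<alpha> \<in> ?D" "fb \<alpha> \<in> ?D" using U.alg_gen_incl[of "{ep \<alpha>, fb \<alpha>}"] by auto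
  have gU: "ep \<alpha> \<in> carrier U" "fb \<alpha> \<in> carrier U" using EF_gens[OF \<alpha>] by auto
  have XY: "?X \<in> carrier ?W" "?Y \<in> carrier ?W" by (rule weyl_word_closed)+
  have "ep \<alpha> \<otimes>\<^bsub>U\<^esub> (inverse c \<odot>\<^bsub>U\<^esub> fb \<alpha>) = inverse c \<odot>\<^bsub>U\<^esub> (?v\<^sup>2 \<odot>\<^bsub>U\<^esub> (fb \<alpha> \<otimes>\<^bsub>U\<^esub> ep \<alpha>) \<oplus>\<^bsub>U\<^esub> c \<odot>\<^bsub>U\<^esub> \<one>\<^bsub>U\<^esub>)"
    using gU ep_fb_same[OF \<alpha>] by (simp add: U.smult_mult_r c_def)
  also have "\<dots> = ?v\<^sup>2 \<odot>\<^bsub>U\<^esub> ((inverse c \<odot>\<^bsub>U\<^esub> fb \<alpha>) \<otimes>\<^bsub>U\<^esub> ep \<alpha>) \<oplus>\<^bsub>U\<^esub> \<one>\<^bsub>U\<^esub>"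
    using gU c by (simp add: U.smult_r_distr U.smult_smult U.smult_mult_l mult.commute)
  finally have rel: "ep \<alpha> \<otimes>\<^bsub>?R\<^esub> (inverse c \<odot>\<^bsub>?R\<^esub> fb \<alpha>) = ?v\<^sup>2 \<odot>\<^bsub>?R\<^esub> ((inverse c \<odot>\<^bsub>?R\<^esub> fb \<alpha>) \<otimes>\<^bsub>?R\<^esub> ep \<alpha>) \<oplus>\<^bsub>?R\<^esub> \<one>\<^bsub>?R\<^esub>"
    by simp
  have YD: "inverse c \<odot>\<^bsub>?R\<^esub> fb \<alpha> \<in> carrier ?R" using gD D by (simp add: subalg_def)
  obtain h where h: "h \<in> alg_hom ?W ?R" "h ?X = ep \<alpha>" "h ?Y = inverse c \<odot>\<^bsub>?R\<^esub> fb \<alpha>"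
    by (rule quantum_weyl_lift[OF R.calg_axioms _ YD rel]) (use gD in auto)
  obtain g where g: "g \<in> alg_hom (restrict_alg U (alg_gen U (fb ` {\<alpha>} \<union> kk ` {0} \<union> ep ` {\<alpha>}))) ?W"
    "g (fb \<alpha>) = c \<odot>\<^bsub>?W\<^esub> ?Y" "g (ep \<alpha>) = ?X"
  proof (rule coideal_hom[OF W.calg_axioms, of "{\<alpha>}" "{\<alpha>}" "{0}" "\<lambda>_. c \<odot>\<^bsub>?W\<^esub> ?Y" "\<lambda>_. ?X" "\<lambda>_. \<one>\<^bsub>?W\<^esub>"])
    fix \<gamma> assume "\<gamma> \<in> {\<alpha>}"
    then have "\<gamma> = \<alpha>" by simp
    have "?X \<otimes>\<^bsub>?W\<^esub> (c \<odot>\<^bsub>?W\<^esub> ?Y) = c \<odot>\<^bsub>?W\<^esub> (?v\<^sup>2 \<odot>\<^bsub>?W\<^esub> (?Y \<otimes>\<^bsub>?W\<^esub> ?X) \<oplus>\<^bsub>?W\<^esub> \<one>\<^bsub>?W\<^esub>)"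
      using XY quantum_weyl_relation[of ?v] by (simp add: W.smult_mult_r)
    also have "\<dots> = ?v\<^sup>2 \<odot>\<^bsub>?W\<^esub> ((c \<odot>\<^bsub>?W\<^esub> ?Y) \<otimes>\<^bsub>?W\<^esub> ?X) \<oplus>\<^bsub>?W\<^esub> c \<odot>\<^bsub>?W\<^esub> \<one>\<^bsub>?W\<^esub>"
      using XY by (simp add: W.smult_r_distr W.smult_smult W.smult_mult_l mult.commute)
    finally show "?X \<otimes>\<^bsub>?W\<^esub> (c \<odot>\<^bsub>?W\<^esub> ?Y) =
        (q_root q \<gamma>)\<^sup>2 \<odot>\<^bsub>?W\<^esub> ((c \<odot>\<^bsub>?W\<^esub> ?Y) \<otimes>\<^bsub>?W\<^esub> ?X) \<oplus>\<^bsub>?W\<^esub> weyl_const \<gamma> \<odot>\<^bsub>?W\<^esub> \<one>\<^bsub>?W\<^esub>"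
      by (simp only: \<open>\<gamma> = \<alpha>\<close> c_def)
  qed (use \<alpha> \<alpha>B XY L0_zero in auto)
  have "?D \<subseteq> alg_gen U (fb ` {\<alpha>} \<union> kk ` {0} \<union> ep ` {\<alpha>})" by (rule U.alg_gen_mono) simp
  with g(1) have g': "g \<in> alg_hom ?R ?W" by (rule alg_hom_restrict)
  note gh = alg_homD[OF g'] and hh = alg_homD[OF h(1)]
  have "h \<in> alg_iso ?W ?R"
  proof (rule alg_iso_on_generators[OF W.calg_axioms quantum_weyl_generated U.calg_axioms EF_gens[OF \<alpha>] h(1) g'])
    have "g (inverse c \<odot>\<^bsub>?R\<^esub> fb \<alpha>) = ?Y"
      using gh(4)[of "fb \<alpha>" "inverse c"] gD g(2) XY c by (simp add: W.smult_smult)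
    then show "g (h x) = x" if "x \<in> {?X, ?Y}" for x using that h g by auto
    have "h (c \<odot>\<^bsub>?W\<^esub> ?Y) = fb \<alpha>" using hh(4)[OF XY(2), of c] h(3) gU c by (simp add: U.smult_smult)
    then show "h (g y) = y" if "y \<in> {ep \<alpha>, fb \<alpha>}" for y using that h g by auto
  qed
  then show ?thesis unfolding is_quantum_weyl_def
    using h gU c by (intro exI[of _ h] exI[of _ 1] exI[of _ "inverse c"]) simp
qed

end

section \<open>The quotient of the coideal subalgebra\<close>

text \<open>The quotient is stated in terms of \<open>\<lambda>\<^sup>+\<close> with arbitrary values outside \<open>supp\<close>, of which \<open>l\<close> is the
  extension by zero.\<close>

locale bar_data = coideal_data +
  fixes lp :: "'a \<Rightarrow> complex"
  assumes lp: "\<And>\<alpha>. \<alpha> \<in> supp \<Longrightarrow> lp \<alpha> = l \<alpha>"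
begin

abbreviation "CB \<equiv> C_bar B q supp lp lm"
abbreviation "inc \<equiv> bar_incl B q supp lp lm"
abbreviation "fac \<equiv> bar_factor B q supp lp lm"

lemma E_bar_lp: "\<alpha> \<in> supp \<Longrightarrow> E_bar B q lp \<alpha> = ep \<alpha>"
  by (simp add: E_bar_def lp)

lemma fac_None: "fac None = restrict_alg U (torus_alg B q L0)"
  by (simp add: bar_factor_def)

lemma fac_Some: "\<alpha> \<in> supp \<Longrightarrow> fac (Some \<alpha>) = restrict_alg U (alg_gen U {ep \<alpha>, fb \<alpha>})"
  by (simp add: bar_factor_def EF_alg_def E_bar_lp)

lemma torus_alg_gen: "torus_alg B q L0 = alg_gen U (kk ` L0)"
proof
  have kL: "kk ` L0 \<subseteq> carrier U" using kk_closed by auto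
  show "torus_alg B q L0 \<subseteq> alg_gen U (kk ` L0)"
    unfolding torus_alg_def by (rule U.lin_span_least[OF U.alg_gen_subalg[OF kL] U.alg_gen_incl])
  show "alg_gen U (kk ` L0) \<subseteq> torus_alg B q L0"
    by (rule U.alg_gen_least[OF torus_subalg]) (auto simp: torus_alg_def intro: lin_span.span_base)
qed

definition factor_gens :: "'a option \<Rightarrow> 'a uq set" where
  "factor_gens j = (case j of None \<Rightarrow> kk ` L0 | Some \<alpha> \<Rightarrow> {ep \<alpha>, fb \<alpha>})"

lemma factor_gens_closed: "j \<in> bar_index supp \<Longrightarrow> factor_gens j \<subseteq> carrier U"
  using kk_closed EF_gens by (auto simp: bar_index_def factor_gens_def)

lemma fac_eq: "j \<in> bar_index supp \<Longrightarrow> fac j = restrict_alg U (alg_gen U (factor_gens j))"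
  by (auto simp: bar_index_def fac_None fac_Some torus_alg_gen factor_gens_def)

lemma fac_carrier: "j \<in> bar_index supp \<Longrightarrow> carrier (fac j) = alg_gen U (factor_gens j)"
  by (simp add: fac_eq)

sublocale TB: tensor_family "bar_index supp" fac
  by (rule tensor_family.intro) (simp add: fac_eq U.subalg_calg U.alg_gen_subalg factor_gens_closed)

lemma fin_index: "finite (bar_index supp)"
  using finsupp by (simp add: bar_index_def)

sublocale CB: calg CB
  unfolding C_bar_def by (rule TB.T.calg_axioms)

lemma inc_hom: "j \<in> bar_index supp \<Longrightarrow> inc j \<in> alg_hom (fac j) CB"
  unfolding C_bar_def bar_incl_def by (rule TB.incl_alg_hom)

lemma inc_commute: "i \<in> bar_index supp \<Longrightarrow> j \<in> bar_index supp \<Longrightarrow> i \<noteq> j \<Longrightarrow> a \<in> carrier (fac i) \<Longrightarrow> b \<in> carrier (fac j) \<Longrightarrow>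
    inc i a \<otimes>\<^bsub>CB\<^esub> inc j b = inc j b \<otimes>\<^bsub>CB\<^esub> inc i a"
  unfolding C_bar_def bar_incl_def by (rule TB.incl_commute)

lemma CB_generated: "subalg S CB \<Longrightarrow> (\<And>j a. j \<in> bar_index supp \<Longrightarrow> a \<in> carrier (fac j) \<Longrightarrow> inc j a \<in> S) \<Longrightarrow> S = carrier CB"
  unfolding C_bar_def bar_incl_def by (rule TB.tensor_generated[OF fin_index])

lemma index_simps [simp]: "None \<in> bar_index supp" "\<alpha> \<in> supp \<Longrightarrow> Some \<alpha> \<in> bar_index supp"
  by (auto simp: bar_index_def)

lemma fac_mem: "\<mu> \<in> L0 \<Longrightarrow> kk \<mu> \<in> carrier (fac None)" "\<alpha> \<in> supp \<Longrightarrow> ep \<alpha> \<in> carrier (fac (Some \<alpha>))"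
  "\<alpha> \<in> supp \<Longrightarrow> fb \<alpha> \<in> carrier (fac (Some \<alpha>))"
  using U.alg_gen_incl[of "kk ` L0"] U.alg_gen_incl[of "{ep \<alpha>, fb \<alpha>}"] by (auto simp: fac_carrier factor_gens_def)

lemma fac_sub_C_alg: assumes j: "j \<in> bar_index supp" shows "carrier (fac j) \<subseteq> C_alg"
  unfolding fac_carrier[OF j] C_alg_def
proof (rule U.alg_gen_mono)
  show "factor_gens j \<subseteq> fb ` supp \<union> kk ` L0 \<union> ep ` B"
  proof (cases j)
    case (Some \<alpha>)
    then have "\<alpha> \<in> supp" using j by (auto simp: bar_index_def)
    then show ?thesis using Some supp by (auto simp: factor_gens_def)
  qed (auto simp: factor_gens_def)
qed

lemma hom_eq_inc:
  assumes \<pi>: "\<pi> \<in> alg_hom (restrict_alg U C_alg) CB" and eq: "\<And>x. x \<in> factor_gens j \<Longrightarrow> \<pi> x = inc j x"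
    and j: "j \<in> bar_index supp" and x: "x \<in> carrier (fac j)"
  shows "\<pi> x = inc j x"
proof (rule alg_hom_eq_on_generators[OF U.calg_axioms CB.calg_axioms factor_gens_closed[OF j]])
  show "\<pi> \<in> alg_hom (restrict_alg U (alg_gen U (factor_gens j))) CB"
    using alg_hom_restrict[OF \<pi> fac_sub_C_alg[OF j]] by (simp add: fac_carrier[OF j])
  show "inc j \<in> alg_hom (restrict_alg U (alg_gen U (factor_gens j))) CB" using inc_hom[OF j] by (simp add: fac_eq[OF j])
qed (use eq x in \<open>simp_all add: fac_carrier[OF j]\<close>)

lemma inc_weyl: assumes \<alpha>: "\<alpha> \<in> supp"
  shows "inc (Some \<alpha>) (ep \<alpha>) \<otimes>\<^bsub>CB\<^esub> inc (Some \<alpha>) (fb \<alpha>) =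
    (q_root q \<alpha>)\<^sup>2 \<odot>\<^bsub>CB\<^esub> (inc (Some \<alpha>) (fb \<alpha>) \<otimes>\<^bsub>CB\<^esub> inc (Some \<alpha>) (ep \<alpha>)) \<oplus>\<^bsub>CB\<^esub> weyl_const \<alpha> \<odot>\<^bsub>CB\<^esub> \<one>\<^bsub>CB\<^esub>"
proof -
  let ?F = "fac (Some \<alpha>)" and ?i = "inc (Some \<alpha>)"
  have j: "Some \<alpha> \<in> bar_index supp" using \<alpha> by simp
  interpret F: calg ?F using j by (rule TB.factor_calg)
  note i = alg_homD[OF inc_hom[OF j]]
  note m = fac_mem(2,3)[OF \<alpha>]
  have "ep \<alpha> \<otimes>\<^bsub>?F\<^esub> fb \<alpha> = (q_root q \<alpha>)\<^sup>2 \<odot>\<^bsub>?F\<^esub> (fb \<alpha> \<otimes>\<^bsub>?F\<^esub> ep \<alpha>) \<oplus>\<^bsub>?F\<^esub> weyl_const \<alpha> \<odot>\<^bsub>?F\<^esub> \<one>\<^bsub>?F\<^esub>"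
    using ep_fb_same[OF \<alpha>] by (simp add: fac_Some[OF \<alpha>])
  then have "?i (ep \<alpha> \<otimes>\<^bsub>?F\<^esub> fb \<alpha>) = ?i ((q_root q \<alpha>)\<^sup>2 \<odot>\<^bsub>?F\<^esub> (fb \<alpha> \<otimes>\<^bsub>?F\<^esub> ep \<alpha>) \<oplus>\<^bsub>?F\<^esub> weyl_const \<alpha> \<odot>\<^bsub>?F\<^esub> \<one>\<^bsub>?F\<^esub>)"
    by (rule arg_cong)
  then show ?thesis using m by (simp only: i F.m_closed F.smult_closed F.one_closed)
qed

text \<open>The images in the tensor product satisfy the rules required by the universal property if the \<open>E_bar \<beta>\<close>
  with \<open>\<beta> \<notin> supp\<close> are sent to zero.\<close>

lemma bar_quotient_exists: "\<exists>\<pi>. is_bar_quotient B q supp lp lm C_alg \<pi>"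
proof -
  define f' where "f' \<alpha> = inc (Some \<alpha>) (fb \<alpha>)" for \<alpha>
  define e' where "e' \<beta> = (if \<beta> \<in> supp then inc (Some \<beta>) (ep \<beta>) else \<zero>\<^bsub>CB\<^esub>)" for \<beta>
  define k' where "k' \<mu> = inc None (kk \<mu>)" for \<mu>
  note None = alg_homD[OF inc_hom[OF index_simps(1)]]
  note Some = alg_homD[OF inc_hom[OF index_simps(2)]]
  obtain \<pi> where \<pi>: "\<pi> \<in> alg_hom (restrict_alg U (alg_gen U (fb ` supp \<union> kk ` L0 \<union> ep ` B))) CB"
    "\<And>\<alpha>. \<alpha> \<in> supp \<Longrightarrow> \<pi> (fb \<alpha>) = f' \<alpha>" "\<And>\<mu>. \<mu> \<in> L0 \<Longrightarrow> \<pi> (kk \<mu>) = k' \<mu>" "\<And>\<beta>. \<beta> \<in> B \<Longrightarrow> \<pi> (ep \<beta>) = e' \<beta>"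
  proof (rule coideal_hom[OF CB.calg_axioms, of supp B L0 f' e' k'])
    show "supp \<subseteq> supp" "B \<subseteq> B" "B \<inter> supp = supp" "L0 \<subseteq> L0" "0 \<in> L0" using supp L0_zero by auto
    show "\<mu> + \<nu> \<in> L0" if "\<mu> \<in> L0" "\<nu> \<in> L0" for \<mu> \<nu> using that by (rule L0_add)
    show "f' \<alpha> \<in> carrier CB" if "\<alpha> \<in> supp" for \<alpha> unfolding f'_def using that fac_mem by (intro Some)
    show "e' \<beta> \<in> carrier CB" for \<beta> unfolding e'_def using Some(2) fac_mem by simp
    show "k' \<mu> \<in> carrier CB" if "\<mu> \<in> L0" for \<mu> unfolding k'_def using that fac_mem by (intro None)
    show "k' 0 = \<one>\<^bsub>CB\<^esub>" using None(6) by (simp add: k'_def K_elt_zero fac_None)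
    show "k' \<mu> \<otimes>\<^bsub>CB\<^esub> k' \<nu> = k' (\<mu> + \<nu>)" if "\<mu> \<in> L0" "\<nu> \<in> L0" for \<mu> \<nu>
      using None(5)[OF fac_mem(1)[OF that(1)] fac_mem(1)[OF that(2)]] kk_add[OF that] by (simp add: k'_def fac_None)
    show "k' \<mu> \<otimes>\<^bsub>CB\<^esub> f' \<alpha> = f' \<alpha> \<otimes>\<^bsub>CB\<^esub> k' \<mu>" if "\<mu> \<in> L0" "\<alpha> \<in> supp" for \<mu> \<alpha>
      unfolding k'_def f'_def using that fac_mem by (intro inc_commute) simp_all
    show "e' \<alpha> \<otimes>\<^bsub>CB\<^esub> k' \<mu> = k' \<mu> \<otimes>\<^bsub>CB\<^esub> e' \<alpha>" if "\<mu> \<in> L0" "\<alpha> \<in> supp" for \<mu> \<alpha>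
      unfolding k'_def e'_def using that fac_mem inc_commute by simp
    show "e' \<alpha> \<otimes>\<^bsub>CB\<^esub> f' \<alpha> = (q_root q \<alpha>)\<^sup>2 \<odot>\<^bsub>CB\<^esub> (f' \<alpha> \<otimes>\<^bsub>CB\<^esub> e' \<alpha>) \<oplus>\<^bsub>CB\<^esub> weyl_const \<alpha> \<odot>\<^bsub>CB\<^esub> \<one>\<^bsub>CB\<^esub>"
      if "\<alpha> \<in> supp" for \<alpha> using that inc_weyl by (simp add: e'_def f'_def)
    show "e' \<beta> \<otimes>\<^bsub>CB\<^esub> f' \<alpha> = f' \<alpha> \<otimes>\<^bsub>CB\<^esub> e' \<beta>" if "\<alpha> \<in> supp" "\<beta> \<in> supp" "\<alpha> \<noteq> \<beta>" for \<alpha> \<beta>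
      unfolding e'_def f'_def using that fac_mem inc_commute by simp
    show "f' \<alpha> \<otimes>\<^bsub>CB\<^esub> f' \<beta> = f' \<beta> \<otimes>\<^bsub>CB\<^esub> f' \<alpha>" if "\<alpha> \<in> supp" "\<beta> \<in> supp" for \<alpha> \<beta>
      unfolding f'_def using that fac_mem inc_commute[of "Some \<alpha>" "Some \<beta>"] by (cases "\<alpha> = \<beta>") simp_all
    show "e' \<alpha> \<otimes>\<^bsub>CB\<^esub> e' \<beta> = e' \<beta> \<otimes>\<^bsub>CB\<^esub> e' \<alpha>" if "\<alpha> \<in> supp" "\<beta> \<in> supp" for \<alpha> \<beta>
      unfolding e'_def using that fac_mem inc_commute[of "Some \<alpha>" "Some \<beta>"] by (cases "\<alpha> = \<beta>") simp_all
    show "e' \<beta> = \<zero>\<^bsub>CB\<^esub>" if "\<beta> \<in> B - supp" for \<beta> using that by (simp add: e'_def)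
  qed (rule that)
  have \<pi>h: "\<pi> \<in> alg_hom (restrict_alg U C_alg) CB" using \<pi>(1) by (simp add: C_alg_def)
  have eq: "\<pi> x = inc j x" if "j \<in> bar_index supp" "x \<in> carrier (fac j)" for j x
  proof (rule hom_eq_inc[OF \<pi>h _ that])
    fix y assume y: "y \<in> factor_gens j"
    show "\<pi> y = inc j y"
    proof (cases j)
      case None
      then obtain \<mu> where "y = kk \<mu>" "\<mu> \<in> L0" using y by (auto simp: factor_gens_def)
      then show ?thesis using \<pi>(3) None by (simp add: k'_def)
    next
      case (Some \<alpha>)
      then have \<alpha>: "\<alpha> \<in> supp" "\<alpha> \<in> B" using that(1) supp by (auto simp: bar_index_def)
      consider "y = ep \<alpha>" | "y = fb \<alpha>" using y Some unfolding factor_gens_def by fastforce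
      then show ?thesis using \<pi>(2,4) \<alpha> Some by cases (simp_all add: e'_def f'_def)
    qed
  qed
  have "\<pi> ` C_alg = carrier CB"
  proof (rule CB_generated)
    show "subalg (\<pi> ` C_alg) CB"
      using alg_hom_image_subalg[OF U.subalg_calg[OF C_alg_subalg] CB.calg_axioms \<pi>h calg.subalg_carrier[OF U.subalg_calg[OF C_alg_subalg]]]
      by simp
    show "inc j a \<in> \<pi> ` C_alg" if "j \<in> bar_index supp" "a \<in> carrier (fac j)" for j a
      using eq[OF that, symmetric] fac_sub_C_alg[OF that(1)] that(2) by blast
  qed
  then have "is_bar_quotient B q supp lp lm C_alg \<pi>"
    using \<pi>h eq[of None] eq[of "Some _"] fac_mem supp by (simp add: is_bar_quotient_def fac_None E_bar_lp)
  then show ?thesis by blast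
qed

end

section \<open>Eigenvalues of an operator on a finite-dimensional space\<close>

context cspace
begin

text \<open>The vector with coordinates \<open>c\<close> with respect to \<open>S\<close>.\<close>

definition comb :: "'v set \<Rightarrow> ('v \<Rightarrow>\<^sub>0 complex) \<Rightarrow> 'v" where
  "comb S c = finsum V (\<lambda>s. Poly_Mapping.lookup c s \<odot> s) S"

context
  fixes S assumes S: "finite S" "S \<subseteq> carrier V"
begin

lemma S_mem: "s \<in> S \<Longrightarrow> s \<in> carrier V" using S by auto

lemma comb_closed: "comb S c \<in> carrier V"
  unfolding comb_def by (rule finsum_closed) (use S_mem in auto)

lemma comb_add: "comb S (c + d) = comb S c \<oplus> comb S d"
proof -
  have "comb S (c + d) = finsum V (\<lambda>s. Poly_Mapping.lookup c s \<odot> s \<oplus> Poly_Mapping.lookup d s \<odot> s) S"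
    unfolding comb_def by (rule finsum_cong') (use S_mem in \<open>auto simp: lookup_add smult_l_distr\<close>)
  also have "\<dots> = comb S c \<oplus> comb S d"
    unfolding comb_def by (rule finsum_addf) (use S_mem in auto)
  finally show ?thesis .
qed

lemma comb_scale: "comb S (pm_scale k c) = k \<odot> comb S c"
proof -
  have "k \<odot> comb S c = finsum V (\<lambda>s. k \<odot> (Poly_Mapping.lookup c s \<odot> s)) S"
    unfolding comb_def by (rule smult_finsum) (use S_mem in auto)
  also have "\<dots> = comb S (pm_scale k c)"
    unfolding comb_def
  proof (rule finsum_cong')
    show "k \<odot> (Poly_Mapping.lookup c s \<odot> s) = Poly_Mapping.lookup (pm_scale k c) s \<odot> s" if "s \<in> S" for s
      using S_mem[OF that] by (simp add: Poly_Mapping.map.rep_eq when_def smult_smult)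
  qed (use S_mem in auto)
  finally show ?thesis by simp
qed

lemma comb_zero: "comb S 0 = \<zero>"
  using comb_scale[of 0 0] comb_closed[of 0] by (simp add: pm_scale_simps)

lemma comb_single: "s \<in> S \<Longrightarrow> comb S (Poly_Mapping.single s 1) = s"
proof -
  assume s: "s \<in> S"
  have "comb S (Poly_Mapping.single s 1) = finsum V (\<lambda>t. if s = t then t else \<zero>) S"
    unfolding comb_def by (rule finsum_cong') (use S_mem in \<open>auto simp: lookup_single when_def\<close>)
  also have "\<dots> = s" using add.finprod_singleton[of s S "\<lambda>t. t"] s S S_mem by auto
  finally show ?thesis .
qed

lemma comb_span: assumes "v \<in> lin_span V S" obtains c where "Poly_Mapping.keys c \<subseteq> S" "comb S c = v"
proof -
  from assms have "\<exists>c. Poly_Mapping.keys c \<subseteq> S \<and> comb S c = v"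
  proof induction
    case span_zero
    then show ?case using comb_zero by (intro exI[of _ 0]) simp
  next
    case (span_base x)
    then show ?case using comb_single by (intro exI[of _ "Poly_Mapping.single x 1"]) simp
  next
    case (span_add x y)
    then obtain c d where "Poly_Mapping.keys c \<subseteq> S" "comb S c = x" "Poly_Mapping.keys d \<subseteq> S" "comb S d = y" by blast
    then show ?case using comb_add keys_add_subset[of c S d] by (intro exI[of _ "c + d"]) auto
  next
    case (span_smult x k)
    then obtain c where "Poly_Mapping.keys c \<subseteq> S" "comb S c = x" by blast
    then show ?case using comb_scale keys_pm_scale[of k c] by (intro exI[of _ "pm_scale k c"]) auto
  qed
  then show ?thesis using that by blast
qed

lemma comb_sum: "finite I \<Longrightarrow> comb S (\<Sum>i\<in>I. pm_scale (a i) (c i)) = finsum V (\<lambda>i. a i \<odot> comb S (c i)) I"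
  by (induction I rule: finite_induct) (auto simp: comb_zero comb_add comb_scale comb_closed finsum_insert)

text \<open>Pass to coordinate vectors.\<close>

lemma dependent_family:
  assumes w: "\<And>i. i \<le> card S \<Longrightarrow> w i \<in> lin_span V S"
  obtains a :: "nat \<Rightarrow> complex" and i where "i \<le> card S" "a i \<noteq> 0" "finsum V (\<lambda>i. a i \<odot> w i) {..card S} = \<zero>"
proof -
  interpret pm: vector_space "pm_scale :: complex \<Rightarrow> ('v \<Rightarrow>\<^sub>0 complex) \<Rightarrow> _"
    by unfold_locales (auto simp: pm_scale_simps(1-4))
  have "\<forall>i. \<exists>c. i \<le> card S \<longrightarrow> Poly_Mapping.keys c \<subseteq> S \<and> comb S c = w i" using w comb_span by metis
  then obtain c where c: "\<And>i. i \<le> card S \<Longrightarrow> Poly_Mapping.keys (c i) \<subseteq> S" "\<And>i. i \<le> card S \<Longrightarrow> comb S (c i) = w i" by metis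
  have wc: "w i \<in> carrier V" if "i \<le> card S" for i using c(2)[OF that] comb_closed[of "c i"] by simp
  have dep: "\<exists>a i. i \<le> card S \<and> a i \<noteq> 0 \<and> (\<Sum>i\<le>card S. pm_scale (a i) (c i)) = 0"
  proof (cases "inj_on c {..card S}")
    case True
    let ?B = "(\<lambda>s. Poly_Mapping.single s (1::complex)) ` S"
    have "p \<in> pm.span ?B" if "Poly_Mapping.keys p \<subseteq> S" for p
      using that
    proof (induction p rule: poly_mapping_keys_induct)
      case (single s a)
      have "pm_scale a (Poly_Mapping.single s 1) \<in> pm.span ?B" using single by (intro pm.span_scale pm.span_base imageI)
      then show ?case by (simp add: pm_scale_simps(6))
    qed (auto intro: pm.span_zero pm.span_add)
    then have "c ` {..card S} \<subseteq> pm.span ?B" using c(1) by auto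
    moreover have "card ?B < card (c ` {..card S})"
      using card_image_le[OF S(1), of "\<lambda>s. Poly_Mapping.single s (1::complex)"] card_image[OF True] by simp
    ultimately have "pm.dependent (c ` {..card S})"
      using pm.independent_span_bound[of ?B "c ` {..card S}"] S(1) by fastforce
    then obtain a x where a: "x \<in> c ` {..card S}" "a x \<noteq> 0" "(\<Sum>x\<in>c ` {..card S}. pm_scale (a x) x) = 0"
      unfolding pm.dependent_finite[OF finite_imageI[OF finite_atMost]] by blast
    then have "(\<Sum>i\<le>card S. pm_scale (a (c i)) (c i)) = 0" by (subst (asm) sum.reindex[OF True]) simp
    then show ?thesis using a by (intro exI[of _ "\<lambda>i. a (c i)"]) auto
  next
    case False
    then obtain i j where ij: "i \<le> card S" "j \<le> card S" "i \<noteq> j" "c i = c j" by (auto simp: inj_on_def)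
    let ?a = "\<lambda>k. if k = i then 1 else if k = j then - 1 else (0 :: complex)"
    have "(\<Sum>k\<le>card S. pm_scale (?a k) (c k)) = (\<Sum>k\<in>{i, j}. pm_scale (?a k) (c k))"
      by (rule sum.mono_neutral_right) (use ij in auto)
    also have "\<dots> = pm_scale 1 (c j) + pm_scale (- 1) (c j)" using ij by simp
    also have "\<dots> = 0" unfolding pm_scale_simps(2)[symmetric] by simp
    finally show ?thesis using ij by (intro exI[of _ ?a] exI[of _ i]) auto
  qed
  then obtain a i where ai: "i \<le> card S" "a i \<noteq> 0" "(\<Sum>i\<le>card S. pm_scale (a i) (c i)) = 0" by blast
  have "finsum V (\<lambda>i. a i \<odot> w i) {..card S} = finsum V (\<lambda>i. a i \<odot> comb S (c i)) {..card S}"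
    by (rule finsum_cong') (use c(2) comb_closed in auto)
  also have "\<dots> = comb S (\<Sum>i\<le>card S. pm_scale (a i) (c i))" by (rule comb_sum[symmetric]) simp
  also have "\<dots> = \<zero>" using ai(3) comb_zero by simp
  finally show ?thesis using that ai by blast
qed

end

end

lemma cspaceI: "Module.module complex_alg V \<Longrightarrow> cspace V"
proof -
  assume "Module.module complex_alg V"
  then interpret M: Module.module complex_alg V .
  show "cspace V"
    using M.smult_closed M.smult_l_distr M.smult_r_distr M.smult_assoc1 M.smult_one
    by (intro cspace.intro cspace_axioms.intro M.abelian_group_axioms) simp_all
qed

locale operator = cspace V for V :: "(complex, 'v) module" (structure) +
  fixes T :: "'v \<Rightarrow> 'v"
  assumes T_closed [simp]: "v \<in> carrier V \<Longrightarrow> T v \<in> carrier V"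
    and T_add: "v \<in> carrier V \<Longrightarrow> w \<in> carrier V \<Longrightarrow> T (v \<oplus> w) = T v \<oplus> T w"
    and T_smult: "v \<in> carrier V \<Longrightarrow> T (c \<odot> v) = c \<odot> T v"
begin

lemma T_zero: "T \<zero> = \<zero>"
  using T_smult[of \<zero> 0] by simp

text \<open>The value of \<open>p(T)\<close> at \<open>v\<close>, by Horner's scheme.\<close>

definition pact :: "complex poly \<Rightarrow> 'v \<Rightarrow> 'v" where
  "pact p = fold_coeffs (\<lambda>a f v. a \<odot> v \<oplus> T (f v)) p (\<lambda>v. \<zero>)"

lemma pact_0 [simp]: "pact 0 v = \<zero>"
  by (simp add: pact_def)

lemma pact_pCons: "v \<in> carrier V \<Longrightarrow> pact (pCons a p) v = a \<odot> v \<oplus> T (pact p v)"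
  by (cases "p = 0 \<and> a = 0") (auto simp: pact_def T_zero)

lemma pact_closed [simp]: "v \<in> carrier V \<Longrightarrow> pact p v \<in> carrier V"
  by (induction p) (simp_all add: pact_pCons)

lemma pact_vec_add: "v \<in> carrier V \<Longrightarrow> w \<in> carrier V \<Longrightarrow> pact p (v \<oplus> w) = pact p v \<oplus> pact p w"
  by (induction p) (simp_all add: pact_pCons T_add smult_r_distr a_ac)

lemma pact_vec_smult: "v \<in> carrier V \<Longrightarrow> pact p (c \<odot> v) = c \<odot> pact p v"
  by (induction p) (simp_all add: pact_pCons T_smult smult_r_distr smult_smult mult.commute)

lemma pact_vec_zero: "pact p \<zero> = \<zero>"
  using pact_vec_smult[of \<zero> p 0] by simp

lemma pact_add: "v \<in> carrier V \<Longrightarrow> pact (p + r) v = pact p v \<oplus> pact r v"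
proof (induction p arbitrary: r)
  case (pCons a p)
  then show ?case by (cases r) (simp_all add: pact_pCons T_add smult_l_distr a_ac)
qed simp

lemma pact_smult: "v \<in> carrier V \<Longrightarrow> pact (Polynomial.smult c p) v = c \<odot> pact p v"
  by (induction p) (simp_all add: pact_pCons T_smult smult_r_distr smult_smult)

lemma pact_mult: "v \<in> carrier V \<Longrightarrow> pact (p * r) v = pact p (pact r v)"
  by (induction p) (simp_all add: pact_pCons pact_add pact_smult mult_pCons_left)

lemma pact_monom: "v \<in> carrier V \<Longrightarrow> pact (monom c n) v = c \<odot> (T ^^ n) v"
proof (induction n)
  case (Suc n)
  have "(T ^^ n) v \<in> carrier V" using Suc.prems by (induction n) simp_all
  then show ?case using Suc by (simp add: monom_Suc pact_pCons T_smult)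
qed (simp add: monom_0 pact_pCons T_zero)

lemma pact_sum: "finite I \<Longrightarrow> v \<in> carrier V \<Longrightarrow> pact (\<Sum>i\<in>I. f i) v = finsum V (\<lambda>i. pact (f i) v) I"
  by (induction I rule: finite_induct) (simp_all add: pact_add finsum_insert)

lemma pact_eigenvector: "v \<in> carrier V \<Longrightarrow> T v = z \<odot> v \<Longrightarrow> pact p v = poly p z \<odot> v"
  by (induction p) (simp_all add: pact_pCons T_smult smult_smult smult_l_distr mult.commute)

text \<open>Split off a root \<open>z\<close> of \<open>p\<close>: either the cofactor still kills \<open>v\<close>, or it maps \<open>v\<close> to an eigenvector.\<close>

lemma eigenvector_exists:
  assumes "p \<noteq> 0" "v \<in> carrier V" "v \<noteq> \<zero>" "pact p v = \<zero>"
  obtains z w where "w \<in> carrier V" "w \<noteq> \<zero>" "T w = z \<odot> w"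
proof -
  have "\<exists>z w. w \<in> carrier V \<and> w \<noteq> \<zero> \<and> T w = z \<odot> w"
    using assms
  proof (induction "degree p" arbitrary: p)
    case 0
    then obtain a where a: "p = [:a:]" "a \<noteq> 0" by (metis degree_eq_zeroE pCons_0_0)
    then have "a \<odot> v = \<zero>" using 0 by (simp add: pact_pCons T_zero)
    then show ?case using smult_eq_zero a 0 by blast
  next
    case (Suc n)
    then obtain z where "poly p z = 0" using fundamental_theorem_of_algebra[of p] constant_degree[of p] by auto
    then obtain r where r: "p = [:- z, 1:] * r" unfolding poly_eq_0_iff_dvd by (rule dvdE)
    have r0: "r \<noteq> 0" using Suc.prems(1) r by auto
    have "degree p = degree [:- z, 1:] + degree r" unfolding r by (rule degree_mult_eq) (use r0 in auto)
    then have deg: "n = degree r" using Suc.hyps(2) by simp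
    show ?case
    proof (cases "pact r v = \<zero>")
      case True
      then show ?thesis using Suc.hyps(1)[OF deg r0] Suc.prems by blast
    next
      case False
      let ?w = "pact r v"
      have w: "?w \<in> carrier V" using Suc.prems by simp
      have "pact [:- z, 1:] ?w = \<zero>"
        using Suc.prems(4) unfolding r pact_mult[OF Suc.prems(2)] .
      then have "(- z) \<odot> ?w \<oplus> T ?w = \<zero>" using w by (simp add: pact_pCons T_zero)
      then have "z \<odot> ?w = z \<odot> ?w \<oplus> ((- z) \<odot> ?w \<oplus> T ?w)" using w by simp
      also have "\<dots> = (z \<odot> ?w \<oplus> (- z) \<odot> ?w) \<oplus> T ?w" by (rule a_assoc[symmetric]) (use w in simp_all)
      also have "z \<odot> ?w \<oplus> (- z) \<odot> ?w = \<zero>" using w smult_l_distr[OF w, of z "- z"] by simp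
      also have "\<zero> \<oplus> T ?w = T ?w" using w by simp
      finally have "T ?w = z \<odot> ?w" by (rule sym)
      then show ?thesis using w False by blast
    qed
  qed
  then show ?thesis using that by blast
qed

text \<open>Take the product of annihilating polynomials for the vectors of a finite spanning set.\<close>

lemma annihilating_poly:
  assumes S: "finite S" "S \<subseteq> carrier V" "lin_span V S = carrier V"
  obtains p where "p \<noteq> 0" "\<And>v. v \<in> carrier V \<Longrightarrow> pact p v = \<zero>"
proof -
  have one: "\<exists>p. p \<noteq> 0 \<and> pact p v = \<zero>" if v: "v \<in> carrier V" for v
  proof -
    have Tv: "(T ^^ i) v \<in> carrier V" for i using v by (induction i) simp_all
    obtain a i where a: "i \<le> card S" "a i \<noteq> 0" "finsum V (\<lambda>i. a i \<odot> (T ^^ i) v) {..card S} = \<zero>"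
      using dependent_family[OF S(1,2), of "\<lambda>i. (T ^^ i) v"] Tv S(3) by metis
    let ?p = "\<Sum>i\<le>card S. monom (a i) i"
    have "pact ?p v = \<zero>" using a(3) v by (simp add: pact_sum pact_monom)
    moreover have "coeff ?p i = a i" using a(1) by (simp add: coeff_sum)
    ultimately show ?thesis using a(2) by (intro exI[of _ ?p]) auto
  qed
  then obtain P where P: "\<And>s. s \<in> S \<Longrightarrow> P s \<noteq> 0" "\<And>s. s \<in> S \<Longrightarrow> pact (P s) s = \<zero>" using S(2) by (metis subsetD)
  let ?p = "\<Prod>s\<in>S. P s"
  have nz: "?p \<noteq> 0" using P(1) S(1) by simp
  have "pact ?p v = \<zero>" if "v \<in> lin_span V S" for v
    using that
  proof induction
    case (span_base s)
    then have "?p = (\<Prod>t\<in>S - {s}. P t) * P s" using S(1) by (simp add: prod.remove[of S s] mult.commute)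
    then show ?case using span_base S(2) P(2) by (simp add: pact_mult pact_vec_zero subset_iff)
  qed (use S(3) in \<open>auto simp: pact_vec_zero pact_vec_add pact_vec_smult\<close>)
  then show ?thesis using that nz S(3) by blast
qed

text \<open>Start from any eigenvalue \<open>z\<close> and take the largest \<open>n\<close> such that \<open>z q\<^sup>n\<close> is an eigenvalue; there are
  only finitely many since \<open>q\<close> is not a root of unity.\<close>

lemma extreme_eigenvalue:
  assumes fd: "finite S" "S \<subseteq> carrier V" "lin_span V S = carrier V" and nz: "carrier V \<noteq> {\<zero>}"
    and inj: "\<And>v. v \<in> carrier V \<Longrightarrow> T v = \<zero> \<Longrightarrow> v = \<zero>"
    and q: "q \<noteq> 0" "\<And>n::nat. n > 0 \<Longrightarrow> q ^ n \<noteq> 1"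
  obtains z w where "w \<in> carrier V" "w \<noteq> \<zero>" "T w = z \<odot> w"
    "\<And>n v. n > 0 \<Longrightarrow> v \<in> carrier V \<Longrightarrow> T v = (z * q ^ n) \<odot> v \<Longrightarrow> v = \<zero>"
proof -
  obtain p where p: "p \<noteq> 0" "\<And>v. v \<in> carrier V \<Longrightarrow> pact p v = \<zero>" by (rule annihilating_poly[OF fd]) (rule that)
  obtain v where v: "v \<in> carrier V" "v \<noteq> \<zero>" using nz zero_closed by blast
  obtain z0 w0 where w0: "w0 \<in> carrier V" "w0 \<noteq> \<zero>" "T w0 = z0 \<odot> w0"
    using eigenvector_exists[OF p(1) v p(2)[OF v(1)]] by blast
  have z0: "z0 \<noteq> 0" using inj[OF w0(1)] w0 by auto
  define N where "N = {n. \<exists>v\<in>carrier V. v \<noteq> \<zero> \<and> T v = (z0 * q ^ n) \<odot> v}"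
  have "inj_on (\<lambda>n. z0 * q ^ n) N"
  proof (rule inj_onI, rule ccontr)
    fix m n assume e: "z0 * q ^ m = z0 * q ^ n" "m \<noteq> n"
    have *: False if "z0 * q ^ m = z0 * q ^ n" "m < n" for m n
    proof -
      have "q ^ n = q ^ m * q ^ (n - m)" using that by (simp add: power_add[symmetric])
      then have "q ^ (n - m) = 1" using that q(1) z0 by simp
      then show False using q(2)[of "n - m"] that by simp
    qed
    show False using *[of m n] *[of n m] e by (cases "m < n") auto
  qed
  moreover have "(\<lambda>n. z0 * q ^ n) ` N \<subseteq> {x. poly p x = 0}"
  proof (rule image_subsetI)
    fix n assume "n \<in> N"
    then obtain v where v: "v \<in> carrier V" "v \<noteq> \<zero>" "T v = (z0 * q ^ n) \<odot> v" by (auto simp: N_def)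
    then have "poly p (z0 * q ^ n) \<odot> v = \<zero>" using pact_eigenvector[OF v(1,3), of p] p(2) by simp
    then show "z0 * q ^ n \<in> {x. poly p x = 0}" using smult_eq_zero v by blast
  qed
  ultimately have fin: "finite N" using poly_roots_finite[OF p(1)] by (meson finite_imageD finite_subset)
  have "0 \<in> N" using w0 by (auto simp: N_def)
  then have "Max N \<in> N" using fin Max_in by blast
  then obtain w where w: "w \<in> carrier V" "w \<noteq> \<zero>" "T w = (z0 * q ^ Max N) \<odot> w" by (auto simp: N_def)
  have "v = \<zero>" if "n > 0" "v \<in> carrier V" "T v = (z0 * q ^ Max N * q ^ n) \<odot> v" for n v
  proof (rule ccontr)
    assume "v \<noteq> \<zero>"
    then have "Max N + n \<in> N" using that by (auto simp: N_def power_add mult.assoc)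
    then show False using Max_ge[OF fin] that(1) by fastforce
  qed
  then show ?thesis using that w by blast
qed

end

section \<open>Irreducible modules\<close>

lemma alg_moduleD:
  assumes "alg_module A V act"
  shows "Module.module complex_alg V"
    "a \<in> carrier A \<Longrightarrow> v \<in> carrier V \<Longrightarrow> act a v \<in> carrier V"
    "a \<in> carrier A \<Longrightarrow> v \<in> carrier V \<Longrightarrow> w \<in> carrier V \<Longrightarrow> act a (v \<oplus>\<^bsub>V\<^esub> w) = act a v \<oplus>\<^bsub>V\<^esub> act a w"
    "a \<in> carrier A \<Longrightarrow> v \<in> carrier V \<Longrightarrow> act a (c \<odot>\<^bsub>V\<^esub> v) = c \<odot>\<^bsub>V\<^esub> act a v"
    "a \<in> carrier A \<Longrightarrow> b \<in> carrier A \<Longrightarrow> v \<in> carrier V \<Longrightarrow> act (a \<oplus>\<^bsub>A\<^esub> b) v = act a v \<oplus>\<^bsub>V\<^esub> act b v"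
    "a \<in> carrier A \<Longrightarrow> v \<in> carrier V \<Longrightarrow> act (c \<odot>\<^bsub>A\<^esub> a) v = c \<odot>\<^bsub>V\<^esub> act a v"
    "a \<in> carrier A \<Longrightarrow> b \<in> carrier A \<Longrightarrow> v \<in> carrier V \<Longrightarrow> act (a \<otimes>\<^bsub>A\<^esub> b) v = act a (act b v)"
    "v \<in> carrier V \<Longrightarrow> act \<one>\<^bsub>A\<^esub> v = v"
  using assms unfolding alg_module_def by blast+

lemma alg_module_pullback:
  assumes m: "m \<in> alg_hom A' A" and V: "alg_module A V act"
  shows "alg_module A' V (\<lambda>a. act (m a))"
  unfolding alg_module_def
  using alg_homD[OF m] alg_moduleD[OF V] by simp

lemma alg_module_zero:
  assumes "calg A" "alg_module A V act" "v \<in> carrier V" shows "act \<zero>\<^bsub>A\<^esub> v = \<zero>\<^bsub>V\<^esub>"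
proof -
  interpret A: calg A by fact
  note m = alg_moduleD[OF assms(2)]
  interpret V: cspace V by (rule cspaceI[OF m(1)])
  have "act (0 \<odot>\<^bsub>A\<^esub> \<zero>\<^bsub>A\<^esub>) v = 0 \<odot>\<^bsub>V\<^esub> act \<zero>\<^bsub>A\<^esub> v" using assms(3) by (intro m) simp_all
  then show ?thesis using m(2)[OF A.zero_closed assms(3)] by simp
qed

context coideal_data
begin

text \<open>Take \<open>\<mu> \<in> L\<close> with positive products with the simple roots outside \<open>supp\<close>. Then \<open>K\<^sub>\<mu>\<close> commutes with all
  generators but the \<open>E_bar \<beta>\<close>, \<open>\<beta> \<notin> supp\<close>, which multiply its eigenvalues by positive powers of \<open>q\<close>.
  For an extreme eigenvalue these \<open>E_bar \<beta>\<close> kill the eigenspace, so it is a submodule, and it is everything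
  by irreducibility.\<close>

lemma irreducible_kills:
  fixes V :: "(complex, 'v) module"
  assumes irr: "irreducible_module (restrict_alg U C_alg) V act" and fd: "finite_dim V"
    and \<beta>: "\<beta> \<in> B - supp" and v: "v \<in> carrier V"
  shows "act (ep \<beta>) v = \<zero>\<^bsub>V\<^esub>"
proof -
  have mod: "alg_module (restrict_alg U C_alg) V act" and nz: "carrier V \<noteq> {\<zero>\<^bsub>V\<^esub>}"
    and sub: "\<And>W. submodule W complex_alg V \<Longrightarrow> (\<And>a w. a \<in> C_alg \<Longrightarrow> w \<in> W \<Longrightarrow> act a w \<in> W) \<Longrightarrow> W = {\<zero>\<^bsub>V\<^esub>} \<or> W = carrier V"
    using irr unfolding irreducible_module_def by auto
  note m = alg_moduleD[OF mod, simplified]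
  interpret V: cspace V by (rule cspaceI[OF m(1)])
  interpret M: Module.module complex_alg V by (rule m(1))
  obtain \<mu> where \<mu>: "\<mu> \<in> L0" "\<And>\<beta>. \<beta> \<in> B - supp \<Longrightarrow> int_form \<mu> \<beta> > 0"
    using orth_dominant_exists[OF supp orth] by blast
  have kC: "kk \<mu> \<in> C_alg" "kk (- \<mu>) \<in> C_alg" using kk_C_alg \<mu>(1) L0_uminus by auto
  define T where "T = act (kk \<mu>)"
  interpret T: operator V T
    unfolding T_def by unfold_locales (use kC m in simp_all)
  have inj: "v = \<zero>\<^bsub>V\<^esub>" if v: "v \<in> carrier V" "T v = \<zero>\<^bsub>V\<^esub>" for v
  proof -
    have "kk (- \<mu>) \<otimes>\<^bsub>U\<^esub> kk \<mu> = \<one>\<^bsub>U\<^esub>" using kk_add[OF L0_uminus[OF \<mu>(1)] \<mu>(1)] K_elt_zero by simp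
    then have "v = act (kk (- \<mu>)) (T v)" unfolding T_def using m(7)[OF kC(2,1) v(1)] m(8)[OF v(1)] by simp
    also have "\<dots> = act (kk (- \<mu>)) (0 \<odot>\<^bsub>V\<^esub> \<zero>\<^bsub>V\<^esub>)" using v by simp
    also have "\<dots> = 0 \<odot>\<^bsub>V\<^esub> act (kk (- \<mu>)) \<zero>\<^bsub>V\<^esub>" using kC by (intro m) simp_all
    also have "\<dots> = \<zero>\<^bsub>V\<^esub>" using m(2)[OF kC(2) V.zero_closed] by simp
    finally show ?thesis .
  qed
  obtain S where S: "finite S" "S \<subseteq> carrier V" "lin_span V S = carrier V" using fd by (auto simp: finite_dim_def)
  obtain z w where w: "w \<in> carrier V" "w \<noteq> \<zero>\<^bsub>V\<^esub>" "T w = z \<odot>\<^bsub>V\<^esub> w"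
    and ext: "\<And>n v. n > 0 \<Longrightarrow> v \<in> carrier V \<Longrightarrow> T v = (z * q ^ n) \<odot>\<^bsub>V\<^esub> v \<Longrightarrow> v = \<zero>\<^bsub>V\<^esub>"
  proof (rule T.extreme_eigenvalue[OF S nz _ q0])
    show "v = \<zero>\<^bsub>V\<^esub>" if "v \<in> carrier V" "T v = \<zero>\<^bsub>V\<^esub>" for v using that by (rule inj)
    show "q ^ n \<noteq> 1" if "n > 0" for n using that by (rule q_not_root)
  qed (rule that)
  define W where "W = {v \<in> carrier V. T v = z \<odot>\<^bsub>V\<^esub> v}"
  have kill: "act (ep \<gamma>) v = \<zero>\<^bsub>V\<^esub>" if \<gamma>: "\<gamma> \<in> B - supp" and v: "v \<in> W" for \<gamma> v
  proof -
    define n where "n = nat (int_form \<mu> \<gamma>)"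
    have n: "n > 0" "q powi int_form \<mu> \<gamma> = q ^ n" using \<mu>(2)[OF \<gamma>] by (simp_all add: n_def power_int_def)
    have e: "ep \<gamma> \<in> C_alg" using ep_C_alg \<gamma> by simp
    have v': "v \<in> carrier V" "act (kk \<mu>) v = z \<odot>\<^bsub>V\<^esub> v" using v by (auto simp: W_def T_def)
    have "T (act (ep \<gamma>) v) = act (kk \<mu> \<otimes>\<^bsub>U\<^esub> ep \<gamma>) v" unfolding T_def using m(7)[OF kC(1) e v'(1)] by simp
    also have "kk \<mu> \<otimes>\<^bsub>U\<^esub> ep \<gamma> = q ^ n \<odot>\<^bsub>U\<^esub> (ep \<gamma> \<otimes>\<^bsub>U\<^esub> kk \<mu>)" using kk_ep[OF \<mu>(1), of \<gamma>] \<gamma> n by (simp add: U.q_comm_def)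
    also have "act \<dots> v = q ^ n \<odot>\<^bsub>V\<^esub> act (ep \<gamma> \<otimes>\<^bsub>U\<^esub> kk \<mu>) v"
      using C_alg_subalg e kC v' by (intro m) (simp_all add: subalg_def)
    also have "act (ep \<gamma> \<otimes>\<^bsub>U\<^esub> kk \<mu>) v = act (ep \<gamma>) (z \<odot>\<^bsub>V\<^esub> v)" using m(7)[OF e kC(1) v'(1)] v'(2) by simp
    also have "\<dots> = z \<odot>\<^bsub>V\<^esub> act (ep \<gamma>) v" using e v' by (intro m)
    finally have "T (act (ep \<gamma>) v) = (z * q ^ n) \<odot>\<^bsub>V\<^esub> act (ep \<gamma>) v"
      using m(2)[OF e v'(1)] by (simp add: V.smult_smult mult.commute)
    then show ?thesis using ext[OF n(1)] m(2)[OF e v'(1)] by simp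
  qed
  have commute: "act a v \<in> W" if a: "a \<in> C_alg" "kk \<mu> \<otimes>\<^bsub>U\<^esub> a = a \<otimes>\<^bsub>U\<^esub> kk \<mu>" and v: "v \<in> W" for a v
  proof -
    have v': "v \<in> carrier V" "act (kk \<mu>) v = z \<odot>\<^bsub>V\<^esub> v" using v by (auto simp: W_def T_def)
    have "T (act a v) = act (kk \<mu> \<otimes>\<^bsub>U\<^esub> a) v" unfolding T_def using m(7)[OF kC(1) a(1) v'(1)] by simp
    also have "\<dots> = act a (z \<odot>\<^bsub>V\<^esub> v)" unfolding a(2) using m(7)[OF a(1) kC(1) v'(1)] v'(2) by simp
    also have "\<dots> = z \<odot>\<^bsub>V\<^esub> act a v" using a v' by (intro m)
    finally show ?thesis using m(2)[OF a(1) v'(1)] by (simp add: W_def)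
  qed
  have Wc: "v \<in> carrier V" if "v \<in> W" for v using that by (simp add: W_def)
  have W0: "\<zero>\<^bsub>V\<^esub> \<in> W" by (simp add: W_def T.T_zero)
  have Wadd: "x \<oplus>\<^bsub>V\<^esub> y \<in> W" if "x \<in> W" "y \<in> W" for x y using that by (simp add: W_def T.T_add V.smult_r_distr)
  have Wsm: "c \<odot>\<^bsub>V\<^esub> x \<in> W" if "x \<in> W" for x c using that by (simp add: W_def T.T_smult V.smult_smult mult.commute)
  have Wsub: "submodule W complex_alg V"
  proof (rule M.submoduleI)
    show "\<ominus>\<^bsub>V\<^esub> a \<in> W" if "a \<in> W" for a
    proof -
      have "\<ominus>\<^bsub>V\<^esub> a = (- 1) \<odot>\<^bsub>V\<^esub> a"
        using Wc[OF that] V.smult_l_distr[of a 1 "- 1"] by (intro V.minus_equality) (simp_all add: V.a_comm)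
      then show ?thesis using Wsm[OF that] by simp
    qed
  qed (use Wc W0 Wadd Wsm in auto)
  have "C_alg \<subseteq> {a \<in> C_alg. \<forall>w\<in>W. act a w \<in> W}"
  proof -
    let ?D = "{a \<in> C_alg. \<forall>w\<in>W. act a w \<in> W}"
    have D: "subalg ?D U"
      unfolding subalg_def
    proof (intro conjI ballI allI)
      show "?D \<subseteq> carrier U" using C_alg_closed by auto
      have Z: "\<zero>\<^bsub>U\<^esub> \<in> C_alg" "\<one>\<^bsub>U\<^esub> \<in> C_alg" using C_alg_subalg by (auto simp: subalg_def)
      have "act \<zero>\<^bsub>U\<^esub> w = \<zero>\<^bsub>V\<^esub>" if "w \<in> W" for w
        using alg_module_zero[OF U.subalg_calg[OF C_alg_subalg] mod Wc[OF that]] by simp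
      then show "\<zero>\<^bsub>U\<^esub> \<in> ?D" using Z W0 by simp
      show "\<one>\<^bsub>U\<^esub> \<in> ?D" using Z m(8) Wc by simp
    next
      fix x y assume xy: "x \<in> ?D" "y \<in> ?D"
      then have c: "x \<in> C_alg" "y \<in> C_alg" "x \<oplus>\<^bsub>U\<^esub> y \<in> C_alg" "x \<otimes>\<^bsub>U\<^esub> y \<in> C_alg" using C_alg_subalg by (auto simp: subalg_def)
      have "act (x \<oplus>\<^bsub>U\<^esub> y) w \<in> W" "act (x \<otimes>\<^bsub>U\<^esub> y) w \<in> W" if "w \<in> W" for w
        using xy m(5)[OF c(1,2) Wc[OF that]] m(7)[OF c(1,2) Wc[OF that]] Wadd that by simp_all
      then show "x \<oplus>\<^bsub>U\<^esub> y \<in> ?D" "x \<otimes>\<^bsub>U\<^esub> y \<in> ?D" using c by simp_all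
    next
      fix c x assume x: "x \<in> ?D"
      then have c: "x \<in> C_alg" "c \<odot>\<^bsub>U\<^esub> x \<in> C_alg" using C_alg_subalg by (auto simp: subalg_def)
      have "act (c \<odot>\<^bsub>U\<^esub> x) w \<in> W" if "w \<in> W" for w
        using x m(6)[OF c(1) Wc[OF that]] Wsm that by simp
      then show "c \<odot>\<^bsub>U\<^esub> x \<in> ?D" using c by simp
    qed
    have f: "fb \<alpha> \<in> ?D" if "\<alpha> \<in> supp" for \<alpha>
      using commute[OF fb_C_alg[OF that] kk_fb[OF \<mu>(1) that]] fb_C_alg[OF that] by simp
    have k: "kk \<nu> \<in> ?D" if "\<nu> \<in> L0" for \<nu>
    proof -
      have "kk \<mu> \<otimes>\<^bsub>U\<^esub> kk \<nu> = kk \<nu> \<otimes>\<^bsub>U\<^esub> kk \<mu>" using that \<mu>(1) by (simp add: kk_add add.commute)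
      from commute[OF kk_C_alg[OF that] this] show ?thesis using kk_C_alg[OF that] by simp
    qed
    have e: "ep \<gamma> \<in> ?D" if "\<gamma> \<in> B" for \<gamma>
    proof (cases "\<gamma> \<in> supp")
      case True
      have "kk \<mu> \<otimes>\<^bsub>U\<^esub> ep \<gamma> = ep \<gamma> \<otimes>\<^bsub>U\<^esub> kk \<mu>"
        using kk_ep[OF \<mu>(1) that] int_form_L0[OF \<mu>(1) True] kk_closed[OF \<mu>(1)] ep_closed[OF that] by (simp add: U.q_comm_def)
      from commute[OF ep_C_alg[OF that] this] show ?thesis using ep_C_alg[OF that] by simp
    next
      case False
      then show ?thesis using kill[of \<gamma>] that ep_C_alg[OF that] W0 by simp
    qed
    have "fb ` supp \<union> kk ` L0 \<union> ep ` B \<subseteq> ?D" using f k e by blast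
    then show ?thesis unfolding C_alg_def[symmetric] using U.alg_gen_least[OF D] by (simp add: C_alg_def)
  qed
  then have "W = {\<zero>\<^bsub>V\<^esub>} \<or> W = carrier V" using sub[OF Wsub] by blast
  moreover have "w \<in> W" using w by (simp add: W_def)
  ultimately have "W = carrier V" using w(2) by blast
  then show ?thesis using kill \<beta> v by blast
qed

end

context bar_data
begin

text \<open>The image of \<open>K\<^sub>\<mu>\<close> is central and invertible, while in \<open>C\<close> it commutes with \<open>E_bar \<beta>\<close> only up to a
  nontrivial power of \<open>q\<close>.\<close>

lemma bar_quotient_kills:
  assumes \<pi>: "is_bar_quotient B q supp lp lm C_alg \<pi>" and \<beta>: "\<beta> \<in> B - supp"
  shows "\<pi> (ep \<beta>) = \<zero>\<^bsub>CB\<^esub>"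
proof -
  have \<pi>h: "\<pi> \<in> alg_hom (restrict_alg U C_alg) CB" using \<pi> by (simp add: is_bar_quotient_def)
  note p = alg_homD[OF \<pi>h, simplified]
  obtain \<mu> where \<mu>: "\<mu> \<in> L0" "\<And>\<beta>. \<beta> \<in> B - supp \<Longrightarrow> int_form \<mu> \<beta> > 0"
    using orth_dominant_exists[OF supp orth] by blast
  have mL: "- \<mu> \<in> L0" using \<mu>(1) L0_uminus by simp
  have k: "\<pi> (kk \<nu>) = inc None (kk \<nu>)" if "\<nu> \<in> L0" for \<nu>
    using \<pi> fac_mem(1)[OF that] by (simp add: is_bar_quotient_def fac_None)
  note N = alg_homD[OF inc_hom[OF index_simps(1)]]
  define K where "K = inc None (kk \<mu>)"
  have Kc: "K \<in> carrier CB" unfolding K_def using fac_mem(1)[OF \<mu>(1)] by (rule N(2))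
  let ?Z = "{x \<in> carrier CB. \<forall>y\<in>{K}. x \<otimes>\<^bsub>CB\<^esub> y = y \<otimes>\<^bsub>CB\<^esub> x}"
  have "?Z = carrier CB"
  proof (rule CB_generated)
    show "subalg ?Z CB" by (rule CB.centralizer_subalg) (use Kc in simp)
    show "inc j a \<in> ?Z" if j: "j \<in> bar_index supp" and a: "a \<in> carrier (fac j)" for j a
    proof (cases "j = None")
      case True
      have a': "a \<in> carrier (fac None)" using a True by simp
      have "a \<otimes>\<^bsub>U\<^esub> kk \<mu> = kk \<mu> \<otimes>\<^bsub>U\<^esub> a"
      proof (rule U.alg_gen_commute)
        show "a \<in> alg_gen U (kk ` L0)" using a' by (simp add: fac_None torus_alg_gen)
        show "kk \<mu> \<in> alg_gen U {kk \<mu>}" using U.alg_gen_incl[of "{kk \<mu>}"] by simp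
        show "s \<otimes>\<^bsub>U\<^esub> t = t \<otimes>\<^bsub>U\<^esub> s" if "s \<in> kk ` L0" "t \<in> {kk \<mu>}" for s t
          using that \<mu>(1) by (elim imageE) (simp add: kk_add add.commute)
      qed (use kk_closed \<mu>(1) in auto)
      then have "inc None (a \<otimes>\<^bsub>fac None\<^esub> kk \<mu>) = inc None (kk \<mu> \<otimes>\<^bsub>fac None\<^esub> a)" by (simp add: fac_None)
      then show ?thesis
        using N(5)[OF a' fac_mem(1)[OF \<mu>(1)]] N(5)[OF fac_mem(1)[OF \<mu>(1)] a'] N(2)[OF a'] True by (simp add: K_def)
    next
      case False
      then show ?thesis
        using inc_commute[OF j index_simps(1) False a fac_mem(1)[OF \<mu>(1)]] alg_homD(2)[OF inc_hom[OF j] a] by (simp add: K_def)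
    qed
  qed
  then have central: "x \<otimes>\<^bsub>CB\<^esub> K = K \<otimes>\<^bsub>CB\<^esub> x" if "x \<in> carrier CB" for x using that by blast
  have \<beta>B: "\<beta> \<in> B" using \<beta> by simp
  let ?e = "\<pi> (ep \<beta>)" and ?c = "q powi int_form \<mu> \<beta>"
  have e: "?e \<in> carrier CB" using p(2) ep_C_alg[OF \<beta>B] by simp
  have mem: "kk \<mu> \<in> C_alg" "ep \<beta> \<in> C_alg" "ep \<beta> \<otimes>\<^bsub>U\<^esub> kk \<mu> \<in> C_alg"
    using kk_C_alg[OF \<mu>(1)] ep_C_alg[OF \<beta>B] C_alg_subalg by (auto simp: subalg_def)
  have "\<pi> (kk \<mu> \<otimes>\<^bsub>U\<^esub> ep \<beta>) = \<pi> (?c \<odot>\<^bsub>U\<^esub> (ep \<beta> \<otimes>\<^bsub>U\<^esub> kk \<mu>))" using kk_ep[OF \<mu>(1) \<beta>B] by (simp add: U.q_comm_def)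
  then have "K \<otimes>\<^bsub>CB\<^esub> ?e = ?c \<odot>\<^bsub>CB\<^esub> (?e \<otimes>\<^bsub>CB\<^esub> K)"
    using p(5)[OF mem(1,2)] p(4)[OF mem(3), of ?c] p(5)[OF mem(2,1)] k[OF \<mu>(1)] by (simp add: K_def)
  then have "K \<otimes>\<^bsub>CB\<^esub> ?e = ?c \<odot>\<^bsub>CB\<^esub> (K \<otimes>\<^bsub>CB\<^esub> ?e)" using central[OF e] by simp
  then have "(1 - ?c) \<odot>\<^bsub>CB\<^esub> (K \<otimes>\<^bsub>CB\<^esub> ?e) = \<zero>\<^bsub>CB\<^esub>"
    using Kc e by (simp add: CB.smult_diff_distr CB.minus_eq CB.r_neg)
  moreover have "1 - ?c \<noteq> 0" using q_powi_eq_1_iff[of "int_form \<mu> \<beta>"] \<mu>(2)[OF \<beta>] by simp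
  ultimately have Ke: "K \<otimes>\<^bsub>CB\<^esub> ?e = \<zero>\<^bsub>CB\<^esub>" using CB.smult_eq_zero Kc e by (metis CB.m_closed)
  have "inc None (kk (- \<mu>)) \<otimes>\<^bsub>CB\<^esub> K = inc None (kk (- \<mu>) \<otimes>\<^bsub>fac None\<^esub> kk \<mu>)"
    unfolding K_def using N(5)[OF fac_mem(1)[OF mL] fac_mem(1)[OF \<mu>(1)]] by simp
  also have "kk (- \<mu>) \<otimes>\<^bsub>fac None\<^esub> kk \<mu> = \<one>\<^bsub>fac None\<^esub>" using kk_add[OF mL \<mu>(1)] by (simp add: fac_None K_elt_zero)
  finally have inv: "inc None (kk (- \<mu>)) \<otimes>\<^bsub>CB\<^esub> K = \<one>\<^bsub>CB\<^esub>" using N(6) by simp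
  have ic: "inc None (kk (- \<mu>)) \<in> carrier CB" using N(2) fac_mem(1)[OF mL] by simp
  have "?e = (inc None (kk (- \<mu>)) \<otimes>\<^bsub>CB\<^esub> K) \<otimes>\<^bsub>CB\<^esub> ?e" using e by (simp add: inv)
  also have "\<dots> = inc None (kk (- \<mu>)) \<otimes>\<^bsub>CB\<^esub> (K \<otimes>\<^bsub>CB\<^esub> ?e)" using ic Kc e by (rule CB.m_assoc)
  also have "\<dots> = \<zero>\<^bsub>CB\<^esub>" using ic by (simp add: Ke)
  finally show ?thesis .
qed

text \<open>The factors commute inside \<open>U\<close>, so multiplication maps the tensor product back into \<open>C\<close>.\<close>

lemma bar_multiplication:
  obtains m where "m \<in> alg_hom CB (restrict_alg U C_alg)" "\<And>j a. j \<in> bar_index supp \<Longrightarrow> a \<in> carrier (fac j) \<Longrightarrow> m (inc j a) = a"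
proof -
  have gens: "s \<otimes>\<^bsub>U\<^esub> t = t \<otimes>\<^bsub>U\<^esub> s" if ij: "i \<in> bar_index supp" "j \<in> bar_index supp" "i \<noteq> j" and st: "s \<in> factor_gens i" "t \<in> factor_gens j" for i j s t
  proof -
    have ke: "kk \<mu> \<otimes>\<^bsub>U\<^esub> x = x \<otimes>\<^bsub>U\<^esub> kk \<mu>" if "\<mu> \<in> L0" "\<alpha> \<in> supp" "x \<in> {ep \<alpha>, fb \<alpha>}" for \<mu> \<alpha> x
    proof -
      have "\<alpha> \<in> B" using that(2) supp by auto
      then have "kk \<mu> \<otimes>\<^bsub>U\<^esub> ep \<alpha> = ep \<alpha> \<otimes>\<^bsub>U\<^esub> kk \<mu>"
        using kk_ep[OF that(1)] int_form_L0[OF that(1,2)] kk_closed[OF that(1)] ep_closed by (simp add: U.q_comm_def)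
      then show ?thesis using kk_fb[OF that(1,2)] that(3) by (elim insertE) simp_all
    qed
    show ?thesis
    proof (cases i)
      case None
      then obtain \<mu> where \<mu>: "s = kk \<mu>" "\<mu> \<in> L0" using st by (auto simp: factor_gens_def)
      obtain \<beta> where \<beta>: "j = Some \<beta>" "\<beta> \<in> supp" using ij None by (auto simp: bar_index_def)
      then show ?thesis using ke[OF \<mu>(2) \<beta>(2), of t] st(2) \<mu>(1) by (simp add: factor_gens_def)
    next
      case (Some \<alpha>)
      then have \<alpha>: "\<alpha> \<in> supp" "\<alpha> \<in> B" using ij supp by (auto simp: bar_index_def)
      have s: "s \<in> {ep \<alpha>, fb \<alpha>}" using st Some by (simp add: factor_gens_def)
      show ?thesis
      proof (cases j)
        case None
        then obtain \<mu> where \<mu>: "t = kk \<mu>" "\<mu> \<in> L0" using st by (auto simp: factor_gens_def)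
        then show ?thesis using ke[OF \<mu>(2) \<alpha>(1) s] by simp
      next
        case (Some \<beta>)
        then have \<beta>: "\<beta> \<in> supp" "\<beta> \<in> B" "\<alpha> \<noteq> \<beta>" using ij supp \<open>i = Some \<alpha>\<close> by (auto simp: bar_index_def)
        have t: "t \<in> {ep \<beta>, fb \<beta>}" using st Some by (simp add: factor_gens_def)
        have o: "int_form \<alpha> \<beta> = 0" "int_form \<beta> \<alpha> = 0"
          using orth[OF \<alpha>(1) \<beta>(1)] orth[OF \<beta>(1) \<alpha>(1)] \<beta>(3) by (simp_all add: int_form_def)
        have "ep \<alpha> \<otimes>\<^bsub>U\<^esub> fb \<beta> = fb \<beta> \<otimes>\<^bsub>U\<^esub> ep \<alpha>" "ep \<beta> \<otimes>\<^bsub>U\<^esub> fb \<alpha> = fb \<alpha> \<otimes>\<^bsub>U\<^esub> ep \<beta>"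
          using ep_fb_diff[OF \<alpha>(2) \<beta>(1)] ep_fb_diff[OF \<beta>(2) \<alpha>(1)] \<beta>(3) o ep_closed fb_closed \<alpha> \<beta>
          by (simp_all add: U.q_comm_def)
        then show ?thesis using s t fb_commute[OF \<alpha>(1) \<beta>(1)] ep_commute[OF \<alpha>(1) \<beta>(1)]
          by (elim insertE) simp_all
      qed
    qed
  qed
  have id: "(\<lambda>a. a) \<in> alg_hom (fac j) (restrict_alg U C_alg)" if "j \<in> bar_index supp" for j
    using subsetD[OF fac_sub_C_alg[OF that]] by (simp add: alg_hom_iff lin_hom_def fac_eq[OF that])
  obtain m where m: "m \<in> alg_hom TB.T (restrict_alg U C_alg)"
    "\<And>j a. j \<in> bar_index supp \<Longrightarrow> a \<in> carrier (fac j) \<Longrightarrow> m (TB.incl j a) = a"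
  proof (rule TB.tensor_alg_lift[OF fin_index U.subalg_calg[OF C_alg_subalg], of "\<lambda>j a. a"])
    show "a \<otimes>\<^bsub>restrict_alg U C_alg\<^esub> b = b \<otimes>\<^bsub>restrict_alg U C_alg\<^esub> a"
      if "i \<in> bar_index supp" "j \<in> bar_index supp" "i \<noteq> j" "a \<in> carrier (fac i)" "b \<in> carrier (fac j)" for i j a b
      using U.alg_gen_commute[OF factor_gens_closed[OF that(1)] factor_gens_closed[OF that(2)] gens[OF that(1-3)], of a b] that
      by (simp add: fac_carrier)
  qed (use id in auto)
  then show ?thesis using that[of m] by (simp add: C_bar_def bar_incl_def)
qed

text \<open>Going to the quotient and back does not change the generators except for the \<open>E_bar \<beta>\<close>, \<open>\<beta> \<notin> supp\<close>,
  which become zero; as these act by zero, it does not change the action of any element.\<close>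

lemma irreducible_factors:
  fixes V :: "(complex, 'v) module"
  assumes \<pi>: "is_bar_quotient B q supp lp lm C_alg \<pi>"
    and irr: "irreducible_module (restrict_alg U C_alg) V act" and fd: "finite_dim V"
  shows "factors_over (restrict_alg U C_alg) V act CB \<pi>"
proof -
  have \<pi>h: "\<pi> \<in> alg_hom (restrict_alg U C_alg) CB" using \<pi> by (simp add: is_bar_quotient_def)
  have mod: "alg_module (restrict_alg U C_alg) V act" using irr by (simp add: irreducible_module_def)
  note a = alg_moduleD[OF mod, simplified]
  have R: "calg (restrict_alg U C_alg)" by (rule U.subalg_calg[OF C_alg_subalg])
  obtain m where m: "m \<in> alg_hom CB (restrict_alg U C_alg)"
    "\<And>j a. j \<in> bar_index supp \<Longrightarrow> a \<in> carrier (fac j) \<Longrightarrow> m (inc j a) = a" by (rule bar_multiplication) blast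
  have mp: "m \<circ> \<pi> \<in> alg_hom (restrict_alg U C_alg) (restrict_alg U C_alg)" by (rule alg_hom_comp[OF \<pi>h m(1)])
  note mpD = alg_homD[OF mp, simplified]
  let ?D = "{c \<in> C_alg. \<forall>v\<in>carrier V. act c v = act (m (\<pi> c)) v}"
  have D: "subalg ?D U"
    unfolding subalg_def
  proof (intro conjI ballI allI)
    have Z: "\<zero>\<^bsub>U\<^esub> \<in> C_alg" "\<one>\<^bsub>U\<^esub> \<in> C_alg" using C_alg_subalg by (auto simp: subalg_def)
    show "?D \<subseteq> carrier U" using C_alg_closed by auto
    have "m (\<pi> \<zero>\<^bsub>U\<^esub>) = \<zero>\<^bsub>U\<^esub>" using lin_hom_zero[OF R R mpD(1)] by simp
    then show "\<zero>\<^bsub>U\<^esub> \<in> ?D" using Z by simp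
    show "\<one>\<^bsub>U\<^esub> \<in> ?D" using Z mpD(6) by simp
  next
    fix x y assume xy: "x \<in> ?D" "y \<in> ?D"
    then have c: "x \<in> C_alg" "y \<in> C_alg" "x \<oplus>\<^bsub>U\<^esub> y \<in> C_alg" "x \<otimes>\<^bsub>U\<^esub> y \<in> C_alg" using C_alg_subalg by (auto simp: subalg_def)
    have mc: "m (\<pi> x) \<in> C_alg" "m (\<pi> y) \<in> C_alg" using mpD(2) c by simp_all
    have "act (x \<oplus>\<^bsub>U\<^esub> y) v = act (m (\<pi> (x \<oplus>\<^bsub>U\<^esub> y))) v" "act (x \<otimes>\<^bsub>U\<^esub> y) v = act (m (\<pi> (x \<otimes>\<^bsub>U\<^esub> y))) v"
      if v: "v \<in> carrier V" for v
    proof -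
      have x: "act x w = act (m (\<pi> x)) w" and y: "act y w = act (m (\<pi> y)) w" if "w \<in> carrier V" for w using xy that by auto
      show "act (x \<oplus>\<^bsub>U\<^esub> y) v = act (m (\<pi> (x \<oplus>\<^bsub>U\<^esub> y))) v"
        using mpD(3)[OF c(1,2)] a(5)[OF c(1,2) v] a(5)[OF mc v] x[OF v] y[OF v] by simp
      show "act (x \<otimes>\<^bsub>U\<^esub> y) v = act (m (\<pi> (x \<otimes>\<^bsub>U\<^esub> y))) v"
        using mpD(5)[OF c(1,2)] a(7)[OF c(1,2) v] a(7)[OF mc v] x[OF a(2)[OF c(2) v]] y[OF v] by simp
    qed
    then show "x \<oplus>\<^bsub>U\<^esub> y \<in> ?D" "x \<otimes>\<^bsub>U\<^esub> y \<in> ?D" using c by blast+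
  next
    fix k x assume x: "x \<in> ?D"
    then have c: "x \<in> C_alg" "k \<odot>\<^bsub>U\<^esub> x \<in> C_alg" using C_alg_subalg by (auto simp: subalg_def)
    have mc: "m (\<pi> x) \<in> C_alg" using mpD(2) c by simp
    have "act (k \<odot>\<^bsub>U\<^esub> x) v = act (m (\<pi> (k \<odot>\<^bsub>U\<^esub> x))) v" if v: "v \<in> carrier V" for v
    proof -
      have "act x v = act (m (\<pi> x)) v" using x v by auto
      then show ?thesis using mpD(4)[OF c(1), of k] a(6)[OF c(1) v] a(6)[OF mc v] by simp
    qed
    then show "k \<odot>\<^bsub>U\<^esub> x \<in> ?D" using c by blast
  qed
  have f: "fb \<alpha> \<in> ?D" and e: "ep \<alpha> \<in> ?D" if \<alpha>: "\<alpha> \<in> supp" for \<alpha>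
  proof -
    have "\<pi> (fb \<alpha>) = inc (Some \<alpha>) (fb \<alpha>)" "\<pi> (ep \<alpha>) = inc (Some \<alpha>) (ep \<alpha>)"
      using \<pi> \<alpha> unfolding is_bar_quotient_def by (simp_all add: E_bar_lp)
    then have "m (\<pi> (fb \<alpha>)) = fb \<alpha>" "m (\<pi> (ep \<alpha>)) = ep \<alpha>" using m(2) fac_mem \<alpha> by simp_all
    then show "fb \<alpha> \<in> ?D" "ep \<alpha> \<in> ?D" using fb_C_alg[OF \<alpha>] ep_C_alg[of \<alpha>] supp \<alpha> by auto
  qed
  have k: "kk \<mu> \<in> ?D" if \<mu>: "\<mu> \<in> L0" for \<mu>
  proof -
    have "\<pi> (kk \<mu>) = inc None (kk \<mu>)" using \<pi> fac_mem(1)[OF \<mu>] by (simp add: is_bar_quotient_def fac_None)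
    then have "m (\<pi> (kk \<mu>)) = kk \<mu>" using m(2) fac_mem(1)[OF \<mu>] by simp
    then show ?thesis using kk_C_alg[OF \<mu>] by simp
  qed
  have z: "ep \<beta> \<in> ?D" if \<beta>: "\<beta> \<in> B - supp" for \<beta>
  proof -
    have "m (\<pi> (ep \<beta>)) = \<zero>\<^bsub>U\<^esub>"
      using bar_quotient_kills[OF \<pi> \<beta>] lin_hom_zero[OF CB.calg_axioms R alg_homD(1)[OF m(1)]] by simp
    then show ?thesis using irreducible_kills[OF irr fd \<beta>] alg_module_zero[OF R mod] ep_C_alg[of \<beta>] \<beta> by simp
  qed
  have "fb ` supp \<union> kk ` L0 \<union> ep ` B \<subseteq> ?D" using f e k z by blast
  then have "C_alg \<subseteq> ?D" using U.alg_gen_least[OF D] by (simp add: C_alg_def)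
  then have "act c v = act (m (\<pi> c)) v" if "c \<in> C_alg" "v \<in> carrier V" for c v using that by blast
  then show ?thesis unfolding factors_over_def using alg_module_pullback[OF m(1) mod]
    by (intro exI[of _ "\<lambda>y. act (m y)"]) simp
qed

lemma bar_factor_quantum_weyl:
  "\<alpha> \<in> supp \<Longrightarrow> is_quantum_weyl (q_root q \<alpha>) (EF_alg B q lp lm \<alpha>) (E_bar B q lp \<alpha>) (F_bar B q lm \<alpha>)"
  using EF_quantum_weyl by (simp add: EF_alg_def E_bar_lp)

end

theorem corollary3p18:
  fixes \<Phi> B supp :: "'a::real_inner set"
    and q :: complex
    and lp lm :: "'a \<Rightarrow> complex"
    and \<Delta> :: "'a uq \<Rightarrow> ((bool \<Rightarrow> 'a uq) \<Rightarrow>\<^sub>0 complex) set"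
    and \<phi>p \<phi>m :: "'a uq \<Rightarrow> complex"
  defines "U \<equiv> Uq B q"
  defines "C \<equiv> coideal_C B q \<Delta> supp \<phi>m \<phi>p"
  assumes "root_system \<Phi>" and "simple_roots \<Phi> B" and "even_form \<Phi>"
    and "q \<noteq> 0" and "\<And>n::nat. n > 0 \<Longrightarrow> q ^ n \<noteq> 1"
    and "is_comult B q \<Delta>"
    and "supp \<subseteq> B"
    and "\<And>\<alpha> \<beta>. \<alpha> \<in> supp \<Longrightarrow> \<beta> \<in> supp \<Longrightarrow> \<alpha> \<noteq> \<beta> \<Longrightarrow> \<alpha> \<bullet> \<beta> = 0"
    and "\<And>\<alpha>. \<alpha> \<in> supp \<Longrightarrow> lp \<alpha> \<noteq> 0 \<and> lm \<alpha> \<noteq> 0"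
    and "\<And>\<alpha>. \<alpha> \<in> supp \<Longrightarrow> lp \<alpha> * lm \<alpha> =
           (q_root q \<alpha>)\<^sup>2 / ((1 - (q_root q \<alpha>)\<^sup>2) * (q_root q \<alpha> - inverse (q_root q \<alpha>)))"
    and "is_character U (psi_Uplus B q) \<phi>p"
    and "\<And>\<alpha>. \<alpha> \<in> B \<Longrightarrow> \<phi>p (EK B q \<alpha>) = (if \<alpha> \<in> supp then lp \<alpha> else 0)"
    and "is_character U (Uminus B q supp) \<phi>m"
    and "\<And>\<alpha>. \<alpha> \<in> supp \<Longrightarrow> \<phi>m (uword B q [gF \<alpha>]) = lm \<alpha>"
  shows "right_coideal_subalg U \<Delta> C \<and>
    (\<exists>\<pi>. is_bar_quotient B q supp lp lm C \<pi>) \<and>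
    (\<forall>\<pi> (V :: (complex, 'v) module) act.
       is_bar_quotient B q supp lp lm C \<pi> \<and>
       irreducible_module (restrict_alg U C) V act \<and> finite_dim V \<longrightarrow>
       factors_over (restrict_alg U C) V act (C_bar B q supp lp lm) \<pi>) \<and>
    (\<forall>\<alpha>\<in>supp. is_quantum_weyl (q_root q \<alpha>) (EF_alg B q lp lm \<alpha>)
                 (E_bar B q lp \<alpha>) (F_bar B q lm \<alpha>))"
proof -
  define l where "l = (\<lambda>\<beta>. if \<beta> \<in> supp then lp \<beta> else 0)"
  have char: "coideal_characters \<Phi> B q supp l lm \<Delta> \<phi>p \<phi>m"
    by unfold_locales (use assms(3-) in \<open>simp_all add: l_def U_def\<close>)
  have bar: "bar_data \<Phi> B q supp l lm lp"
    by unfold_locales (use assms(3-) in \<open>simp_all add: l_def\<close>)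
  have C: "C = coideal_data.C_alg B q supp l lm"
    unfolding C_def by (rule coideal_characters.coideal_C_eq[OF char])
  show ?thesis
    unfolding C U_def
    using coideal_characters.coideal_C_coideal[OF char] bar_data.bar_quotient_exists[OF bar]
      bar_data.irreducible_factors[OF bar] bar_data.bar_factor_quantum_weyl[OF bar]
    by blast
qed

end
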